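(* Let $X\subset\mathbb{R}^3$ be a bounded smooth domain. Call a pair $(\sigma,k)$ admissible if it satisfies the regularity, absorption and isotropicity conditions listed in the context, and for each admissible pair let $\mathcal{A}^{01}_{\sigma,k}:\mathbb{R}^3\times L^\infty(\Gamma_-)\to L^\infty(\Gamma_+)$ be the boundary value map defined in the context. Then: (i) The map $(\sigma,k)\mapsto \mathcal{A}^{01}_{\sigma,k}$ is injective on the set of admissible pairs. (ii) There exists $f\in L^\infty(\Gamma_-)$ such that the data $\mathcal{A}^{01}_{\sigma,k}(Q,f)$, $Q\in\mathbb{R}^3$, determine $\sigma$: if $(\sigma_1,k_1)$ and $(\sigma_2,k_2)$ are admissible and $\mathcal{A}^{01}_{\sigma_1,k_1}(Q,f)=\mathcal{A}^{01}_{\sigma_2,k_2}(Q,f)$ for all $Q\in\mathbb{R}^3$, then $\sigma_1=\sigma_2$. (iii) There is a one-parameter subset $\mathcal{F}\subset L^\infty(\Gamma_-)$ (a family of boundary sources indexed by a single real parameter) such that the map sending an admissible pair $(\sigma,k)$ to the restriction of $\mathcal{A}^{01}_{\sigma,k}$ to $\mathbb{R}^3\times\mathcal{F}$ is still injective: if $(\sigma_1,k_1)$ and $(\sigma_2,k_2)$ are admissible and $\mathcal{A}^{01}_{\sigma_1,k_1}(Q,f)=\mathcal{A}^{01}_{\sigma_2,k_2}(Q,f)$ for all $Q\in\mathbb{R}^3$ and all $f\in\mathcal{F}$, then $\sigma_1=\sigma_2$ and $k_1=k_2$.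
   Context: Let $\nu(x)$ be the outward unit normal to $\partial X$ and $\Gamma_\pm=\{(x,\theta)\in\partial X\times S^2 : \pm\theta\cdot\nu(x)>0\}$. Admissible coefficients $(\sigma,k)$ satisfy: - Regularity: $\sigma\in C(X)$ and $k\in C(X\times S^2\times S^2)$ are nonnegative. - Absorption: there exists $c>0$ such that $\inf_{x\in X}(\sigma(x)-\rho(x))>c$, where $\rho(x)=\left\|\int_{S^2}k(x,\theta,\theta')\,d\theta'\right\|_{L^\infty(S^2)}$ (norm in $\theta$). - Isotropicity: $k(x,\theta,\theta')=k(x,-\theta',-\theta)$ for all $x,\theta,\theta'$. Define $Au(x,\theta)=-\sigma(x)u(x,\theta)+\int_{S^2}k(x,\theta,\theta')u(x,\theta')\,d\theta'$. Let $a$ be a fixed known nonzero real constant (the strength of the acousto-optic effect). For $Q\in\mathbb{R}^3$ and $f\in L^\infty(\Gamma_-)$, let $u_{00},u_{01}\in L^\infty(X\times S^2)$ be the unique solutions of $$\theta\cdot\nabla u_{00}=Au_{00},\qquad u_{00}|_{\Gamma_-}=f,$$ $$\theta\cdot\nabla u_{01}=Au_{01}+a\cos(Q\cdot x)\,u_{00},\qquad u_{01}|_{\Gamma_-}=0,$$ where $\nabla$ is the gradient in $x$. (Existence and uniqueness of these $L^\infty$ solutions for admissible $(\sigma,k)$ is known.) The boundary value map is $\mathcal{A}^{01}_{\sigma,k}(Q,f)=u_{01}|_{\Gamma_+}$. *)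

theory Defs
  imports "HOL-Probability.Probability"
begin

type_synonym vec3 = "real ^ 3"

abbreviation S2 :: "vec3 set" where "S2 \<equiv> sphere 0 1"


subsection \<open>Bounded smooth domains and their boundary\<close>

text \<open>Continuous differentiability of order \<open>n\<close>; meant for open \<open>U\<close>.\<close>

fun Cn_on :: "nat \<Rightarrow> vec3 set \<Rightarrow> (vec3 \<Rightarrow> real) \<Rightarrow> bool" where
  "Cn_on 0 U f \<longleftrightarrow> continuous_on U f"
| "Cn_on (Suc n) U f \<longleftrightarrow>
     (\<exists>f'. (\<forall>x\<in>U. (f has_derivative f' x) (at x)) \<and> (\<forall>v. Cn_on n U (\<lambda>x. f' x v)))"

definition local_defining_function :: "vec3 set \<Rightarrow> vec3 \<Rightarrow> vec3 set \<Rightarrow> (vec3 \<Rightarrow> real) \<Rightarrow> vec3 \<Rightarrow> bool" where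
  "local_defining_function X p U \<psi> D \<longleftrightarrow>
     open U \<and> p \<in> U \<and> (\<forall>n. Cn_on n U \<psi>) \<and> X \<inter> U = {x\<in>U. \<psi> x < 0} \<and>
     (GDERIV \<psi> p :> D) \<and> D \<noteq> 0"

definition bounded_smooth_domain :: "vec3 set \<Rightarrow> bool" where
  "bounded_smooth_domain X \<longleftrightarrow>
     open X \<and> connected X \<and> X \<noteq> {} \<and> bounded X \<and>
     (\<forall>p\<in>frontier X. \<exists>U \<psi> D. local_defining_function X p U \<psi> D)"

text \<open>The normalised gradient of a defining function at \<open>p\<close> does not depend on the defining
  function, and it points out of \<open>X\<close> since \<open>X\<close> is locally where that function is negative.\<close>

definition outward_normal :: "vec3 set \<Rightarrow> vec3 \<Rightarrow> vec3" where
  "outward_normal X p = (THE n. \<exists>U \<psi> D. local_defining_function X p U \<psi> D \<and> n = sgn D)"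

definition Gamma_plus :: "vec3 set \<Rightarrow> (vec3 \<times> vec3) set" where
  "Gamma_plus X = {(x, \<theta>). x \<in> frontier X \<and> \<theta> \<in> S2 \<and> \<theta> \<bullet> outward_normal X x > 0}"

definition Gamma_minus :: "vec3 set \<Rightarrow> (vec3 \<times> vec3) set" where
  "Gamma_minus X = {(x, \<theta>). x \<in> frontier X \<and> \<theta> \<in> S2 \<and> - (\<theta> \<bullet> outward_normal X x) > 0}"


subsection \<open>Measures and \<open>L\<^sup>\<infinity>\<close> spaces\<close>

text \<open>Surface measure on the unit sphere: the area of \<open>A\<close> is three times the volume of the
  cone \<open>{r \<theta> | 0 < r < 1, \<theta> \<in> A}\<close>. The total mass is \<open>4 \<pi>\<close>.\<close>

definition sphere_measure :: "vec3 measure" where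
  "sphere_measure =
     scale_measure 3 (distr (restrict_space lborel (ball 0 1 - {0})) (restrict_space borel S2) sgn)"

text \<open>Two-dimensional Hausdorff (outer) measure, normalised to agree with area on planes.
  On a smooth surface it is the surface measure.\<close>

definition hausdorff2 :: "vec3 set \<Rightarrow> ennreal" where
  "hausdorff2 A = (SUP \<delta>\<in>{0<..}. INF C\<in>{C :: nat \<Rightarrow> vec3 set.
       A \<subseteq> (\<Union>i. C i) \<and> (\<forall>i. bounded (C i) \<and> diameter (C i) \<le> (\<delta>::real))}.
     \<Sum>i. ennreal (pi / 4 * (diameter (C i))\<^sup>2))"

definition boundary_measure :: "vec3 set \<Rightarrow> vec3 measure" where
  "boundary_measure X =
     measure_of (frontier X) (sets (restrict_space borel (frontier X))) hausdorff2"

definition phase_measure :: "vec3 set \<Rightarrow> (vec3 \<times> vec3) measure" where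
  "phase_measure X = restrict_space lborel X \<Otimes>\<^sub>M sphere_measure"

definition inflow_measure :: "vec3 set \<Rightarrow> (vec3 \<times> vec3) measure" where
  "inflow_measure X = restrict_space (boundary_measure X \<Otimes>\<^sub>M sphere_measure) (Gamma_minus X)"

definition outflow_measure :: "vec3 set \<Rightarrow> (vec3 \<times> vec3) measure" where
  "outflow_measure X = restrict_space (boundary_measure X \<Otimes>\<^sub>M sphere_measure) (Gamma_plus X)"

text \<open>Elements are representatives; equality in \<open>L\<^sup>\<infinity>\<close> is equality almost everywhere.\<close>

definition Linf :: "'a measure \<Rightarrow> ('a \<Rightarrow> real) set" where
  "Linf M = {f \<in> borel_measurable M. \<exists>C. AE z in M. \<bar>f z\<bar> \<le> C}"


subsection \<open>Admissible coefficients\<close>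

definition total_scattering :: "(vec3 \<Rightarrow> vec3 \<Rightarrow> vec3 \<Rightarrow> real) \<Rightarrow> vec3 \<Rightarrow> real" where
  "total_scattering k x =
     real_of_ereal (esssup sphere_measure (\<lambda>\<theta>. ereal \<bar>LINT \<theta>'|sphere_measure. k x \<theta> \<theta>'\<bar>))"

text \<open>\<open>C(X)\<close> is the space of bounded continuous functions on the open set \<open>X\<close>; it contains the
  restrictions of all functions continuous up to the boundary. Some boundedness is needed: if
  \<open>\<sigma>\<close> has a divergent integral along rays near the boundary, the inflow condition cannot be
  met.\<close>

definition admissible :: "vec3 set \<Rightarrow> (vec3 \<Rightarrow> real) \<Rightarrow> (vec3 \<Rightarrow> vec3 \<Rightarrow> vec3 \<Rightarrow> real) \<Rightarrow> bool" where
  "admissible X \<sigma> k \<longleftrightarrow>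
     continuous_on X \<sigma> \<and> bounded (\<sigma> ` X) \<and>
     continuous_on (X \<times> S2 \<times> S2) (\<lambda>(x, \<theta>, \<theta>'). k x \<theta> \<theta>') \<and>
     bounded ((\<lambda>(x, \<theta>, \<theta>'). k x \<theta> \<theta>') ` (X \<times> S2 \<times> S2)) \<and>
     (\<forall>x\<in>X. 0 \<le> \<sigma> x) \<and> (\<forall>x\<in>X. \<forall>\<theta>\<in>S2. \<forall>\<theta>'\<in>S2. 0 \<le> k x \<theta> \<theta>') \<and>
     (\<exists>c>0. (INF x\<in>X. \<sigma> x - total_scattering k x) > c) \<and>
     (\<forall>x\<in>X. \<forall>\<theta>\<in>S2. \<forall>\<theta>'\<in>S2. k x \<theta> \<theta>' = k x (- \<theta>') (- \<theta>))"


subsection \<open>Transport equations and the boundary value map\<close>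

definition transport_op ::
    "(vec3 \<Rightarrow> real) \<Rightarrow> (vec3 \<Rightarrow> vec3 \<Rightarrow> vec3 \<Rightarrow> real) \<Rightarrow> (vec3 \<times> vec3 \<Rightarrow> real) \<Rightarrow> vec3 \<times> vec3 \<Rightarrow> real" where
  "transport_op \<sigma> k u = (\<lambda>(x, \<theta>).
     - \<sigma> x * u (x, \<theta>) + (LINT \<theta>'|sphere_measure. k x \<theta> \<theta>' * u (x, \<theta>')))"

text \<open>\<open>\<theta> \<cdot> \<nabla>u = g\<close> in \<open>X \<times> S2\<close> for bounded \<open>u\<close> and \<open>g\<close>: \<open>u\<close> is a representative of its
  \<open>L\<^sup>\<infinity>\<close> class that is absolutely continuous with derivative \<open>g\<close> on almost every segment
  of a line of direction \<open>\<theta>\<close> contained in \<open>X\<close>. Such a representative exists precisely when the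
  equation holds in the sense of distributions.\<close>

definition streaming_eq ::
    "vec3 set \<Rightarrow> (vec3 \<times> vec3 \<Rightarrow> real) \<Rightarrow> (vec3 \<times> vec3 \<Rightarrow> real) \<Rightarrow> bool" where
  "streaming_eq X u g \<longleftrightarrow>
     (AE (x, \<theta>) in phase_measure X. \<forall>t\<ge>0. (\<forall>s\<in>{0..t}. x + s *\<^sub>R \<theta> \<in> X) \<longrightarrow>
        set_integrable lborel {0..t} (\<lambda>s. g (x + s *\<^sub>R \<theta>, \<theta>)) \<and>
        u (x + t *\<^sub>R \<theta>, \<theta>) - u (x, \<theta>) = (LINT s:{0..t}|lborel. g (x + s *\<^sub>R \<theta>, \<theta>)))"

text \<open>Boundary values are limits along the lines just mentioned.\<close>

definition inflow_trace ::
    "vec3 set \<Rightarrow> (vec3 \<times> vec3 \<Rightarrow> real) \<Rightarrow> (vec3 \<times> vec3 \<Rightarrow> real) \<Rightarrow> bool" where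
  "inflow_trace X u f \<longleftrightarrow>
     (AE (y, \<theta>) in inflow_measure X. ((\<lambda>t. u (y + t *\<^sub>R \<theta>, \<theta>)) \<longlongrightarrow> f (y, \<theta>)) (at_right 0))"

definition outflow_trace ::
    "vec3 set \<Rightarrow> (vec3 \<times> vec3 \<Rightarrow> real) \<Rightarrow> (vec3 \<times> vec3 \<Rightarrow> real) \<Rightarrow> bool" where
  "outflow_trace X u g \<longleftrightarrow>
     (AE (y, \<theta>) in outflow_measure X. ((\<lambda>t. u (y - t *\<^sub>R \<theta>, \<theta>)) \<longlongrightarrow> g (y, \<theta>)) (at_right 0))"

text \<open>\<open>u\<close> solves \<open>\<theta> \<cdot> \<nabla>u = A u + S\<close> with boundary value \<open>f\<close> on \<open>\<Gamma>\<^sub>-\<close>.\<close>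

definition transport_solution ::
    "vec3 set \<Rightarrow> (vec3 \<Rightarrow> real) \<Rightarrow> (vec3 \<Rightarrow> vec3 \<Rightarrow> vec3 \<Rightarrow> real) \<Rightarrow>
     (vec3 \<times> vec3 \<Rightarrow> real) \<Rightarrow> (vec3 \<times> vec3 \<Rightarrow> real) \<Rightarrow> (vec3 \<times> vec3 \<Rightarrow> real) \<Rightarrow> bool" where
  "transport_solution X \<sigma> k S f u \<longleftrightarrow>
     u \<in> Linf (phase_measure X) \<and>
     streaming_eq X u (\<lambda>z. transport_op \<sigma> k u z + S z) \<and>
     inflow_trace X u f"

text \<open>The value of the boundary value map at \<open>(Q, f)\<close>, as an element of \<open>L\<^sup>\<infinity>(\<Gamma>\<^sub>+)\<close>, i.e. the
  almost-everywhere class of all representatives of the outflow trace of \<open>u01\<close>. By existence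
  and uniqueness of \<open>u00\<close> and \<open>u01\<close> it is a single nonempty class. Equality of two
  such sets is therefore equality in \<open>L\<^sup>\<infinity>(\<Gamma>\<^sub>+)\<close>.\<close>

definition A01 ::
    "vec3 set \<Rightarrow> real \<Rightarrow> (vec3 \<Rightarrow> real) \<Rightarrow> (vec3 \<Rightarrow> vec3 \<Rightarrow> vec3 \<Rightarrow> real) \<Rightarrow>
     vec3 \<Rightarrow> (vec3 \<times> vec3 \<Rightarrow> real) \<Rightarrow> (vec3 \<times> vec3 \<Rightarrow> real) set" where
  "A01 X a \<sigma> k Q f = {g \<in> Linf (outflow_measure X). \<exists>u00 u01.
     transport_solution X \<sigma> k (\<lambda>_. 0) f u00 \<and>
     transport_solution X \<sigma> k (\<lambda>(x, \<theta>). a * cos (Q \<bullet> x) * u00 (x, \<theta>)) (\<lambda>_. 0) u01 \<and>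
     outflow_trace X u01 g}"

end

theory Submission
  imports Defs
begin

text \<open>
  The starting point is that the boundary data see single points of the interior.

  \<^emph>\<open>Solutions.\<close> Let \<open>E\<close> be the attenuation along the whole chord behind a point, \<open>J\<close> the integral of
  attenuated sources along that chord, and \<open>K\<close> the scattering operator. The solution with source
  \<open>S\<close> and inflow \<open>f\<close> is the fixed point of \<open>u = E f + J (K u + S)\<close>. The absorption hypothesis makes
  \<open>L = J K\<close> a contraction of the sup norm (\<open>L_contract\<close>), so the fixed point is a Neumann series,
  defined at every point. Every solution in the sense of \<open>L\<^sup>\<infinity>\<close> classes agrees with it almost
  everywhere (\<open>solution_unique\<close>), and so do the exit values (\<open>exit_value\<close>). To carry boundary values
  from the surface measure to lines one needs that a set of Hausdorff measure zero meets almost no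
  line of a given direction (\<open>hausdorff2_null_lines\<close>) and that almost no line is tangential to the
  boundary (\<open>glancing_null\<close>).

  \<^emph>\<open>Localisation.\<close> The exit value of \<open>u\<^sub>0\<^sub>1\<close> is linear and bounded in the modulation. Cosines
  of rational frequencies generate a dense set of even functions, so equal data give equal exit
  values when \<open>cos (Q \<bullet> x)\<close> is replaced by any even continuous function, in particular by a bump of
  radius \<open>r\<close> at \<open>p\<close> together with its reflection at \<open>- p\<close>. Along a line through \<open>p\<close> that misses the
  origin, the light that leaves the bump unscattered contributes order \<open>r\<close>. Scattered light
  contributes \<open>O(r\<^sup>2)\<close>: the glowing ball has brightness \<open>O(r)\<close> and, integrated along any line, its
  solid angle is again \<open>O(r)\<close> (\<open>L_beam\<close>). For small \<open>r\<close> the data therefore determine \<open>u\<^sub>0\<^sub>0\<close> at \<open>p\<close> times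
  the attenuation from \<open>p\<close> to the exit (\<open>weights_equal\<close>).

  \<^emph>\<open>Attenuation.\<close> Take \<open>f = 1\<close> and let \<open>p\<close> approach the entrance of the chord. There \<open>u\<^sub>0\<^sub>0\<close> tends to
  \<open>1\<close>, so the weights give the transmission along the whole chord, that is, the integral of \<open>\<sigma>\<close>. The
  X-ray transform is injective (\<open>xray_injective\<close>).

  \<^emph>\<open>Scattering.\<close> Once \<open>\<sigma>\<close> is known, the weights determine \<open>u\<^sub>0\<^sub>0\<close> inside \<open>X\<close> for each available \<open>f\<close>. Let \<open>f\<close> be
  the indicator of the lines that meet a ball of radius \<open>r\<close> with directions near \<open>c\<close>. In that ball
  \<open>u\<^sub>0\<^sub>0\<close> is \<open>E f + O(r)\<close>, and the gain by scattering into direction \<open>\<theta>\<close> is, up to \<open>O(r)\<close>, the integral of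
  \<open>k(x, \<theta>, \<cdot>) E\<close> over the directions near \<open>c\<close>. Equal \<open>u\<^sub>0\<^sub>0\<close> force equal gains along short
  segments, so the two kernels cannot differ (\<open>kernel_not_greater\<close>). Countably many such beams
  suffice, and they are enumerated by a real parameter.
\<close>

section \<open>The surface measure of the unit sphere\<close>

lemma sphere_measure_space [simp]: "space sphere_measure = S2"
  by (simp add: sphere_measure_def space_scale_measure)

lemma sphere_measure_sets [measurable_cong]: "sets sphere_measure = sets (restrict_space borel S2)"
  by (simp add: sphere_measure_def)

lemma measurable_sgn_sphere:
  "sgn \<in> restrict_space lborel (ball 0 1 - {0::vec3}) \<rightarrow>\<^sub>M restrict_space borel S2"
proof (rule measurable_restrict_space2)
  show "sgn \<in> space (restrict_space lborel (ball 0 1 - {0::vec3})) \<rightarrow> S2"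
    by (auto simp: space_restrict_space norm_sgn)
  show "sgn \<in> borel_measurable (restrict_space lborel (ball 0 1 - {0::vec3}))"
    unfolding sgn_div_norm by (intro measurable_restrict_space1) measurable
qed

lemma emeasure_sphere_measure:
  assumes "A \<in> sets sphere_measure"
  shows "emeasure sphere_measure A = 3 * emeasure lborel {x \<in> ball 0 1 - {0}. sgn x \<in> A}"
proof -
  have A: "A \<in> sets (restrict_space borel S2)"
    using assms by (simp add: sphere_measure_sets)
  have "emeasure sphere_measure A =
      3 * emeasure (restrict_space lborel (ball 0 1 - {0})) (sgn -` A \<inter> (ball 0 1 - {0}))"
    unfolding sphere_measure_def using measurable_sgn_sphere A
    by (simp add: emeasure_scale_measure emeasure_distr space_restrict_space)
  also have "emeasure (restrict_space lborel (ball 0 1 - {0})) (sgn -` A \<inter> (ball 0 1 - {0})) =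
      emeasure lborel (sgn -` A \<inter> (ball 0 1 - {0}))"
    by (rule emeasure_restrict_space) auto
  also have "sgn -` A \<inter> (ball 0 1 - {0}) = {x \<in> ball 0 1 - {0}. sgn x \<in> A}" by auto
  finally show ?thesis .
qed

lemma sphere_measure_sets_borel: "B \<in> sets borel \<Longrightarrow> {\<theta> \<in> S2. \<theta> \<in> B} \<in> sets sphere_measure"
  by (auto simp: sphere_measure_sets sets_restrict_space)

lemma cbox_around: "cball (c::vec3) \<rho> \<subseteq> cbox (c - (\<chi> i. \<rho>)) (c + (\<chi> i. \<rho>))"
proof
  fix x assume x: "x \<in> cball c \<rho>"
  have "\<bar>(x - c) $ i\<bar> \<le> \<rho>" for i
    using component_le_norm_cart[of "x - c" i] x by (simp add: dist_norm norm_minus_commute)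
  then show "x \<in> cbox (c - (\<chi> i. \<rho>)) (c + (\<chi> i. \<rho>))"
    by (auto simp: mem_box_cart abs_le_iff) (smt (verit, best))+
qed

lemma emeasure_cube:
  assumes "0 \<le> \<rho>"
  shows "emeasure lborel (cbox (c - (\<chi> i. \<rho>)) (c + (\<chi> i. \<rho>) :: vec3)) = ennreal (8 * \<rho>^3)"
proof -
  have "measure lborel (cbox (c - (\<chi> i. \<rho>)) (c + (\<chi> i. \<rho>) :: vec3)) = (2 * \<rho>)^3"
    using assms by (subst content_cbox_cart) (auto simp: interval_eq_empty_cart)
  then have "measure lborel (cbox (c - (\<chi> i. \<rho>)) (c + (\<chi> i. \<rho>) :: vec3)) = 8 * \<rho>^3"
    by (simp add: power_mult_distrib)
  then show ?thesis
    by (subst emeasure_eq_ennreal_measure)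
      (use emeasure_lborel_cbox_finite in \<open>auto simp: less_top\<close>)
qed

definition tube :: "vec3 \<Rightarrow> vec3 \<Rightarrow> real \<Rightarrow> real \<Rightarrow> vec3 set" where
  "tube c \<theta> l \<rho> = (\<Union>s\<in>{0..l}. cball (c + s *\<^sub>R \<theta>) \<rho>)"

lemma compact_tube: "compact (tube c \<theta> l \<rho>)"
proof -
  have "tube c \<theta> l \<rho> = (\<lambda>(s, y). c + s *\<^sub>R \<theta> + y) ` ({0..l} \<times> cball 0 \<rho>)" (is "_ = ?R")
  proof
    show "tube c \<theta> l \<rho> \<subseteq> ?R"
    proof
      fix x assume "x \<in> tube c \<theta> l \<rho>"
      then obtain s where s: "s \<in> {0..l}" "dist (c + s *\<^sub>R \<theta>) x \<le> \<rho>" by (auto simp: tube_def)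
      then have "x = (\<lambda>(s, y). c + s *\<^sub>R \<theta> + y) (s, x - (c + s *\<^sub>R \<theta>))"
        "(s, x - (c + s *\<^sub>R \<theta>)) \<in> {0..l} \<times> cball 0 \<rho>"
        by (auto simp: dist_norm norm_minus_commute)
      then show "x \<in> ?R" by blast
    qed
    show "?R \<subseteq> tube c \<theta> l \<rho>"
      by (force simp: tube_def dist_norm)
  qed
  moreover have "compact ?R"
    by (intro compact_continuous_image compact_Times)
       (auto intro!: continuous_intros simp: split_beta)
  ultimately show ?thesis by simp
qed

text \<open>A tube is covered by about \<open>l / \<rho>\<close> cubes of side \<open>4 \<rho>\<close>, which gives the right order
  \<open>\<rho>\<^sup>2 l\<close> without rotating coordinates.\<close>

lemma emeasure_tube_le:
  assumes "norm \<theta> = 1" "0 < \<rho>" "0 \<le> l"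
  shows "emeasure lborel (tube c \<theta> l \<rho>) \<le> ennreal (64 * \<rho>\<^sup>2 * (l + 2 * \<rho>))"
proof -
  define n where "n = nat \<lceil>l / \<rho>\<rceil>"
  define Q where "Q i = (let d = c + (real i * \<rho>) *\<^sub>R \<theta> in
      cbox (d - (\<chi> i. 2 * \<rho>)) (d + (\<chi> i. 2 * \<rho>)) :: vec3 set)" for i
  have sub: "tube c \<theta> l \<rho> \<subseteq> (\<Union>i\<in>{..n}. Q i)"
  proof
    fix x assume "x \<in> tube c \<theta> l \<rho>"
    then obtain s where s: "0 \<le> s" "s \<le> l" "dist (c + s *\<^sub>R \<theta>) x \<le> \<rho>" by (auto simp: tube_def)
    define i where "i = nat \<lfloor>s / \<rho>\<rfloor>"
    have ri: "real i = of_int \<lfloor>s / \<rho>\<rfloor>"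
      using s assms by (simp add: i_def)
    have i1: "real i \<le> s / \<rho>" "s / \<rho> < real i + 1"
      unfolding ri by linarith+
    have "i \<le> n"
    proof -
      have "s / \<rho> \<le> l / \<rho>" using s assms by (simp add: divide_right_mono)
      then have "\<lfloor>s / \<rho>\<rfloor> \<le> \<lceil>l / \<rho>\<rceil>" by linarith
      then show ?thesis by (simp add: i_def n_def nat_mono)
    qed
    have "\<bar>s - real i * \<rho>\<bar> \<le> \<rho>"
      using i1 assms by (auto simp: field_simps abs_le_iff)
    then have "dist (c + (real i * \<rho>) *\<^sub>R \<theta>) (c + s *\<^sub>R \<theta>) \<le> \<rho>"
      using assms by (simp add: dist_norm abs_minus_commute flip: scaleR_diff_left)
    then have "x \<in> cball (c + (real i * \<rho>) *\<^sub>R \<theta>) (2 * \<rho>)"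
      using s dist_triangle[of "c + (real i * \<rho>) *\<^sub>R \<theta>" x "c + s *\<^sub>R \<theta>"] by simp
    then have "x \<in> Q i" using cbox_around unfolding Q_def Let_def by blast
    then show "x \<in> (\<Union>i\<in>{..n}. Q i)" using \<open>i \<le> n\<close> by auto
  qed
  have "emeasure lborel (tube c \<theta> l \<rho>) \<le> emeasure lborel (\<Union>i\<in>{..n}. Q i)"
    by (rule emeasure_mono[OF sub]) (auto simp: Q_def Let_def)
  also have "\<dots> \<le> (\<Sum>i\<in>{..n}. emeasure lborel (Q i))"
    by (rule emeasure_subadditive_finite) (auto simp: Q_def Let_def)
  also have "\<dots> = (\<Sum>i\<in>{..n}. ennreal (64 * \<rho>^3))"
    using assms by (intro sum.cong) (simp_all add: Q_def Let_def emeasure_cube power_mult_distrib)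
  also have "\<dots> = ennreal ((real n + 1) * (64 * \<rho>^3))"
    using assms by (subst sum_ennreal) (auto simp: algebra_simps)
  also have "\<dots> \<le> ennreal (64 * \<rho>\<^sup>2 * (l + 2 * \<rho>))"
  proof (rule ennreal_leI)
    have "real n \<le> l / \<rho> + 1"
      using assms unfolding n_def by (smt (verit) divide_nonneg_pos of_int_ceiling_le_add_one
          of_nat_nat zero_le_ceiling)
    then have "(real n + 1) * (64 * \<rho>^3) \<le> (l / \<rho> + 2) * (64 * \<rho>^3)"
      using assms by (intro mult_right_mono) auto
    also have "\<dots> = 64 * \<rho>\<^sup>2 * (l + 2 * \<rho>)"
      using assms by (simp add: field_simps power2_eq_square power3_eq_cube)
    finally show "(real n + 1) * (64 * \<rho>^3) \<le> 64 * \<rho>\<^sup>2 * (l + 2 * \<rho>)" .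
  qed
  finally show ?thesis .
qed

lemma emeasure_sphere_measure_le: "emeasure sphere_measure S2 \<le> 24"
proof -
  have "emeasure sphere_measure S2 = 3 * emeasure lborel {x \<in> ball 0 1 - {0::vec3}. sgn x \<in> S2}"
    by (rule emeasure_sphere_measure) (use sets.top[of sphere_measure] in simp)
  also have "\<dots> \<le> 3 * emeasure lborel (cbox (0 - (\<chi> i. 1)) (0 + (\<chi> i. 1)) :: vec3 set)"
  proof (intro mult_left_mono emeasure_mono)
    have "{x \<in> ball 0 1 - {0::vec3}. sgn x \<in> S2} \<subseteq> cball 0 1" by auto
    then show "{x \<in> ball 0 1 - {0::vec3}. sgn x \<in> S2} \<subseteq> cbox (0 - (\<chi> i. 1)) (0 + (\<chi> i. 1))"
      using cbox_around[of 0 1] by blast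
  qed auto
  also have "\<dots> = 24"
    using emeasure_cube[of 1 0]
    by (simp del: diff_0 add_0_left add: ennreal_mult''[symmetric] flip: ennreal_numeral)
  finally show ?thesis .
qed

interpretation sphere: finite_measure sphere_measure
  by standard (use emeasure_sphere_measure_le in \<open>auto simp: top_unique\<close>)

lemma measure_sphere_le: "measure sphere_measure A \<le> 24"
proof -
  have "measure sphere_measure A \<le> measure sphere_measure S2"
    using sphere.bounded_measure[of A] by simp
  also have "\<dots> \<le> 24"
    using emeasure_sphere_measure_le by (simp add: sphere.emeasure_eq_measure flip: ennreal_numeral)
  finally show ?thesis .
qed

lemma great_circle_null:
  assumes "n \<noteq> (0::vec3)"
  shows "AE \<theta> in sphere_measure. \<theta> \<bullet> n \<noteq> 0"
proof -
  let ?A = "{\<theta> \<in> S2. \<theta> \<in> {\<theta>. \<theta> \<bullet> n = 0}}"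
  have A: "?A \<in> sets sphere_measure"
    by (rule sphere_measure_sets_borel) measurable
  have "negligible {x. n \<bullet> x = 0}" using assms by (intro negligible_hyperplane) auto
  then have null: "{x. n \<bullet> x = 0} \<in> null_sets lborel"
    by (auto simp: negligible_iff_null_sets null_sets_completion_iff)
  have "emeasure lborel {x \<in> ball 0 1 - {0}. sgn x \<in> ?A} \<le> emeasure lborel {x. n \<bullet> x = 0}"
    by (intro emeasure_mono) (auto simp: sgn_div_norm inner_commute)
  then have "emeasure sphere_measure ?A = 0"
    unfolding emeasure_sphere_measure[OF A] using null by (simp add: null_sets_def)
  then have "?A \<in> null_sets sphere_measure" using A by auto
  then show ?thesis
    by (rule AE_I') auto
qed

lemma sphere_measure_open_pos:
  assumes "open U" "\<theta> \<in> U" "\<theta> \<in> S2"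
  shows "0 < measure sphere_measure {\<theta> \<in> S2. \<theta> \<in> U}"
proof -
  let ?A = "{\<theta> \<in> S2. \<theta> \<in> U}" and ?C = "{x \<in> ball 0 1 - {0}. sgn x \<in> U}"
  have A: "?A \<in> sets sphere_measure"
    by (rule sphere_measure_sets_borel) (use assms in auto)
  have "continuous_on (ball 0 1 - {0::vec3}) sgn"
    unfolding sgn_div_norm by (intro continuous_intros) auto
  then have "open (sgn -` U \<inter> (ball 0 1 - {0::vec3}))"
    using continuous_open_preimage[of "ball 0 1 - {0::vec3}" sgn U] assms
    by (simp add: Int_commute open_delete)
  moreover have "sgn -` U \<inter> (ball 0 1 - {0::vec3}) = ?C" by auto
  ultimately have op: "open ?C" by simp
  have "(1/2) *\<^sub>R \<theta> \<in> ?C"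
    using assms by (auto simp: sgn_div_norm)
  then have "\<not> negligible ?C" using op open_not_negligible by blast
  then have "emeasure lborel ?C \<noteq> 0"
    using op by (auto simp: negligible_iff_null_sets null_sets_completion_iff null_sets_def)
  moreover have "{x \<in> ball 0 1 - {0}. sgn x \<in> ?A} = ?C" by (auto simp: norm_sgn)
  ultimately have "emeasure sphere_measure ?A \<noteq> 0"
    unfolding emeasure_sphere_measure[OF A] by simp
  then show ?thesis
    by (simp add: sphere.emeasure_eq_measure zero_less_measure_iff)
qed

text \<open>The cone over a cap of radius \<open>\<rho>\<close> around \<open>e\<close> lies in the tube of radius \<open>\<rho>\<close> around the segment
  from \<open>0\<close> to \<open>e\<close>.\<close>

lemma measure_cap_le:
  assumes "norm e = 1" "0 < \<rho>" "\<rho> \<le> 1"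
  shows "measure sphere_measure {\<theta> \<in> S2. norm (\<theta> - e) \<le> \<rho>} \<le> 576 * \<rho>\<^sup>2"
proof -
  let ?A = "{\<theta> \<in> S2. \<theta> \<in> {\<theta>. norm (\<theta> - e) \<le> \<rho>}}"
  have A: "?A \<in> sets sphere_measure"
    by (rule sphere_measure_sets_borel) measurable
  have sub: "{x \<in> ball 0 1 - {0}. sgn x \<in> ?A} \<subseteq> tube 0 e 1 \<rho>"
  proof
    fix x assume x: "x \<in> {x \<in> ball 0 1 - {0}. sgn x \<in> ?A}"
    have "norm x *\<^sub>R (sgn x - e) = x - norm x *\<^sub>R e"
      using x by (simp add: scaleR_diff_right sgn_div_norm)
    then have "norm (x - norm x *\<^sub>R e) = norm x * norm (sgn x - e)"
      by (metis abs_norm_cancel norm_scaleR)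
    also have "\<dots> \<le> 1 * \<rho>" using x by (intro mult_mono) auto
    finally have "x \<in> cball (0 + norm x *\<^sub>R e) \<rho>" by (simp add: dist_norm norm_minus_commute)
    moreover have "norm x \<in> {0..1}" using x by auto
    ultimately show "x \<in> tube 0 e 1 \<rho>" unfolding tube_def by blast
  qed
  have "emeasure sphere_measure ?A \<le> 3 * emeasure lborel (tube 0 e 1 \<rho>)"
    unfolding emeasure_sphere_measure[OF A]
    by (intro mult_left_mono emeasure_mono sub) (auto intro: compact_tube borel_compact)
  also have "\<dots> \<le> 3 * ennreal (64 * \<rho>\<^sup>2 * (1 + 2 * \<rho>))"
    using assms by (intro mult_left_mono emeasure_tube_le) auto
  also have "\<dots> = ennreal (192 * \<rho>\<^sup>2 * (1 + 2 * \<rho>))"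
    using assms by (simp add: ennreal_mult''[symmetric] flip: ennreal_numeral)
  also have "\<dots> \<le> ennreal (192 * \<rho>\<^sup>2 * 3)"
    using assms by (intro ennreal_leI mult_left_mono) auto
  finally have "ennreal (measure sphere_measure ?A) \<le> ennreal (576 * \<rho>\<^sup>2)"
    by (simp add: sphere.emeasure_eq_measure)
  then show ?thesis by (simp add: ennreal_le_iff)
qed

lemma norm_sgn_diff_le:
  fixes v w :: vec3
  assumes "v \<noteq> 0"
  shows "norm (sgn w - sgn v) \<le> 2 * norm (w - v) / norm v"
proof -
  have "norm v *\<^sub>R (sgn w - sgn v) = (norm v - norm w) *\<^sub>R sgn w + (w - v)"
    using assms by (cases "w = 0") (simp_all add: algebra_simps sgn_div_norm)
  then have "norm v * norm (sgn w - sgn v) = norm ((norm v - norm w) *\<^sub>R sgn w + (w - v))"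
    by (metis abs_norm_cancel norm_scaleR)
  also have "\<dots> \<le> \<bar>norm v - norm w\<bar> * norm (sgn w) + norm (w - v)"
    using norm_triangle_ineq by (metis norm_scaleR)
  also have "\<dots> \<le> \<bar>norm v - norm w\<bar> * 1 + norm (w - v)"
    by (intro add_right_mono mult_left_mono) (auto simp: norm_sgn)
  also have "\<dots> \<le> 2 * norm (w - v)"
    using norm_triangle_ineq3[of v w] by (simp add: norm_minus_commute)
  finally show ?thesis using assms by (simp add: field_simps)
qed

definition hits_ball :: "vec3 \<Rightarrow> real \<Rightarrow> vec3 \<Rightarrow> vec3 \<Rightarrow> bool" where
  "hits_ball p r z \<theta> \<longleftrightarrow> (\<exists>t. dist (z + t *\<^sub>R \<theta>) p < r)"

lemma hits_ball_shift [simp]: "hits_ball p r (z + s *\<^sub>R \<theta>) \<theta> = hits_ball p r z \<theta>"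
proof -
  have "dist (z + (s + t) *\<^sub>R \<theta>) p = dist (z + s *\<^sub>R \<theta> + t *\<^sub>R \<theta>) p" for t
    by (simp add: algebra_simps)
  then show ?thesis unfolding hits_ball_def by (metis add.commute diff_add_cancel)
qed

lemma open_hits_ball: "open {(z, \<theta>). hits_ball p r z \<theta>}"
proof -
  have "{(z, \<theta>). hits_ball p r z \<theta>} = (\<Union>t. {x. dist (fst x + t *\<^sub>R snd x) p < r})"
    by (auto simp: hits_ball_def)
  moreover have "open {x::vec3\<times>vec3. dist (fst x + t *\<^sub>R snd x) p < r}" for t
    by (intro open_Collect_less continuous_intros)
  ultimately show ?thesis by auto
qed

lemma sets_hits_ball: "{\<theta> \<in> S2. hits_ball p r z \<theta>} \<in> sets sphere_measure"
proof -
  have "{\<theta>. hits_ball p r z \<theta>} = (\<Union>t. {\<theta>. dist (z + t *\<^sub>R \<theta>) p < r})"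
    by (auto simp: hits_ball_def)
  moreover have "open {\<theta>::vec3. dist (z + t *\<^sub>R \<theta>) p < r}" for t
    by (intro open_Collect_less continuous_intros)
  ultimately have "open {\<theta>. hits_ball p r z \<theta>}" by auto
  then show ?thesis using sphere_measure_sets_borel[of "{\<theta>. hits_ball p r z \<theta>}"] by simp
qed

text \<open>Seen from a distance \<open>d > 2 r\<close>, the lines that meet the ball have directions in two opposite caps of
  radius \<open>2 r / d\<close>. For smaller \<open>d\<close> the right side exceeds the area of the sphere.\<close>

lemma measure_hits_ball_le:
  assumes "0 < r"
  shows "measure sphere_measure {\<theta> \<in> S2. hits_ball p r z \<theta>} \<le> 5760 * (r\<^sup>2 / (r\<^sup>2 + (dist z p)\<^sup>2))"
proof (cases "dist z p \<le> 2 * r")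
  case True
  then have "(dist z p)\<^sup>2 \<le> (2 * r)\<^sup>2" by (intro power_mono) auto
  then have "r\<^sup>2 + (dist z p)\<^sup>2 \<le> 5 * r\<^sup>2" by (simp add: power_mult_distrib)
  moreover have "0 < r\<^sup>2 + (dist z p)\<^sup>2" using assms by (simp add: add_pos_nonneg)
  ultimately have "1/5 \<le> r\<^sup>2 / (r\<^sup>2 + (dist z p)\<^sup>2)" by (simp add: field_simps)
  then show ?thesis using measure_sphere_le[of "{\<theta> \<in> S2. hits_ball p r z \<theta>}"] by linarith
next
  case False
  define v where "v = p - z"
  define e where "e = sgn v"
  define \<rho> where "\<rho> = 2 * r / norm v"
  have nv: "norm v = dist z p" by (simp add: v_def dist_norm norm_minus_commute)
  have v: "norm v > 2 * r" "v \<noteq> 0" using False assms nv by auto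
  have \<rho>: "0 < \<rho>" "\<rho> \<le> 1" using v assms by (auto simp: \<rho>_def)
  have e: "norm e = 1" "norm (- e) = 1" using v by (auto simp: e_def norm_sgn)
  have sub: "{\<theta> \<in> S2. hits_ball p r z \<theta>} \<subseteq>
      {\<theta> \<in> S2. norm (\<theta> - e) \<le> \<rho>} \<union> {\<theta> \<in> S2. norm (\<theta> - (- e)) \<le> \<rho>}"
  proof
    fix \<theta> assume "\<theta> \<in> {\<theta> \<in> S2. hits_ball p r z \<theta>}"
    then obtain t where \<theta>: "norm \<theta> = 1" and t: "dist (z + t *\<^sub>R \<theta>) p < r"
      by (auto simp: hits_ball_def)
    have t': "norm (t *\<^sub>R \<theta> - v) < r" using t by (simp add: v_def dist_norm algebra_simps)
    have "norm (sgn (t *\<^sub>R \<theta>) - e) \<le> 2 * norm (t *\<^sub>R \<theta> - v) / norm v"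
      unfolding e_def by (rule norm_sgn_diff_le) (fact v)
    also have "\<dots> \<le> \<rho>"
      unfolding \<rho>_def using t' v assms by (intro divide_right_mono) auto
    finally have *: "norm (sgn (t *\<^sub>R \<theta>) - e) \<le> \<rho>" .
    have "t \<noteq> 0" using t' v assms by auto
    moreover have "sgn (t *\<^sub>R \<theta>) = sgn t *\<^sub>R \<theta>"
      using \<theta> by (simp add: sgn_div_norm)
    ultimately consider "sgn (t *\<^sub>R \<theta>) = \<theta>" | "sgn (t *\<^sub>R \<theta>) = - \<theta>"
      by (cases "t > 0") auto
    then show "\<theta> \<in> {\<theta> \<in> S2. norm (\<theta> - e) \<le> \<rho>} \<union> {\<theta> \<in> S2. norm (\<theta> - (- e)) \<le> \<rho>}"
    proof cases
      case 1 then show ?thesis using * \<theta> by simp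
    next
      case 2
      have "norm (\<theta> + e) = norm (- \<theta> - e)" by (metis minus_add_distrib norm_minus_cancel uminus_add_conv_diff add.commute)
      then show ?thesis using * \<theta> 2 by simp
    qed
  qed
  have sets: "{\<theta> \<in> S2. norm (\<theta> - d) \<le> \<rho>} \<in> sets sphere_measure" for d
    using sphere_measure_sets_borel[of "{\<theta>. norm (\<theta> - d) \<le> \<rho>}"] by simp
  have "measure sphere_measure {\<theta> \<in> S2. hits_ball p r z \<theta>} \<le>
      measure sphere_measure ({\<theta> \<in> S2. norm (\<theta> - e) \<le> \<rho>} \<union> {\<theta> \<in> S2. norm (\<theta> - (- e)) \<le> \<rho>})"
    by (intro sphere.finite_measure_mono sub sets.Un sets)
  also have "\<dots> \<le> 576 * \<rho>\<^sup>2 + 576 * \<rho>\<^sup>2"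
    by (rule order_trans[OF measure_Un_le[OF sets sets]])
      (intro add_mono measure_cap_le e \<rho>)
  also have "\<dots> = 4608 * (r\<^sup>2 / (norm v)\<^sup>2)"
    by (simp add: \<rho>_def power_divide power_mult_distrib)
  also have "\<dots> \<le> 4608 * ((5/4) * (r\<^sup>2 / (r\<^sup>2 + (norm v)\<^sup>2)))"
  proof (intro mult_left_mono)
    have "(2 * r)\<^sup>2 \<le> (norm v)\<^sup>2" using v assms by (intro power_mono) auto
    then have "4 * (r\<^sup>2 + (norm v)\<^sup>2) \<le> 5 * (norm v)\<^sup>2" by (simp add: power_mult_distrib)
    moreover have "0 < r\<^sup>2 + (norm v)\<^sup>2" "0 < (norm v)\<^sup>2" using assms v by (auto intro: add_pos_nonneg)
    ultimately have "1 / (norm v)\<^sup>2 \<le> (5/4) * (1 / (r\<^sup>2 + (norm v)\<^sup>2))" by (simp add: field_simps)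
    from mult_left_mono[OF this, of "r\<^sup>2"]
    show "r\<^sup>2 / (norm v)\<^sup>2 \<le> (5/4) * (r\<^sup>2 / (r\<^sup>2 + (norm v)\<^sup>2))" by (simp add: field_simps)
  qed auto
  finally have "measure sphere_measure {\<theta> \<in> S2. hits_ball p r z \<theta>} \<le>
      (4608 * (5/4)) * (r\<^sup>2 / (r\<^sup>2 + (norm v)\<^sup>2))"
    by (simp only: mult.assoc)
  moreover have "4608 * (5/4) = (5760::real)" by simp
  ultimately show ?thesis by (simp only: nv)
qed

section \<open>Two-dimensional Hausdorff measure\<close>

definition size_covers :: "real \<Rightarrow> vec3 set \<Rightarrow> (nat \<Rightarrow> vec3 set) set" where
  "size_covers \<delta> A = {C. A \<subseteq> (\<Union>i. C i) \<and> (\<forall>i. bounded (C i) \<and> diameter (C i) \<le> \<delta>)}"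

definition cover_weight :: "(nat \<Rightarrow> vec3 set) \<Rightarrow> ennreal" where
  "cover_weight C = (\<Sum>i. ennreal (pi / 4 * (diameter (C i))\<^sup>2))"

definition hausdorff_pre :: "real \<Rightarrow> vec3 set \<Rightarrow> ennreal" where
  "hausdorff_pre \<delta> A = (INF C\<in>size_covers \<delta> A. cover_weight C)"

lemma hausdorff2_alt: "hausdorff2 A = (SUP \<delta>\<in>{0<..}. hausdorff_pre \<delta> A)"
  by (simp add: hausdorff2_def hausdorff_pre_def size_covers_def cover_weight_def)

lemma hausdorff_pre_le: "C \<in> size_covers \<delta> A \<Longrightarrow> hausdorff_pre \<delta> A \<le> cover_weight C"
  unfolding hausdorff_pre_def by (rule INF_lower)

lemma hausdorff_pre_antimono: "\<delta> \<le> \<delta>' \<Longrightarrow> hausdorff_pre \<delta>' A \<le> hausdorff_pre \<delta> A"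
  unfolding hausdorff_pre_def
  by (rule INF_superset_mono) (auto simp: size_covers_def intro: order_trans)

lemma hausdorff_pre_mono: "A \<subseteq> B \<Longrightarrow> hausdorff_pre \<delta> A \<le> hausdorff_pre \<delta> B"
  unfolding hausdorff_pre_def by (rule INF_superset_mono) (auto simp: size_covers_def)

lemma hausdorff_pre_le_hausdorff2: "0 < \<delta> \<Longrightarrow> hausdorff_pre \<delta> A \<le> hausdorff2 A"
  unfolding hausdorff2_alt by (rule SUP_upper) auto

lemma hausdorff2_mono: "A \<subseteq> B \<Longrightarrow> hausdorff2 A \<le> hausdorff2 B"
  unfolding hausdorff2_alt by (intro SUP_mono) (auto intro: hausdorff_pre_mono)

lemma hausdorff2_empty: "hausdorff2 {} = 0"
proof -
  have "hausdorff_pre \<delta> {} \<le> 0" if "0 < \<delta>" for \<delta>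
  proof -
    have "(\<lambda>_. {}) \<in> size_covers \<delta> {}" using that by (simp add: size_covers_def)
    from hausdorff_pre_le[OF this] show ?thesis by (simp add: cover_weight_def)
  qed
  then show ?thesis unfolding hausdorff2_alt by (simp add: SUP_eq_const)
qed

lemma hausdorff2_eq_SUP: "hausdorff2 A = (SUP n. hausdorff_pre (1 / real (Suc n)) A)"
proof (rule antisym)
  show "hausdorff2 A \<le> (SUP n. hausdorff_pre (1 / real (Suc n)) A)"
    unfolding hausdorff2_alt
  proof (rule SUP_least)
    fix \<delta> :: real assume "\<delta> \<in> {0<..}"
    then obtain n where "inverse (real (Suc n)) < \<delta>" using reals_Archimedean by auto
    then have "hausdorff_pre \<delta> A \<le> hausdorff_pre (1 / real (Suc n)) A"
      by (intro hausdorff_pre_antimono) (simp add: inverse_eq_divide)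
    then show "hausdorff_pre \<delta> A \<le> (SUP n. hausdorff_pre (1 / real (Suc n)) A)"
      by (rule order_trans) (rule SUP_upper, simp)
  qed
  show "(SUP n. hausdorff_pre (1 / real (Suc n)) A) \<le> hausdorff2 A"
    by (intro SUP_least hausdorff_pre_le_hausdorff2) simp
qed

lemma near_optimal_cover:
  assumes "hausdorff_pre \<delta> A < \<top>" "0 < (e::ennreal)"
  obtains C where "C \<in> size_covers \<delta> A" "cover_weight C \<le> hausdorff_pre \<delta> A + e"
proof -
  have "hausdorff_pre \<delta> A < hausdorff_pre \<delta> A + e"
    using assms by (cases "hausdorff_pre \<delta> A") (auto simp: ennreal_add_left_cancel_less intro: ennreal_between)
  then obtain C where "C \<in> size_covers \<delta> A" "cover_weight C < hausdorff_pre \<delta> A + e"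
    unfolding hausdorff_pre_def INF_less_iff by blast
  then show ?thesis using that by (auto intro: less_imp_le)
qed

lemma hausdorff_pre_countable_subadditive:
  "hausdorff_pre \<delta> (\<Union>n::nat. A n) \<le> (\<Sum>n. hausdorff_pre \<delta> (A n))"
proof (cases "(\<Sum>n. hausdorff_pre \<delta> (A n)) = \<top>")
  case False
  have fin: "hausdorff_pre \<delta> (A n) < \<top>" for n
    using False ennreal_suminf_lessD less_top by blast
  show ?thesis
  proof (rule ennreal_le_epsilon)
    fix e :: real assume e: "0 < e"
    have "\<exists>C. C \<in> size_covers \<delta> (A n) \<and>
        cover_weight C \<le> hausdorff_pre \<delta> (A n) + ennreal (e * (1/2)^Suc n)" for n
      using near_optimal_cover[OF fin, of "ennreal (e * (1/2)^Suc n)" n] e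
      by (metis ennreal_0 ennreal_less_iff mult_pos_pos order_refl zero_less_divide_1_iff
          zero_less_numeral zero_less_power)
    then obtain C where C: "\<And>n. C n \<in> size_covers \<delta> (A n)"
      "\<And>n. cover_weight (C n) \<le> hausdorff_pre \<delta> (A n) + ennreal (e * (1/2)^Suc n)" by metis
    define D where "D k = C (fst (prod_decode k)) (snd (prod_decode k))" for k
    have "D \<in> size_covers \<delta> (\<Union>n. A n)"
      unfolding size_covers_def
    proof (intro CollectI conjI allI)
      show "(\<Union>n. A n) \<subseteq> (\<Union>i. D i)"
      proof
        fix x assume "x \<in> (\<Union>n. A n)"
        then obtain n i where "x \<in> C n i" using C(1) unfolding size_covers_def by blast
        then have "x \<in> D (prod_encode (n, i))" by (simp add: D_def)
        then show "x \<in> (\<Union>i. D i)" by blast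
      qed
    qed (use C(1) in \<open>auto simp: size_covers_def D_def\<close>)
    then have "hausdorff_pre \<delta> (\<Union>n. A n) \<le> cover_weight D" by (rule hausdorff_pre_le)
    also have "cover_weight D = (\<Sum>n. cover_weight (C n))"
    proof -
      have "(\<Sum>n. (\<lambda>(n, i). ennreal (pi / 4 * (diameter (C n i))\<^sup>2)) (prod_decode n)) =
          (\<Sum>n. cover_weight (C n))"
        by (rule suminf_ennreal_2dimen[unfolded o_def]) (simp add: cover_weight_def)
      then show ?thesis by (simp add: cover_weight_def D_def split_beta)
    qed
    also have "\<dots> \<le> (\<Sum>n. hausdorff_pre \<delta> (A n) + ennreal (e * (1/2)^Suc n))"
      by (intro suminf_le C summableI)
    also have "\<dots> = (\<Sum>n. hausdorff_pre \<delta> (A n)) + (\<Sum>n. ennreal (e * (1/2)^Suc n))"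
      by (rule suminf_add[symmetric]) auto
    also have "(\<Sum>n. ennreal (e * (1/2)^Suc n)) = ennreal e"
      using e power_half_series sums_mult[OF power_half_series, of e]
      by (intro suminf_ennreal_eq) auto
    finally show "hausdorff_pre \<delta> (\<Union>n. A n) \<le> (\<Sum>n. hausdorff_pre \<delta> (A n)) + ennreal e" .
  qed
qed simp

lemma hausdorff2_countable_subadditive: "hausdorff2 (\<Union>n::nat. A n) \<le> (\<Sum>n. hausdorff2 (A n))"
  unfolding hausdorff2_alt[of "\<Union>n. A n"]
proof (rule SUP_least)
  fix \<delta> :: real assume "\<delta> \<in> {0<..}"
  then have "(\<Sum>n. hausdorff_pre \<delta> (A n)) \<le> (\<Sum>n. hausdorff2 (A n))"
    by (intro suminf_le hausdorff_pre_le_hausdorff2 summableI) auto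
  then show "hausdorff_pre \<delta> (\<Union>n. A n) \<le> (\<Sum>n. hausdorff2 (A n))"
    using hausdorff_pre_countable_subadditive order_trans by blast
qed

lemma hausdorff2_subadditive: "hausdorff2 (A \<union> B) \<le> hausdorff2 A + hausdorff2 B"
proof -
  have "hausdorff2 (\<Union>i. binaryset A B i) \<le> (\<Sum>i. hausdorff2 (binaryset A B i))"
    by (rule hausdorff2_countable_subadditive)
  then show ?thesis
    by (simp add: UN_binaryset_eq suminf_binaryset_eq[unfolded o_def] hausdorff2_empty)
qed

text \<open>A set of a cover with diameters below the distance of \<open>A\<close> and \<open>B\<close> meets at most one of
  the two, so such a cover splits into a cover of \<open>A\<close> and a cover of \<open>B\<close>.\<close>

lemma hausdorff2_metric:
  assumes "0 < d" "\<And>a b. a \<in> A \<Longrightarrow> b \<in> B \<Longrightarrow> d \<le> dist a b"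
  shows "hausdorff2 A + hausdorff2 B \<le> hausdorff2 (A \<union> B)"
proof -
  have main: "hausdorff_pre \<delta> A + hausdorff_pre \<delta> B \<le> hausdorff_pre \<delta> (A \<union> B)"
    if \<delta>: "0 < \<delta>" "\<delta> < d" for \<delta>
    unfolding hausdorff_pre_def[of \<delta> "A \<union> B"]
  proof (rule INF_greatest)
    fix C assume C: "C \<in> size_covers \<delta> (A \<union> B)"
    define P where "P S i = (if C i \<inter> S \<noteq> {} then C i else {})" for S i
    have PA: "P A \<in> size_covers \<delta> A" and PB: "P B \<in> size_covers \<delta> B"
      using C \<delta> unfolding size_covers_def P_def by (auto split: if_splits) blast+
    have disj: "P A i = {} \<or> P B i = {}" for i
    proof (rule ccontr)
      assume "\<not> ?thesis"
      then obtain a b where "a \<in> C i" "a \<in> A" "b \<in> C i" "b \<in> B"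
        by (auto simp: P_def split: if_splits)
      moreover then have "dist a b \<le> \<delta>"
        using C diameter_bounded_bound[of "C i" a b] order_trans[of "dist a b" "diameter (C i)" \<delta>]
        by (simp add: size_covers_def)
      ultimately show False using assms(2)[of a b] \<delta> by linarith
    qed
    have "hausdorff_pre \<delta> A + hausdorff_pre \<delta> B \<le> cover_weight (P A) + cover_weight (P B)"
      by (intro add_mono hausdorff_pre_le PA PB)
    also have "\<dots> = (\<Sum>i. ennreal (pi / 4 * (diameter (P A i))\<^sup>2) + ennreal (pi / 4 * (diameter (P B i))\<^sup>2))"
      unfolding cover_weight_def by (rule suminf_add) auto
    also have "\<dots> \<le> cover_weight C"
      unfolding cover_weight_def
    proof (intro suminf_le summableI)
      fix i
      show "ennreal (pi / 4 * (diameter (P A i))\<^sup>2) + ennreal (pi / 4 * (diameter (P B i))\<^sup>2)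
          \<le> ennreal (pi / 4 * (diameter (C i))\<^sup>2)"
        using disj[of i] unfolding P_def by (cases "C i = {}") (auto simp: P_def split: if_splits)
    qed
    finally show "hausdorff_pre \<delta> A + hausdorff_pre \<delta> B \<le> cover_weight C" .
  qed
  have inc: "incseq (\<lambda>n. hausdorff_pre (1 / real (Suc n)) S)" for S
    by (intro incseq_SucI hausdorff_pre_antimono) (simp add: field_simps)
  have "hausdorff2 A + hausdorff2 B =
      (SUP n. hausdorff_pre (1 / real (Suc n)) A + hausdorff_pre (1 / real (Suc n)) B)"
    unfolding hausdorff2_eq_SUP by (rule ennreal_SUP_add[symmetric]) (rule inc)+
  also have "\<dots> \<le> hausdorff2 (A \<union> B)"
  proof (rule SUP_least)
    fix n
    define \<delta> where "\<delta> = min (1 / real (Suc n)) (d / 2)"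
    have \<delta>: "0 < \<delta>" "\<delta> < d" "\<delta> \<le> 1 / real (Suc n)" using assms(1) by (auto simp: \<delta>_def min_def)
    have "hausdorff_pre (1 / real (Suc n)) A + hausdorff_pre (1 / real (Suc n)) B
        \<le> hausdorff_pre \<delta> A + hausdorff_pre \<delta> B"
      by (intro add_mono hausdorff_pre_antimono \<delta>)
    also have "\<dots> \<le> hausdorff_pre \<delta> (A \<union> B)" by (rule main) (use \<delta> in auto)
    also have "\<dots> \<le> hausdorff2 (A \<union> B)" by (rule hausdorff_pre_le_hausdorff2) (use \<delta> in auto)
    finally show "hausdorff_pre (1 / real (Suc n)) A + hausdorff_pre (1 / real (Suc n)) B
        \<le> hausdorff2 (A \<union> B)" .
  qed
  finally show ?thesis .
qed

lemma infdist_diff_le_dist: "infdist a F - infdist b F \<le> dist a b"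
  using infdist_triangle[of a F b] by linarith

text \<open>Caratheodory's criterion for closed sets. The shells \<open>R k\<close> of points of \<open>T\<close> at distance
  about \<open>1 / k\<close> from \<open>F\<close> have finite total measure, because every second shell is at positive
  distance from the previous ones. Hence removing a thin neighbourhood of \<open>F\<close> changes the
  measure of \<open>T - F\<close> arbitrarily little.\<close>

lemma hausdorff2_closed_split:
  assumes "closed F" "F \<noteq> {}"
  shows "hausdorff2 (T \<inter> F) + hausdorff2 (T - F) \<le> hausdorff2 T"
proof (cases "hausdorff2 T = \<top>")
  case False
  define R where "R k = {x\<in>T. 1 / real (k + 2) \<le> infdist x F \<and> infdist x F < 1 / real (k + 1)}" for k
  define Tn where "Tn n = {x\<in>T. 1 / real (n + 1) \<le> infdist x F}" for n
  have dec: "T - F = Tn n \<union> (\<Union>k. R (k + n))" for n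
  proof (intro equalityI subsetI)
    fix x assume x: "x \<in> T - F"
    then have pos: "0 < infdist x F"
      using assms by (metis DiffD2 in_closed_iff_infdist_zero infdist_nonneg order_le_less)
    show "x \<in> Tn n \<union> (\<Union>k. R (k + n))"
    proof (cases "1 / real (n + 1) \<le> infdist x F")
      case False
      have ex: "\<exists>m. 1 / real (m + 1) \<le> infdist x F"
        using reals_Archimedean[OF pos] by (auto simp: inverse_eq_divide intro: less_imp_le)
      define m where "m = (LEAST m. 1 / real (m + 1) \<le> infdist x F)"
      have m: "1 / real (m + 1) \<le> infdist x F" unfolding m_def using ex by (rule LeastI_ex)
      have "m > n"
      proof (rule ccontr)
        assume "\<not> m > n"
        then have "1 / real (n + 1) \<le> 1 / real (m + 1)" by (simp add: field_simps)
        then show False using m False by linarith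
      qed
      then obtain j where j: "m = Suc (j + n)" by (metis add.commute less_iff_Suc_add)
      have "infdist x F < 1 / real (j + n + 1)"
        using not_less_Least[of "j + n" "\<lambda>m. 1 / real (m + 1) \<le> infdist x F"] j
        unfolding m_def by simp
      then have "x \<in> R (j + n)" using m x j by (simp add: R_def algebra_simps)
      then show ?thesis by blast
    qed (use x in \<open>auto simp: Tn_def\<close>)
  next
    fix x assume "x \<in> Tn n \<union> (\<Union>k. R (k + n))"
    then consider "x \<in> Tn n" | k where "x \<in> R (k + n)" by blast
    then obtain m where "x \<in> T" "1 / real (m + 1) \<le> infdist x F"
    proof cases
      case 1 then show ?thesis using that[of n] by (simp add: Tn_def)
    next
      case 2 then show ?thesis using that[of "k + n + 1"] by (simp add: R_def algebra_simps)
    qed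
    moreover have "0 < 1 / real (m + 1)" by simp
    ultimately show "x \<in> T - F" by (auto dest: infdist_zero) 
  qed
  \<comment> \<open>The even (\<open>j = 0\<close>) and the odd (\<open>j = 1\<close>) shells are summed separately.\<close>
  have half: "(\<Sum>k<N. hausdorff2 (R (2 * k + j))) \<le> hausdorff2 (\<Union>k<N. R (2 * k + j))" for N j
  proof (induction N)
    case (Suc N)
    have "(\<Sum>k<Suc N. hausdorff2 (R (2 * k + j))) \<le>
        hausdorff2 (\<Union>k<N. R (2 * k + j)) + hausdorff2 (R (2 * N + j))"
      using Suc by (simp add: add_right_mono)
    also have "\<dots> \<le> hausdorff2 ((\<Union>k<N. R (2 * k + j)) \<union> R (2 * N + j))"
    proof (cases "N = 0")
      case False
      show ?thesis
      proof (rule hausdorff2_metric)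
        show "0 < 1 / real (2 * N + j) - 1 / real (2 * N + j + 1)"
          using False by (simp add: divide_strict_left_mono)
        fix a b assume a: "a \<in> (\<Union>k<N. R (2 * k + j))" and b: "b \<in> R (2 * N + j)"
        from a obtain k where k: "k < N" "1 / real (2 * k + j + 2) \<le> infdist a F"
          by (auto simp: R_def)
        have "1 / real (2 * N + j) \<le> 1 / real (2 * k + j + 2)"
          using k by (intro divide_left_mono) auto
        then show "1 / real (2 * N + j) - 1 / real (2 * N + j + 1) \<le> dist a b"
          using k b infdist_diff_le_dist[of a F b] by (auto simp: R_def)
      qed
    qed (simp add: hausdorff2_empty)
    also have "(\<Union>k<N. R (2 * k + j)) \<union> R (2 * N + j) = (\<Union>k<Suc N. R (2 * k + j))"
      by (auto simp: lessThan_Suc)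
    finally show ?case .
  qed (simp add: hausdorff2_empty)
  have half_le: "(\<Sum>k<N. hausdorff2 (R (2 * k + j))) \<le> hausdorff2 T" for N j
    using half[of j N] hausdorff2_mono[of "\<Union>k<N. R (2 * k + j)" T]
    by (auto simp: R_def intro: order_trans)
  have part: "(\<Sum>k<2 * N. hausdorff2 (R k)) = (\<Sum>k<N. hausdorff2 (R (2 * k + 0))) + (\<Sum>k<N. hausdorff2 (R (2 * k + 1)))" for N
    by (induction N) (simp_all add: algebra_simps)
  have "(\<Sum>k. hausdorff2 (R k)) \<le> hausdorff2 T + hausdorff2 T"
  proof (rule suminf_le_const[OF summableI])
    fix N
    have "(\<Sum>k<N. hausdorff2 (R k)) \<le> (\<Sum>k<2 * N. hausdorff2 (R k))"
      by (intro sum_mono2) auto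
    also have "\<dots> \<le> hausdorff2 T + hausdorff2 T"
      unfolding part by (intro add_mono half_le)
    finally show "(\<Sum>k<N. hausdorff2 (R k)) \<le> hausdorff2 T + hausdorff2 T" .
  qed
  moreover have "hausdorff2 T + hausdorff2 T < \<top>" using False by (simp add: less_top)
  ultimately have fin: "(\<Sum>k. hausdorff2 (R k)) \<noteq> \<top>" by (metis leD)
  have tail: "(\<lambda>n. \<Sum>k. hausdorff2 (R (k + n))) \<longlonglongrightarrow> 0"
  proof -
    let ?s = "\<lambda>n. \<Sum>k<n. hausdorff2 (R k)" and ?a = "\<Sum>k. hausdorff2 (R k)"
    have split: "?a = (\<Sum>k. hausdorff2 (R (k + n))) + ?s n" for n
      by (rule suminf_offset) auto
    have sf: "?s n \<noteq> \<top>" for n using fin split[of n] by auto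
    have "(\<lambda>n. ?a - ?s n) \<longlonglongrightarrow> ?a - ?a"
      by (intro tendsto_diff_ennreal tendsto_const summable_LIMSEQ summableI) (use fin in auto)
    moreover have "?a - ?s n = (\<Sum>k. hausdorff2 (R (k + n)))" for n
      by (subst split[of n]) (use sf[of n] in \<open>simp add: ennreal_add_diff_cancel_right\<close>)
    moreover have "?a - ?a = 0" using fin by (simp add: diff_eq_0_iff_ennreal less_top)
    ultimately show ?thesis by simp
  qed
  have bound: "hausdorff2 (T \<inter> F) + hausdorff2 (T - F) \<le> hausdorff2 T + (\<Sum>k. hausdorff2 (R (k + n)))" for n
  proof -
    have "hausdorff2 (T - F) \<le> hausdorff2 (Tn n) + hausdorff2 (\<Union>k. R (k + n))"
      unfolding dec[of n] by (rule hausdorff2_subadditive)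
    also have "\<dots> \<le> hausdorff2 (Tn n) + (\<Sum>k. hausdorff2 (R (k + n)))"
      by (intro add_left_mono hausdorff2_countable_subadditive)
    finally have "hausdorff2 (T \<inter> F) + hausdorff2 (T - F) \<le>
        (hausdorff2 (T \<inter> F) + hausdorff2 (Tn n)) + (\<Sum>k. hausdorff2 (R (k + n)))"
      by (simp add: add.assoc add_left_mono)
    also have "hausdorff2 (T \<inter> F) + hausdorff2 (Tn n) \<le> hausdorff2 (T \<inter> F \<union> Tn n)"
    proof (rule hausdorff2_metric[of "1 / real (n + 1)"])
      fix a b assume "a \<in> T \<inter> F" "b \<in> Tn n"
      then show "1 / real (n + 1) \<le> dist a b"
        using infdist_diff_le_dist[of b F a] by (simp add: Tn_def dist_commute)
    qed simp
    also have "\<dots> \<le> hausdorff2 T" by (rule hausdorff2_mono) (auto simp: Tn_def)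
    finally show ?thesis by (simp add: add_right_mono)
  qed
  have "(\<lambda>n. hausdorff2 T + (\<Sum>k. hausdorff2 (R (k + n)))) \<longlonglongrightarrow> hausdorff2 T + 0"
    by (intro tendsto_add tendsto_const tail)
  then have "hausdorff2 (T \<inter> F) + hausdorff2 (T - F) \<le> hausdorff2 T + 0"
    by (rule LIMSEQ_le_const) (use bound in auto)
  then show ?thesis by simp
qed simp

lemma hausdorff2_outer_measure: "outer_measure_space UNIV hausdorff2"
  unfolding outer_measure_space_def positive_def increasing_def countably_subadditive_def
  by (auto simp: hausdorff2_empty intro: hausdorff2_mono hausdorff2_countable_subadditive)

lemma hausdorff2_measure_space: "measure_space UNIV (sets borel) hausdorff2"
proof -
  interpret sigma_algebra UNIV "UNIV :: vec3 set set"
    using sigma_algebra_Pow[of "UNIV :: vec3 set"] by simp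
  have ms: "measure_space UNIV (lambda_system UNIV UNIV hausdorff2) hausdorff2"
    by (rule caratheodory_lemma[OF hausdorff2_outer_measure])
  have closed: "F \<in> lambda_system UNIV UNIV hausdorff2" if "closed F" for F :: "vec3 set"
  proof (cases "F = {}")
    case False
    have "hausdorff2 (F \<inter> T) + hausdorff2 ((UNIV - F) \<inter> T) = hausdorff2 T" for T
    proof (rule antisym)
      have "(UNIV - F) \<inter> T = T - F" by auto
      then show "hausdorff2 (F \<inter> T) + hausdorff2 ((UNIV - F) \<inter> T) \<le> hausdorff2 T"
        using hausdorff2_closed_split[OF that False, of T] by (simp add: Int_commute)
      have "T = F \<inter> T \<union> (UNIV - F) \<inter> T" by auto
      then show "hausdorff2 T \<le> hausdorff2 (F \<inter> T) + hausdorff2 ((UNIV - F) \<inter> T)"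
        using hausdorff2_subadditive by metis
    qed
    then show ?thesis by (simp add: lambda_system_def)
  qed (simp add: lambda_system_def hausdorff2_empty)
  have sub: "sets (borel :: vec3 measure) \<subseteq> lambda_system UNIV UNIV hausdorff2"
  proof -
    interpret L: sigma_algebra UNIV "lambda_system UNIV UNIV hausdorff2"
      using ms by (simp add: measure_space_def)
    have "sets (borel :: vec3 measure) = sigma_sets UNIV (Collect closed)"
      by (simp add: borel_eq_closed)
    then show ?thesis using L.sigma_sets_subset[of "Collect closed"] closed by auto
  qed
  show ?thesis
    by (rule measure_down[OF ms _ sub]) (use sets.sigma_algebra_axioms[of borel] in simp)
qed

lemma boundary_measure_space [simp]: "space (boundary_measure X) = frontier X"
  unfolding boundary_measure_def by (rule space_measure_of) (auto simp: sets_restrict_space)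

lemma boundary_measure_sets [measurable_cong]:
  "sets (boundary_measure X) = sets (restrict_space borel (frontier X))"
  unfolding boundary_measure_def
  using sets.sets_measure_of_eq[of "restrict_space borel (frontier X)"]
  by (simp add: space_restrict_space)

lemma emeasure_boundary_measure:
  assumes "A \<in> sets (boundary_measure X)"
  shows "emeasure (boundary_measure X) A = hausdorff2 A"
proof (rule emeasure_measure_of[OF boundary_measure_def])
  have sub: "sets (restrict_space borel (frontier X)) \<subseteq> sets borel"
    by (auto simp: sets_restrict_space)
  show "sets (restrict_space borel (frontier X)) \<subseteq> Pow (frontier X)"
    by (auto simp: sets_restrict_space)
  show "positive (sets (boundary_measure X)) hausdorff2"
    by (simp add: positive_def hausdorff2_empty)
  show "countably_additive (sets (boundary_measure X)) hausdorff2"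
    using hausdorff2_measure_space sub
    unfolding boundary_measure_sets measure_space_def countably_additive_def by blast
qed fact

lemma hausdorff_pre_finite_cover:
  assumes "finite I" "A \<subseteq> (\<Union>i\<in>I. C i)" "\<And>i. i \<in> I \<Longrightarrow> bounded (C i)"
    "\<And>i. i \<in> I \<Longrightarrow> diameter (C i) \<le> \<delta>" "0 < \<delta>" "\<delta> \<le> \<delta>'"
  shows "hausdorff_pre \<delta>' A \<le> ennreal (real (card I) * (pi / 4 * \<delta>\<^sup>2))"
proof -
  obtain e where e: "bij_betw e {..<card I} I"
    using ex_bij_betw_nat_finite[OF assms(1)] atLeast0LessThan by auto
  define D where "D k = (if k < card I then C (e k) else {})" for k
  have ek: "e k \<in> I" if "k < card I" for k using e that by (auto dest: bij_betwE)
  have "D \<in> size_covers \<delta>' A"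
    unfolding size_covers_def
  proof (intro CollectI conjI allI)
    show "A \<subseteq> (\<Union>i. D i)"
    proof
      fix x assume "x \<in> A"
      then obtain i where i: "i \<in> I" "x \<in> C i" using assms(2) by blast
      have "i \<in> e ` {..<card I}" using e i by (simp add: bij_betw_def)
      then obtain k where "k < card I" "e k = i" by auto
      then have "x \<in> D k" using i by (simp add: D_def)
      then show "x \<in> (\<Union>i. D i)" by blast
    qed
    show "bounded (D k)" for k using assms(3) ek by (simp add: D_def)
    show "diameter (D k) \<le> \<delta>'" for k using assms(4)[OF ek, of k] assms(5,6) by (auto simp: D_def)
  qed
  then have "hausdorff_pre \<delta>' A \<le> cover_weight D" by (rule hausdorff_pre_le)
  also have "\<dots> = (\<Sum>k<card I. ennreal (pi / 4 * (diameter (D k))\<^sup>2))"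
    unfolding cover_weight_def by (rule suminf_finite) (auto simp: D_def)
  also have "\<dots> \<le> (\<Sum>k<card I. ennreal (pi / 4 * \<delta>\<^sup>2))"
  proof (intro sum_mono ennreal_leI mult_left_mono power_mono)
    fix k assume "k \<in> {..<card I}"
    then show "diameter (D k) \<le> \<delta>" using assms(4)[OF ek, of k] by (simp add: D_def)
    have "bounded (D k)" using assms(3) ek by (simp add: D_def)
    then show "0 \<le> diameter (D k)" by (rule diameter_ge_0)
  qed auto
  also have "\<dots> = ennreal (real (card I) * (pi / 4 * \<delta>\<^sup>2))"
    by (subst sum_ennreal) auto
  finally show ?thesis .
qed

text \<open>A bounded set that two real functions parametrize with Lipschitz inverse has finite area:
  the preimages of the squares of a grid of mesh \<open>1 / n\<close> are \<open>O(n\<^sup>2)\<close> sets of diameter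
  \<open>O(1 / n)\<close>.\<close>

lemma hausdorff2_finite_of_two_parameters:
  fixes p q :: "vec3 \<Rightarrow> real"
  assumes B: "0 \<le> B" "\<And>x. x \<in> S \<Longrightarrow> \<bar>p x\<bar> \<le> B" "\<And>x. x \<in> S \<Longrightarrow> \<bar>q x\<bar> \<le> B"
    and K: "0 < K" "\<And>x y. x \<in> S \<Longrightarrow> y \<in> S \<Longrightarrow> dist x y \<le> K * (\<bar>p x - p y\<bar> + \<bar>q x - q y\<bar>)"
  shows "hausdorff2 S < \<top>"
proof -
  define M where "M = pi * K\<^sup>2 * (2 * B + 4)\<^sup>2"
  have "hausdorff_pre \<delta>' S \<le> ennreal M" if "0 < \<delta>'" for \<delta>'
  proof -
    obtain n0 :: nat where "2 * K / \<delta>' \<le> real n0" using real_arch_simple by blast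
    then obtain n :: nat where n: "n > 0" "2 * K / \<delta>' \<le> real n"
      by (intro that[of "Suc n0"]) auto
    define m where "m = \<lceil>real n * B\<rceil>"
    define I where "I = {-m-1..m} \<times> {-m-1..m}"
    define C where "C = (\<lambda>(a, b). {x\<in>S. \<lfloor>real n * p x\<rfloor> = a \<and> \<lfloor>real n * q x\<rfloor> = b})"
    define \<delta> where "\<delta> = 2 * K / real n"
    have "0 \<le> real n * B" using B(1) by simp
    then have m: "0 \<le> m" unfolding m_def by linarith
    have rng: "\<lfloor>real n * y\<rfloor> \<in> {-m-1..m}" if "\<bar>y\<bar> \<le> B" for y
    proof -
      have "real n * \<bar>y\<bar> \<le> real n * B" using that by (intro mult_left_mono) auto
      then have "\<bar>real n * y\<bar> \<le> of_int m" unfolding m_def abs_mult by (simp) linarith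
      then show ?thesis by auto linarith+
    qed
    have dist_C: "dist x y \<le> \<delta>" if "x \<in> C i" "y \<in> C i" for x y i
    proof -
      have one: "\<bar>u - v\<bar> \<le> 1 / real n" if "\<lfloor>real n * u\<rfloor> = \<lfloor>real n * v\<rfloor>" for u v
      proof -
        have "\<bar>real n * u - real n * v\<bar> \<le> 1" using that by linarith
        then have "real n * \<bar>u - v\<bar> \<le> 1" by (simp add: abs_mult flip: right_diff_distrib)
        then show ?thesis using n by (simp add: field_simps)
      qed
      have "dist x y \<le> K * (\<bar>p x - p y\<bar> + \<bar>q x - q y\<bar>)"
        using that by (intro K) (auto simp: C_def split: prod.splits)
      also have "\<dots> \<le> K * (1 / real n + 1 / real n)"
        using that K(1) by (intro mult_left_mono add_mono one) (auto simp: C_def split: prod.splits)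
      finally show ?thesis by (simp add: \<delta>_def mult.commute)
    qed
    have \<delta>: "0 < \<delta>" "\<delta> \<le> \<delta>'" using n K(1) that by (auto simp: \<delta>_def field_simps)
    have "hausdorff_pre \<delta>' S \<le> ennreal (real (card I) * (pi / 4 * \<delta>\<^sup>2))"
    proof (rule hausdorff_pre_finite_cover)
      show "finite I" by (simp add: I_def)
      show "S \<subseteq> (\<Union>i\<in>I. C i)" using rng B by (auto simp: I_def C_def)
      show "bounded (C i)" for i
        unfolding bounded_two_points using dist_C[of _ i] by blast
      show "diameter (C i) \<le> \<delta>" for i
        by (rule diameter_le) (use dist_C[of _ i] \<delta> in \<open>auto simp: dist_norm\<close>)
    qed (use \<delta> in auto)
    also have "\<dots> \<le> ennreal M"
    proof (rule ennreal_leI)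
      have "card I = (nat (2 * m + 2))\<^sup>2" using m by (simp add: I_def power2_eq_square add.commute)
      then have "real (card I) = (2 * real_of_int m + 2)\<^sup>2" using m by (simp add: algebra_simps)
      also have "\<dots> \<le> (real n * (2 * B + 4))\<^sup>2"
      proof (rule power_mono)
        have "real_of_int m \<le> real n * B + 1" unfolding m_def by linarith
        moreover have "1 \<le> real n" using n by linarith
        ultimately show "2 * real_of_int m + 2 \<le> real n * (2 * B + 4)" by (simp add: algebra_simps)
      qed (use m in auto)
      finally have "real (card I) * (pi / 4 * \<delta>\<^sup>2) \<le> (real n * (2 * B + 4))\<^sup>2 * (pi / 4 * \<delta>\<^sup>2)"
        by (rule mult_right_mono) simp
      also have "\<dots> = pi * K\<^sup>2 * (2 * B + 4)\<^sup>2"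
        using n unfolding power_mult_distrib \<delta>_def power_divide by simp
      finally show "real (card I) * (pi / 4 * \<delta>\<^sup>2) \<le> M" by (simp add: M_def)
    qed
    finally show ?thesis .
  qed
  then have "hausdorff2 S \<le> ennreal M" unfolding hausdorff2_alt by (auto intro: SUP_least)
  then show ?thesis by (rule order_le_less_trans) simp
qed

text \<open>Lines in direction \<open>\<theta>\<close> through a set of diameter \<open>d\<close> form a tube of cross section \<open>O(d\<^sup>2)\<close>, and a
  null set has covers for which the sum of the squared diameters is arbitrarily small.\<close>

lemma hausdorff2_null_lines:
  assumes E: "hausdorff2 E = 0" and \<theta>: "norm \<theta> = 1"
  shows "AE x in lborel. \<forall>t. x + t *\<^sub>R \<theta> \<notin> E"
proof -
  have "AE x in lborel. \<forall>t\<in>{-real L..real L}. x + t *\<^sub>R \<theta> \<notin> E" for L :: nat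
  proof -
    define c0 where "c0 = 64 * (2 * real L + 4)"
    have c0: "0 < c0" by (simp add: c0_def)
    have ex: "\<exists>G\<in>sets lborel. {x. \<exists>t\<in>{-real L..real L}. x + t *\<^sub>R \<theta> \<in> E} \<subseteq> G \<and>
       emeasure lborel G \<le> ennreal (c0 * (3 * e))" if e: "0 < e" "e \<le> 1" for e
    proof -
      have h0: "hausdorff_pre 1 E = 0" using hausdorff_pre_le_hausdorff2[of 1 E] E by simp
      obtain C where C: "C \<in> size_covers 1 E" "cover_weight C \<le> 0 + ennreal (pi / 4 * e)"
        using near_optimal_cover[of 1 E "ennreal (pi / 4 * e)"] h0 e by auto
      have "ennreal (pi / 4) * (\<Sum>i. ennreal ((diameter (C i))\<^sup>2)) \<le> ennreal (pi / 4) * ennreal e"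
      proof -
        have "cover_weight C = ennreal (pi / 4) * (\<Sum>i. ennreal ((diameter (C i))\<^sup>2))"
          unfolding cover_weight_def ennreal_suminf_cmult[symmetric]
          by (intro suminf_cong ennreal_mult') simp
        moreover have "ennreal (pi / 4 * e) = ennreal (pi / 4) * ennreal e"
          by (intro ennreal_mult') simp
        ultimately show ?thesis using C(2) by simp
      qed
      then have small: "(\<Sum>i. ennreal ((diameter (C i))\<^sup>2)) \<le> ennreal e"
        by (subst (asm) ennreal_mult_le_mult_iff) auto
      \<comment> \<open>The summable extra term keeps the radius positive when \<open>C i\<close> is a point.\<close>
      define \<rho> where "\<rho> i = sqrt ((diameter (C i))\<^sup>2 + e * (1/2)^Suc i)" for i
      define c where "c i = (SOME y. y \<in> C i)" for i
      define G where "G = (\<Union>i. tube (c i - real L *\<^sub>R \<theta>) \<theta> (2 * real L) (\<rho> i))"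
      have dC: "bounded (C i)" "diameter (C i) \<le> 1" "0 \<le> diameter (C i)" for i
        using C diameter_ge_0 unfolding size_covers_def by auto
      have \<rho>2: "(\<rho> i)\<^sup>2 = (diameter (C i))\<^sup>2 + e * (1/2)^Suc i" for i
        unfolding \<rho>_def using e by (intro real_sqrt_pow2) (auto intro!: add_nonneg_nonneg)
      have \<rho>0: "0 < \<rho> i" for i unfolding \<rho>_def using e by (auto intro!: add_nonneg_pos)
      have \<rho>d: "diameter (C i) \<le> \<rho> i" for i unfolding \<rho>_def using e by (intro real_le_rsqrt) auto
      have \<rho>le: "\<rho> i \<le> 2" for i
      proof -
        have "(diameter (C i))\<^sup>2 \<le> 1" using dC by (simp add: power_le_one)
        moreover have "e * (1/2)^Suc i \<le> 1 * 1" using e by (intro mult_mono power_le_one) auto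
        ultimately have "(\<rho> i)\<^sup>2 \<le> 2\<^sup>2" unfolding \<rho>2 by simp
        then show ?thesis by (rule power2_le_imp_le) simp
      qed
      have meas: "tube a \<theta> l r \<in> sets lborel" for a l r
        by (simp add: borel_compact compact_tube)
      show ?thesis
      proof (intro bexI conjI)
        show "G \<in> sets lborel" unfolding G_def using meas by blast
        show "{x. \<exists>t\<in>{-real L..real L}. x + t *\<^sub>R \<theta> \<in> E} \<subseteq> G"
        proof
          fix x assume "x \<in> {x. \<exists>t\<in>{-real L..real L}. x + t *\<^sub>R \<theta> \<in> E}"
          then obtain t where t: "-real L \<le> t" "t \<le> real L" "x + t *\<^sub>R \<theta> \<in> E" by auto
          then obtain i where i: "x + t *\<^sub>R \<theta> \<in> C i" using C unfolding size_covers_def by auto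
          then have "c i \<in> C i" unfolding c_def by (rule someI)
          then have "dist (c i) (x + t *\<^sub>R \<theta>) \<le> \<rho> i"
            using i diameter_bounded_bound[OF dC(1)] \<rho>d[of i] by (meson order_trans)
          then have "x \<in> cball (c i - real L *\<^sub>R \<theta> + (real L - t) *\<^sub>R \<theta>) (\<rho> i)"
            by (simp add: dist_norm algebra_simps)
          moreover have "real L - t \<in> {0..2 * real L}" using t by auto
          ultimately show "x \<in> G" unfolding G_def tube_def by blast
        qed
        have "emeasure lborel G \<le> (\<Sum>i. emeasure lborel (tube (c i - real L *\<^sub>R \<theta>) \<theta> (2 * real L) (\<rho> i)))"
          unfolding G_def by (rule emeasure_subadditive_countably) (use meas in auto)
        also have "\<dots> \<le> (\<Sum>i. ennreal c0 * (ennreal ((diameter (C i))\<^sup>2) + ennreal (e * (1/2)^Suc i)))"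
        proof (intro suminf_le summableI)
          fix i
          have "emeasure lborel (tube (c i - real L *\<^sub>R \<theta>) \<theta> (2 * real L) (\<rho> i))
              \<le> ennreal (64 * (\<rho> i)\<^sup>2 * (2 * real L + 2 * \<rho> i))"
            by (rule emeasure_tube_le) (use \<theta> \<rho>0 in auto)
          also have "\<dots> \<le> ennreal (64 * (\<rho> i)\<^sup>2 * (2 * real L + 2 * 2))"
            using \<rho>le[of i] by (intro ennreal_leI mult_left_mono add_left_mono) auto
          also have "64 * (\<rho> i)\<^sup>2 * (2 * real L + 2 * 2) = c0 * ((diameter (C i))\<^sup>2 + e * (1/2)^Suc i)"
            unfolding \<rho>2[symmetric] by (simp add: c0_def)
          also have "ennreal \<dots> = ennreal c0 * ennreal ((diameter (C i))\<^sup>2 + e * (1/2)^Suc i)"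
            using c0 by (intro ennreal_mult') simp
          also have "ennreal ((diameter (C i))\<^sup>2 + e * (1/2)^Suc i) =
              ennreal ((diameter (C i))\<^sup>2) + ennreal (e * (1/2)^Suc i)"
            using e by (intro ennreal_plus) auto
          finally show "emeasure lborel (tube (c i - real L *\<^sub>R \<theta>) \<theta> (2 * real L) (\<rho> i)) \<le>
              ennreal c0 * (ennreal ((diameter (C i))\<^sup>2) + ennreal (e * (1/2)^Suc i))" .
        qed
        also have "\<dots> = ennreal c0 * ((\<Sum>i. ennreal ((diameter (C i))\<^sup>2)) + (\<Sum>i. ennreal (e * (1/2)^Suc i)))"
          by (simp only: ennreal_suminf_cmult suminf_add[OF summableI summableI])
        also have "(\<Sum>i. ennreal (e * (1/2)^Suc i)) = ennreal e"
          using e sums_mult[OF power_half_series, of e] by (intro suminf_ennreal_eq) auto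
        also have "ennreal c0 * ((\<Sum>i. ennreal ((diameter (C i))\<^sup>2)) + ennreal e) \<le>
            ennreal c0 * (ennreal e + ennreal e)"
          by (intro mult_left_mono add_right_mono small) auto
        also have "ennreal e + ennreal e = ennreal (2 * e)"
          using e by (simp flip: ennreal_plus)
        also have "ennreal c0 * ennreal (2 * e) = ennreal (c0 * (2 * e))"
          using c0 by (intro ennreal_mult'[symmetric]) simp
        also have "\<dots> \<le> ennreal (c0 * (3 * e))" using e c0 by (intro ennreal_leI mult_left_mono) auto
        finally show "emeasure lborel G \<le> ennreal (c0 * (3 * e))" .
      qed
    qed
    define good where "good n G \<longleftrightarrow> G \<in> sets lborel \<and>
       {x. \<exists>t\<in>{-real L..real L}. x + t *\<^sub>R \<theta> \<in> E} \<subseteq> G \<and>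
       emeasure lborel G \<le> ennreal (c0 * (3 * (1 / real (Suc n))))" for n G
    have "\<forall>n. \<exists>G. good n G"
      unfolding good_def Bex_def[symmetric] by (intro allI ex) simp_all
    then obtain G where good: "\<And>n. good n (G n)" by (auto dest: choice)
    have G: "G n \<in> sets lborel" "{x. \<exists>t\<in>{-real L..real L}. x + t *\<^sub>R \<theta> \<in> E} \<subseteq> G n"
       "emeasure lborel (G n) \<le> ennreal (c0 * (3 * (1 / real (Suc n))))" for n
      using good[of n] by (simp_all only: good_def)
    have N: "(\<Inter>n. G n) \<in> sets lborel" using G(1) by blast
    have "emeasure lborel (\<Inter>n. G n) \<le> ennreal (c0 * (3 * (1 / real (Suc n))))" for n
      by (rule order_trans[OF emeasure_mono G(3)]) (use G(1) in auto)
    moreover have "(\<lambda>n. ennreal (c0 * (3 * (1 / real (Suc n))))) \<longlonglongrightarrow> ennreal (c0 * (3 * 0))"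
      by (intro tendsto_ennrealI tendsto_mult tendsto_const lim_1_over_real_power[of 1, simplified] LIMSEQ_Suc[OF lim_1_over_n])
    ultimately have "emeasure lborel (\<Inter>n. G n) \<le> ennreal (c0 * (3 * 0))"
      by (intro LIMSEQ_le_const) auto
    then have "(\<Inter>n. G n) \<in> null_sets lborel" using N by (auto simp: null_sets_def)
    then show ?thesis by (rule AE_I') (use G(2) in blast)
  qed
  then have "AE x in lborel. \<forall>L::nat. \<forall>t\<in>{-real L..real L}. x + t *\<^sub>R \<theta> \<notin> E"
    by (simp add: AE_all_countable)
  then show ?thesis
  proof (rule AE_mp, intro AE_I2 impI allI)
    fix x t assume *: "\<forall>L::nat. \<forall>t\<in>{-real L..real L}. x + t *\<^sub>R \<theta> \<notin> E"
    obtain L :: nat where "\<bar>t\<bar> \<le> real L" using real_arch_simple by blast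
    then have "t \<in> {-real L..real L}" by auto
    then show "x + t *\<^sub>R \<theta> \<notin> E" using * by blast
  qed
qed

section \<open>The boundary of a smooth domain\<close>

lemma AE_space_mono:
  assumes "AE x in M. P x" "\<And>x. x \<in> space M \<Longrightarrow> P x \<Longrightarrow> Q x"
  shows "AE x in M. Q x"
  using assms by (auto elim!: AE_mp)

lemma Cn_on_subset: "Cn_on n U f \<Longrightarrow> V \<subseteq> U \<Longrightarrow> Cn_on n V f"
proof (induction n arbitrary: f)
  case 0 then show ?case by (auto intro: continuous_on_subset)
next
  case (Suc n)
  from Suc.prems(1) obtain f' where f': "\<forall>x\<in>U. (f has_derivative f' x) (at x)"
    "\<forall>v. Cn_on n U (\<lambda>x. f' x v)" by auto
  have "\<forall>v. Cn_on n V (\<lambda>x. f' x v)" using Suc.IH f'(2) Suc.prems(2) by blast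
  then show ?case using f'(1) Suc.prems(2) by auto
qed

text \<open>One defining function serves for all boundary points near \<open>p\<close>, because its gradient is
  continuous and therefore stays nonzero nearby.\<close>

lemma local_defining_gradient:
  assumes "bounded_smooth_domain X" "p \<in> frontier X"
  obtains U \<psi> G where "open U" "p \<in> U" "continuous_on U G"
    "\<And>x. x \<in> U \<Longrightarrow> (\<psi> has_derivative (\<lambda>h. h \<bullet> G x)) (at x)"
    "X \<inter> U = {x\<in>U. \<psi> x < 0}" "\<And>x. x \<in> U \<Longrightarrow> G x \<noteq> 0"
    "\<And>q. q \<in> U \<Longrightarrow> local_defining_function X q U \<psi> (G q)"
proof -
  obtain U \<psi> D where loc: "local_defining_function X p U \<psi> D"
    using assms unfolding bounded_smooth_domain_def by blast
  then have U: "open U" "p \<in> U" "\<And>n. Cn_on n U \<psi>" "X \<inter> U = {x\<in>U. \<psi> x < 0}"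
    "GDERIV \<psi> p :> D" "D \<noteq> 0" by (auto simp: local_defining_function_def)
  from U(3)[of 1] obtain f' where f': "\<And>x. x \<in> U \<Longrightarrow> (\<psi> has_derivative f' x) (at x)"
    "\<And>v. continuous_on U (\<lambda>x. f' x v)" by auto
  define G where "G x = (\<Sum>b\<in>Basis. f' x b *\<^sub>R b)" for x
  have G: "f' x h = h \<bullet> G x" if "x \<in> U" for x h
  proof -
    have "linear (f' x)" using f'(1)[OF that] by (rule has_derivative_linear)
    then have "f' x h = (\<Sum>b\<in>Basis. (h \<bullet> b) * f' x b)"
      using Linear_Algebra.linear_componentwise[of "f' x" h 1] by simp
    then show ?thesis by (simp add: G_def inner_sum_right mult.commute)
  qed
  have der: "(\<psi> has_derivative (\<lambda>h. h \<bullet> G x)) (at x)" if "x \<in> U" for x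
  proof -
    have "f' x = (\<lambda>h. h \<bullet> G x)" using G[OF that] by auto
    then show ?thesis using f'(1)[OF that] by simp
  qed
  have contG: "continuous_on U G"
    unfolding G_def by (intro continuous_intros f'(2))
  have "(\<lambda>h. h \<bullet> D) = (\<lambda>h. h \<bullet> G p)"
    using has_derivative_unique[OF _ der[OF U(2)]] U(5) unfolding gderiv_def by blast
  then have "D \<bullet> D = D \<bullet> G p" by metis
  then have Gp: "G p \<noteq> 0" using U(6) by auto
  define V where "V = {x\<in>U. G x \<noteq> 0}"
  have "V = U \<inter> G -` (- {0})" by (auto simp: V_def)
  then have V: "open V" using continuous_open_preimage[OF contG U(1), of "- {0}"] by auto
  have sub: "V \<subseteq> U" by (auto simp: V_def)
  show ?thesis
  proof (rule that[of V G \<psi>])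
    show "X \<inter> V = {x\<in>V. \<psi> x < 0}" using U(4) sub by auto
    then show "local_defining_function X q V \<psi> (G q)" if "q \<in> V" for q
      using that V Cn_on_subset[OF U(3) sub] der sub
      by (auto simp: local_defining_function_def gderiv_def V_def)
  qed (use U Gp V der sub contG in \<open>auto simp: V_def intro: continuous_on_subset\<close>)
qed

lemma local_defining_zero:
  assumes "local_defining_function X p U \<psi> D" "p \<in> frontier X" "open X"
  shows "\<psi> p = 0"
proof (rule ccontr)
  assume ne: "\<psi> p \<noteq> 0"
  from assms(1) have U: "open U" "p \<in> U" "continuous_on U \<psi>" "X \<inter> U = {x\<in>U. \<psi> x < 0}"
    by (auto simp: local_defining_function_def dest: spec[of _ 0])
  have XU: "x \<in> X \<longleftrightarrow> \<psi> x < 0" if "x \<in> U" for x using U(4) that by blast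
  have pX: "p \<notin> X" "p \<in> closure X"
    using assms by (auto simp: frontier_def interior_open)
  have pos: "0 < \<psi> p" using XU[OF U(2)] pX(1) ne by linarith
  have "open (U \<inter> \<psi> -` {0<..})"
    using continuous_open_preimage[OF U(3,1), of "{0<..}"] by auto
  then have "(U \<inter> \<psi> -` {0<..}) \<inter> X \<noteq> {}"
    using open_Int_closure_eq_empty[of "U \<inter> \<psi> -` {0<..}" X] pX(2) U(2) pos by auto
  then obtain x where "x \<in> X" "x \<in> U" "0 < \<psi> x" by auto
  then show False using XU by force
qed

lemma local_defining_direction:
  assumes "local_defining_function X p U \<psi> D" "p \<in> frontier X" "open X"
  shows "D \<bullet> v < 0 \<Longrightarrow> eventually (\<lambda>t. p + t *\<^sub>R v \<in> X) (at_right 0)"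
    and "0 < D \<bullet> v \<Longrightarrow> eventually (\<lambda>t. p + t *\<^sub>R v \<notin> X) (at_right 0)"
proof -
  from assms(1) have U: "open U" "p \<in> U" "\<And>x. x \<in> U \<Longrightarrow> x \<in> X \<longleftrightarrow> \<psi> x < 0"
    and der: "(\<psi> has_derivative (\<lambda>h. h \<bullet> D)) (at p)"
    by (auto simp: local_defining_function_def gderiv_def)
  have z: "\<psi> p = 0" by (rule local_defining_zero[OF assms])
  have "((\<lambda>t. p + t *\<^sub>R v) \<longlongrightarrow> p + 0 *\<^sub>R v) (at_right 0)"
    by (intro tendsto_intros)
  then have evU: "eventually (\<lambda>t. p + t *\<^sub>R v \<in> U) (at_right 0)"
    using U by (intro topological_tendstoD) auto
  have "((\<lambda>t. \<psi> (p + t *\<^sub>R v)) has_derivative (\<lambda>t. (t *\<^sub>R v) \<bullet> D)) (at 0)"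
    by (rule has_derivative_compose[of "\<lambda>t. p + t *\<^sub>R v" "\<lambda>t. t *\<^sub>R v" 0 UNIV \<psi>])
      (use der in \<open>auto intro!: derivative_eq_intros\<close>)
  then have D: "DERIV (\<lambda>t. \<psi> (p + t *\<^sub>R v)) 0 :> D \<bullet> v"
    unfolding has_field_derivative_def
    by (rule has_derivative_eq_rhs) (auto simp: inner_commute mult.commute)
  show "eventually (\<lambda>t. p + t *\<^sub>R v \<in> X) (at_right 0)" if neg: "D \<bullet> v < 0"
  proof -
    obtain d where d: "d > 0" "\<And>h. 0 < h \<Longrightarrow> h < d \<Longrightarrow> \<psi> (p + 0 *\<^sub>R v) > \<psi> (p + (0 + h) *\<^sub>R v)"
      using DERIV_neg_dec_right[OF D neg] by auto
    have "eventually (\<lambda>t::real. t \<in> {0<..<d}) (at_right 0)" using d by (intro eventually_at_right_real)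
    then show ?thesis
      using evU by eventually_elim (use d(2) z U in auto)
  qed
  show "eventually (\<lambda>t. p + t *\<^sub>R v \<notin> X) (at_right 0)" if pos: "0 < D \<bullet> v"
  proof -
    obtain d where d: "d > 0" "\<And>h. 0 < h \<Longrightarrow> h < d \<Longrightarrow> \<psi> (p + 0 *\<^sub>R v) < \<psi> (p + (0 + h) *\<^sub>R v)"
      using DERIV_pos_inc_right[OF D pos] by auto
    have "eventually (\<lambda>t::real. t \<in> {0<..<d}) (at_right 0)" using d by (intro eventually_at_right_real)
    then show ?thesis
      using evU
    proof eventually_elim
      case (elim t)
      then have "0 < \<psi> (p + t *\<^sub>R v)" using d(2)[of t] z by auto
      then show ?case using U(3) elim by auto
    qed
  qed
qed

text \<open>If two defining functions had different normal directions at \<open>p\<close>, the difference of the two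
  unit normals would point into \<open>X\<close> for one and out of \<open>X\<close> for the other.\<close>

lemma local_defining_sgn_unique:
  assumes "local_defining_function X p U \<psi> D" "local_defining_function X p U' \<psi>' D'"
    "p \<in> frontier X" "open X"
  shows "sgn D = sgn D'"
proof (rule ccontr)
  assume ne: "sgn D \<noteq> sgn D'"
  have D: "D \<noteq> 0" "D' \<noteq> 0" using assms by (auto simp: local_defining_function_def)
  let ?v = "sgn D' - sgn D"
  have n1: "norm (sgn D) = 1" "norm (sgn D') = 1" using D by (auto simp: norm_sgn)
  have "0 < ?v \<bullet> ?v" using ne by simp
  also have "?v \<bullet> ?v = 2 - 2 * (sgn D \<bullet> sgn D')"
    using n1 by (simp add: inner_diff_left inner_diff_right norm_eq_1 inner_commute)
  finally have lt: "sgn D \<bullet> sgn D' < 1" by simp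
  have "sgn D \<bullet> ?v < 0" "0 < sgn D' \<bullet> ?v"
    using n1 lt by (auto simp: inner_diff_right norm_eq_1 inner_commute)
  then have "norm D * (sgn D \<bullet> ?v) < 0" "0 < norm D' * (sgn D' \<bullet> ?v)"
    using D by (auto intro: mult_pos_neg)
  moreover have "norm D * (sgn D \<bullet> ?v) = D \<bullet> ?v" "norm D' * (sgn D' \<bullet> ?v) = D' \<bullet> ?v"
    using D by (auto simp: sgn_div_norm)
  ultimately have "D \<bullet> ?v < 0" "0 < D' \<bullet> ?v" by auto
  then have "eventually (\<lambda>t. p + t *\<^sub>R ?v \<in> X) (at_right 0)"
    "eventually (\<lambda>t. p + t *\<^sub>R ?v \<notin> X) (at_right 0)"
    using local_defining_direction(1)[OF assms(1,3,4)] local_defining_direction(2)[OF assms(2,3,4)]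
    by auto
  then have "eventually (\<lambda>t::real. False) (at_right 0)" by eventually_elim auto
  then show False by (simp add: trivial_limit_at_right_real)
qed

lemma outward_normal_eq:
  assumes "local_defining_function X p U \<psi> D" "p \<in> frontier X" "open X"
  shows "outward_normal X p = sgn D"
  unfolding outward_normal_def
  by (rule the_equality) (use assms local_defining_sgn_unique in \<open>blast+\<close>)

lemma smooth_domain_open: "bounded_smooth_domain X \<Longrightarrow> open X"
  by (simp add: bounded_smooth_domain_def)

lemma outward_normal_direction:
  assumes X: "bounded_smooth_domain X" and y: "y \<in> frontier X"
  shows "v \<bullet> outward_normal X y < 0 \<Longrightarrow> eventually (\<lambda>t. y + t *\<^sub>R v \<in> X) (at_right 0)"
    and "0 < v \<bullet> outward_normal X y \<Longrightarrow> eventually (\<lambda>t. y + t *\<^sub>R v \<notin> X) (at_right 0)"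
    and "outward_normal X y \<noteq> 0"
proof -
  obtain U \<psi> D where loc: "local_defining_function X y U \<psi> D"
    using X y unfolding bounded_smooth_domain_def by blast
  have D: "D \<noteq> 0" using loc by (auto simp: local_defining_function_def)
  have n: "outward_normal X y = sgn D"
    by (rule outward_normal_eq[OF loc y smooth_domain_open[OF X]])
  have "v \<bullet> sgn D = (D \<bullet> v) / norm D" by (simp add: sgn_div_norm inner_commute divide_inverse mult.commute)
  then have "v \<bullet> outward_normal X y < 0 \<longleftrightarrow> D \<bullet> v < 0" "0 < v \<bullet> outward_normal X y \<longleftrightarrow> 0 < D \<bullet> v"
    using D by (auto simp: n divide_less_0_iff zero_less_divide_iff)
  then show "v \<bullet> outward_normal X y < 0 \<Longrightarrow> eventually (\<lambda>t. y + t *\<^sub>R v \<in> X) (at_right 0)"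
    "0 < v \<bullet> outward_normal X y \<Longrightarrow> eventually (\<lambda>t. y + t *\<^sub>R v \<notin> X) (at_right 0)"
    using local_defining_direction[OF loc y smooth_domain_open[OF X]] by auto
  show "outward_normal X y \<noteq> 0" using n D by (simp add: sgn_zero_iff)
qed

lemma continuous_on_outward_normal:
  assumes X: "bounded_smooth_domain X"
  shows "continuous_on (frontier X) (outward_normal X)"
  unfolding continuous_on_eq_continuous_within
proof
  fix p assume p: "p \<in> frontier X"
  obtain U \<psi> G where U: "open U" "p \<in> U" "continuous_on U G" "\<And>x. x \<in> U \<Longrightarrow> G x \<noteq> 0"
    "\<And>q. q \<in> U \<Longrightarrow> local_defining_function X q U \<psi> (G q)"
    by (rule local_defining_gradient[OF X p]) blast
  have eq: "outward_normal X q = sgn (G q)" if "q \<in> U" "q \<in> frontier X" for q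
    by (rule outward_normal_eq[OF U(5)[OF that(1)] that(2) smooth_domain_open[OF X]])
  have "continuous_on U (\<lambda>q. sgn (G q))"
    unfolding sgn_div_norm using U by (intro continuous_intros) auto
  then have "((\<lambda>q. sgn (G q)) \<longlongrightarrow> sgn (G p)) (at p)"
    using U by (auto simp: continuous_on_eq_continuous_at isCont_def)
  then have "((\<lambda>q. sgn (G q)) \<longlongrightarrow> outward_normal X p) (at p within frontier X)"
    unfolding eq[OF U(2) p] by (rule tendsto_within_subset) simp
  then show "continuous (at p within frontier X) (outward_normal X)"
    unfolding continuous_within
  proof (rule Lim_transform_eventually)
    have "eventually (\<lambda>q. q \<in> U) (at p within frontier X)"
      using U by (metis eventually_at_topological)
    moreover have "eventually (\<lambda>q. q \<in> frontier X) (at p within frontier X)"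
      by (simp add: eventually_at_filter)
    ultimately show "eventually (\<lambda>q. sgn (G q) = outward_normal X q) (at p within frontier X)"
      by eventually_elim (simp add: eq)
  qed
qed

text \<open>If \<open>c $ i \<noteq> 0\<close>, a vector almost orthogonal to \<open>c\<close> has its \<open>i\<close>-th coordinate controlled by the
  other two.\<close>

lemma two_coordinates_dominate:
  fixes c :: vec3
  assumes "c \<noteq> 0"
  obtains j k :: 3 and \<epsilon> K :: real where "0 < \<epsilon>" "0 < K"
    "\<And>d. \<bar>c \<bullet> d\<bar> \<le> \<epsilon> * norm d \<Longrightarrow> norm d \<le> K * (\<bar>d $ j\<bar> + \<bar>d $ k\<bar>)"
proof -
  obtain i where i: "c $ i \<noteq> 0" using assms by (auto simp: vec_eq_iff)
  obtain j k where jk: "UNIV = {i, j, k}" "i \<noteq> j" "i \<noteq> k" "j \<noteq> k"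
  proof -
    have "card (UNIV - {i}) = 2" by (simp add: card_Diff_singleton)
    then obtain j k where jk: "UNIV - {i} = {j, k}" "j \<noteq> k"
      unfolding card_2_iff by blast
    show ?thesis
    proof (rule that)
      show "UNIV = {i, j, k}" using jk(1) by (metis insert_Diff UNIV_I)
      show "i \<noteq> j" "i \<noteq> k" using jk(1) by (metis DiffD2 insertI1 insertI2)+
    qed (rule jk)
  qed
  have sum: "(\<Sum>n\<in>UNIV. f n) = f i + (f j + f k)" for f :: "3 \<Rightarrow> real"
    unfolding jk(1) using jk(2-4) by simp
  define m where "m = \<bar>c $ i\<bar>"
  define M where "M = norm c + m / 2"
  have m: "0 < m" using i by (simp add: m_def)
  have M: "0 < M" using m by (simp add: M_def add_nonneg_pos)
  show ?thesis
  proof (rule that[of "m / 2" "2 * M / m + 1" j k])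
    fix d :: vec3 assume d: "\<bar>c \<bullet> d\<bar> \<le> m / 2 * norm d"
    have l1: "norm d \<le> \<bar>d $ i\<bar> + (\<bar>d $ j\<bar> + \<bar>d $ k\<bar>)"
      using norm_le_l1_cart[of d] unfolding sum .
    have "c \<bullet> d = c $ i * d $ i + (c $ j * d $ j + c $ k * d $ k)"
      unfolding inner_vec_def sum by simp
    then have "m * \<bar>d $ i\<bar> \<le> \<bar>c \<bullet> d\<bar> + (\<bar>c $ j * d $ j\<bar> + \<bar>c $ k * d $ k\<bar>)"
      unfolding m_def abs_mult[symmetric] by linarith
    also have "\<dots> \<le> m / 2 * (\<bar>d $ i\<bar> + (\<bar>d $ j\<bar> + \<bar>d $ k\<bar>)) + (norm c * \<bar>d $ j\<bar> + norm c * \<bar>d $ k\<bar>)"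
      unfolding abs_mult
      using m by (intro add_mono order_trans[OF d] mult_left_mono l1 mult_right_mono component_le_norm_cart) auto
    finally have "m / 2 * \<bar>d $ i\<bar> \<le> M * (\<bar>d $ j\<bar> + \<bar>d $ k\<bar>)"
      by (simp add: M_def algebra_simps)
    then have "\<bar>d $ i\<bar> \<le> 2 * M / m * (\<bar>d $ j\<bar> + \<bar>d $ k\<bar>)"
      using m by (simp add: field_simps)
    then show "norm d \<le> (2 * M / m + 1) * (\<bar>d $ j\<bar> + \<bar>d $ k\<bar>)"
      using l1 by (simp add: algebra_simps)
  qed (use m M in \<open>auto intro: add_pos_pos\<close>)
qed

text \<open>Near a boundary point the chord between two boundary points is almost orthogonal to the
  normal (mean value theorem), so two of the three coordinates parametrize the boundary there
  with Lipschitz inverse.\<close>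

lemma hausdorff2_frontier_local:
  assumes X: "bounded_smooth_domain X" and p: "p \<in> frontier X"
  obtains r where "0 < r" "hausdorff2 (frontier X \<inter> ball p r) < \<top>"
proof -
  obtain U \<psi> G where U: "open U" "p \<in> U" "continuous_on U G" "\<And>x. x \<in> U \<Longrightarrow> G x \<noteq> 0"
    "\<And>x. x \<in> U \<Longrightarrow> (\<psi> has_derivative (\<lambda>h. h \<bullet> G x)) (at x)"
    "\<And>q. q \<in> U \<Longrightarrow> local_defining_function X q U \<psi> (G q)"
    by (rule local_defining_gradient[OF X p]) blast
  obtain j k \<epsilon> K where dom: "0 < \<epsilon>" "0 < K"
    "\<And>d. \<bar>G p \<bullet> d\<bar> \<le> \<epsilon> * norm d \<Longrightarrow> norm d \<le> K * (\<bar>d $ j\<bar> + \<bar>d $ k\<bar>)"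
    by (rule two_coordinates_dominate[OF U(4)[OF U(2)]]) blast
  have "isCont G p" using U by (simp add: continuous_on_eq_continuous_at)
  then obtain r1 where r1: "0 < r1" "\<And>x. dist x p < r1 \<Longrightarrow> dist (G x) (G p) < \<epsilon>"
    using dom(1) unfolding continuous_at_eps_delta by blast
  obtain r2 where r2: "0 < r2" "ball p r2 \<subseteq> U" using U by (meson open_contains_ball)
  define r where "r = min r1 r2"
  let ?S = "frontier X \<inter> ball p r"
  have r: "0 < r" "ball p r \<subseteq> U" using r1 r2 by (auto simp: r_def)
  have Lip: "dist x y \<le> K * (\<bar>x $ j - y $ j\<bar> + \<bar>x $ k - y $ k\<bar>)" if x: "x \<in> ?S" and y: "y \<in> ?S" for x y
  proof -
    have zero: "\<psi> x = 0" "\<psi> y = 0"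
      using x y r local_defining_zero[OF U(6) _ smooth_domain_open[OF X]] by blast+
    have seg: "x + t *\<^sub>R (y - x) \<in> ball p r" if "t \<in> {0..1}" for t
    proof -
      have "(1 - t) *\<^sub>R x + t *\<^sub>R y \<in> ball p r"
        using x y that by (intro convexD[OF convex_ball]) auto
      then show ?thesis by (simp add: algebra_simps)
    qed
    have "\<exists>t\<in>{0..1}. \<psi> (x + 1 *\<^sub>R (y - x)) - \<psi> (x + 0 *\<^sub>R (y - x)) =
        ((1 - 0) *\<^sub>R (y - x)) \<bullet> G (x + t *\<^sub>R (y - x))"
    proof (rule mvt_very_simple[where f="\<lambda>t. \<psi> (x + t *\<^sub>R (y - x))" and f'="\<lambda>t h. (h *\<^sub>R (y - x)) \<bullet> G (x + t *\<^sub>R (y - x))"])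
      fix t :: real assume "0 \<le> t" "t \<le> 1"
      then have "x + t *\<^sub>R (y - x) \<in> U" using seg r by auto
      from U(5)[OF this]
      show "((\<lambda>t. \<psi> (x + t *\<^sub>R (y - x))) has_derivative (\<lambda>h. (h *\<^sub>R (y - x)) \<bullet> G (x + t *\<^sub>R (y - x)))) (at t within {0..1})"
      proof (rule has_derivative_compose[of "\<lambda>t. x + t *\<^sub>R (y - x)" "\<lambda>t. t *\<^sub>R (y - x)", rotated])
        show "((\<lambda>t. x + t *\<^sub>R (y - x)) has_derivative (\<lambda>t. t *\<^sub>R (y - x))) (at t within {0..1})"
          by (auto intro!: derivative_eq_intros)
      qed
    qed simp
    then obtain t where t: "t \<in> {0..1}" "(y - x) \<bullet> G (x + t *\<^sub>R (y - x)) = 0"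
      using zero by auto
    define \<xi> where "\<xi> = x + t *\<^sub>R (y - x)"
    have "dist \<xi> p < r1" using seg[OF t(1)] by (simp add: \<xi>_def r_def dist_commute)
    then have "norm (G p - G \<xi>) \<le> \<epsilon>" using r1(2) by (simp add: dist_norm norm_minus_commute less_imp_le)
    moreover have "G p \<bullet> (y - x) = (G p - G \<xi>) \<bullet> (y - x)"
      using t(2) unfolding \<xi>_def[symmetric] inner_diff_left[of "G p"] inner_commute[of "G \<xi>"] by linarith
    ultimately have "\<bar>G p \<bullet> (y - x)\<bar> \<le> \<epsilon> * norm (y - x)"
      using Cauchy_Schwarz_ineq2[of "G p - G \<xi>" "y - x"] mult_right_mono[of "norm (G p - G \<xi>)" \<epsilon> "norm (y - x)"]
      by simp
    from dom(3)[OF this] show ?thesis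
      by (simp add: dist_norm norm_minus_commute abs_minus_commute)
  qed
  have "hausdorff2 ?S < \<top>"
  proof (rule hausdorff2_finite_of_two_parameters[of "norm p + r" _ "\<lambda>x. x $ j" "\<lambda>x. x $ k" K])
    have "norm x \<le> norm p + r" if "x \<in> ?S" for x
      using that norm_triangle_ineq2[of x p] by (simp add: dist_norm norm_minus_commute)
    then show "\<bar>x $ j\<bar> \<le> norm p + r" "\<bar>x $ k\<bar> \<le> norm p + r" if "x \<in> ?S" for x
      using that component_le_norm_cart[of x j] component_le_norm_cart[of x k] by fastforce+
  qed (use r dom Lip in auto)
  then show ?thesis using r that by blast
qed

lemma hausdorff2_frontier_finite:
  assumes X: "bounded_smooth_domain X"
  shows "hausdorff2 (frontier X) < \<top>"
proof -
  have "\<forall>p\<in>frontier X. \<exists>r. 0 < r \<and> hausdorff2 (frontier X \<inter> ball p r) < \<top>"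
  proof
    fix p assume "p \<in> frontier X"
    then show "\<exists>r. 0 < r \<and> hausdorff2 (frontier X \<inter> ball p r) < \<top>"
      by (rule hausdorff2_frontier_local[OF X]) blast
  qed
  then obtain r where r: "\<And>p. p \<in> frontier X \<Longrightarrow> 0 < r p \<and> hausdorff2 (frontier X \<inter> ball p (r p)) < \<top>"
    by (auto dest!: bchoice)
  have "compact (frontier X)"
    using X by (simp add: bounded_smooth_domain_def compact_frontier_bounded)
  moreover have "frontier X \<subseteq> (\<Union>p\<in>frontier X. ball p (r p))" using r by force
  ultimately obtain F where F: "F \<subseteq> frontier X" "finite F" "frontier X \<subseteq> (\<Union>p\<in>F. ball p (r p))"
    by (rule compactE_image[OF _ open_ball])
  have "hausdorff2 (\<Union>p\<in>F. frontier X \<inter> ball p (r p)) < \<top>"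
    using F(2,1)
  proof (induction F)
    case (insert p F)
    have "hausdorff2 (\<Union>p\<in>insert p F. frontier X \<inter> ball p (r p)) \<le>
        hausdorff2 (frontier X \<inter> ball p (r p)) + hausdorff2 (\<Union>p\<in>F. frontier X \<inter> ball p (r p))"
      using hausdorff2_subadditive by simp
    also have "\<dots> < \<top>" using insert r[of p] by simp
    finally show ?case .
  qed (simp add: hausdorff2_empty)
  moreover have "frontier X \<subseteq> (\<Union>p\<in>F. frontier X \<inter> ball p (r p))" using F by auto
  ultimately show ?thesis by (meson hausdorff2_mono order_le_less_trans)
qed

lemma finite_boundary_measure:
  assumes "bounded_smooth_domain X"
  shows "finite_measure (boundary_measure X)"
proof
  have "frontier X \<in> sets (boundary_measure X)"
    using sets.top[of "boundary_measure X"] by simp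
  then show "emeasure (boundary_measure X) (space (boundary_measure X)) \<noteq> \<infinity>"
    using hausdorff2_frontier_finite[OF assms] by (simp add: emeasure_boundary_measure)
qed

lemma measurable_outward_normal:
  assumes "bounded_smooth_domain X"
  shows "outward_normal X \<in> borel_measurable (boundary_measure X)"
  using borel_measurable_continuous_on_restrict[OF continuous_on_outward_normal[OF assms]]
  by (simp cong: measurable_cong_sets add: boundary_measure_sets)

lemma id_sphere_measurable [measurable]: "(\<lambda>x. x) \<in> borel_measurable sphere_measure"
  using measurable_restrict_space1[of "\<lambda>x. x" borel borel S2]
  by (simp cong: measurable_cong_sets add: sphere_measure_sets)

lemma sets_Gamma:
  assumes X: "bounded_smooth_domain X"
  shows "Gamma_plus X \<in> sets (boundary_measure X \<Otimes>\<^sub>M sphere_measure)"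
    and "Gamma_minus X \<in> sets (boundary_measure X \<Otimes>\<^sub>M sphere_measure)"
proof -
  let ?M = "boundary_measure X \<Otimes>\<^sub>M sphere_measure"
  note [measurable] = measurable_outward_normal[OF X]
  have m: "(\<lambda>z. snd z \<bullet> outward_normal X (fst z)) \<in> borel_measurable ?M" by measurable
  have "{z\<in>space ?M. snd z \<bullet> outward_normal X (fst z) > 0} \<in> sets ?M" using m by measurable
  moreover have "{z\<in>space ?M. snd z \<bullet> outward_normal X (fst z) > 0} = Gamma_plus X"
    by (auto simp: Gamma_plus_def space_pair_measure)
  ultimately show "Gamma_plus X \<in> sets ?M" by simp
  have "{z\<in>space ?M. - (snd z \<bullet> outward_normal X (fst z)) > 0} \<in> sets ?M" using m by measurable
  moreover have "{z\<in>space ?M. - (snd z \<bullet> outward_normal X (fst z)) > 0} = Gamma_minus X"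
    by (auto simp: Gamma_minus_def space_pair_measure)
  ultimately show "Gamma_minus X \<in> sets ?M" by metis
qed

text \<open>Null sets of \<open>\<partial>X \<times> S\<^sup>2\<close> are invisible for almost every line: for almost every direction the
  section is a null set of \<open>\<partial>X\<close>, and the lines through it fill a null set of space.\<close>

lemma boundary_AE_lines:
  assumes X: "bounded_smooth_domain X" and P: "AE z in boundary_measure X \<Otimes>\<^sub>M sphere_measure. P z"
  shows "AE \<theta> in sphere_measure. AE x in lborel. \<forall>t. x + t *\<^sub>R \<theta> \<in> frontier X \<longrightarrow> P (x + t *\<^sub>R \<theta>, \<theta>)"
proof -
  interpret B: finite_measure "boundary_measure X" by (rule finite_boundary_measure[OF X])
  interpret pair_sigma_finite "boundary_measure X" sphere_measure ..
  obtain N where N: "N \<in> null_sets (boundary_measure X \<Otimes>\<^sub>M sphere_measure)"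
    "{z\<in>space (boundary_measure X \<Otimes>\<^sub>M sphere_measure). \<not> P z} \<subseteq> N"
    using P by (auto simp: eventually_ae_filter)
  have Ns [measurable]: "N \<in> sets (boundary_measure X \<Otimes>\<^sub>M sphere_measure)" using N(1) by auto
  have "AE z in boundary_measure X \<Otimes>\<^sub>M sphere_measure. z \<notin> N" using N(1) by (rule AE_not_in)
  then have "AE y in boundary_measure X. AE \<theta> in sphere_measure. (y, \<theta>) \<notin> N" by (rule AE_pair)
  then have "AE \<theta> in sphere_measure. AE y in boundary_measure X. (y, \<theta>) \<notin> N"
    by (subst (asm) AE_commute) auto
  then show ?thesis
  proof (rule AE_space_mono)
    fix \<theta> assume \<theta>: "\<theta> \<in> space sphere_measure" and ae: "AE y in boundary_measure X. (y, \<theta>) \<notin> N"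
    let ?E = "{y \<in> frontier X. (y, \<theta>) \<in> N}"
    have "?E = (\<lambda>y. (y, \<theta>)) -` N \<inter> space (boundary_measure X)" by auto
    moreover have "\<dots> \<in> sets (boundary_measure X)"
      by (rule measurable_sets[OF measurable_Pair2'[OF \<theta>] Ns])
    ultimately have E: "?E \<in> sets (boundary_measure X)" by simp
    have "emeasure (boundary_measure X) ?E = 0"
      using ae E by (subst (asm) AE_iff_measurable[OF E]) auto
    then have "hausdorff2 ?E = 0" using E by (simp add: emeasure_boundary_measure)
    then have "AE x in lborel. \<forall>t. x + t *\<^sub>R \<theta> \<notin> ?E"
      using \<theta> by (intro hausdorff2_null_lines) auto
    then show "AE x in lborel. \<forall>t. x + t *\<^sub>R \<theta> \<in> frontier X \<longrightarrow> P (x + t *\<^sub>R \<theta>, \<theta>)"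
    proof (rule AE_space_mono, intro impI allI)
      fix x t assume notE: "\<forall>t. x + t *\<^sub>R \<theta> \<notin> ?E" and fr: "x + t *\<^sub>R \<theta> \<in> frontier X"
      have "(x + t *\<^sub>R \<theta>, \<theta>) \<notin> N" using notE fr by blast
      moreover have "(x + t *\<^sub>R \<theta>, \<theta>) \<in> space (boundary_measure X \<Otimes>\<^sub>M sphere_measure)"
        using fr \<theta> by (simp add: space_pair_measure)
      ultimately show "P (x + t *\<^sub>R \<theta>, \<theta>)" using N(2) by blast
    qed
  qed
qed

text \<open>Glancing lines are negligible: over a fixed boundary point the glancing directions form a
  great circle.\<close>

lemma glancing_null:
  assumes X: "bounded_smooth_domain X"
  shows "AE z in boundary_measure X \<Otimes>\<^sub>M sphere_measure. snd z \<bullet> outward_normal X (fst z) \<noteq> 0"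
proof -
  interpret B: finite_measure "boundary_measure X" by (rule finite_boundary_measure[OF X])
  interpret pair_sigma_finite "boundary_measure X" sphere_measure ..
  note [measurable] = measurable_outward_normal[OF X]
  show ?thesis
  proof (rule AE_pair_measure)
    show "AE x in boundary_measure X. AE \<theta> in sphere_measure. snd (x, \<theta>) \<bullet> outward_normal X (fst (x, \<theta>)) \<noteq> 0"
    proof (rule AE_I2, unfold fst_conv snd_conv)
      fix x assume "x \<in> space (boundary_measure X)"
      then show "AE \<theta> in sphere_measure. \<theta> \<bullet> outward_normal X x \<noteq> 0"
        by (intro great_circle_null outward_normal_direction(3)[OF X]) simp
    qed
  qed measurable
qed

section \<open>Chords\<close>

text \<open>The time for which one can travel backwards from \<open>x\<close> in direction \<open>\<theta>\<close> inside \<open>X\<close>. The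
  starting point may lie on the boundary, so that the same formulas give values in \<open>X\<close> and
  outgoing boundary values.\<close>

definition back_time :: "vec3 set \<Rightarrow> vec3 \<Rightarrow> vec3 \<Rightarrow> real" where
  "back_time X x \<theta> =
     (if \<theta> \<in> S2 then Sup {s. 0 \<le> s \<and> (\<forall>r\<in>{0<..s}. x - r *\<^sub>R \<theta> \<in> X)} else 0)"

locale transport_domain =
  fixes X :: "vec3 set" and R :: real
  assumes smooth: "bounded_smooth_domain X" and in_ball: "X \<subseteq> ball 0 R"
begin

lemma X_open: "open X" by (rule smooth_domain_open[OF smooth])

lemma X_borel [measurable]: "X \<in> sets borel" using X_open by simp

lemma R_pos: "0 < R"
  using smooth in_ball by (auto simp: bounded_smooth_domain_def) (metis ball_empty in_mono empty_iff not_le)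

abbreviation \<tau> :: "vec3 \<Rightarrow> vec3 \<Rightarrow> real" where "\<tau> \<equiv> back_time X"

lemma chord_length_le:
  assumes "norm \<theta> = 1" "0 \<le> s" "\<And>r. r \<in> {0<..s} \<Longrightarrow> x - r *\<^sub>R \<theta> \<in> X"
  shows "s \<le> 2 * R"
proof (rule field_le_epsilon)
  fix e :: real assume e: "0 < e"
  show "s \<le> 2 * R + e"
  proof (cases "e < s")
    case True
    have "x - e *\<^sub>R \<theta> \<in> ball 0 R" "x - s *\<^sub>R \<theta> \<in> ball 0 R"
      using assms(3)[of e] assms(3)[of s] True e in_ball by auto
    then have "norm ((x - e *\<^sub>R \<theta>) - (x - s *\<^sub>R \<theta>)) < R + R"
      using norm_triangle_ineq4[of "x - e *\<^sub>R \<theta>" "x - s *\<^sub>R \<theta>"] by simp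
    moreover have "(x - e *\<^sub>R \<theta>) - (x - s *\<^sub>R \<theta>) = (s - e) *\<^sub>R \<theta>" by (simp add: algebra_simps)
    ultimately show ?thesis using True assms(1) by simp
  qed (use R_pos in auto)
qed

abbreviation back_set :: "vec3 \<Rightarrow> vec3 \<Rightarrow> real set" where
  "back_set x \<theta> \<equiv> {s. 0 \<le> s \<and> (\<forall>r\<in>{0<..s}. x - r *\<^sub>R \<theta> \<in> X)}"

context
  fixes x \<theta> :: vec3 assumes \<theta>: "\<theta> \<in> S2"
begin

lemma back_set_bdd: "bdd_above (back_set x \<theta>)"
  using chord_length_le[of \<theta> _ x] \<theta> by (intro bdd_aboveI[of _ "2 * R"]) auto

lemma back_set_zero: "0 \<in> back_set x \<theta>" by auto

lemma tau_eq: "\<tau> x \<theta> = Sup (back_set x \<theta>)" using \<theta> by (simp add: back_time_def)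

lemma tau_upper:
  assumes "0 \<le> s" "\<And>r. r \<in> {0<..s} \<Longrightarrow> x - r *\<^sub>R \<theta> \<in> X"
  shows "s \<le> \<tau> x \<theta>"
  unfolding tau_eq by (rule cSup_upper[OF _ back_set_bdd]) (use assms in auto)

lemma tau_bounds: "0 \<le> \<tau> x \<theta>" "\<tau> x \<theta> \<le> 2 * R"
proof -
  show "0 \<le> \<tau> x \<theta>" by (rule tau_upper) auto
  show "\<tau> x \<theta> \<le> 2 * R"
    unfolding tau_eq
  proof (rule cSup_least)
    show "back_set x \<theta> \<noteq> {}" using back_set_zero by blast
    show "s \<le> 2 * R" if "s \<in> back_set x \<theta>" for s
      using that \<theta> by (intro chord_length_le[of \<theta> s x]) auto
  qed
qed

lemma inside_chord':
  assumes "0 < r" "r < \<tau> x \<theta>"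
  shows "x - r *\<^sub>R \<theta> \<in> X"
proof -
  obtain s where "s \<in> back_set x \<theta>" "r < s"
    using assms(2) less_cSup_iff[OF _ back_set_bdd, of r] back_set_zero unfolding tau_eq by blast
  then show ?thesis using assms(1) by auto
qed

lemma tau_greater:
  assumes "0 < s" "\<And>r. r \<in> {0<..s} \<Longrightarrow> x - r *\<^sub>R \<theta> \<in> X"
  shows "s < \<tau> x \<theta>"
proof -
  have "x - s *\<^sub>R \<theta> \<in> X" using assms by auto
  then obtain e where e: "0 < e" "ball (x - s *\<^sub>R \<theta>) e \<subseteq> X" using X_open open_contains_ball by blast
  have "s + e / 2 \<le> \<tau> x \<theta>"
  proof (rule tau_upper)
    fix r assume r: "r \<in> {0<..s + e / 2}"
    show "x - r *\<^sub>R \<theta> \<in> X"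
    proof (cases "r \<le> s")
      case False
      have "(x - s *\<^sub>R \<theta>) - (x - r *\<^sub>R \<theta>) = (r - s) *\<^sub>R \<theta>" by (simp add: algebra_simps)
      then have "dist (x - s *\<^sub>R \<theta>) (x - r *\<^sub>R \<theta>) = r - s"
        using \<theta> False by (simp add: dist_norm)
      then show ?thesis using r e by (intro subsetD[OF e(2)]) auto
    qed (use r assms in auto)
  qed (use assms e in auto)
  then show ?thesis using e by simp
qed

lemma tau_ge:
  assumes "\<And>r. r \<in> {0<..<s} \<Longrightarrow> x - r *\<^sub>R \<theta> \<in> X"
  shows "s \<le> \<tau> x \<theta>"
proof (rule dense_le)
  fix t assume "t < s"
  show "t \<le> \<tau> x \<theta>"
  proof (cases "t \<le> 0")
    case True then show ?thesis using tau_bounds by linarith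
  next
    case False then show ?thesis using \<open>t < s\<close> by (intro tau_upper assms) auto
  qed
qed

lemma exit_notin: "0 < \<tau> x \<theta> \<Longrightarrow> x - \<tau> x \<theta> *\<^sub>R \<theta> \<notin> X"
  using tau_greater[of "\<tau> x \<theta>"] inside_chord' by (metis greaterThanAtMost_iff less_irrefl order_le_less)

lemma exit_frontier:
  assumes "0 < \<tau> x \<theta>"
  shows "x - \<tau> x \<theta> *\<^sub>R \<theta> \<in> frontier X"
proof -
  have "((\<lambda>r. x - r *\<^sub>R \<theta>) \<longlongrightarrow> x - \<tau> x \<theta> *\<^sub>R \<theta>) (at_left (\<tau> x \<theta>))" by (intro tendsto_intros)
  moreover have "eventually (\<lambda>r. r \<in> {0<..<\<tau> x \<theta>}) (at_left (\<tau> x \<theta>))"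
    using assms by (rule eventually_at_left_real)
  then have "eventually (\<lambda>r. x - r *\<^sub>R \<theta> \<in> closure X) (at_left (\<tau> x \<theta>))"
    by eventually_elim (use inside_chord' closure_subset[of X] in auto)
  ultimately have "x - \<tau> x \<theta> *\<^sub>R \<theta> \<in> closure X"
    by (intro Lim_in_closed_set[OF closed_closure]) (auto simp: trivial_limit_at_left_real)
  then show ?thesis using exit_notin[OF assms] X_open by (simp add: frontier_def interior_open)
qed

lemma tau_pos:
  assumes "x \<in> X"
  shows "0 < \<tau> x \<theta>"
proof -
  obtain e where e: "0 < e" "ball x e \<subseteq> X" using X_open assms open_contains_ball by blast
  have "e / 2 < \<tau> x \<theta>"
  proof (rule tau_greater)
    fix r assume "r \<in> {0<..e / 2}"
    then show "x - r *\<^sub>R \<theta> \<in> X" using e \<theta> by (intro subsetD[OF e(2)]) (auto simp: dist_norm)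
  qed (use e in auto)
  then show ?thesis using e by linarith
qed

end

lemma inside_chord: "0 < r \<Longrightarrow> r < \<tau> x \<theta> \<Longrightarrow> x - r *\<^sub>R \<theta> \<in> X"
  by (cases "\<theta> \<in> S2") (auto intro: inside_chord' simp: back_time_def)

lemma tau_nonneg: "0 \<le> \<tau> x \<theta>"
  using tau_bounds(1)[of \<theta> x] by (cases "\<theta> \<in> S2") (simp_all add: back_time_def)

lemma tau_le: "\<tau> x \<theta> \<le> 2 * R"
  using R_pos tau_bounds(2)[of \<theta> x] by (cases "\<theta> \<in> S2") (simp_all add: back_time_def)

lemma tau_shift:
  assumes \<theta>: "\<theta> \<in> S2" and t: "0 \<le> t" and x: "x \<in> X" and seg: "\<And>r. 0 \<le> r \<Longrightarrow> r < t \<Longrightarrow> x + r *\<^sub>R \<theta> \<in> X"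
  shows "\<tau> (x + t *\<^sub>R \<theta>) \<theta> = t + \<tau> x \<theta>"
proof (rule antisym)
  have eq: "x + t *\<^sub>R \<theta> - r *\<^sub>R \<theta> = x + (t - r) *\<^sub>R \<theta>" "x + t *\<^sub>R \<theta> - r *\<^sub>R \<theta> = x - (r - t) *\<^sub>R \<theta>" for r
    by (simp_all add: algebra_simps)
  show "t + \<tau> x \<theta> \<le> \<tau> (x + t *\<^sub>R \<theta>) \<theta>"
  proof (rule tau_ge[OF \<theta>])
    fix r assume r: "r \<in> {0<..<t + \<tau> x \<theta>}"
    consider "r \<le> t" | "r > t" by linarith
    then show "x + t *\<^sub>R \<theta> - r *\<^sub>R \<theta> \<in> X"
    proof cases
      case 1 then show ?thesis unfolding eq(1) using r by (intro seg) auto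
    next
      case 2 then show ?thesis unfolding eq(2) using r by (intro inside_chord) auto
    qed
  qed
  show "\<tau> (x + t *\<^sub>R \<theta>) \<theta> \<le> t + \<tau> x \<theta>"
  proof (rule ccontr)
    assume "\<not> ?thesis"
    then have "x + t *\<^sub>R \<theta> - (t + \<tau> x \<theta>) *\<^sub>R \<theta> \<in> X"
      using tau_pos[OF \<theta> x] t by (intro inside_chord) auto
    then show False using exit_notin[OF \<theta> tau_pos[OF \<theta> x]] by (simp add: eq(2))
  qed
qed

lemma tau_back:
  assumes \<theta>: "\<theta> \<in> S2" and t: "0 < t" "t < \<tau> z \<theta>"
  shows "z - t *\<^sub>R \<theta> \<in> X" "\<tau> z \<theta> = t + \<tau> (z - t *\<^sub>R \<theta>) \<theta>"
proof -
  show x: "z - t *\<^sub>R \<theta> \<in> X" using t by (rule inside_chord)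
  have "\<tau> (z - t *\<^sub>R \<theta> + t *\<^sub>R \<theta>) \<theta> = t + \<tau> (z - t *\<^sub>R \<theta>) \<theta>"
  proof (rule tau_shift[OF \<theta> _ x])
    fix r assume "0 \<le> r" "r < t"
    then have "z - (t - r) *\<^sub>R \<theta> \<in> X" using t by (intro inside_chord) auto
    then show "z - t *\<^sub>R \<theta> + r *\<^sub>R \<theta> \<in> X" by (simp add: algebra_simps)
  qed (use t in auto)
  then show "\<tau> z \<theta> = t + \<tau> (z - t *\<^sub>R \<theta>) \<theta>" by simp
qed

lemma tau_entry:
  assumes \<theta>: "\<theta> \<in> S2" and y: "y \<notin> X" and t: "0 < t" and seg: "\<And>r. 0 < r \<Longrightarrow> r < t \<Longrightarrow> y + r *\<^sub>R \<theta> \<in> X"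
  shows "\<tau> (y + t *\<^sub>R \<theta>) \<theta> = t"
proof (rule antisym)
  show "t \<le> \<tau> (y + t *\<^sub>R \<theta>) \<theta>"
  proof (rule tau_ge[OF \<theta>])
    fix r assume "r \<in> {0<..<t}"
    then have "y + (t - r) *\<^sub>R \<theta> \<in> X" by (intro seg) auto
    then show "y + t *\<^sub>R \<theta> - r *\<^sub>R \<theta> \<in> X" by (simp add: algebra_simps)
  qed
  show "\<tau> (y + t *\<^sub>R \<theta>) \<theta> \<le> t"
  proof (rule ccontr)
    assume "\<not> ?thesis"
    then have "y + t *\<^sub>R \<theta> - t *\<^sub>R \<theta> \<in> X" using t by (intro inside_chord) auto
    then show False using y by simp
  qed
qed

lemma open_segment_in:
  assumes "a \<le> b"
  shows "open {z. \<forall>r\<in>{a..b}. fst z - r *\<^sub>R snd z \<in> X}"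
proof -
  have "closed {p::real \<times> vec3 \<times> vec3. fst (snd p) - fst p *\<^sub>R snd (snd p) \<in> - X}"
    by (intro closed_Compl[OF X_open, THEN closed_vimage[unfolded vimage_def]] continuous_intros)
  then have "closed {z. \<exists>r. r \<in> {a..b} \<and> (r, z) \<in> {p::real \<times> vec3 \<times> vec3. fst (snd p) - fst p *\<^sub>R snd (snd p) \<in> - X}}"
    by (intro closed_compact_projection) auto
  then have "open (- {z. \<exists>r. r \<in> {a..b} \<and> (r, z) \<in> {p::real \<times> vec3 \<times> vec3. fst (snd p) - fst p *\<^sub>R snd (snd p) \<in> - X}})"
    by (rule open_Compl)
  also have "- {z. \<exists>r. r \<in> {a..b} \<and> (r, z) \<in> {p::real \<times> vec3 \<times> vec3. fst (snd p) - fst p *\<^sub>R snd (snd p) \<in> - X}} =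
    {z. \<forall>r\<in>{a..b}. fst z - r *\<^sub>R snd z \<in> X}" by auto
  finally show ?thesis .
qed

text \<open>The half-open segments in the definition of \<open>back_time\<close> are exhausted by compact ones, and that
  a compact segment lies in the open set \<open>X\<close> is an open condition on its data.\<close>

lemma measurable_back_time: "(\<lambda>z. \<tau> (fst z) (snd z)) \<in> borel_measurable borel"
proof (rule borel_measurable_iff_greater[THEN iffD2], rule allI)
  fix a
  define G where "G q n = {z. \<forall>r\<in>{inverse (real (Suc n))..q}. fst z - r *\<^sub>R snd z \<in> X}" for q :: real and n
  have G: "G q n \<in> sets borel" for q n
    using open_segment_in[of "inverse (real (Suc n))" q] unfolding G_def
    by (cases "inverse (real (Suc n)) \<le> q") auto
  have S: "{z::vec3\<times>vec3. snd z \<in> S2} \<in> sets borel"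
    by (intro borel_closed closed_vimage[unfolded vimage_def] continuous_intros) auto
  show "{w \<in> space borel. a < \<tau> (fst w) (snd w)} \<in> sets borel"
  proof (cases "0 \<le> a")
    case False
    then have "{w \<in> space borel. a < \<tau> (fst w) (snd w)} = UNIV"
      using tau_nonneg by (auto intro: order_less_le_trans[of a 0])
    then show ?thesis by simp
  next
    case True
    have "{w \<in> space borel. a < \<tau> (fst w) (snd w)} =
        {z. snd z \<in> S2} \<inter> (\<Union>q\<in>\<rat> \<inter> {a<..}. \<Inter>n. G q n)"
    proof (intro equalityI subsetI)
      fix w assume "w \<in> {w \<in> space borel. a < \<tau> (fst w) (snd w)}"
      then have w: "a < \<tau> (fst w) (snd w)" by simp
      then have \<theta>: "snd w \<in> S2" using True by (auto simp: back_time_def split: if_splits)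
      obtain q where q: "q \<in> \<rat>" "a < q" "q < \<tau> (fst w) (snd w)"
        using Rats_dense_in_real[OF w] by blast
      have "w \<in> G q n" for n
        unfolding G_def
      proof (intro CollectI ballI inside_chord)
        fix r assume r: "r \<in> {inverse (real (Suc n))..q}"
        have "0 < inverse (real (Suc n))" by simp
        then show "0 < r" using r unfolding atLeastAtMost_iff by linarith
        show "r < \<tau> (fst w) (snd w)" using r q by simp
      qed
      then show "w \<in> {z. snd z \<in> S2} \<inter> (\<Union>q\<in>\<rat> \<inter> {a<..}. \<Inter>n. G q n)" using q \<theta> by auto
    next
      fix w assume "w \<in> {z. snd z \<in> S2} \<inter> (\<Union>q\<in>\<rat> \<inter> {a<..}. \<Inter>n. G q n)"
      then obtain q where \<theta>: "snd w \<in> S2" and q: "a < q" "\<And>n. w \<in> G q n" by auto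
      have "q < \<tau> (fst w) (snd w)"
      proof (rule tau_greater[OF \<theta>])
        fix r assume r: "r \<in> {0<..q}"
        then obtain n where "inverse (real (Suc n)) < r" using reals_Archimedean by auto
        then show "fst w - r *\<^sub>R snd w \<in> X" using q(2)[of n] r by (auto simp: G_def)
      qed (use True q in auto)
      then show "w \<in> {w \<in> space borel. a < \<tau> (fst w) (snd w)}" using q by simp
    qed
    moreover have "countable (\<rat> \<inter> {a<..})" using countable_rat by auto
    moreover have "(\<Inter>n. G q n) \<in> sets borel" for q using G by (intro sets.countable_INT) auto
    ultimately show ?thesis using S by (auto intro!: sets.Int sets.countable_UN')
  qed
qed

text \<open>Statements about the surface measure are used in this form, along almost every line.\<close>

lemma boundary_AE_transversal:
  assumes P: "AE z in boundary_measure X \<Otimes>\<^sub>M sphere_measure. P z"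
  shows "AE \<theta> in sphere_measure. AE x in lborel. \<forall>t. x + t *\<^sub>R \<theta> \<in> frontier X \<longrightarrow>
    P (x + t *\<^sub>R \<theta>, \<theta>) \<and> \<theta> \<bullet> outward_normal X (x + t *\<^sub>R \<theta>) \<noteq> 0"
proof -
  have "AE z in boundary_measure X \<Otimes>\<^sub>M sphere_measure. P z \<and> snd z \<bullet> outward_normal X (fst z) \<noteq> 0"
    using P glancing_null[OF smooth] by eventually_elim simp
  from boundary_AE_lines[OF smooth this] show ?thesis by simp
qed

lemma inflow_AE:
  assumes P: "AE z in inflow_measure X. P z"
  shows "AE \<theta> in sphere_measure. AE x in lborel. x \<in> X \<longrightarrow>
    (x - \<tau> x \<theta> *\<^sub>R \<theta>, \<theta>) \<in> Gamma_minus X \<and> P (x - \<tau> x \<theta> *\<^sub>R \<theta>, \<theta>)"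
proof -
  have "AE z in boundary_measure X \<Otimes>\<^sub>M sphere_measure. z \<in> Gamma_minus X \<longrightarrow> P z"
    using P unfolding inflow_measure_def
    by (subst (asm) AE_restrict_space_iff) (auto intro: sets_Gamma[OF smooth])
  from boundary_AE_transversal[OF this] show ?thesis
  proof (rule AE_space_mono)
    fix \<theta> assume "\<theta> \<in> space sphere_measure" and
      ae: "AE x in lborel. \<forall>t. x + t *\<^sub>R \<theta> \<in> frontier X \<longrightarrow>
        ((x + t *\<^sub>R \<theta>, \<theta>) \<in> Gamma_minus X \<longrightarrow> P (x + t *\<^sub>R \<theta>, \<theta>)) \<and>
        \<theta> \<bullet> outward_normal X (x + t *\<^sub>R \<theta>) \<noteq> 0"
    then have \<theta>: "\<theta> \<in> S2" by simp
    from ae show "AE x in lborel. x \<in> X \<longrightarrow>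
      (x - \<tau> x \<theta> *\<^sub>R \<theta>, \<theta>) \<in> Gamma_minus X \<and> P (x - \<tau> x \<theta> *\<^sub>R \<theta>, \<theta>)"
    proof (rule AE_space_mono, intro impI)
      fix x assume ax: "\<forall>t. x + t *\<^sub>R \<theta> \<in> frontier X \<longrightarrow>
        ((x + t *\<^sub>R \<theta>, \<theta>) \<in> Gamma_minus X \<longrightarrow> P (x + t *\<^sub>R \<theta>, \<theta>)) \<and>
        \<theta> \<bullet> outward_normal X (x + t *\<^sub>R \<theta>) \<noteq> 0" and x: "x \<in> X"
      define y where "y = x - \<tau> x \<theta> *\<^sub>R \<theta>"
      have y: "y \<in> frontier X" unfolding y_def by (rule exit_frontier[OF \<theta> tau_pos[OF \<theta> x]])
      have fact: "((y, \<theta>) \<in> Gamma_minus X \<longrightarrow> P (y, \<theta>)) \<and> \<theta> \<bullet> outward_normal X y \<noteq> 0"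
        using ax[rule_format, of "- \<tau> x \<theta>"] y by (simp add: y_def)
      have "\<not> 0 < \<theta> \<bullet> outward_normal X y"
      proof
        assume "0 < \<theta> \<bullet> outward_normal X y"
        then have "eventually (\<lambda>t. y + t *\<^sub>R \<theta> \<notin> X) (at_right 0)"
          by (rule outward_normal_direction(2)[OF smooth y])
        moreover have "eventually (\<lambda>t. t \<in> {0<..<\<tau> x \<theta>}) (at_right 0)"
          using tau_pos[OF \<theta> x] by (rule eventually_at_right_real)
        ultimately have "eventually (\<lambda>t::real. False) (at_right 0)"
        proof eventually_elim
          case (elim t)
          have "x - (\<tau> x \<theta> - t) *\<^sub>R \<theta> \<in> X" using elim by (intro inside_chord) auto
          then show False using elim by (simp add: y_def algebra_simps)
        qed
        then show False by (simp add: trivial_limit_at_right_real)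
      qed
      then have "(y, \<theta>) \<in> Gamma_minus X" using fact y \<theta> by (auto simp: Gamma_minus_def)
      then show "(x - \<tau> x \<theta> *\<^sub>R \<theta>, \<theta>) \<in> Gamma_minus X \<and> P (x - \<tau> x \<theta> *\<^sub>R \<theta>, \<theta>)"
        using fact by (simp add: y_def)
    qed
  qed
qed

lemma outflow_AE:
  assumes P: "AE z in outflow_measure X. P z"
  shows "AE \<theta> in sphere_measure. AE x in lborel. x \<in> X \<longrightarrow>
    (x + \<tau> x (- \<theta>) *\<^sub>R \<theta>, \<theta>) \<in> Gamma_plus X \<and> P (x + \<tau> x (- \<theta>) *\<^sub>R \<theta>, \<theta>)"
proof -
  have "AE z in boundary_measure X \<Otimes>\<^sub>M sphere_measure. z \<in> Gamma_plus X \<longrightarrow> P z"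
    using P unfolding outflow_measure_def
    by (subst (asm) AE_restrict_space_iff) (auto intro: sets_Gamma[OF smooth])
  from boundary_AE_transversal[OF this] show ?thesis
  proof (rule AE_space_mono)
    fix \<theta> assume "\<theta> \<in> space sphere_measure" and
      ae: "AE x in lborel. \<forall>t. x + t *\<^sub>R \<theta> \<in> frontier X \<longrightarrow>
        ((x + t *\<^sub>R \<theta>, \<theta>) \<in> Gamma_plus X \<longrightarrow> P (x + t *\<^sub>R \<theta>, \<theta>)) \<and>
        \<theta> \<bullet> outward_normal X (x + t *\<^sub>R \<theta>) \<noteq> 0"
    then have \<theta>: "\<theta> \<in> S2" "- \<theta> \<in> S2" by simp_all
    from ae show "AE x in lborel. x \<in> X \<longrightarrow>
      (x + \<tau> x (- \<theta>) *\<^sub>R \<theta>, \<theta>) \<in> Gamma_plus X \<and> P (x + \<tau> x (- \<theta>) *\<^sub>R \<theta>, \<theta>)"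
    proof (rule AE_space_mono, intro impI)
      fix x assume ax: "\<forall>t. x + t *\<^sub>R \<theta> \<in> frontier X \<longrightarrow>
        ((x + t *\<^sub>R \<theta>, \<theta>) \<in> Gamma_plus X \<longrightarrow> P (x + t *\<^sub>R \<theta>, \<theta>)) \<and>
        \<theta> \<bullet> outward_normal X (x + t *\<^sub>R \<theta>) \<noteq> 0" and x: "x \<in> X"
      define T where "T = \<tau> x (- \<theta>)"
      define y where "y = x + T *\<^sub>R \<theta>"
      have T: "0 < T" unfolding T_def by (rule tau_pos[OF \<theta>(2) x])
      have y: "y \<in> frontier X"
        using exit_frontier[OF \<theta>(2) tau_pos[OF \<theta>(2) x]] by (simp add: y_def T_def)
      have fact: "((y, \<theta>) \<in> Gamma_plus X \<longrightarrow> P (y, \<theta>)) \<and> \<theta> \<bullet> outward_normal X y \<noteq> 0"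
        using ax[rule_format, of T] y by (simp add: y_def)
      have "\<not> \<theta> \<bullet> outward_normal X y < 0"
      proof
        assume "\<theta> \<bullet> outward_normal X y < 0"
        then have "0 < (- \<theta>) \<bullet> outward_normal X y" by simp
        then have "eventually (\<lambda>t. y + t *\<^sub>R (- \<theta>) \<notin> X) (at_right 0)"
          by (rule outward_normal_direction(2)[OF smooth y])
        moreover have "eventually (\<lambda>t. t \<in> {0<..<T}) (at_right 0)"
          using T by (rule eventually_at_right_real)
        ultimately have "eventually (\<lambda>t::real. False) (at_right 0)"
        proof eventually_elim
          case (elim t)
          have "x - (T - t) *\<^sub>R (- \<theta>) \<in> X" using elim by (intro inside_chord) (auto simp: T_def)
          then show False using elim by (simp add: y_def algebra_simps)
        qed
        then show False by (simp add: trivial_limit_at_right_real)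
      qed
      then have "(y, \<theta>) \<in> Gamma_plus X" using fact y \<theta> by (auto simp: Gamma_plus_def)
      then show "(x + \<tau> x (- \<theta>) *\<^sub>R \<theta>, \<theta>) \<in> Gamma_plus X \<and> P (x + \<tau> x (- \<theta>) *\<^sub>R \<theta>, \<theta>)"
        using fact by (simp add: y_def T_def)
    qed
  qed
qed

end

section \<open>Linear transport along a line\<close>

lemma set_integrable_bounded:
  fixes f :: "real \<Rightarrow> real"
  assumes [measurable]: "f \<in> borel_measurable borel" and "\<And>t. t \<in> {a..b} \<Longrightarrow> \<bar>f t\<bar> \<le> M"
  shows "set_integrable lborel {a..b} f"
  unfolding set_integrable_def
proof (rule Bochner_Integration.integrable_bound)
  show "integrable lborel (\<lambda>t. indicator {a..b} t *\<^sub>R M)"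
    by (intro integrable_scaleR_left integrable_real_indicator) (auto simp: emeasure_lborel_Icc_eq)
  show "AE t in lborel. norm (indicator {a..b} t *\<^sub>R f t) \<le> norm (indicator {a..b} t *\<^sub>R M)"
    using assms(2) by (intro AE_I2) (auto simp: indicator_def intro: order_trans[OF _ abs_ge_self])
qed measurable

lemma measurable_set_integral [measurable]:
  fixes f :: "'a \<Rightarrow> real \<Rightarrow> real"
  assumes [measurable]: "(\<lambda>(x, t). f x t) \<in> borel_measurable (N \<Otimes>\<^sub>M borel)"
    "a \<in> borel_measurable N" "b \<in> borel_measurable N"
  shows "(\<lambda>x. LINT t:{a x..b x}|lborel. f x t) \<in> borel_measurable N"
proof -
  have "(\<lambda>(x, t). (if a x \<le> t \<and> t \<le> b x then 1 else 0) * f x t) \<in> borel_measurable (N \<Otimes>\<^sub>M lborel)"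
    by (simp add: split_beta) measurable
  then have "(\<lambda>x. LINT t|lborel. (if a x \<le> t \<and> t \<le> b x then 1 else 0) * f x t) \<in> borel_measurable N"
    by (rule lborel.borel_measurable_lebesgue_integral)
  then show ?thesis
    by (simp add: set_lebesgue_integral_def indicator_def)
qed

lemma set_integral_bound:
  fixes f :: "real \<Rightarrow> real"
  assumes "\<And>t. t \<in> {a..b} \<Longrightarrow> \<bar>f t\<bar> \<le> M" "0 \<le> M" "a \<le> b"
  shows "\<bar>LINT t:{a..b}|lborel. f t\<bar> \<le> M * (b - a)"
proof (cases "set_integrable lborel {a..b} f")
  case True
  have "\<bar>LINT t:{a..b}|lborel. f t\<bar> \<le> (LINT t:{a..b}|lborel. \<bar>f t\<bar>)"
    using set_integral_norm_bound[OF True] by simp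
  also have "\<dots> \<le> (LINT t:{a..b}|lborel. M)"
  proof (rule set_integral_mono)
    show "set_integrable lborel {a..b} (\<lambda>t. \<bar>f t\<bar>)" using True by (rule set_integrable_abs)
    show "set_integrable lborel {a..b} (\<lambda>t. M)" using assms by (intro set_integrable_bounded[where M=M]) auto
  qed (use assms in auto)
  also have "\<dots> = M * (b - a)" using assms by (simp add: set_integral_const)
  finally show ?thesis .
next
  case False
  then show ?thesis using assms by (simp add: set_integrable_def set_lebesgue_integral_def not_integrable_integral_eq)
qed

lemma triangle_Fubini:
  fixes g h :: "real \<Rightarrow> real"
  assumes [measurable]: "g \<in> borel_measurable borel" "h \<in> borel_measurable borel"
    and g: "\<And>r. r \<in> {0..t} \<Longrightarrow> \<bar>g r\<bar> \<le> A" and h: "\<And>r. r \<in> {0..t} \<Longrightarrow> \<bar>h r\<bar> \<le> B"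
  shows "(LINT r:{0..t}|lborel. g r * (LINT p:{0..r}|lborel. h p)) =
    (LINT p:{0..t}|lborel. h p * (LINT r:{p..t}|lborel. g r))"
proof -
  define f where "f r p = (if 0 \<le> p \<and> p \<le> r \<and> r \<le> t then g r * h p else 0)" for r p
  have f_meas: "(\<lambda>(r, p). f r p) \<in> borel_measurable (lborel \<Otimes>\<^sub>M lborel)"
    unfolding f_def by (simp add: split_beta) measurable
  have int: "integrable (lborel \<Otimes>\<^sub>M lborel) (\<lambda>(r, p). f r p)"
  proof (rule Bochner_Integration.integrable_bound[OF _ f_meas])
    show "integrable (lborel \<Otimes>\<^sub>M lborel) (\<lambda>z. indicator (cbox (0, 0) (t, t)) z *\<^sub>R (A * B))"
      unfolding lborel_prod
      by (intro integrable_scaleR_left integrable_real_indicator emeasure_lborel_cbox_finite) auto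
    show "AE z in lborel \<Otimes>\<^sub>M lborel. norm (case z of (r, p) \<Rightarrow> f r p) \<le>
        norm (indicator (cbox (0, 0) (t, t)) z *\<^sub>R (A * B))"
    proof (intro AE_I2, clarify)
      fix r p
      show "norm (f r p) \<le> norm (indicator (cbox (0, 0) (t, t)) (r, p) *\<^sub>R (A * B))"
      proof (cases "0 \<le> p \<and> p \<le> r \<and> r \<le> t")
        case True
        then have "\<bar>g r\<bar> \<le> A" "\<bar>h p\<bar> \<le> B" "(r, p) \<in> cbox (0, 0) (t, t)"
          using g[of r] h[of p] by auto
        then show ?thesis using True mult_mono[of "\<bar>g r\<bar>" A "\<bar>h p\<bar>" B]
          by (auto simp: f_def abs_mult intro: order_trans[OF _ abs_ge_self])
      next
        case False
        then have "f r p = 0" by (auto simp: f_def)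
        then show ?thesis by simp
      qed
    qed
  qed
  have "(\<integral>r. \<integral>p. f r p \<partial>lborel \<partial>lborel) = (\<integral>p. \<integral>r. f r p \<partial>lborel \<partial>lborel)"
    by (rule lborel_pair.Fubini_integral[OF int, symmetric])
  moreover have "(\<integral>p. f r p \<partial>lborel) = indicator {0..t} r *\<^sub>R (g r * (LINT p:{0..r}|lborel. h p))" for r
  proof (cases "r \<in> {0..t}")
    case True
    then have "(\<lambda>p. f r p) = (\<lambda>p. g r * (indicator {0..r} p *\<^sub>R h p))"
      by (auto simp: f_def indicator_def fun_eq_iff)
    then show ?thesis using True by (simp add: set_lebesgue_integral_def)
  next
    case False
    then have "(\<lambda>p. f r p) = (\<lambda>p. 0)" by (auto simp: f_def fun_eq_iff)
    then show ?thesis using False by simp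
  qed
  moreover have "(\<integral>r. f r p \<partial>lborel) = indicator {0..t} p *\<^sub>R (h p * (LINT r:{p..t}|lborel. g r))" for p
  proof (cases "p \<in> {0..t}")
    case True
    then have "(\<lambda>r. f r p) = (\<lambda>r. h p * (indicator {p..t} r *\<^sub>R g r))"
      by (auto simp: f_def indicator_def fun_eq_iff)
    then show ?thesis using True by (simp add: set_lebesgue_integral_def)
  next
    case False
    then have "(\<lambda>r. f r p) = (\<lambda>p. 0)" by (auto simp: f_def fun_eq_iff)
    then show ?thesis using False by simp
  qed
  ultimately show ?thesis by (simp add: set_lebesgue_integral_def)
qed

lemma indefinite_continuous:
  fixes f :: "real \<Rightarrow> real"
  assumes "set_integrable lborel {0..T} f"
  shows "continuous_on {0..T} (\<lambda>t. LINT r:{0..t}|lborel. f r)"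
proof -
  have sub: "set_integrable lborel {0..t} f" if "t \<le> T" for t
    using assms by (rule set_integrable_subset) (use that in auto)
  have "continuous_on {0..T} (\<lambda>t. integral {0..t} f)"
    by (intro indefinite_integral_continuous_1 set_borel_integral_eq_integral(1) assms)
  then show ?thesis
    by (rule continuous_on_eq) (use sub in \<open>auto intro!: set_borel_integral_eq_integral(2)[symmetric]\<close>)
qed

lemma indefinite_derivative:
  fixes f :: "real \<Rightarrow> real"
  assumes int: "set_integrable lborel {0..T} f" and cont: "continuous_on {0<..<T} f" and t: "0 < t" "t < T"
  shows "((\<lambda>t. LINT r:{0..t}|lborel. f r) has_real_derivative f t) (at t)"
proof -
  define a b where "a = t / 2" and "b = (t + T) / 2"
  have ab: "0 < a" "a < t" "t < b" "b < T" using t by (auto simp: a_def b_def)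
  have sub: "set_integrable lborel {c..d} f" if "0 \<le> c" "d \<le> T" for c d
    using int by (rule set_integrable_subset) (use that in auto)
  have cf: "continuous_on {a..b} f"
    using cont by (rule continuous_on_subset) (use ab in auto)
  have "((\<lambda>x. integral {a..x} f) has_real_derivative f t) (at t within {a..b})"
    by (rule integral_has_real_derivative[OF cf]) (use ab in auto)
  then have "((\<lambda>x. integral {a..x} f) has_real_derivative f t) (at t)"
    unfolding at_within_Icc_at[OF ab(2,3)] .
  then have "((\<lambda>x. (LINT r:{0..a}|lborel. f r) + integral {a..x} f) has_real_derivative f t) (at t)"
    by (auto intro!: derivative_eq_intros)
  then show ?thesis
  proof (rule DERIV_cong_ev[THEN iffD1, rotated -1])
    have "eventually (\<lambda>x. x \<in> {a<..<b}) (nhds t)"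
      using ab by (intro eventually_nhds_in_open) auto
    then show "eventually (\<lambda>x. (LINT r:{0..a}|lborel. f r) + integral {a..x} f = (LINT r:{0..x}|lborel. f r)) (nhds t)"
    proof eventually_elim
      case (elim x)
      have "(LINT r:{0..x}|lborel. f r) = integral {0..x} f"
        using ab elim by (intro set_borel_integral_eq_integral(2) sub) auto
      moreover have "(LINT r:{0..a}|lborel. f r) = integral {0..a} f"
        using ab elim by (intro set_borel_integral_eq_integral(2) sub) auto
      moreover have "integral {0..a} f + integral {a..x} f = integral {0..x} f"
        using ab elim by (intro Henstock_Kurzweil_Integration.integral_combine set_borel_integral_eq_integral(1) sub) auto
      ultimately show ?case by simp
    qed
  qed auto
qed

lemma split_set_integral:
  fixes f :: "real \<Rightarrow> real"
  assumes "set_integrable lborel {a..c} f" "a \<le> b" "b \<le> c"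
  shows "(LINT t:{a..c}|lborel. f t) = (LINT t:{a..b}|lborel. f t) + (LINT t:{b..c}|lborel. f t)"
proof -
  have sub: "set_integrable lborel {a..b} f" "set_integrable lborel {b..c} f"
    using assms by (auto intro: set_integrable_subset)
  show ?thesis
    using Henstock_Kurzweil_Integration.integral_combine[OF assms(2,3) set_borel_integral_eq_integral(1)[OF assms(1)]]
    by (simp add: set_borel_integral_eq_integral(2) assms(1) sub)
qed

lemma shift_set_integral:
  fixes f :: "real \<Rightarrow> real"
  shows "(LINT t:{a + c..b + c}|lborel. f t) = (LINT t:{a..b}|lborel. f (t + c))"
proof -
  have "(LINT t:{a + c..b + c}|lborel. f t) = (LINT t|lborel. indicator {a + c..b + c} (c + t) *\<^sub>R f (c + t))"
    unfolding set_lebesgue_integral_def using lborel_integral_real_affine[of 1 "\<lambda>t. indicator {a + c..b + c} t *\<^sub>R f t" c] by simp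
  also have "(\<lambda>t. indicator {a + c..b + c} (c + t) *\<^sub>R f (c + t)) = (\<lambda>t. indicator {a..b} t *\<^sub>R f (t + c))"
    by (auto simp: indicator_def fun_eq_iff add.commute)
  finally show ?thesis by (simp add: set_lebesgue_integral_def)
qed

lemma reflect_set_integral:
  fixes f :: "real \<Rightarrow> real"
  shows "(LINT t:{a..b}|lborel. f (c - t)) = (LINT t:{c - b..c - a}|lborel. f t)"
proof -
  have "(LINT t:{c - b..c - a}|lborel. f t) = (LINT t|lborel. indicator {c - b..c - a} (c + -1 * t) *\<^sub>R f (c + -1 * t))"
    unfolding set_lebesgue_integral_def using lborel_integral_real_affine[of "-1" "\<lambda>t. indicator {c - b..c - a} t *\<^sub>R f t" c] by simp
  also have "(\<lambda>t. indicator {c - b..c - a} (c + -1 * t) *\<^sub>R f (c + -1 * t)) = (\<lambda>t. indicator {a..b} t *\<^sub>R f (c - t))"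
    by (auto simp: indicator_def fun_eq_iff)
  finally show ?thesis by (simp add: set_lebesgue_integral_def)
qed

text \<open>The equation \<open>u' = h - s u\<close> along a line, with attenuation \<open>s\<close> that is continuous in the
  interior of the interval and source \<open>h\<close> that is merely measurable.\<close>

locale line_transport =
  fixes s h :: "real \<Rightarrow> real" and T A B :: real
  assumes s_meas [measurable]: "s \<in> borel_measurable borel" and s_bound: "\<And>t. t \<in> {0..T} \<Longrightarrow> \<bar>s t\<bar> \<le> A"
    and s_cont: "continuous_on {0<..<T} s"
    and h_meas [measurable]: "h \<in> borel_measurable borel" and h_bound: "\<And>t. t \<in> {0..T} \<Longrightarrow> \<bar>h t\<bar> \<le> B"
    and T_nonneg: "0 \<le> T"
begin

definition Lam :: "real \<Rightarrow> real" where "Lam t = (LINT r:{0..t}|lborel. s r)"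

lemma A_nonneg: "0 \<le> A" using s_bound[of 0] T_nonneg by auto
lemma B_nonneg: "0 \<le> B" using h_bound[of 0] T_nonneg by auto

lemma Lam_meas [measurable]: "Lam \<in> borel_measurable borel"
  unfolding Lam_def by measurable

lemma Lam_0 [simp]: "Lam 0 = 0"
  using set_integral_bound[of 0 0 s A] s_bound T_nonneg A_nonneg by (auto simp: Lam_def)

lemma s_int: "set_integrable lborel {0..T} s"
  by (rule set_integrable_bounded[OF s_meas s_bound])

lemma Lam_bound:
  assumes "t \<in> {0..T}"
  shows "\<bar>Lam t\<bar> \<le> A * T"
proof -
  have "\<bar>Lam t\<bar> \<le> A * (t - 0)"
    unfolding Lam_def using assms s_bound A_nonneg by (intro set_integral_bound) auto
  also have "\<dots> \<le> A * T" using assms A_nonneg by (intro mult_left_mono) auto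
  finally show ?thesis .
qed

lemma Lam_cont: "continuous_on {0..T} Lam"
  unfolding Lam_def by (rule indefinite_continuous[OF s_int])

lemma Lam_deriv: "0 < t \<Longrightarrow> t < T \<Longrightarrow> (Lam has_real_derivative s t) (at t)"
  unfolding Lam_def by (rule indefinite_derivative[OF s_int s_cont])

lemma exp_bounds:
  assumes "t \<in> {0..T}"
  shows "\<bar>exp (Lam t)\<bar> \<le> exp (A * T)" "\<bar>exp (- Lam t)\<bar> \<le> exp (A * T)"
  using Lam_bound[OF assms] by simp_all

lemma integral_exp_Lam:
  assumes "0 \<le> a" "a \<le> b" "b \<le> T"
  shows "(LINT r:{a..b}|lborel. s r * exp (- Lam r)) = exp (- Lam a) - exp (- Lam b)"
proof -
  have int: "set_integrable lborel {a..b} (\<lambda>r. s r * exp (- Lam r))"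
    by (rule set_integrable_bounded[where M="A * exp (A * T)"])
      (use assms s_bound exp_bounds A_nonneg in \<open>auto simp: abs_mult intro!: mult_mono\<close>)
  have "((\<lambda>r. s r * exp (- Lam r)) has_integral (- exp (- Lam b)) - (- exp (- Lam a))) {a..b}"
  proof (rule fundamental_theorem_of_calculus_interior[OF assms(2)])
    show "continuous_on {a..b} (\<lambda>r. - exp (- Lam r))"
      by (intro continuous_intros continuous_on_subset[OF Lam_cont]) (use assms in auto)
    fix x assume "x \<in> {a<..<b}"
    then have "(Lam has_real_derivative s x) (at x)" using assms by (intro Lam_deriv) auto
    then have "((\<lambda>r. - exp (- Lam r)) has_real_derivative s x * exp (- Lam x)) (at x)"
      by (auto intro!: derivative_eq_intros)
    then show "((\<lambda>r. - exp (- Lam r)) has_vector_derivative s x * exp (- Lam x)) (at x)"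
      by (simp add: has_real_derivative_iff_has_vector_derivative)
  qed
  then show ?thesis
    by (simp add: set_borel_integral_eq_integral(2)[OF int] integral_unique)
qed

text \<open>The variation-of-constants formula with initial value \<open>u0\<close>.\<close>

definition W :: "real \<Rightarrow> real \<Rightarrow> real" where
  "W u0 t = exp (- Lam t) * (u0 + (LINT r:{0..t}|lborel. exp (Lam r) * h r))"

lemma expLam_h_int:
  assumes "0 \<le> a" "b \<le> T"
  shows "set_integrable lborel {a..b} (\<lambda>r. exp (Lam r) * h r)"
  by (rule set_integrable_bounded[where M="exp (A * T) * B"])
    (use assms h_bound exp_bounds B_nonneg in \<open>auto simp: abs_mult simp del: abs_exp_cancel intro!: mult_mono\<close>)

lemma W_cont: "continuous_on {0..T} (W u0)"
  unfolding W_def by (intro continuous_intros Lam_cont indefinite_continuous expLam_h_int) auto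

lemma W_meas [measurable]: "W u0 \<in> borel_measurable borel"
  unfolding W_def by measurable

lemma W_bounded: "\<exists>M. \<forall>t\<in>{0..T}. \<bar>W u0 t\<bar> \<le> M"
proof -
  have "bounded (W u0 ` {0..T})"
    by (intro compact_imp_bounded compact_continuous_image W_cont) auto
  then show ?thesis by (auto simp: bounded_iff)
qed

lemma sW_int: "0 \<le> a \<Longrightarrow> b \<le> T \<Longrightarrow> set_integrable lborel {a..b} (\<lambda>r. s r * W u0 r)"
proof -
  assume ab: "0 \<le> a" "b \<le> T"
  obtain M where M: "\<And>t. t \<in> {0..T} \<Longrightarrow> \<bar>W u0 t\<bar> \<le> M" using W_bounded by blast
  show ?thesis
    by (rule set_integrable_bounded[where M="A * M"])
      (use ab s_bound M A_nonneg in \<open>auto simp: abs_mult intro!: mult_mono\<close>)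
qed

lemma h_int: "0 \<le> a \<Longrightarrow> b \<le> T \<Longrightarrow> set_integrable lborel {a..b} h"
  by (rule set_integrable_bounded[where M=B]) (use h_bound in auto)

text \<open>The source may be discontinuous, so the formula is verified in integrated form, by exchanging
  the order of integration.\<close>

lemma W_solves:
  assumes t: "t \<in> {0..T}"
  shows "W u0 t - u0 = (LINT r:{0..t}|lborel. h r - s r * W u0 r)"
proof -
  have se: "set_integrable lborel {0..t} (\<lambda>r. s r * exp (- Lam r))"
    by (rule set_integrable_bounded[where M="A * exp (A * T)"])
      (use t s_bound exp_bounds A_nonneg in \<open>auto simp: abs_mult simp del: abs_exp_cancel intro!: mult_mono\<close>)
  let ?I = "\<lambda>t. LINT r:{0..t}|lborel. exp (Lam r) * h r"
  have I_meas [measurable]: "?I \<in> borel_measurable borel" by measurable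
  have "(LINT r:{0..t}|lborel. s r * W u0 r) =
      (LINT r:{0..t}|lborel. u0 * (s r * exp (- Lam r)) + s r * exp (- Lam r) * ?I r)"
    by (intro set_lebesgue_integral_cong) (auto simp: W_def algebra_simps)
  also have "\<dots> = u0 * (LINT r:{0..t}|lborel. s r * exp (- Lam r)) + (LINT r:{0..t}|lborel. s r * exp (- Lam r) * ?I r)"
  proof -
    have "set_integrable lborel {0..t} (\<lambda>r. s r * W u0 r - u0 * (s r * exp (- Lam r)))"
      using se sW_int[of 0 t u0] t by (intro set_integral_diff(1)) auto
    moreover have "(\<lambda>r. s r * W u0 r - u0 * (s r * exp (- Lam r))) = (\<lambda>r. s r * exp (- Lam r) * ?I r)"
      by (auto simp: W_def algebra_simps)
    ultimately show ?thesis using se by (subst set_integral_add) auto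
  qed
  also have "(LINT r:{0..t}|lborel. s r * exp (- Lam r) * ?I r) =
      (LINT p:{0..t}|lborel. exp (Lam p) * h p * (LINT r:{p..t}|lborel. s r * exp (- Lam r)))"
    by (rule triangle_Fubini[where A="A * exp (A * T)" and B="exp (A * T) * B"])
      (use t s_bound h_bound exp_bounds A_nonneg B_nonneg in \<open>auto simp: abs_mult simp del: abs_exp_cancel intro!: mult_mono\<close>)
  also have "\<dots> = (LINT p:{0..t}|lborel. h p - exp (- Lam t) * (exp (Lam p) * h p))"
  proof (rule set_lebesgue_integral_cong)
    show "\<forall>p. p \<in> {0..t} \<longrightarrow> exp (Lam p) * h p * (LINT r:{p..t}|lborel. s r * exp (- Lam r)) =
        h p - exp (- Lam t) * (exp (Lam p) * h p)"
    proof (intro allI impI)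
      fix p assume "p \<in> {0..t}"
      then have "(LINT r:{p..t}|lborel. s r * exp (- Lam r)) = exp (- Lam p) - exp (- Lam t)"
        using t by (intro integral_exp_Lam) auto
      moreover have "exp (Lam p) * exp (- Lam p) = 1" by (simp flip: exp_add)
      then have "exp (Lam p) * h p * (exp (- Lam p) - exp (- Lam t)) =
          h p - exp (- Lam t) * (exp (Lam p) * h p)" by algebra
      ultimately show "exp (Lam p) * h p * (LINT r:{p..t}|lborel. s r * exp (- Lam r)) =
        h p - exp (- Lam t) * (exp (Lam p) * h p)" by simp
    qed
  qed auto
  also have "\<dots> = (LINT p:{0..t}|lborel. h p) - exp (- Lam t) * ?I t"
    using t by (subst set_integral_diff) (auto intro: h_int expLam_h_int)
  also have "(LINT r:{0..t}|lborel. s r * exp (- Lam r)) = 1 - exp (- Lam t)"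
    using integral_exp_Lam[of 0 t] t by simp
  finally have "(LINT r:{0..t}|lborel. s r * W u0 r) = u0 - exp (- Lam t) * u0 + ((LINT p:{0..t}|lborel. h p) - exp (- Lam t) * ?I t)"
    by (simp add: algebra_simps)
  moreover have "(LINT r:{0..t}|lborel. h r - s r * W u0 r) = (LINT r:{0..t}|lborel. h r) - (LINT r:{0..t}|lborel. s r * W u0 r)"
    using t by (intro set_integral_diff(2) h_int sW_int) auto
  ultimately show ?thesis by (simp add: W_def algebra_simps)
qed

text \<open>The difference of two solutions solves the homogeneous equation, is therefore continuously
  differentiable, and has vanishing derivative after multiplication by \<open>exp Lam\<close>.\<close>

lemma W_unique:
  assumes int: "\<And>t. t \<in> {0..T} \<Longrightarrow> set_integrable lborel {0..t} (\<lambda>r. h r - s r * u r)"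
    and eq: "\<And>t. t \<in> {0..T} \<Longrightarrow> u t - u 0 = (LINT r:{0..t}|lborel. h r - s r * u r)"
    and t: "t \<in> {0..T}"
  shows "u t = W (u 0) t"
proof (cases "t = 0")
  case True
  have "(LINT r:{0..0}|lborel. exp (Lam r) * h r) = 0"
    using set_integral_bound[of 0 0 "\<lambda>r. exp (Lam r) * h r" "\<bar>exp (Lam 0) * h 0\<bar>"] by simp
  then show ?thesis using True by (simp add: W_def)
next
  case False
  then have T: "0 < T" "0 < t" "t \<le> T" using t by auto
  define v where "v r = u r - W (u 0) r" for r
  have sv: "set_integrable lborel {0..r} (\<lambda>r. - (s r * v r))" if "r \<in> {0..T}" for r
  proof -
    have "set_integrable lborel {0..r} (\<lambda>r. (h r - s r * u r) - (h r - s r * W (u 0) r))"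
      using that by (intro set_integral_diff(1) int h_int sW_int) auto
    then show ?thesis by (simp add: v_def algebra_simps)
  qed
  have v_eq: "v r = (LINT r:{0..r}|lborel. - (s r * v r))" if "r \<in> {0..T}" for r
  proof -
    have "(LINT r:{0..r}|lborel. (h r - s r * u r) - (h r - s r * W (u 0) r)) =
        (LINT r:{0..r}|lborel. h r - s r * u r) - (LINT r:{0..r}|lborel. h r - s r * W (u 0) r)"
      using that by (intro set_integral_diff(2) int set_integral_diff(1) h_int sW_int) auto
    also have "\<dots> = (u r - u 0) - (W (u 0) r - u 0)" using eq[OF that] W_solves[OF that] by simp
    finally show ?thesis by (simp add: v_def algebra_simps)
  qed
  have v_cont: "continuous_on {0..T} v"
  proof (rule continuous_on_eq)
    show "continuous_on {0..T} (\<lambda>r. LINT r:{0..r}|lborel. - (s r * v r))"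
      using T by (intro indefinite_continuous sv) auto
  qed (use v_eq in auto)
  have v_deriv: "(v has_real_derivative - (s r * v r)) (at r)" if "0 < r" "r < T" for r
  proof (rule DERIV_cong_ev[THEN iffD1])
    show "((\<lambda>r. LINT r:{0..r}|lborel. - (s r * v r)) has_real_derivative - (s r * v r)) (at r)"
      using T that
      by (intro indefinite_derivative[where T=T] sv continuous_intros s_cont continuous_on_subset[OF v_cont]) auto
    have "eventually (\<lambda>r. r \<in> {0<..<T}) (nhds r)"
      using that by (intro eventually_nhds_in_open) auto
    then show "eventually (\<lambda>r. (LINT r:{0..r}|lborel. - (s r * v r)) = v r) (nhds r)"
      by eventually_elim (use v_eq in auto)
  qed auto
  have "v t * exp (Lam t) = v 0 * exp (Lam 0)"
  proof (rule DERIV_isconst_end[OF \<open>0 < t\<close>])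
    show "continuous_on {0..t} (\<lambda>r. v r * exp (Lam r))"
      using T by (intro continuous_intros continuous_on_subset[OF v_cont] continuous_on_subset[OF Lam_cont]) auto
    fix r assume "0 < r" "r < t"
    then have "(v has_real_derivative - (s r * v r)) (at r)" "(Lam has_real_derivative s r) (at r)"
      using T by (auto intro: v_deriv Lam_deriv)
    then show "((\<lambda>r. v r * exp (Lam r)) has_real_derivative 0) (at r)"
      by (auto intro!: derivative_eq_intros)
  qed
  moreover have "v 0 = 0"
    using v_eq[of 0] T_nonneg set_integral_bound[of 0 0 "\<lambda>r. - (s r * v r)" "\<bar>s 0 * v 0\<bar>"] by auto
  ultimately show ?thesis by (simp add: v_def)
qed

end

section \<open>The integral form of the transport equation\<close>

definition bounded_borel :: "(vec3 \<times> vec3 \<Rightarrow> real) \<Rightarrow> bool" where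
  "bounded_borel u \<longleftrightarrow> u \<in> borel_measurable borel \<and> (\<exists>M. \<forall>z. \<bar>u z\<bar> \<le> M)"

lemma bounded_borelI: "u \<in> borel_measurable borel \<Longrightarrow> (\<And>z. \<bar>u z\<bar> \<le> M) \<Longrightarrow> bounded_borel u"
  by (auto simp: bounded_borel_def)

lemma bounded_borel_meas [measurable_dest]: "bounded_borel u \<Longrightarrow> u \<in> borel_measurable borel"
  by (simp add: bounded_borel_def)

lemma bounded_borelE:
  assumes "bounded_borel u"
  obtains M where "0 \<le> M" "\<And>z. \<bar>u z\<bar> \<le> M"
proof -
  obtain M where M: "\<And>z. \<bar>u z\<bar> \<le> M" using assms by (auto simp: bounded_borel_def)
  moreover have "0 \<le> M" using M[of undefined] by linarith
  ultimately show ?thesis using that by blast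
qed

lemma bounded_borel_const: "bounded_borel (\<lambda>_. c)"
  by (rule bounded_borelI[where M="\<bar>c\<bar>"]) auto

lemma bounded_borel_add:
  assumes "bounded_borel u" "bounded_borel v"
  shows "bounded_borel (\<lambda>z. u z + v z)"
proof -
  note [measurable] = assms[THEN bounded_borel_meas]
  obtain M N where "\<And>z. \<bar>u z\<bar> \<le> M" "\<And>z. \<bar>v z\<bar> \<le> N" using assms bounded_borelE by metis
  then show ?thesis
    by (intro bounded_borelI[where M="M + N"]) (auto intro: order_trans[OF abs_triangle_ineq add_mono])
qed

lemma bounded_borel_mult:
  assumes "bounded_borel u" "bounded_borel v"
  shows "bounded_borel (\<lambda>z. u z * v z)"
proof -
  note [measurable] = assms[THEN bounded_borel_meas]
  obtain M where M: "0 \<le> M" "\<And>z. \<bar>u z\<bar> \<le> M" using bounded_borelE[OF assms(1)] by blast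
  obtain N where N: "0 \<le> N" "\<And>z. \<bar>v z\<bar> \<le> N" using bounded_borelE[OF assms(2)] by blast
  show ?thesis
    by (rule bounded_borelI[where M="M * N"]) (auto simp: abs_mult M N intro!: mult_mono)
qed

lemma bounded_borel_cmult: "bounded_borel u \<Longrightarrow> bounded_borel (\<lambda>z. c * u z)"
  by (intro bounded_borel_mult bounded_borel_const)

lemma bounded_borel_diff:
  assumes "bounded_borel u" "bounded_borel v"
  shows "bounded_borel (\<lambda>z. u z - v z)"
  using bounded_borel_add[OF assms(1) bounded_borel_cmult[OF assms(2), of "-1"]] by simp

lemma bounded_borel_sum: "(\<And>i. i \<in> I \<Longrightarrow> bounded_borel (u i)) \<Longrightarrow> bounded_borel (\<lambda>z. \<Sum>i\<in>I. u i z)"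
  by (induction I rule: infinite_finite_induct) (auto intro: bounded_borel_const bounded_borel_add)

lemma fst_borel [measurable]: "(fst :: vec3 \<times> vec3 \<Rightarrow> vec3) \<in> borel_measurable borel"
  by (intro borel_measurable_continuous_onI continuous_intros)

lemma snd_borel [measurable]: "(snd :: vec3 \<times> vec3 \<Rightarrow> vec3) \<in> borel_measurable borel"
  by (intro borel_measurable_continuous_onI continuous_intros)

text \<open>The fraction of light travelling in direction \<open>\<theta>\<close> that survives the last stretch of length \<open>t\<close>
  before \<open>x\<close>.\<close>

definition att :: "(vec3 \<Rightarrow> real) \<Rightarrow> vec3 \<Rightarrow> vec3 \<Rightarrow> real \<Rightarrow> real" where
  "att s x \<theta> t = exp (- (LINT r:{0..t}|lborel. s (x - r *\<^sub>R \<theta>)))"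

text \<open>Coefficients extended to all of space. The constant \<open>q < 1\<close> bounds the ratio of scattering to
  total attenuation and is the contraction constant of the scattering operator.\<close>

locale coefficients = transport_domain +
  fixes s :: "vec3 \<Rightarrow> real" and kk :: "vec3 \<Rightarrow> vec3 \<Rightarrow> vec3 \<Rightarrow> real" and q Smax Kmax :: real
  assumes s_meas [measurable]: "s \<in> borel_measurable borel" and s_nonneg: "0 \<le> s x" and s_le: "s x \<le> Smax"
    and s_cont: "continuous_on X s"
    and kk_meas: "(\<lambda>z. kk (fst z) (fst (snd z)) (snd (snd z))) \<in> borel_measurable borel"
    and kk_nonneg: "0 \<le> kk x \<theta> \<theta>'" and kk_le: "kk x \<theta> \<theta>' \<le> Kmax"
    and q_nonneg: "0 \<le> q" and q_less: "q < 1"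
    and scatter_le: "x \<in> X \<Longrightarrow> \<theta> \<in> S2 \<Longrightarrow> (LINT \<theta>'|sphere_measure. kk x \<theta> \<theta>') \<le> q * s x"
begin

lemma Smax_nonneg: "0 \<le> Smax" using s_nonneg[of 0] s_le[of 0] by linarith
lemma Kmax_nonneg: "0 \<le> Kmax" using kk_nonneg[of 0 0 0] kk_le[of 0 0 0] by linarith
lemma s_abs: "\<bar>s x\<bar> \<le> Smax" using s_nonneg[of x] s_le[of x] by linarith

text \<open>The transport problem with source \<open>S\<close> and inflow \<open>f\<close> becomes \<open>u = E f + J (K u + S)\<close>: light enters and
  is attenuated along the whole chord behind the point (\<open>E\<close>), is scattered (\<open>K\<close>), and is collected with
  attenuation along the chord (\<open>J\<close>).\<close>

definition J :: "(vec3 \<times> vec3 \<Rightarrow> real) \<Rightarrow> vec3 \<times> vec3 \<Rightarrow> real" where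
  "J h z = (LINT t:{0..\<tau> (fst z) (snd z)}|lborel. att s (fst z) (snd z) t * h (fst z - t *\<^sub>R snd z, snd z))"

definition E :: "vec3 \<times> vec3 \<Rightarrow> real" where
  "E z = att s (fst z) (snd z) (\<tau> (fst z) (snd z))"

definition K :: "(vec3 \<times> vec3 \<Rightarrow> real) \<Rightarrow> vec3 \<times> vec3 \<Rightarrow> real" where
  "K u z = (LINT \<theta>'|sphere_measure. kk (fst z) (snd z) \<theta>' * u (fst z, \<theta>'))"

definition L :: "(vec3 \<times> vec3 \<Rightarrow> real) \<Rightarrow> vec3 \<times> vec3 \<Rightarrow> real" where
  "L u = J (K u)"

lemma s_line_int: "set_integrable lborel {a..b} (\<lambda>r. s (x - r *\<^sub>R \<theta>))"
  by (rule set_integrable_bounded[where M=Smax]) (auto simp: s_abs)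

lemma att_pos: "0 < att s x \<theta> t" by (simp add: att_def)

lemma att_le_1: "att s x \<theta> t \<le> 1"
proof -
  have "0 \<le> (LINT r:{0..t}|lborel. s (x - r *\<^sub>R \<theta>))"
    unfolding set_lebesgue_integral_def by (intro integral_nonneg_AE AE_I2) (auto simp: s_nonneg)
  then show ?thesis by (simp add: att_def)
qed

lemma att_ge: "0 \<le> t \<Longrightarrow> exp (- (Smax * t)) \<le> att s x \<theta> t"
  using set_integral_bound[of 0 t "\<lambda>r. s (x - r *\<^sub>R \<theta>)" Smax] by (auto simp: att_def s_abs Smax_nonneg)

lemma att_0 [simp]: "att s x \<theta> 0 = 1"
  using set_integral_bound[of 0 0 "\<lambda>r. s (x - r *\<^sub>R \<theta>)" Smax] by (auto simp: att_def s_abs Smax_nonneg)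

lemma att_add:
  assumes "0 \<le> t" "0 \<le> p"
  shows "att s x \<theta> (t + p) = att s x \<theta> t * att s (x - t *\<^sub>R \<theta>) \<theta> p"
proof -
  have "(LINT r:{0..t + p}|lborel. s (x - r *\<^sub>R \<theta>)) =
      (LINT r:{0..t}|lborel. s (x - r *\<^sub>R \<theta>)) + (LINT r:{0 + t..p + t}|lborel. s (x - r *\<^sub>R \<theta>))"
    using assms split_set_integral[OF s_line_int, of 0 t "t + p"] by (simp add: add.commute)
  also have "(LINT r:{0 + t..p + t}|lborel. s (x - r *\<^sub>R \<theta>)) = (LINT r:{0..p}|lborel. s (x - t *\<^sub>R \<theta> - r *\<^sub>R \<theta>))"
    by (subst shift_set_integral) (simp add: algebra_simps)
  finally show ?thesis by (simp add: att_def exp_add[symmetric])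
qed

lemma att_meas [measurable]:
  assumes [measurable]: "f \<in> borel_measurable N" "g \<in> borel_measurable N" "h \<in> borel_measurable N"
  shows "(\<lambda>z. att s (f z) (g z) (h z)) \<in> borel_measurable N"
  unfolding att_def by measurable

lemma tau_meas [measurable]:
  assumes [measurable]: "f \<in> borel_measurable N" "g \<in> borel_measurable N"
  shows "(\<lambda>z. \<tau> (f z) (g z)) \<in> borel_measurable N"
  using measurable_compose[OF borel_measurable_Pair[OF assms] measurable_back_time] by simp

lemma line_source_meas:
  fixes h :: "vec3 \<times> vec3 \<Rightarrow> real"
  assumes "h \<in> borel_measurable borel"
  shows "(\<lambda>t. h (x - t *\<^sub>R \<theta>, \<theta>)) \<in> borel_measurable borel"
proof -
  have "(\<lambda>t::real. (x - t *\<^sub>R \<theta>, \<theta>)) \<in> borel_measurable borel"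
    by (intro borel_measurable_continuous_onI continuous_intros)
  from measurable_compose[OF this assms] show ?thesis .
qed

lemma att_h_int:
  assumes "bounded_borel h"
  shows "set_integrable lborel {a..b} (\<lambda>t. att s x \<theta> t * h (x - t *\<^sub>R \<theta>, \<theta>))"
proof -
  obtain M where M: "0 \<le> M" "\<And>z. \<bar>h z\<bar> \<le> M" using assms bounded_borelE by blast
  note [measurable] = line_source_meas[OF bounded_borel_meas[OF assms]]
  show ?thesis
  proof (rule set_integrable_bounded[where M="1 * M"])
    show "\<bar>att s x \<theta> t * h (x - t *\<^sub>R \<theta>, \<theta>)\<bar> \<le> 1 * M" for t
      unfolding abs_mult using M att_pos[of x \<theta> t] att_le_1[of x \<theta> t] by (intro mult_mono) auto
  qed measurable
qed

lemma J_bound: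
  assumes "\<And>z. \<bar>h z\<bar> \<le> M"
  shows "\<bar>J h z\<bar> \<le> M * (2 * R)"
proof -
  have M: "0 \<le> M" using assms[of undefined] by linarith
  have "\<bar>J h z\<bar> \<le> M * (\<tau> (fst z) (snd z) - 0)"
    unfolding J_def
  proof (rule set_integral_bound)
    fix t
    have "\<bar>att s (fst z) (snd z) t\<bar> * \<bar>h (fst z - t *\<^sub>R snd z, snd z)\<bar> \<le> 1 * M"
      using assms M att_pos[of "fst z" "snd z" t] att_le_1[of "fst z" "snd z" t] by (intro mult_mono) auto
    then show "\<bar>att s (fst z) (snd z) t * h (fst z - t *\<^sub>R snd z, snd z)\<bar> \<le> M" by (simp add: abs_mult)
  qed (use M tau_nonneg in auto)
  also have "\<dots> \<le> M * (2 * R)" using M tau_le by (intro mult_left_mono) auto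
  finally show ?thesis .
qed

lemma J_meas:
  assumes [measurable]: "h \<in> borel_measurable borel"
  shows "J h \<in> borel_measurable borel"
proof -
  have "(\<lambda>w::(vec3 \<times> vec3) \<times> real. (fst (fst w) - snd w *\<^sub>R snd (fst w), snd (fst w))) \<in> borel \<Otimes>\<^sub>M borel \<rightarrow>\<^sub>M borel"
    unfolding borel_prod by (intro borel_measurable_continuous_onI continuous_intros)
  from measurable_compose[OF this assms]
  have [measurable]: "(\<lambda>(z, t). h (fst z - t *\<^sub>R snd z, snd z)) \<in> borel_measurable (borel \<Otimes>\<^sub>M borel)"
    by (simp add: split_beta)
  show ?thesis
    unfolding J_def by measurable
qed

lemma J_bounded_borel: "bounded_borel h \<Longrightarrow> bounded_borel (J h)"
  by (metis J_bound J_meas bounded_borelE bounded_borelI bounded_borel_meas)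

lemma J_add: "bounded_borel g \<Longrightarrow> bounded_borel h \<Longrightarrow> J (\<lambda>z. g z + h z) z = J g z + J h z"
  unfolding J_def distrib_left by (intro set_integral_add(2) att_h_int)

lemma J_diff: "bounded_borel g \<Longrightarrow> bounded_borel h \<Longrightarrow> J (\<lambda>z. g z - h z) z = J g z - J h z"
  unfolding J_def right_diff_distrib by (intro set_integral_diff(2) att_h_int)

lemma J_cmult: "J (\<lambda>z. c * h z) z = c * J h z"
  unfolding J_def by (simp add: mult.left_commute[of _ c])

lemma E_bounds: "0 < E z" "E z \<le> 1" "exp (- (Smax * (2 * R))) \<le> E z"
proof -
  show "0 < E z" "E z \<le> 1" by (simp_all add: E_def att_pos att_le_1)
  have "exp (- (Smax * (2 * R))) \<le> exp (- (Smax * \<tau> (fst z) (snd z)))"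
    using tau_le Smax_nonneg by (simp add: mult_left_mono)
  also have "\<dots> \<le> E z" unfolding E_def by (rule att_ge) (rule tau_nonneg)
  finally show "exp (- (Smax * (2 * R))) \<le> E z" .
qed

lemma E_bounded_borel: "bounded_borel E"
proof (rule bounded_borelI[where M=1])
  show "E \<in> borel_measurable borel" unfolding E_def by measurable
  show "\<bar>E z\<bar> \<le> 1" for z using E_bounds[of z] by simp
qed

text \<open>Because \<open>\<integral> exp (- \<integral> s) s \<le> 1\<close> along every chord, sources dominated by \<open>M s\<close> produce solutions
  bounded by \<open>M\<close>.\<close>

lemma J_weighted_bound:
  assumes h: "bounded_borel h" and M: "0 \<le> M"
    and ae: "AE t in lborel. 0 < t \<and> t < \<tau> (fst z) (snd z) \<longrightarrow>
      \<bar>h (fst z - t *\<^sub>R snd z, snd z)\<bar> \<le> M * s (fst z - t *\<^sub>R snd z)"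
  shows "\<bar>J h z\<bar> \<le> M"
proof (cases "snd z \<in> S2")
  case False
  then have "\<tau> (fst z) (snd z) = 0" by (simp add: back_time_def)
  moreover obtain N where "0 \<le> N" "\<And>z. \<bar>h z\<bar> \<le> N" using h bounded_borelE by blast
  ultimately have "\<bar>J h z\<bar> \<le> \<bar>att s (fst z) (snd z) 0 * h (fst z - 0 *\<^sub>R snd z, snd z)\<bar> * (0 - 0)"
    unfolding J_def by (intro order_trans[OF set_integral_bound]) auto
  then show ?thesis using M by simp
next
  case True
  obtain x \<theta> where z: "z = (x, \<theta>)" by force
  define T where "T = \<tau> x \<theta>"
  have T: "0 \<le> T" unfolding T_def by (rule tau_nonneg)
  interpret line_transport "\<lambda>t. s (x - t *\<^sub>R \<theta>)" "\<lambda>_. 0" T Smax 0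
  proof
    show "continuous_on {0<..<T} (\<lambda>t. s (x - t *\<^sub>R \<theta>))"
      by (rule continuous_on_compose2[OF s_cont]) (auto intro!: continuous_intros inside_chord simp: T_def)
  qed (auto simp: s_abs T)
  have att: "att s x \<theta> t = exp (- Lam t)" for t by (simp add: att_def Lam_def)
  have "\<bar>J h z\<bar> \<le> (LINT t:{0..T}|lborel. \<bar>att s x \<theta> t * h (x - t *\<^sub>R \<theta>, \<theta>)\<bar>)"
    using set_integral_norm_bound[OF att_h_int[OF h, of 0 T x \<theta>]] by (simp add: J_def z T_def)
  also have "\<dots> \<le> (LINT t:{0..T}|lborel. M * (s (x - t *\<^sub>R \<theta>) * exp (- Lam t)))"
  proof (rule set_integral_mono_AE)
    show "set_integrable lborel {0..T} (\<lambda>t. \<bar>att s x \<theta> t * h (x - t *\<^sub>R \<theta>, \<theta>)\<bar>)"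
      by (intro set_integrable_abs att_h_int h)
    have "set_integrable lborel {0..T} (\<lambda>t. s (x - t *\<^sub>R \<theta>) * exp (- Lam t))"
    proof (rule set_integrable_bounded[where M="Smax * 1"])
      fix t
      show "\<bar>s (x - t *\<^sub>R \<theta>) * exp (- Lam t)\<bar> \<le> Smax * 1"
        unfolding abs_mult att[symmetric] using att_pos[of x \<theta> t] att_le_1[of x \<theta> t] s_abs Smax_nonneg
        by (intro mult_mono) auto
    qed measurable
    then show "set_integrable lborel {0..T} (\<lambda>t. M * (s (x - t *\<^sub>R \<theta>) * exp (- Lam t)))" by simp
    have "AE t in lborel. t \<noteq> (0::real)" "AE t in lborel. t \<noteq> T" by (auto intro: AE_lborel_singleton)
    moreover note ae
    ultimately show "AE t\<in>{0..T} in lborel. \<bar>att s x \<theta> t * h (x - t *\<^sub>R \<theta>, \<theta>)\<bar> \<le> M * (s (x - t *\<^sub>R \<theta>) * exp (- Lam t))"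
    proof eventually_elim
      case (elim t)
      show ?case
      proof
        assume "t \<in> {0..T}"
        then have "\<bar>h (x - t *\<^sub>R \<theta>, \<theta>)\<bar> \<le> M * s (x - t *\<^sub>R \<theta>)"
          using elim by (simp add: z T_def)
        from mult_left_mono[OF this, of "att s x \<theta> t"]
        show "\<bar>att s x \<theta> t * h (x - t *\<^sub>R \<theta>, \<theta>)\<bar> \<le> M * (s (x - t *\<^sub>R \<theta>) * exp (- Lam t))"
          using att_pos[of x \<theta> t] by (simp add: abs_mult att mult_ac)
      qed
    qed
  qed
  also have "\<dots> = M * (1 - exp (- Lam T))"
    using integral_exp_Lam[of 0 T] T by simp
  also have "\<dots> \<le> M * 1" using M by (intro mult_left_mono) auto
  finally show ?thesis by simp
qed

lemma kk_section [measurable]: "(\<lambda>\<theta>'. kk x \<theta> \<theta>') \<in> borel_measurable sphere_measure"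
proof -
  have "(\<lambda>\<theta>'. (x, \<theta>, \<theta>')) \<in> sphere_measure \<rightarrow>\<^sub>M borel"
    by (intro borel_measurable_Pair) auto
  from measurable_compose[OF this kk_meas] show ?thesis by simp
qed

lemma section_meas:
  fixes u :: "vec3 \<times> vec3 \<Rightarrow> real"
  assumes "u \<in> borel_measurable borel"
  shows "(\<lambda>\<theta>'. u (x, \<theta>')) \<in> borel_measurable sphere_measure"
proof -
  have "(\<lambda>\<theta>'. (x, \<theta>')) \<in> sphere_measure \<rightarrow>\<^sub>M borel"
    by (rule borel_measurable_Pair[of "\<lambda>_. x" _ "\<lambda>\<theta>'. \<theta>'"]) auto
  from measurable_compose[OF this assms] show ?thesis by simp
qed

lemma kk_u_int:
  assumes "bounded_borel u"
  shows "integrable sphere_measure (\<lambda>\<theta>'. kk x \<theta> \<theta>' * u (x, \<theta>'))"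
proof -
  obtain M where M: "0 \<le> M" "\<And>z. \<bar>u z\<bar> \<le> M" using assms bounded_borelE by blast
  note [measurable] = section_meas[OF bounded_borel_meas[OF assms]]
  show ?thesis
  proof (rule sphere.integrable_const_bound[where B="Kmax * M"])
    show "AE \<theta>' in sphere_measure. norm (kk x \<theta> \<theta>' * u (x, \<theta>')) \<le> Kmax * M"
      using M kk_nonneg kk_le Kmax_nonneg by (intro AE_I2) (auto simp: abs_mult intro!: mult_mono)
  qed measurable
qed

lemma kk_int: "integrable sphere_measure (\<lambda>\<theta>'. kk x \<theta> \<theta>')"
  using kk_u_int[OF bounded_borel_const[of 1], of x \<theta>] by simp

lemma K_bound:
  assumes u: "bounded_borel u" and M: "AE \<theta>' in sphere_measure. \<bar>u (x, \<theta>')\<bar> \<le> M"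
  shows "\<bar>K u (x, \<theta>)\<bar> \<le> M * (LINT \<theta>'|sphere_measure. kk x \<theta> \<theta>')"
proof -
  have "\<bar>K u (x, \<theta>)\<bar> \<le> (LINT \<theta>'|sphere_measure. norm (kk x \<theta> \<theta>' * u (x, \<theta>')))"
    unfolding K_def fst_conv snd_conv real_norm_def[symmetric] by (rule integral_norm_bound)
  also have "\<dots> \<le> (LINT \<theta>'|sphere_measure. M * kk x \<theta> \<theta>')"
  proof (intro integral_mono_AE integrable_norm kk_u_int u integrable_mult_right kk_int)
    show "AE \<theta>' in sphere_measure. norm (kk x \<theta> \<theta>' * u (x, \<theta>')) \<le> M * kk x \<theta> \<theta>'"
      using M by eventually_elim (simp add: abs_mult kk_nonneg mult.commute[of M] mult_left_mono)
  qed
  finally show ?thesis by simp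
qed

lemma kk_integral_le: "(LINT \<theta>'|sphere_measure. kk x \<theta> \<theta>') \<le> 24 * Kmax"
proof -
  have "(LINT \<theta>'|sphere_measure. kk x \<theta> \<theta>') \<le> (LINT \<theta>'|sphere_measure. Kmax)"
    by (intro integral_mono kk_int) (auto simp: kk_le)
  also have "\<dots> = measure sphere_measure S2 * Kmax" by simp
  also have "\<dots> \<le> 24 * Kmax" by (intro mult_right_mono measure_sphere_le Kmax_nonneg)
  finally show ?thesis .
qed

lemma K_bound_global:
  assumes u: "bounded_borel u" and M: "\<And>z. \<bar>u z\<bar> \<le> M"
  shows "\<bar>K u z\<bar> \<le> M * (24 * Kmax)"
proof -
  have "0 \<le> M" using M[of undefined] by linarith
  then have "M * (LINT \<theta>'|sphere_measure. kk (fst z) (snd z) \<theta>') \<le> M * (24 * Kmax)"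
    by (intro mult_left_mono kk_integral_le)
  then show ?thesis
    using K_bound[OF u, of "fst z" M "snd z"] M by (auto intro: order_trans)
qed

lemma K_meas:
  assumes u: "u \<in> borel_measurable borel"
  shows "K u \<in> borel_measurable borel"
proof -
  have m3: "snd \<in> borel_measurable ((borel :: (vec3 \<times> vec3) measure) \<Otimes>\<^sub>M sphere_measure)"
    using measurable_compose[OF measurable_snd id_sphere_measurable] by simp
  have m: "(\<lambda>w. fst (fst w)) \<in> borel_measurable ((borel :: (vec3 \<times> vec3) measure) \<Otimes>\<^sub>M sphere_measure)"
    "(\<lambda>w. snd (fst w)) \<in> borel_measurable ((borel :: (vec3 \<times> vec3) measure) \<Otimes>\<^sub>M sphere_measure)"
    using measurable_compose[OF measurable_fst fst_borel] measurable_compose[OF measurable_fst snd_borel] by simp_all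
  have 1: "(\<lambda>w. (fst (fst w), snd (fst w), snd w)) \<in> borel \<Otimes>\<^sub>M sphere_measure \<rightarrow>\<^sub>M (borel :: (vec3 \<times> vec3 \<times> vec3) measure)"
    by (rule borel_measurable_Pair[OF m(1) borel_measurable_Pair[OF m(2) m3]])
  have 2: "(\<lambda>w::(vec3 \<times> vec3) \<times> vec3. (fst (fst w), snd w)) \<in> borel \<Otimes>\<^sub>M sphere_measure \<rightarrow>\<^sub>M (borel :: (vec3 \<times> vec3) measure)"
    by (rule borel_measurable_Pair[OF m(1) m3])
  have "(\<lambda>(z, \<theta>'). kk (fst z) (snd z) \<theta>' * u (fst z, \<theta>')) \<in> borel_measurable (borel \<Otimes>\<^sub>M sphere_measure)"
    using borel_measurable_times[OF measurable_compose[OF 1 kk_meas] measurable_compose[OF 2 u]]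
    by (simp add: split_beta)
  then show ?thesis
    unfolding K_def by (rule sphere.borel_measurable_lebesgue_integral)
qed

lemma K_bounded_borel: "bounded_borel u \<Longrightarrow> bounded_borel (K u)"
  by (metis K_bound_global K_meas bounded_borelE bounded_borelI bounded_borel_meas)

lemma K_add: "bounded_borel u \<Longrightarrow> bounded_borel v \<Longrightarrow> K (\<lambda>z. u z + v z) z = K u z + K v z"
  unfolding K_def distrib_left by (intro Bochner_Integration.integral_add kk_u_int)

lemma K_diff: "bounded_borel u \<Longrightarrow> bounded_borel v \<Longrightarrow> K (\<lambda>z. u z - v z) z = K u z - K v z"
  unfolding K_def right_diff_distrib by (intro Bochner_Integration.integral_diff kk_u_int)

lemma K_cmult: "K (\<lambda>z. c * u z) z = c * K u z"
  unfolding K_def by (simp add: mult.left_commute[of _ c])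

lemma L_bounded_borel: "bounded_borel u \<Longrightarrow> bounded_borel (L u)"
  unfolding L_def by (intro J_bounded_borel K_bounded_borel)

lemma L_add:
  assumes "bounded_borel u" "bounded_borel v"
  shows "L (\<lambda>z. u z + v z) z = L u z + L v z"
proof -
  have "K (\<lambda>z. u z + v z) = (\<lambda>z. K u z + K v z)" using assms by (auto simp: K_add)
  then show ?thesis unfolding L_def using assms by (simp add: J_add K_bounded_borel)
qed

lemma L_diff:
  assumes "bounded_borel u" "bounded_borel v"
  shows "L (\<lambda>z. u z - v z) z = L u z - L v z"
proof -
  have "K (\<lambda>z. u z - v z) = (\<lambda>z. K u z - K v z)" using assms by (auto simp: K_diff)
  then show ?thesis unfolding L_def using assms by (simp add: J_diff K_bounded_borel)
qed

lemma L_cmult: "L (\<lambda>z. c * u z) z = c * L u z"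
proof -
  have "K (\<lambda>z. c * u z) = (\<lambda>z. c * K u z)" by (auto simp: K_cmult)
  then show ?thesis unfolding L_def by (simp add: J_cmult)
qed

text \<open>The scattered source \<open>K u\<close> is at most \<open>q M s\<close>, so \<open>J_weighted_bound\<close> applies. Comparing with \<open>s\<close>
  yields the factor \<open>q\<close> whatever the lengths of the chords.\<close>

lemma L_contract_AE:
  assumes u: "bounded_borel u" and M: "0 \<le> M"
    and ae: "AE t in lborel. 0 < t \<and> t < \<tau> x \<theta> \<longrightarrow>
      (AE \<theta>' in sphere_measure. \<bar>u (x - t *\<^sub>R \<theta>, \<theta>')\<bar> \<le> M)"
  shows "\<bar>L u (x, \<theta>)\<bar> \<le> q * M"
  unfolding L_def
proof (rule J_weighted_bound[OF K_bounded_borel[OF u]])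
  show "0 \<le> q * M" using q_nonneg M by simp
  show "AE t in lborel. 0 < t \<and> t < \<tau> (fst (x, \<theta>)) (snd (x, \<theta>)) \<longrightarrow>
      \<bar>K u (fst (x, \<theta>) - t *\<^sub>R snd (x, \<theta>), snd (x, \<theta>))\<bar> \<le> q * M * s (fst (x, \<theta>) - t *\<^sub>R snd (x, \<theta>))"
    using ae unfolding fst_conv snd_conv
  proof (rule AE_space_mono, intro impI)
    fix t assume t: "0 < t \<and> t < \<tau> x \<theta>" and
      "0 < t \<and> t < \<tau> x \<theta> \<longrightarrow> (AE \<theta>' in sphere_measure. \<bar>u (x - t *\<^sub>R \<theta>, \<theta>')\<bar> \<le> M)"
    then have ae': "AE \<theta>' in sphere_measure. \<bar>u (x - t *\<^sub>R \<theta>, \<theta>')\<bar> \<le> M" by blast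
    have \<theta>: "\<theta> \<in> S2" using t by (auto simp: back_time_def split: if_splits)
    have "\<bar>K u (x - t *\<^sub>R \<theta>, \<theta>)\<bar> \<le> M * (LINT \<theta>'|sphere_measure. kk (x - t *\<^sub>R \<theta>) \<theta> \<theta>')"
      by (rule K_bound[OF u ae'])
    also have "\<dots> \<le> M * (q * s (x - t *\<^sub>R \<theta>))"
      using M t \<theta> by (intro mult_left_mono scatter_le inside_chord) auto
    finally show "\<bar>K u (x - t *\<^sub>R \<theta>, \<theta>)\<bar> \<le> q * M * s (x - t *\<^sub>R \<theta>)" by (simp add: mult_ac)
  qed
qed

lemma L_contract:
  assumes u: "bounded_borel u" and M: "\<And>z. \<bar>u z\<bar> \<le> M"
  shows "\<bar>L u z\<bar> \<le> q * M"
  using L_contract_AE[OF u, of M "fst z" "snd z"] M order_trans[OF abs_ge_zero M] by auto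

text \<open>The Neumann series \<open>(1 - L)\<^sup>-\<^sup>1 g\<close>, one term per number of scattering events.\<close>

definition res :: "(vec3 \<times> vec3 \<Rightarrow> real) \<Rightarrow> vec3 \<times> vec3 \<Rightarrow> real" where
  "res g z = (\<Sum>n. (L ^^ n) g z)"

context
  fixes g G assumes g: "bounded_borel g" and G: "\<And>z. \<bar>g z\<bar> \<le> G"
begin

lemma L_power_bounded_borel: "bounded_borel ((L ^^ n) g)"
  by (induction n) (simp_all add: g L_bounded_borel)

lemma L_power_bound: "\<bar>(L ^^ n) g z\<bar> \<le> q ^ n * G"
proof (induction n arbitrary: z)
  case (Suc n)
  then show ?case using L_contract[OF L_power_bounded_borel, of n "q ^ n * G" z] by (simp add: mult.assoc)
qed (simp add: G)

lemma res_summable: "summable (\<lambda>n. (L ^^ n) g z)"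
  by (rule summable_comparison_test'[where g="\<lambda>n. q ^ n * G"])
    (use L_power_bound q_nonneg q_less in \<open>auto intro!: summable_mult2 summable_geometric\<close>)

lemma geometric_tail: "(\<lambda>n. q ^ (n + N) * G) sums (q ^ N * G / (1 - q))"
proof -
  have "(\<lambda>n. q ^ n) sums (1 / (1 - q))" using q_nonneg q_less by (intro geometric_sums) simp
  from sums_mult[OF this, of "q ^ N * G"] show ?thesis by (simp add: power_add mult_ac)
qed

lemma res_tail: "\<bar>res g z - (\<Sum>n<N. (L ^^ n) g z)\<bar> \<le> q ^ N * G / (1 - q)"
proof -
  have "res g z - (\<Sum>n<N. (L ^^ n) g z) = (\<Sum>n. (L ^^ (n + N)) g z)"
    unfolding res_def using suminf_minus_initial_segment[OF res_summable] by simp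
  also have "norm \<dots> \<le> (\<Sum>n. q ^ (n + N) * G)"
  proof (rule norm_suminf_le)
    show "norm ((L ^^ (n + N)) g z) \<le> q ^ (n + N) * G" for n using L_power_bound[of "n + N"] by simp
    show "summable (\<lambda>n. q ^ (n + N) * G)" using geometric_tail by (rule sums_summable)
  qed
  also have "\<dots> = q ^ N * G / (1 - q)" using geometric_tail by (rule sums_unique[symmetric])
  finally show ?thesis by simp
qed

lemma res_bound: "\<bar>res g z\<bar> \<le> G / (1 - q)"
  using res_tail[of z 0] by simp

lemma res_bounded_borel: "bounded_borel (res g)"
proof (rule bounded_borelI[OF _ res_bound])
  have [measurable]: "(L ^^ n) g \<in> borel_measurable borel" for n
    by (rule bounded_borel_meas[OF L_power_bounded_borel])
  show "res g \<in> borel_measurable borel" unfolding res_def by measurable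
qed

lemma res_eq: "res g z = g z + L (res g) z"
proof -
  define S where "S N z = (\<Sum>n<N. (L ^^ n) g z)" for N z
  have S_bb: "bounded_borel (S N)" for N
    unfolding S_def by (intro bounded_borel_sum L_power_bounded_borel)
  have S_L: "S (Suc N) z = g z + L (S N) z" for N z
  proof (induction N arbitrary: z)
    case 0
    have "L (\<lambda>z. 0 * g z) z = 0 * L g z" by (rule L_cmult)
    then show ?case by (simp add: S_def)
  next
    case (Suc N)
    have "S (Suc N) = (\<lambda>z. S N z + (L ^^ N) g z)" by (auto simp: S_def)
    then have "L (S (Suc N)) z = L (S N) z + L ((L ^^ N) g) z"
      using L_add[OF S_bb L_power_bounded_borel, of N N z] by simp
    moreover have "S (Suc (Suc N)) z = S (Suc N) z + L ((L ^^ N) g) z" by (simp add: S_def)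
    ultimately show ?case using Suc[of z] by simp
  qed
  have lim0: "(\<lambda>N. q ^ N * G / (1 - q)) \<longlonglongrightarrow> 0"
  proof -
    have "(\<lambda>N. q ^ N * (G / (1 - q))) \<longlonglongrightarrow> 0 * (G / (1 - q))"
      by (intro tendsto_mult tendsto_const LIMSEQ_realpow_zero q_nonneg q_less)
    then show ?thesis by simp
  qed
  have l1: "(\<lambda>N. S N z) \<longlonglongrightarrow> res g z" for z
    unfolding S_def res_def by (intro summable_LIMSEQ res_summable)
  have "\<bar>L (S N) z - L (res g) z\<bar> \<le> q ^ N * G / (1 - q)" for N
  proof -
    have "L (S N) z - L (res g) z = L (\<lambda>z. S N z - res g z) z"
      by (rule L_diff[symmetric]) (intro S_bb res_bounded_borel)+
    also have "\<bar>\<dots>\<bar> \<le> q * (q ^ N * G / (1 - q))"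
      using res_tail by (intro L_contract bounded_borel_diff S_bb res_bounded_borel) (simp add: S_def abs_minus_commute)
    also have "\<dots> \<le> 1 * (q ^ N * G / (1 - q))"
      using q_less order_trans[OF abs_ge_zero res_tail] by (intro mult_right_mono) auto
    finally show ?thesis by simp
  qed
  then have "(\<lambda>N. L (S N) z - L (res g) z) \<longlonglongrightarrow> 0"
    by (intro Lim_null_comparison[OF _ lim0]) auto
  then have "(\<lambda>N. g z + L (S N) z) \<longlonglongrightarrow> g z + L (res g) z"
    by (intro tendsto_add tendsto_const) (simp add: LIM_zero_iff)
  moreover have "(\<lambda>N. g z + L (S N) z) \<longlonglongrightarrow> res g z"
    using LIMSEQ_Suc[OF l1[of z]] by (simp add: S_L)
  ultimately show ?thesis by (rule LIMSEQ_unique[rotated])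
qed

end

lemma res_unique:
  assumes u: "bounded_borel u" and g: "bounded_borel g" and eq: "\<And>z. u z = g z + L u z"
  shows "u = res g"
proof
  fix z
  obtain G where G: "\<And>z. \<bar>g z\<bar> \<le> G" using g bounded_borelE by blast
  note r = res_bounded_borel[OF g G] res_eq[OF g G]
  define d where "d = (\<lambda>z. u z - res g z)"
  have d: "bounded_borel d" unfolding d_def by (intro bounded_borel_diff u r)
  obtain M where M: "\<And>z. \<bar>d z\<bar> \<le> M" using d bounded_borelE by blast
  have Ld: "d z = L d z" for z
    using eq[of z] r(2)[of z] L_diff[OF u r(1), of z] by (simp add: d_def)
  have "\<bar>d z\<bar> \<le> q ^ n * M" for n z
  proof (induction n arbitrary: z)
    case (Suc n)
    then show ?case using L_contract[OF d, of "q ^ n * M" z] Ld[of z] by (simp add: mult.assoc)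
  qed (use M in auto)
  moreover have "(\<lambda>n. q ^ n * M) \<longlonglongrightarrow> 0 * M"
    by (intro tendsto_mult tendsto_const LIMSEQ_realpow_zero q_nonneg q_less)
  ultimately have "\<bar>d z\<bar> \<le> 0" by (intro LIMSEQ_le_const[of "\<lambda>n. q ^ n * M"]) auto
  then show "u z = res g z" by (simp add: d_def)
qed

text \<open>The solution with source \<open>S\<close> and inflow value \<open>f\<close>. An inflow value is given
  as a function on all of phase space that is constant along lines.\<close>

definition sol :: "(vec3 \<times> vec3 \<Rightarrow> real) \<Rightarrow> (vec3 \<times> vec3 \<Rightarrow> real) \<Rightarrow> vec3 \<times> vec3 \<Rightarrow> real" where
  "sol S f = res (\<lambda>z. E z * f z + J S z)"

lemma base_bounded_borel: "bounded_borel S \<Longrightarrow> bounded_borel f \<Longrightarrow> bounded_borel (\<lambda>z. E z * f z + J S z)"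
  by (intro bounded_borel_add bounded_borel_mult E_bounded_borel J_bounded_borel)

lemma sol_bounded_borel:
  assumes "bounded_borel S" "bounded_borel f"
  shows "bounded_borel (sol S f)"
proof -
  obtain G where "\<And>z. \<bar>E z * f z + J S z\<bar> \<le> G" using base_bounded_borel[OF assms] bounded_borelE by blast
  from res_bounded_borel[OF base_bounded_borel[OF assms] this] show ?thesis by (simp add: sol_def)
qed

lemma sol_eq_L:
  assumes "bounded_borel S" "bounded_borel f"
  shows "sol S f z = E z * f z + J S z + L (sol S f) z"
proof -
  obtain G where "\<And>z. \<bar>E z * f z + J S z\<bar> \<le> G" using base_bounded_borel[OF assms] bounded_borelE by blast
  from res_eq[OF base_bounded_borel[OF assms] this] show ?thesis by (simp add: sol_def)
qed

lemma sol_eq: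
  assumes "bounded_borel S" "bounded_borel f"
  shows "sol S f z = E z * f z + J (\<lambda>z. K (sol S f) z + S z) z"
  using sol_eq_L[OF assms, of z] assms
  by (simp add: J_add K_bounded_borel sol_bounded_borel L_def)

lemma sol_add_source:
  assumes "bounded_borel S" "bounded_borel S'"
  shows "sol (\<lambda>z. S z + S' z) (\<lambda>_. 0) z = sol S (\<lambda>_. 0) z + sol S' (\<lambda>_. 0) z"
proof -
  note bb = sol_bounded_borel[OF assms(1) bounded_borel_const[of 0]] sol_bounded_borel[OF assms(2) bounded_borel_const[of 0]]
  have "(\<lambda>z. sol S (\<lambda>_. 0) z + sol S' (\<lambda>_. 0) z) = sol (\<lambda>z. S z + S' z) (\<lambda>_. 0)"
    unfolding sol_def[of "\<lambda>z. S z + S' z"]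
  proof (rule res_unique)
    fix z
    show "sol S (\<lambda>_. 0) z + sol S' (\<lambda>_. 0) z = E z * 0 + J (\<lambda>z. S z + S' z) z +
        L (\<lambda>z. sol S (\<lambda>_. 0) z + sol S' (\<lambda>_. 0) z) z"
      using sol_eq_L[OF assms(1) bounded_borel_const[of 0], of z]
        sol_eq_L[OF assms(2) bounded_borel_const[of 0], of z]
      by (simp add: L_add bb J_add assms)
  qed (intro base_bounded_borel bounded_borel_add bounded_borel_const assms bb)+
  then show ?thesis by metis
qed

lemma sol_cmult_source:
  assumes "bounded_borel S"
  shows "sol (\<lambda>z. c * S z) (\<lambda>_. 0) z = c * sol S (\<lambda>_. 0) z"
proof -
  note bb = sol_bounded_borel[OF assms(1) bounded_borel_const[of 0]]
  have "(\<lambda>z. c * sol S (\<lambda>_. 0) z) = sol (\<lambda>z. c * S z) (\<lambda>_. 0)"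
    unfolding sol_def[of "\<lambda>z. c * S z"]
  proof (rule res_unique)
    fix z
    show "c * sol S (\<lambda>_. 0) z = E z * 0 + J (\<lambda>z. c * S z) z + L (\<lambda>z. c * sol S (\<lambda>_. 0) z) z"
      using sol_eq_L[OF assms(1) bounded_borel_const[of 0], of z]
      by (simp add: L_cmult J_cmult distrib_left)
  qed (intro base_bounded_borel bounded_borel_cmult bounded_borel_const assms bb)+
  then show ?thesis by metis
qed

lemma sol_bound_source:
  assumes "bounded_borel S" "\<And>z. \<bar>S z\<bar> \<le> M"
  shows "\<bar>sol S (\<lambda>_. 0) z\<bar> \<le> M * (2 * R) / (1 - q)"
  unfolding sol_def
  by (rule res_bound[OF base_bounded_borel[OF assms(1) bounded_borel_const]]) (simp add: J_bound[OF assms(2)])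

end

section \<open>The Neumann series solves the transport equation\<close>

definition line_inv :: "(vec3 \<times> vec3 \<Rightarrow> real) \<Rightarrow> bool" where
  "line_inv f \<longleftrightarrow> (\<forall>x \<theta> t. f (x + t *\<^sub>R \<theta>, \<theta>) = f (x, \<theta>))"

lemma line_invD: "line_inv f \<Longrightarrow> f (x + t *\<^sub>R \<theta>, \<theta>) = f (x, \<theta>)"
  by (simp add: line_inv_def)

lemma line_inv_zero: "line_inv (\<lambda>_. 0)" by (simp add: line_inv_def)

context coefficients
begin

lemma line_transport_on_segment:
  assumes h: "bounded_borel h" and T: "0 \<le> T" and seg: "\<And>r. 0 \<le> r \<Longrightarrow> r < T \<Longrightarrow> x + r *\<^sub>R \<theta> \<in> X"
  obtains B where "line_transport (\<lambda>r. s (x + r *\<^sub>R \<theta>)) (\<lambda>r. h (x + r *\<^sub>R \<theta>, \<theta>)) T Smax B"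
proof -
  obtain B where B: "\<And>z. \<bar>h z\<bar> \<le> B" using h bounded_borelE by blast
  have "(\<lambda>r. h (x + r *\<^sub>R \<theta>, \<theta>)) \<in> borel_measurable borel"
    using measurable_compose[OF _ line_source_meas[OF bounded_borel_meas[OF h], of x \<theta>], of "\<lambda>r. - r" borel] by simp
  then have "line_transport (\<lambda>r. s (x + r *\<^sub>R \<theta>)) (\<lambda>r. h (x + r *\<^sub>R \<theta>, \<theta>)) T Smax B"
  proof unfold_locales
    show "continuous_on {0<..<T} (\<lambda>r. s (x + r *\<^sub>R \<theta>))"
      by (rule continuous_on_compose2[OF s_cont]) (auto intro!: continuous_intros seg)
  qed (use s_abs B T in auto)
  then show ?thesis by (rule that)
qed

text \<open>The chord behind \<open>x + t \<theta>\<close> is split at \<open>x\<close>.\<close>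

lemma ballistic_flow:
  assumes h: "bounded_borel h" and f: "line_inv f" and \<theta>: "\<theta> \<in> S2" and t: "0 \<le> t" and x: "x \<in> X"
    and seg: "\<And>r. 0 \<le> r \<Longrightarrow> r < t \<Longrightarrow> x + r *\<^sub>R \<theta> \<in> X"
    and u: "\<And>z. u z = E z * f z + J h z"
  shows "u (x + t *\<^sub>R \<theta>, \<theta>) =
    att s (x + t *\<^sub>R \<theta>) \<theta> t * u (x, \<theta>) + (LINT p:{0..t}|lborel. att s (x + t *\<^sub>R \<theta>) \<theta> p * h (x + t *\<^sub>R \<theta> - p *\<^sub>R \<theta>, \<theta>))"
proof -
  define z where "z = x + t *\<^sub>R \<theta>"
  have zx: "z - t *\<^sub>R \<theta> = x" by (simp add: z_def)
  have \<tau>: "\<tau> z \<theta> = t + \<tau> x \<theta>" unfolding z_def by (rule tau_shift[OF \<theta> t x seg])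
  have E: "E (z, \<theta>) = att s z \<theta> t * E (x, \<theta>)"
    using att_add[OF t tau_nonneg, of z \<theta> x \<theta>] by (simp add: E_def \<tau> zx)
  have "J h (z, \<theta>) = (LINT p:{0..t}|lborel. att s z \<theta> p * h (z - p *\<^sub>R \<theta>, \<theta>)) +
      (LINT p:{t..t + \<tau> x \<theta>}|lborel. att s z \<theta> p * h (z - p *\<^sub>R \<theta>, \<theta>))"
    unfolding J_def fst_conv snd_conv \<tau> using t tau_nonneg[of x \<theta>]
    by (intro split_set_integral att_h_int h) auto
  also have "(LINT p:{t..t + \<tau> x \<theta>}|lborel. att s z \<theta> p * h (z - p *\<^sub>R \<theta>, \<theta>)) =
      (LINT p:{0 + t..\<tau> x \<theta> + t}|lborel. att s z \<theta> p * h (z - p *\<^sub>R \<theta>, \<theta>))"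
    by (simp add: add.commute)
  also have "\<dots> = (LINT p:{0..\<tau> x \<theta>}|lborel. att s z \<theta> t * (att s x \<theta> p * h (x - p *\<^sub>R \<theta>, \<theta>)))"
    unfolding shift_set_integral
  proof (rule set_lebesgue_integral_cong)
    show "\<forall>p. p \<in> {0..\<tau> x \<theta>} \<longrightarrow> att s z \<theta> (p + t) * h (z - (p + t) *\<^sub>R \<theta>, \<theta>) =
        att s z \<theta> t * (att s x \<theta> p * h (x - p *\<^sub>R \<theta>, \<theta>))"
    proof (intro allI impI)
      fix p assume "p \<in> {0..\<tau> x \<theta>}"
      then have "att s z \<theta> (p + t) = att s z \<theta> t * att s x \<theta> p"
        using att_add[OF t, of p z \<theta>] by (simp add: zx add.commute)
      moreover have "z - (p + t) *\<^sub>R \<theta> = x - p *\<^sub>R \<theta>" by (simp add: z_def algebra_simps)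
      ultimately show "att s z \<theta> (p + t) * h (z - (p + t) *\<^sub>R \<theta>, \<theta>) =
        att s z \<theta> t * (att s x \<theta> p * h (x - p *\<^sub>R \<theta>, \<theta>))" by simp
    qed
  qed auto
  also have "\<dots> = att s z \<theta> t * J h (x, \<theta>)" by (simp add: J_def)
  finally show ?thesis
    unfolding z_def[symmetric] using E line_invD[OF f, of x t \<theta>]
    by (simp add: u z_def[symmetric] algebra_simps)
qed

text \<open>The backward representation along a segment is the variation-of-constants formula.\<close>

lemma backward_eq_W:
  assumes lt: "line_transport (\<lambda>r. s (x + r *\<^sub>R \<theta>)) (\<lambda>r. h (x + r *\<^sub>R \<theta>, \<theta>)) T Smax B"
    and t: "t \<in> {0..T}"
  shows "line_transport.W (\<lambda>r. s (x + r *\<^sub>R \<theta>)) (\<lambda>r. h (x + r *\<^sub>R \<theta>, \<theta>)) c t =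
    att s (x + t *\<^sub>R \<theta>) \<theta> t * c + (LINT p:{0..t}|lborel. att s (x + t *\<^sub>R \<theta>) \<theta> p * h (x + t *\<^sub>R \<theta> - p *\<^sub>R \<theta>, \<theta>))"
proof -
  interpret line_transport "\<lambda>r. s (x + r *\<^sub>R \<theta>)" "\<lambda>r. h (x + r *\<^sub>R \<theta>, \<theta>)" T Smax B by fact
  have shift: "x + t *\<^sub>R \<theta> - p *\<^sub>R \<theta> = x + (t - p) *\<^sub>R \<theta>" for p by (simp add: algebra_simps)
  have att: "att s (x + t *\<^sub>R \<theta>) \<theta> p = exp (- Lam t) * exp (Lam (t - p))" if p: "p \<in> {0..t}" for p
  proof -
    have "(LINT r:{0..p}|lborel. s (x + (t - r) *\<^sub>R \<theta>)) = (LINT r:{t - p..t - 0}|lborel. s (x + r *\<^sub>R \<theta>))"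
      by (rule reflect_set_integral)
    also have "\<dots> = Lam t - Lam (t - p)"
      using p t split_set_integral[OF set_integrable_subset[OF s_int, of "{0..t}"], of "t - p"]
      by (simp add: Lam_def)
    finally show ?thesis by (simp add: att_def shift exp_add[symmetric])
  qed
  have "att s (x + t *\<^sub>R \<theta>) \<theta> t = exp (- Lam t)" using att[of t] t by simp
  moreover have "(LINT p:{0..t}|lborel. att s (x + t *\<^sub>R \<theta>) \<theta> p * h (x + t *\<^sub>R \<theta> - p *\<^sub>R \<theta>, \<theta>)) =
      (LINT p:{0..t}|lborel. exp (- Lam t) * (\<lambda>r. exp (Lam r) * h (x + r *\<^sub>R \<theta>, \<theta>)) (t - p))"
    by (intro set_lebesgue_integral_cong) (auto simp: att shift)
  moreover have "\<dots> = exp (- Lam t) * (LINT r:{t - t..t - 0}|lborel. exp (Lam r) * h (x + r *\<^sub>R \<theta>, \<theta>))"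
    unfolding set_integral_mult_right by (subst reflect_set_integral) simp
  ultimately show ?thesis by (simp add: W_def algebra_simps)
qed

lemma ballistic_flow_W:
  assumes h: "bounded_borel h" and f: "line_inv f" and \<theta>: "\<theta> \<in> S2" and x: "x \<in> X"
    and seg: "\<And>r. 0 \<le> r \<Longrightarrow> r < T \<Longrightarrow> x + r *\<^sub>R \<theta> \<in> X"
    and u: "\<And>z. u z = E z * f z + J h z" and t: "t \<in> {0..T}"
    and lt: "line_transport (\<lambda>r. s (x + r *\<^sub>R \<theta>)) (\<lambda>r. h (x + r *\<^sub>R \<theta>, \<theta>)) T Smax B"
  shows "u (x + t *\<^sub>R \<theta>, \<theta>) = line_transport.W (\<lambda>r. s (x + r *\<^sub>R \<theta>)) (\<lambda>r. h (x + r *\<^sub>R \<theta>, \<theta>)) (u (x, \<theta>)) t"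
  unfolding backward_eq_W[OF lt t]
  by (rule ballistic_flow[OF h f \<theta> _ x _ u]) (use t seg in auto)

lemma sol_flow:
  assumes S: "bounded_borel S" and f: "bounded_borel f" "line_inv f" and \<theta>: "\<theta> \<in> S2" and x: "x \<in> X"
    and seg: "\<And>r. 0 \<le> r \<Longrightarrow> r < T \<Longrightarrow> x + r *\<^sub>R \<theta> \<in> X" and T: "0 \<le> T"
  obtains B where
    "line_transport (\<lambda>r. s (x + r *\<^sub>R \<theta>)) (\<lambda>r. K (sol S f) (x + r *\<^sub>R \<theta>, \<theta>) + S (x + r *\<^sub>R \<theta>, \<theta>)) T Smax B"
    "\<And>t. t \<in> {0..T} \<Longrightarrow> sol S f (x + t *\<^sub>R \<theta>, \<theta>) =
      line_transport.W (\<lambda>r. s (x + r *\<^sub>R \<theta>)) (\<lambda>r. K (sol S f) (x + r *\<^sub>R \<theta>, \<theta>) + S (x + r *\<^sub>R \<theta>, \<theta>)) (sol S f (x, \<theta>)) t"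
proof -
  have h: "bounded_borel (\<lambda>z. K (sol S f) z + S z)"
    by (intro bounded_borel_add K_bounded_borel sol_bounded_borel S f)
  obtain B where lt: "line_transport (\<lambda>r. s (x + r *\<^sub>R \<theta>)) (\<lambda>r. K (sol S f) (x + r *\<^sub>R \<theta>, \<theta>) + S (x + r *\<^sub>R \<theta>, \<theta>)) T Smax B"
    by (rule line_transport_on_segment[OF h T seg]) blast+
  show ?thesis
    by (rule that[OF lt]) (rule ballistic_flow_W[OF h f(2) \<theta> x seg sol_eq[OF S f(1)] _ lt])
qed

lemma sol_continuous_on_segment:
  assumes S: "bounded_borel S" and f: "bounded_borel f" "line_inv f" and \<theta>: "\<theta> \<in> S2" and x: "x \<in> X"
    and seg: "\<And>r. 0 \<le> r \<Longrightarrow> r < T \<Longrightarrow> x + r *\<^sub>R \<theta> \<in> X" and T: "0 \<le> T"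
  shows "continuous_on {0..T} (\<lambda>t. sol S f (x + t *\<^sub>R \<theta>, \<theta>))"
proof -
  obtain B where B: "line_transport (\<lambda>r. s (x + r *\<^sub>R \<theta>)) (\<lambda>r. K (sol S f) (x + r *\<^sub>R \<theta>, \<theta>) + S (x + r *\<^sub>R \<theta>, \<theta>)) T Smax B"
    "\<And>t. t \<in> {0..T} \<Longrightarrow> sol S f (x + t *\<^sub>R \<theta>, \<theta>) =
      line_transport.W (\<lambda>r. s (x + r *\<^sub>R \<theta>)) (\<lambda>r. K (sol S f) (x + r *\<^sub>R \<theta>, \<theta>) + S (x + r *\<^sub>R \<theta>, \<theta>)) (sol S f (x, \<theta>)) t"
    by (rule sol_flow[OF S f \<theta> x seg T]) blast+
  show ?thesis
    by (rule continuous_on_eq[OF line_transport.W_cont[OF B(1)]]) (use B(2) in auto)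
qed

lemma sol_entry_limit:
  assumes S: "bounded_borel S" and f: "bounded_borel f" "line_inv f" and yG: "(y, \<theta>) \<in> Gamma_minus X"
  shows "((\<lambda>t. sol S f (y + t *\<^sub>R \<theta>, \<theta>)) \<longlongrightarrow> f (y, \<theta>)) (at_right 0)"
proof -
  have y: "y \<in> frontier X" "\<theta> \<in> S2" "\<theta> \<bullet> outward_normal X y < 0"
    using yG by (auto simp: Gamma_minus_def)
  have yX: "y \<notin> X" using y X_open by (simp add: frontier_def interior_open)
  obtain b where b: "0 < b" "\<And>t. 0 < t \<Longrightarrow> t < b \<Longrightarrow> y + t *\<^sub>R \<theta> \<in> X"
    using outward_normal_direction(1)[OF smooth y(1,3)] by (auto simp: eventually_at_right_field)
  have h: "bounded_borel (\<lambda>z. K (sol S f) z + S z)"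
    by (intro bounded_borel_add K_bounded_borel sol_bounded_borel S f)
  obtain M where M: "0 \<le> M" "\<And>z. \<bar>K (sol S f) z + S z\<bar> \<le> M" using h bounded_borelE by blast
  have close: "\<bar>sol S f (y + t *\<^sub>R \<theta>, \<theta>) - f (y, \<theta>)\<bar> \<le> (1 - exp (- (Smax * t))) * \<bar>f (y, \<theta>)\<bar> + M * t"
    if t: "0 < t" "t < b" for t
  proof -
    have \<tau>: "\<tau> (y + t *\<^sub>R \<theta>) \<theta> = t" by (rule tau_entry[OF y(2) yX t(1)]) (use b t in auto)
    let ?e = "E (y + t *\<^sub>R \<theta>, \<theta>)" and ?j = "J (\<lambda>z. K (sol S f) z + S z) (y + t *\<^sub>R \<theta>, \<theta>)"
    have "\<bar>?j\<bar> \<le> M * (t - 0)"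
      unfolding J_def fst_conv snd_conv \<tau>
    proof (rule set_integral_bound)
      fix p
      have "\<bar>att s (y + t *\<^sub>R \<theta>) \<theta> p\<bar> * \<bar>K (sol S f) (y + t *\<^sub>R \<theta> - p *\<^sub>R \<theta>, \<theta>) + S (y + t *\<^sub>R \<theta> - p *\<^sub>R \<theta>, \<theta>)\<bar> \<le> 1 * M"
        using M att_pos[of "y + t *\<^sub>R \<theta>" \<theta> p] att_le_1[of "y + t *\<^sub>R \<theta>" \<theta> p] by (intro mult_mono) auto
      then show "\<bar>att s (y + t *\<^sub>R \<theta>) \<theta> p * (K (sol S f) (y + t *\<^sub>R \<theta> - p *\<^sub>R \<theta>, \<theta>) + S (y + t *\<^sub>R \<theta> - p *\<^sub>R \<theta>, \<theta>))\<bar> \<le> M"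
        by (simp add: abs_mult)
    qed (use M t in auto)
    moreover have "exp (- (Smax * t)) \<le> ?e" unfolding E_def fst_conv snd_conv \<tau> using t by (intro att_ge) simp
    then have "\<bar>?e - 1\<bar> \<le> 1 - exp (- (Smax * t))" using E_bounds(2)[of "(y + t *\<^sub>R \<theta>, \<theta>)"] by auto
    then have "\<bar>(?e - 1) * f (y, \<theta>)\<bar> \<le> (1 - exp (- (Smax * t))) * \<bar>f (y, \<theta>)\<bar>"
      unfolding abs_mult by (rule mult_right_mono) simp
    moreover have "sol S f (y + t *\<^sub>R \<theta>, \<theta>) - f (y, \<theta>) = (?e - 1) * f (y, \<theta>) + ?j"
      using sol_eq[OF S f(1), of "(y + t *\<^sub>R \<theta>, \<theta>)"] line_invD[OF f(2), of y t \<theta>] by (simp add: algebra_simps)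
    ultimately show ?thesis using abs_triangle_ineq[of "(?e - 1) * f (y, \<theta>)" ?j] by simp
  qed
  have "((\<lambda>t. (1 - exp (- (Smax * t))) * \<bar>f (y, \<theta>)\<bar> + M * t) \<longlongrightarrow> (1 - exp (- (Smax * 0))) * \<bar>f (y, \<theta>)\<bar> + M * 0) (at_right 0)"
    by (intro tendsto_intros)
  then have lim: "((\<lambda>t. (1 - exp (- (Smax * t))) * \<bar>f (y, \<theta>)\<bar> + M * t) \<longlongrightarrow> 0) (at_right 0)" by simp
  have "((\<lambda>t. sol S f (y + t *\<^sub>R \<theta>, \<theta>) - f (y, \<theta>)) \<longlongrightarrow> 0) (at_right 0)"
  proof (rule Lim_null_comparison[OF _ lim])
    show "eventually (\<lambda>t. norm (sol S f (y + t *\<^sub>R \<theta>, \<theta>) - f (y, \<theta>)) \<le> (1 - exp (- (Smax * t))) * \<bar>f (y, \<theta>)\<bar> + M * t) (at_right 0)"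
      using eventually_at_right_real[OF b(1)] by eventually_elim (use close in auto)
  qed
  then show ?thesis by (simp add: LIM_zero_iff)
qed

lemma sol_exit_limit:
  assumes S: "bounded_borel S" and f: "bounded_borel f" "line_inv f" and \<theta>: "\<theta> \<in> S2"
    and b: "0 < b" "\<And>t. 0 < t \<Longrightarrow> t < b \<Longrightarrow> y - t *\<^sub>R \<theta> \<in> X"
  shows "((\<lambda>t. sol S f (y - t *\<^sub>R \<theta>, \<theta>)) \<longlongrightarrow> sol S f (y, \<theta>)) (at_right 0)"
proof -
  define c where "c = b / 2"
  have c: "0 < c" "c < b" using b by (auto simp: c_def)
  define x where "x = y - c *\<^sub>R \<theta>"
  have x: "x \<in> X" unfolding x_def using c b by auto
  have seg: "x + r *\<^sub>R \<theta> \<in> X" if "0 \<le> r" "r < c" for r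
  proof -
    have "y - (c - r) *\<^sub>R \<theta> \<in> X" using that c by (intro b) auto
    then show ?thesis by (simp add: x_def algebra_simps)
  qed
  have "continuous_on {0..c} (\<lambda>t. sol S f (x + t *\<^sub>R \<theta>, \<theta>))"
    by (rule sol_continuous_on_segment[OF S f \<theta> x seg]) (use c in auto)
  then have "continuous_on {0..c} (\<lambda>t. sol S f (x + (c - t) *\<^sub>R \<theta>, \<theta>))"
    by (rule continuous_on_compose2[where f="\<lambda>t. c - t"]) (auto intro!: continuous_intros)
  moreover have "x + (c - t) *\<^sub>R \<theta> = y - t *\<^sub>R \<theta>" for t by (simp add: x_def algebra_simps)
  ultimately have "continuous_on {0..c} (\<lambda>t. sol S f (y - t *\<^sub>R \<theta>, \<theta>))" by simp
  then have "((\<lambda>t. sol S f (y - t *\<^sub>R \<theta>, \<theta>)) \<longlongrightarrow> sol S f (y - 0 *\<^sub>R \<theta>, \<theta>)) (at 0 within {0..c})"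
    using c unfolding continuous_on by (auto dest!: bspec[where x=0])
  then show ?thesis using c by (simp add: at_within_Icc_at_right)
qed

end

lemma measurable_phase_id: "(\<lambda>z. z) \<in> phase_measure X \<rightarrow>\<^sub>M borel"
proof -
  have 1: "fst \<in> phase_measure X \<rightarrow>\<^sub>M borel"
    unfolding phase_measure_def by (rule measurable_compose[OF measurable_fst]) (auto intro: measurable_restrict_space1)
  have 2: "snd \<in> phase_measure X \<rightarrow>\<^sub>M borel"
    unfolding phase_measure_def by (rule measurable_compose[OF measurable_snd id_sphere_measurable])
  show ?thesis using borel_measurable_Pair[OF 1 2] by simp
qed

lemma measurable_boundary_id: "(\<lambda>z. z) \<in> boundary_measure X \<Otimes>\<^sub>M sphere_measure \<rightarrow>\<^sub>M borel"
proof -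
  have "(\<lambda>x. x) \<in> boundary_measure X \<rightarrow>\<^sub>M borel"
    using measurable_restrict_space1[of "\<lambda>x. x" borel borel "frontier X"]
    by (simp cong: measurable_cong_sets add: boundary_measure_sets)
  from measurable_compose[OF measurable_fst this, of sphere_measure]
  have 1: "fst \<in> boundary_measure X \<Otimes>\<^sub>M sphere_measure \<rightarrow>\<^sub>M borel" by simp
  have 2: "snd \<in> boundary_measure X \<Otimes>\<^sub>M sphere_measure \<rightarrow>\<^sub>M borel"
    by (rule measurable_compose[OF measurable_snd id_sphere_measurable])
  show ?thesis using borel_measurable_Pair[OF 1 2] by simp
qed

lemma bounded_borel_Linf:
  assumes "bounded_borel u"
  shows "u \<in> Linf (phase_measure X)" "u \<in> Linf (inflow_measure X)" "u \<in> Linf (outflow_measure X)"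
proof -
  obtain M where M: "\<And>z. \<bar>u z\<bar> \<le> M" using assms bounded_borelE by blast
  note u = bounded_borel_meas[OF assms]
  show "u \<in> Linf (phase_measure X)"
    using measurable_compose[OF measurable_phase_id u] M by (auto simp: Linf_def intro!: exI[of _ M])
  show "u \<in> Linf (inflow_measure X)" "u \<in> Linf (outflow_measure X)"
    using measurable_compose[OF measurable_boundary_id u] M
    by (auto simp: Linf_def inflow_measure_def outflow_measure_def intro!: measurable_restrict_space1 exI[of _ M])
qed

lemma space_phase: "space (phase_measure X) = X \<times> S2"
  by (simp add: phase_measure_def space_pair_measure space_restrict_space)

text \<open>The formulas of the previous section use Borel functions on all of space, the transport equation
  only sees their values on \<open>X\<close>.\<close>

locale extended_coefficients = coefficients +
  fixes \<sigma> :: "vec3 \<Rightarrow> real" and k :: "vec3 \<Rightarrow> vec3 \<Rightarrow> vec3 \<Rightarrow> real"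
  assumes s_eq: "x \<in> X \<Longrightarrow> s x = \<sigma> x"
    and kk_eq: "x \<in> X \<Longrightarrow> \<theta> \<in> S2 \<Longrightarrow> \<theta>' \<in> S2 \<Longrightarrow> kk x \<theta> \<theta>' = k x \<theta> \<theta>'"
begin

lemma transport_op_eq:
  assumes "x \<in> X" "\<theta> \<in> S2"
  shows "transport_op \<sigma> k u (x, \<theta>) = K u (x, \<theta>) - s x * u (x, \<theta>)"
proof -
  have "(LINT \<theta>'|sphere_measure. k x \<theta> \<theta>' * u (x, \<theta>')) = K u (x, \<theta>)"
    unfolding K_def fst_conv snd_conv using assms by (intro Bochner_Integration.integral_cong) (auto simp: kk_eq)
  then show ?thesis by (simp add: transport_op_def s_eq assms)
qed

lemma sol_transport_solution:
  assumes S: "bounded_borel S" and f: "bounded_borel f" "line_inv f"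
  shows "transport_solution X \<sigma> k S f (sol S f)"
  unfolding transport_solution_def
proof (intro conjI)
  show "sol S f \<in> Linf (phase_measure X)"
    by (intro bounded_borel_Linf sol_bounded_borel S f)
  show "inflow_trace X (sol S f) f"
    unfolding inflow_trace_def inflow_measure_def
    by (rule AE_I2) (auto simp: space_restrict_space intro!: sol_entry_limit[OF S f])
  show "streaming_eq X (sol S f) (\<lambda>z. transport_op \<sigma> k (sol S f) z + S z)"
    unfolding streaming_eq_def
  proof (rule AE_I2, clarify)
    fix x \<theta> and t :: real
    assume sp: "(x, \<theta>) \<in> space (phase_measure X)" and t: "0 \<le> t" and seg: "\<forall>s\<in>{0..t}. x + s *\<^sub>R \<theta> \<in> X"
    have x: "x \<in> X" "\<theta> \<in> S2" using sp by (auto simp: space_phase)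
    obtain B where lt: "line_transport (\<lambda>r. s (x + r *\<^sub>R \<theta>)) (\<lambda>r. K (sol S f) (x + r *\<^sub>R \<theta>, \<theta>) + S (x + r *\<^sub>R \<theta>, \<theta>)) t Smax B"
      and flow: "\<And>r. r \<in> {0..t} \<Longrightarrow> sol S f (x + r *\<^sub>R \<theta>, \<theta>) =
        line_transport.W (\<lambda>r. s (x + r *\<^sub>R \<theta>)) (\<lambda>r. K (sol S f) (x + r *\<^sub>R \<theta>, \<theta>) + S (x + r *\<^sub>R \<theta>, \<theta>)) (sol S f (x, \<theta>)) r"
      by (rule sol_flow[OF S f x(2,1) _ t]) (use seg in auto)
    interpret line_transport "\<lambda>r. s (x + r *\<^sub>R \<theta>)" "\<lambda>r. K (sol S f) (x + r *\<^sub>R \<theta>, \<theta>) + S (x + r *\<^sub>R \<theta>, \<theta>)" t Smax B by fact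
    have eq: "transport_op \<sigma> k (sol S f) (x + r *\<^sub>R \<theta>, \<theta>) + S (x + r *\<^sub>R \<theta>, \<theta>) =
        (K (sol S f) (x + r *\<^sub>R \<theta>, \<theta>) + S (x + r *\<^sub>R \<theta>, \<theta>)) - s (x + r *\<^sub>R \<theta>) * W (sol S f (x, \<theta>)) r"
      if "r \<in> {0..t}" for r
      using seg that x by (simp add: transport_op_eq flow[OF that, symmetric])
    have "set_integrable lborel {0..t} (\<lambda>r. (K (sol S f) (x + r *\<^sub>R \<theta>, \<theta>) + S (x + r *\<^sub>R \<theta>, \<theta>)) - s (x + r *\<^sub>R \<theta>) * W (sol S f (x, \<theta>)) r)"
      by (intro set_integral_diff(1) h_int sW_int) auto
    then show "set_integrable lborel {0..t} (\<lambda>s. transport_op \<sigma> k (sol S f) (x + s *\<^sub>R \<theta>, \<theta>) + S (x + s *\<^sub>R \<theta>, \<theta>)) \<and>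
        sol S f (x + t *\<^sub>R \<theta>, \<theta>) - sol S f (x, \<theta>) =
        (LINT s:{0..t}|lborel. transport_op \<sigma> k (sol S f) (x + s *\<^sub>R \<theta>, \<theta>) + S (x + s *\<^sub>R \<theta>, \<theta>))"
      using W_solves[of t "sol S f (x, \<theta>)"] t flow[of t]
      by (subst set_integrable_cong[OF refl refl eq], simp, subst set_lebesgue_integral_cong[OF _ allI[OF impI[OF eq]]]) auto
  qed
qed

lemma sol_outflow_trace:
  assumes S: "bounded_borel S" and f: "bounded_borel f" "line_inv f"
  shows "outflow_trace X (sol S f) (sol S f)"
  unfolding outflow_trace_def outflow_measure_def
proof (rule AE_I2, clarify)
  fix y \<theta> assume "(y, \<theta>) \<in> space (restrict_space (boundary_measure X \<Otimes>\<^sub>M sphere_measure) (Gamma_plus X))"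
  then have y: "y \<in> frontier X" "\<theta> \<in> S2" "(- \<theta>) \<bullet> outward_normal X y < 0"
    by (auto simp: space_restrict_space Gamma_plus_def)
  obtain b where "0 < b" "\<And>t. 0 < t \<Longrightarrow> t < b \<Longrightarrow> y - t *\<^sub>R \<theta> \<in> X"
    using outward_normal_direction(1)[OF smooth y(1,3)] by (auto simp: eventually_at_right_field)
  then show "((\<lambda>t. sol S f (y - t *\<^sub>R \<theta>, \<theta>)) \<longlongrightarrow> sol S f (y, \<theta>)) (at_right 0)"
    by (rule sol_exit_limit[OF S f y(2)])
qed

end

section \<open>Almost everywhere uniqueness\<close>

lemma AE_lborel_affine:
  fixes c e :: real
  assumes "AE t in lborel. Q t" "e \<noteq> 0"
  shows "AE r in lborel. Q (c + e * r)"
proof -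
  obtain N where N: "N \<in> null_sets lborel" "{t\<in>space lborel. \<not> Q t} \<subseteq> N"
    using assms(1) by (auto simp: eventually_ae_filter)
  have [measurable]: "N \<in> sets borel" using N(1) by auto
  have "AE t in density (distr lborel borel (\<lambda>r. c + e * r)) (\<lambda>_. ennreal \<bar>e\<bar>). t \<notin> N"
    by (subst lborel_real_affine[OF assms(2), of c, symmetric]) (rule AE_not_in[OF N(1)])
  then have "AE t in distr lborel borel (\<lambda>r. c + e * r). t \<notin> N"
    using assms(2) by (subst (asm) AE_density) auto
  then have "AE r in lborel. c + e * r \<notin> N"
    by (subst (asm) AE_distr_iff) auto
  then show ?thesis by (rule AE_space_mono) (use N(2) in auto)
qed

lemma AE_ex_interval:
  assumes "AE t in lborel. P t" "a < (b::real)"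
  shows "\<exists>t. a < t \<and> t < b \<and> P t"
proof (rule ccontr)
  assume no: "\<not> ?thesis"
  obtain N where N: "N \<in> null_sets lborel" "{t\<in>space lborel. \<not> P t} \<subseteq> N"
    using assms(1) by (auto simp: eventually_ae_filter)
  have "{a<..<b} \<subseteq> N" using no N(2) by auto
  then have "emeasure lborel {a<..<b} \<le> emeasure lborel N" using N(1) by (intro emeasure_mono) auto
  then show False using N(1) assms(2) by (auto simp: null_sets_def)
qed

lemma limit_zero_of_AE_zero:
  fixes \<phi> :: "real \<Rightarrow> real"
  assumes "(\<phi> \<longlongrightarrow> l) (at_right 0)" "0 < b" "AE t in lborel. 0 < t \<and> t < b \<longrightarrow> \<phi> t = 0"
  shows "l = 0"
proof (rule ccontr)
  assume "l \<noteq> 0"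
  then have "eventually (\<lambda>t. \<phi> t \<noteq> 0) (at_right 0)" using assms(1) tendsto_imp_eventually_ne by blast
  then obtain c where c: "0 < c" "\<And>t. 0 < t \<Longrightarrow> t < c \<Longrightarrow> \<phi> t \<noteq> 0"
    by (auto simp: eventually_at_right_field)
  obtain t where "0 < t" "t < min b c" "0 < t \<and> t < b \<longrightarrow> \<phi> t = 0"
    using AE_ex_interval[OF assms(3), of 0 "min b c"] c assms(2) by auto
  then show False using c(2)[of t] by auto
qed

text \<open>By translation invariance and Tonelli, the line through almost every point meets an exceptional
  null set in a null set only.\<close>

lemma chord_AE:
  assumes "AE x in lborel. P x"
  shows "AE x in lborel. AE t in lborel. P (x - t *\<^sub>R \<theta> :: vec3)"
proof -
  obtain N where N: "N \<in> null_sets lborel" "{x\<in>space lborel. \<not> P x} \<subseteq> N"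
    using assms by (auto simp: eventually_ae_filter)
  have Nb: "N \<in> sets borel" using N(1) by auto
  have "AE x in lborel. x - t *\<^sub>R \<theta> \<notin> N" for t
  proof -
    have "AE x in distr lborel borel ((+) (- t *\<^sub>R \<theta>)). x \<notin> N"
      unfolding lborel_distr_plus by (rule AE_not_in[OF N(1)])
    then have "AE x in lborel. (- t *\<^sub>R \<theta>) + x \<notin> N" using Nb by (subst (asm) AE_distr_iff) auto
    then show ?thesis by simp
  qed
  then have "AE t in lborel. AE x in lborel. x - t *\<^sub>R \<theta> \<notin> N" by simp
  moreover have "{z \<in> space (lborel \<Otimes>\<^sub>M lborel). fst z - snd z *\<^sub>R \<theta> \<notin> N} \<in> sets (lborel \<Otimes>\<^sub>M lborel)"
  proof -
    have "(\<lambda>z::vec3 \<times> real. fst z - snd z *\<^sub>R \<theta>) \<in> borel_measurable borel"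
      by (intro borel_measurable_continuous_onI continuous_intros)
    then have "(\<lambda>z::vec3 \<times> real. fst z - snd z *\<^sub>R \<theta>) \<in> borel_measurable (lborel \<Otimes>\<^sub>M lborel)"
      by (simp add: lborel_prod)
    from measurable_sets[OF this, of "- N"] Nb show ?thesis
      by (auto simp: vimage_def Int_def conj_commute)
  qed
  ultimately have "AE x in lborel. AE t in lborel. x - t *\<^sub>R \<theta> \<notin> N"
    using pair_sigma_finite.AE_commute[OF pair_sigma_finite.intro[OF sigma_finite_lborel sigma_finite_lborel],
        of "\<lambda>x t. x - t *\<^sub>R \<theta> \<notin> N"] by auto
  then show ?thesis
  proof (rule AE_space_mono)
    fix x assume "AE t in lborel. x - t *\<^sub>R \<theta> \<notin> N"
    then show "AE t in lborel. P (x - t *\<^sub>R \<theta>)" by (rule AE_space_mono) (use N(2) in auto)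
  qed
qed

context transport_domain
begin

lemma phase_AE:
  assumes "AE z in phase_measure X. P z"
  shows "AE x in lborel. x \<in> X \<longrightarrow> (AE \<theta> in sphere_measure. P (x, \<theta>))"
    and "AE \<theta> in sphere_measure. AE x in lborel. x \<in> X \<longrightarrow> P (x, \<theta>)"
proof -
  interpret A: sigma_finite_measure "restrict_space lborel X"
    by (rule sigma_finite_measure_restrict_space[OF sigma_finite_lborel]) simp
  interpret pair_sigma_finite "restrict_space lborel X" sphere_measure ..
  obtain N where N: "N \<in> null_sets (restrict_space lborel X \<Otimes>\<^sub>M sphere_measure)"
    "{z\<in>space (restrict_space lborel X \<Otimes>\<^sub>M sphere_measure). \<not> P z} \<subseteq> N"
    using assms unfolding phase_measure_def by (auto simp: eventually_ae_filter)
  have [measurable]: "N \<in> sets (restrict_space lborel X \<Otimes>\<^sub>M sphere_measure)" using N(1) by auto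
  have PN: "P (x, \<theta>)" if "x \<in> X" "\<theta> \<in> S2" "(x, \<theta>) \<notin> N" for x \<theta>
    using subsetD[OF N(2), of "(x, \<theta>)"] that by (auto simp: space_pair_measure space_restrict_space)
  have 1: "AE x in restrict_space lborel X. AE \<theta> in sphere_measure. (x, \<theta>) \<notin> N"
    by (rule AE_pair[OF AE_not_in[OF N(1)]])
  then have "AE x in lborel. x \<in> X \<longrightarrow> (AE \<theta> in sphere_measure. (x, \<theta>) \<notin> N)"
    by (subst (asm) AE_restrict_space_iff) auto
  then show "AE x in lborel. x \<in> X \<longrightarrow> (AE \<theta> in sphere_measure. P (x, \<theta>))"
  proof (rule AE_space_mono, intro impI)
    fix x assume "x \<in> X \<longrightarrow> (AE \<theta> in sphere_measure. (x, \<theta>) \<notin> N)" and x: "x \<in> X"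
    then have "AE \<theta> in sphere_measure. (x, \<theta>) \<notin> N" by blast
    then show "AE \<theta> in sphere_measure. P (x, \<theta>)" by (rule AE_space_mono) (use x PN in auto)
  qed
  have "AE \<theta> in sphere_measure. AE x in restrict_space lborel X. (x, \<theta>) \<notin> N"
    using 1 by (subst (asm) AE_commute) auto
  then show "AE \<theta> in sphere_measure. AE x in lborel. x \<in> X \<longrightarrow> P (x, \<theta>)"
  proof (rule AE_space_mono)
    fix \<theta> assume \<theta>: "\<theta> \<in> space sphere_measure" and "AE x in restrict_space lborel X. (x, \<theta>) \<notin> N"
    then have "AE x in lborel. x \<in> X \<longrightarrow> (x, \<theta>) \<notin> N" by (subst (asm) AE_restrict_space_iff) auto
    then show "AE x in lborel. x \<in> X \<longrightarrow> P (x, \<theta>)" by (rule AE_space_mono) (use \<theta> PN in auto)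
  qed
qed

lemma AE_swap:
  assumes P: "{z. P z} \<in> sets borel"
  shows "(AE \<theta> in sphere_measure. AE x in lborel. x \<in> X \<longrightarrow> P (x, \<theta>)) \<longleftrightarrow>
    (AE x in lborel. x \<in> X \<longrightarrow> (AE \<theta> in sphere_measure. P (x, \<theta>)))"
proof -
  interpret pair_sigma_finite lborel sphere_measure ..
  have "(\<lambda>z. (fst z, snd z)) \<in> lborel \<Otimes>\<^sub>M sphere_measure \<rightarrow>\<^sub>M (borel :: (vec3 \<times> vec3) measure)"
    by (rule borel_measurable_Pair) (auto intro: measurable_compose[OF measurable_snd id_sphere_measurable])
  then have id: "(\<lambda>z. z) \<in> lborel \<Otimes>\<^sub>M sphere_measure \<rightarrow>\<^sub>M (borel :: (vec3 \<times> vec3) measure)" by simp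
  have "{z. fst z \<in> X \<longrightarrow> P z} = - (X \<times> UNIV) \<union> {z. P z}" by auto
  moreover have "X \<times> (UNIV :: vec3 set) \<in> sets borel" using X_open by (intro borel_open open_Times) auto
  ultimately have "{z. fst z \<in> X \<longrightarrow> P z} \<in> sets borel"
    using sets.Un[OF borel_comp P] by metis
  from measurable_sets[OF id this]
  have "{z \<in> space (lborel \<Otimes>\<^sub>M sphere_measure). fst z \<in> X \<longrightarrow> P (fst z, snd z)} \<in> sets (lborel \<Otimes>\<^sub>M sphere_measure)"
    by (simp add: vimage_def Int_def conj_commute)
  from AE_commute[of "\<lambda>x \<theta>. x \<in> X \<longrightarrow> P (x, \<theta>)", OF this]
  have "(AE \<theta> in sphere_measure. AE x in lborel. x \<in> X \<longrightarrow> P (x, \<theta>)) \<longleftrightarrow>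
    (AE x in lborel. AE \<theta> in sphere_measure. x \<in> X \<longrightarrow> P (x, \<theta>))" by simp
  also have "(\<lambda>x. AE \<theta> in sphere_measure. x \<in> X \<longrightarrow> P (x, \<theta>)) = (\<lambda>x. x \<in> X \<longrightarrow> (AE \<theta> in sphere_measure. P (x, \<theta>)))"
  proof
    fix x show "(AE \<theta> in sphere_measure. x \<in> X \<longrightarrow> P (x, \<theta>)) = (x \<in> X \<longrightarrow> (AE \<theta> in sphere_measure. P (x, \<theta>)))"
      by (cases "x \<in> X") simp_all
  qed
  finally show ?thesis .
qed

lemma bounded_borel_representative:
  assumes "u \<in> Linf (phase_measure X)"
  obtains v where "bounded_borel v" "AE z in phase_measure X. v z = u z"
proof -
  obtain C where C: "AE z in phase_measure X. \<bar>u z\<bar> \<le> C" and u: "u \<in> borel_measurable (phase_measure X)"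
    using assms by (auto simp: Linf_def)
  obtain x0 where x0: "x0 \<in> X" using smooth by (auto simp: bounded_smooth_domain_def)
  define \<theta>0 :: vec3 where "\<theta>0 = axis 1 1"
  have \<theta>0: "\<theta>0 \<in> S2" by (simp add: \<theta>0_def)
  define p1 where "p1 z = (if fst z \<in> X then fst z else x0)" for z :: "vec3 \<times> vec3"
  define p2 where "p2 z = (if snd z \<in> S2 then snd z else \<theta>0)" for z :: "vec3 \<times> vec3"
  have S2b [measurable]: "S2 \<in> sets (borel :: vec3 measure)" by (intro borel_closed) auto
  have m1: "p1 \<in> borel \<rightarrow>\<^sub>M restrict_space lborel X"
  proof (rule measurable_restrict_space2)
    show "p1 \<in> borel \<rightarrow>\<^sub>M lborel" unfolding p1_def by simp
  qed (auto simp: p1_def x0)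
  have m2: "p2 \<in> borel \<rightarrow>\<^sub>M sphere_measure"
    unfolding measurable_cong_sets[OF refl sphere_measure_sets]
  proof (rule measurable_restrict_space2)
    show "p2 \<in> borel_measurable borel" unfolding p2_def by measurable
  qed (use \<theta>0 in \<open>auto simp: p2_def\<close>)
  have "(\<lambda>z. (p1 z, p2 z)) \<in> borel \<rightarrow>\<^sub>M phase_measure X"
    unfolding phase_measure_def by (rule measurable_Pair[OF m1 m2])
  from measurable_compose[OF this u] have [measurable]: "(\<lambda>z. u (p1 z, p2 z)) \<in> borel_measurable borel" .
  define v where "v z = (if \<bar>u (p1 z, p2 z)\<bar> \<le> C then u (p1 z, p2 z) else 0)" for z
  have "bounded_borel v"
  proof (rule bounded_borelI[where M="\<bar>C\<bar>"])
    show "v \<in> borel_measurable borel" unfolding v_def by measurable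
  qed (auto simp: v_def)
  moreover have "AE z in phase_measure X. v z = u z"
    using C by (rule AE_space_mono) (auto simp: space_phase v_def p1_def p2_def)
  ultimately show ?thesis by (rule that)
qed

end

context coefficients
begin

text \<open>The equation is available from almost every starting point of the chord. From such a point the
  variation-of-constants formula leads to \<open>x\<close>, and the entrance is approached through such points.\<close>

lemma chord_representation:
  assumes \<theta>: "\<theta> \<in> S2" and x: "x \<in> X" and h: "bounded_borel h"
    and ae_g: "AE t in lborel. x - t *\<^sub>R \<theta> \<in> X \<longrightarrow>
      g (x - t *\<^sub>R \<theta>) = h (x - t *\<^sub>R \<theta>, \<theta>) - s (x - t *\<^sub>R \<theta>) * u (x - t *\<^sub>R \<theta>)"
    and ae_str: "AE t in lborel. x - t *\<^sub>R \<theta> \<in> X \<longrightarrow>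
      (\<forall>T\<ge>0. (\<forall>r\<in>{0..T}. x - t *\<^sub>R \<theta> + r *\<^sub>R \<theta> \<in> X) \<longrightarrow>
        set_integrable lborel {0..T} (\<lambda>r. g (x - t *\<^sub>R \<theta> + r *\<^sub>R \<theta>)) \<and>
        u (x - t *\<^sub>R \<theta> + T *\<^sub>R \<theta>) - u (x - t *\<^sub>R \<theta>) = (LINT r:{0..T}|lborel. g (x - t *\<^sub>R \<theta> + r *\<^sub>R \<theta>)))"
    and lim: "((\<lambda>t. u (x - \<tau> x \<theta> *\<^sub>R \<theta> + t *\<^sub>R \<theta>)) \<longlongrightarrow> c) (at_right 0)"
  shows "u x = E (x, \<theta>) * c + J h (x, \<theta>)"
proof -
  define T0 where "T0 = \<tau> x \<theta>"
  have T0: "0 < T0" unfolding T0_def by (rule tau_pos[OF \<theta> x])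
  let ?D = "\<lambda>t. att s x \<theta> t * u (x - t *\<^sub>R \<theta>) + (LINT p:{0..t}|lborel. att s x \<theta> p * h (x - p *\<^sub>R \<theta>, \<theta>))"
  have rep: "AE t in lborel. 0 < t \<and> t < T0 \<longrightarrow> u x = ?D t"
    using ae_str
  proof (rule AE_space_mono, intro impI)
    fix t assume str: "x - t *\<^sub>R \<theta> \<in> X \<longrightarrow>
      (\<forall>T\<ge>0. (\<forall>r\<in>{0..T}. x - t *\<^sub>R \<theta> + r *\<^sub>R \<theta> \<in> X) \<longrightarrow>
        set_integrable lborel {0..T} (\<lambda>r. g (x - t *\<^sub>R \<theta> + r *\<^sub>R \<theta>)) \<and>
        u (x - t *\<^sub>R \<theta> + T *\<^sub>R \<theta>) - u (x - t *\<^sub>R \<theta>) = (LINT r:{0..T}|lborel. g (x - t *\<^sub>R \<theta> + r *\<^sub>R \<theta>)))"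
      and t: "0 < t \<and> t < T0"
    define p where "p = x - t *\<^sub>R \<theta>"
    have px: "p + t *\<^sub>R \<theta> = x" by (simp add: p_def)
    have seg: "p + r *\<^sub>R \<theta> \<in> X" if r: "r \<in> {0..t}" for r
    proof (cases "r = t")
      case False
      then have "x - (t - r) *\<^sub>R \<theta> \<in> X" using t r by (intro inside_chord) (auto simp: T0_def)
      then show ?thesis by (simp add: p_def algebra_simps)
    qed (use px x in simp)
    have pX: "p \<in> X" using seg[of 0] t by simp
    define v where "v r = u (p + r *\<^sub>R \<theta>)" for r
    have g_int: "set_integrable lborel {0..T} (\<lambda>r. g (p + r *\<^sub>R \<theta>))"
      and v_eq: "v T - v 0 = (LINT r:{0..T}|lborel. g (p + r *\<^sub>R \<theta>))" if T: "T \<in> {0..t}" for T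
      using str[unfolded p_def[symmetric], rule_format, OF pX, of T] T seg by (auto simp: v_def)
    have "continuous_on {0..t} (\<lambda>T. v 0 + (LINT r:{0..T}|lborel. g (p + r *\<^sub>R \<theta>)))"
      using t by (intro continuous_intros indefinite_continuous g_int) auto
    then have v_cont: "continuous_on {0..t} v"
    proof (rule continuous_on_eq)
      fix T assume "T \<in> {0..t}"
      from v_eq[OF this] show "v 0 + (LINT r:{0..T}|lborel. g (p + r *\<^sub>R \<theta>)) = v T" by linarith
    qed
    define w where "w r = indicator {0..t} r *\<^sub>R v r" for r
    have [measurable]: "w \<in> borel_measurable borel"
      unfolding w_def by (rule borel_measurable_continuous_on_indicator[OF _ v_cont]) auto
    have w_v: "w r = v r" if "r \<in> {0..t}" for r using that by (simp add: w_def)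
    have "bounded (v ` {0..t})" by (intro compact_imp_bounded compact_continuous_image v_cont) auto
    then obtain Mw where "\<forall>r\<in>{0..t}. \<bar>v r\<bar> \<le> Mw" by (auto simp: bounded_iff)
    then have Mw: "\<bar>w r\<bar> \<le> Mw" if "r \<in> {0..t}" for r using that w_v[OF that] by simp
    obtain B where lt: "line_transport (\<lambda>r. s (p + r *\<^sub>R \<theta>)) (\<lambda>r. h (p + r *\<^sub>R \<theta>, \<theta>)) t Smax B"
    proof (rule line_transport_on_segment[OF h, of t p \<theta>])
      show "p + r *\<^sub>R \<theta> \<in> X" if "0 \<le> r" "r < t" for r using that seg by simp
    qed (use t in auto)
    interpret line_transport "\<lambda>r. s (p + r *\<^sub>R \<theta>)" "\<lambda>r. h (p + r *\<^sub>R \<theta>, \<theta>)" t Smax B by fact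
    have int: "set_integrable lborel {0..T} (\<lambda>r. h (p + r *\<^sub>R \<theta>, \<theta>) - s (p + r *\<^sub>R \<theta>) * w r)" if T: "T \<in> {0..t}" for T
    proof (intro set_integral_diff(1) h_int)
      show "set_integrable lborel {0..T} (\<lambda>r. s (p + r *\<^sub>R \<theta>) * w r)"
        by (rule set_integrable_bounded[where M="Smax * Mw"])
          (use T Mw s_abs Smax_nonneg in \<open>auto simp: abs_mult intro!: mult_mono\<close>)
    qed (use T in auto)
    have "w t = W (w 0) t"
    proof (rule W_unique[OF int])
      fix T assume T: "T \<in> {0..t}"
      have "w T - w 0 = (LINT r:{0..T}|lborel. g (p + r *\<^sub>R \<theta>))"
        using v_eq[OF T] T t by (simp add: w_v)
      also have "\<dots> = (LINT r:{0..T}|lborel. h (p + r *\<^sub>R \<theta>, \<theta>) - s (p + r *\<^sub>R \<theta>) * w r)"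
        unfolding set_lebesgue_integral_def
      proof (rule integral_cong_AE)
        show "(\<lambda>r. indicator {0..T} r *\<^sub>R g (p + r *\<^sub>R \<theta>)) \<in> borel_measurable lborel"
          using g_int[OF T] unfolding set_integrable_def by (rule borel_measurable_integrable)
        show "(\<lambda>r. indicator {0..T} r *\<^sub>R (h (p + r *\<^sub>R \<theta>, \<theta>) - s (p + r *\<^sub>R \<theta>) * w r)) \<in> borel_measurable lborel"
          using int[OF T] unfolding set_integrable_def by (rule borel_measurable_integrable)
        have "x - (t + -1 * r) *\<^sub>R \<theta> = p + r *\<^sub>R \<theta>" for r by (simp add: p_def algebra_simps)
        then have "AE r in lborel. p + r *\<^sub>R \<theta> \<in> X \<longrightarrow>
            g (p + r *\<^sub>R \<theta>) = h (p + r *\<^sub>R \<theta>, \<theta>) - s (p + r *\<^sub>R \<theta>) * u (p + r *\<^sub>R \<theta>)"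
          using AE_lborel_affine[OF ae_g, of "-1" t] by simp
        then show "AE r in lborel. indicator {0..T} r *\<^sub>R g (p + r *\<^sub>R \<theta>) =
            indicator {0..T} r *\<^sub>R (h (p + r *\<^sub>R \<theta>, \<theta>) - s (p + r *\<^sub>R \<theta>) * w r)"
        proof eventually_elim
          case (elim r)
          show ?case
          proof (cases "r \<in> {0..T}")
            case True
            then have "r \<in> {0..t}" using T by auto
            then show ?thesis using elim seg[of r] w_v[of r] by (simp add: v_def)
          qed simp
        qed
      qed
      finally show "w T - w 0 = (LINT r:{0..T}|lborel. h (p + r *\<^sub>R \<theta>, \<theta>) - s (p + r *\<^sub>R \<theta>) * w r)" .
    qed (use t in auto)
    moreover have "w t = u x" "w 0 = u (x - t *\<^sub>R \<theta>)" using t w_v[of t] w_v[of 0] by (simp_all add: v_def px p_def)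
    moreover have "W (w 0) t = att s x \<theta> t * w 0 + (LINT p:{0..t}|lborel. att s x \<theta> p * h (x - p *\<^sub>R \<theta>, \<theta>))"
      using backward_eq_W[OF lt, of t "w 0"] t by (simp add: px)
    ultimately show "u x = ?D t" by simp
  qed
  let ?\<phi> = "\<lambda>r. u x - ?D (T0 - r)"
  have "AE r in lborel. 0 < T0 + -1 * r \<and> T0 + -1 * r < T0 \<longrightarrow> u x = ?D (T0 + -1 * r)"
    by (rule AE_lborel_affine[OF rep]) simp
  then have ae0: "AE r in lborel. 0 < r \<and> r < T0 \<longrightarrow> ?\<phi> r = 0" by eventually_elim auto
  have at_end: "((\<lambda>r. F (T0 - r)) \<longlongrightarrow> F T0) (at_right 0)" if "continuous_on {0..T0} F" for F :: "real \<Rightarrow> real"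
  proof -
    have "continuous_on {0..T0} (\<lambda>r. F (T0 - r))"
      by (rule continuous_on_compose2[OF that]) (auto intro!: continuous_intros)
    then have "((\<lambda>r. F (T0 - r)) \<longlongrightarrow> F (T0 - 0)) (at 0 within {0..T0})"
      using T0 unfolding continuous_on by (auto dest!: bspec[where x=0])
    then show ?thesis using T0 by (simp add: at_within_Icc_at_right)
  qed
  have c1: "continuous_on {0..T0} (\<lambda>t. att s x \<theta> t)"
    unfolding att_def by (intro continuous_intros indefinite_continuous s_line_int)
  have c2: "continuous_on {0..T0} (\<lambda>t. LINT p:{0..t}|lborel. att s x \<theta> p * h (x - p *\<^sub>R \<theta>, \<theta>))"
    by (intro indefinite_continuous att_h_int h)
  have "x - (T0 - r) *\<^sub>R \<theta> = x - \<tau> x \<theta> *\<^sub>R \<theta> + r *\<^sub>R \<theta>" for r by (simp add: T0_def algebra_simps)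
  then have lim': "((\<lambda>r. u (x - (T0 - r) *\<^sub>R \<theta>)) \<longlongrightarrow> c) (at_right 0)" using lim by (simp only:)
  have "(?\<phi> \<longlongrightarrow> u x - (att s x \<theta> T0 * c + (LINT p:{0..T0}|lborel. att s x \<theta> p * h (x - p *\<^sub>R \<theta>, \<theta>)))) (at_right 0)"
    by (intro tendsto_intros at_end[OF c1] at_end[OF c2] lim')
  then have "u x - (att s x \<theta> T0 * c + (LINT p:{0..T0}|lborel. att s x \<theta> p * h (x - p *\<^sub>R \<theta>, \<theta>))) = 0"
    by (rule limit_zero_of_AE_zero[OF _ T0 ae0])
  then show ?thesis by (simp add: E_def J_def T0_def)
qed

text \<open>The fixed point equation holds almost everywhere only, so the sup norm is replaced by bounds
  \<open>q\<^sup>n M\<close> almost everywhere. The bound for \<open>n\<close> holds at almost every point of almost every chord, and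
  that is all the contraction estimate looks at.\<close>

lemma contraction_AE:
  assumes d: "bounded_borel d" and eq: "AE \<theta> in sphere_measure. AE x in lborel. x \<in> X \<longrightarrow> d (x, \<theta>) = L d (x, \<theta>)"
  shows "AE \<theta> in sphere_measure. AE x in lborel. x \<in> X \<longrightarrow> d (x, \<theta>) = 0"
proof -
  obtain M where M: "0 \<le> M" "\<And>z. \<bar>d z\<bar> \<le> M" using d bounded_borelE by blast
  note [measurable] = bounded_borel_meas[OF d]
  have "AE \<theta> in sphere_measure. AE x in lborel. x \<in> X \<longrightarrow> \<bar>d (x, \<theta>)\<bar> \<le> q ^ n * M" for n
  proof (induction n)
    case (Suc n)
    have "AE x in lborel. x \<in> X \<longrightarrow> (AE \<theta> in sphere_measure. \<bar>d (x, \<theta>)\<bar> \<le> q ^ n * M)"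
      using Suc by (subst (asm) AE_swap[of "\<lambda>z. \<bar>d z\<bar> \<le> q ^ n * M"]) measurable
    note ae = chord_AE[OF this]
    from eq show ?case
    proof (rule AE_space_mono)
      fix \<theta> assume "AE x in lborel. x \<in> X \<longrightarrow> d (x, \<theta>) = L d (x, \<theta>)"
      then show "AE x in lborel. x \<in> X \<longrightarrow> \<bar>d (x, \<theta>)\<bar> \<le> q ^ Suc n * M"
        using ae[of \<theta>]
      proof eventually_elim
        case (elim x)
        have "\<bar>L d (x, \<theta>)\<bar> \<le> q * (q ^ n * M)"
        proof (rule L_contract_AE[OF d])
          show "AE t in lborel. 0 < t \<and> t < \<tau> x \<theta> \<longrightarrow> (AE \<theta>' in sphere_measure. \<bar>d (x - t *\<^sub>R \<theta>, \<theta>')\<bar> \<le> q ^ n * M)"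
            using elim(2) by (rule AE_space_mono) (auto intro: inside_chord)
        qed (use M q_nonneg in auto)
        then show ?case using elim(1) by (simp add: mult.assoc)
      qed
    qed
  qed (simp add: M)
  then have "AE \<theta> in sphere_measure. \<forall>n. AE x in lborel. x \<in> X \<longrightarrow> \<bar>d (x, \<theta>)\<bar> \<le> q ^ n * M"
    by (simp add: AE_all_countable)
  then show ?thesis
  proof (rule AE_space_mono)
    fix \<theta> assume "\<forall>n. AE x in lborel. x \<in> X \<longrightarrow> \<bar>d (x, \<theta>)\<bar> \<le> q ^ n * M"
    then have "AE x in lborel. \<forall>n. x \<in> X \<longrightarrow> \<bar>d (x, \<theta>)\<bar> \<le> q ^ n * M"
      by (rule AE_all_countable[THEN iffD2])
    then show "AE x in lborel. x \<in> X \<longrightarrow> d (x, \<theta>) = 0"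
    proof (rule AE_space_mono, intro impI)
      fix x assume "\<forall>n. x \<in> X \<longrightarrow> \<bar>d (x, \<theta>)\<bar> \<le> q ^ n * M" "x \<in> X"
      then have le: "\<bar>d (x, \<theta>)\<bar> \<le> q ^ n * M" for n by blast
      have "(\<lambda>n. q ^ n * M) \<longlonglongrightarrow> 0 * M"
        by (intro tendsto_mult tendsto_const LIMSEQ_realpow_zero q_nonneg q_less)
      then have "\<bar>d (x, \<theta>)\<bar> \<le> 0" by (intro LIMSEQ_le_const[of "\<lambda>n. q ^ n * M"]) (use le in auto)
      then show "d (x, \<theta>) = 0" by simp
    qed
  qed
qed

end

context extended_coefficients
begin

text \<open>Along almost every chord \<open>chord_representation\<close> gives \<open>u = E f + J (K u + S)\<close>, so the difference
  from the Neumann series is almost everywhere a fixed point of \<open>L\<close>.\<close>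

theorem solution_unique:
  assumes sol: "transport_solution X \<sigma> k S' f u" and S: "bounded_borel S" and f: "bounded_borel f" "line_inv f"
    and SS: "AE \<theta> in sphere_measure. AE x in lborel. x \<in> X \<longrightarrow> S' (x, \<theta>) = S (x, \<theta>)"
  shows "AE \<theta> in sphere_measure. AE x in lborel. x \<in> X \<longrightarrow> u (x, \<theta>) = sol S f (x, \<theta>)"
proof -
  have uL: "u \<in> Linf (phase_measure X)" and str: "streaming_eq X u (\<lambda>z. transport_op \<sigma> k u z + S' z)"
    and infl: "inflow_trace X u f" using sol by (auto simp: transport_solution_def)
  obtain v where v: "bounded_borel v" "AE z in phase_measure X. v z = u z"
    by (rule bounded_borel_representative[OF uL])
  have h: "bounded_borel (\<lambda>z. K v z + S z)" by (intro bounded_borel_add K_bounded_borel v S)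
  \<comment> \<open>Scattering integrates over directions and does not see the choice of representative.\<close>
  have uv1: "AE x in lborel. x \<in> X \<longrightarrow> (\<forall>\<theta>. K u (x, \<theta>) = K v (x, \<theta>))"
    using phase_AE(1)[OF v(2)]
  proof (rule AE_space_mono, intro impI allI)
    fix x \<theta> assume "x \<in> X \<longrightarrow> (AE \<theta> in sphere_measure. v (x, \<theta>) = u (x, \<theta>))" "x \<in> X"
    then have ae: "AE \<theta> in sphere_measure. u (x, \<theta>) = v (x, \<theta>)" by auto
    have u_m: "(\<lambda>\<theta>'. u (x, \<theta>')) \<in> borel_measurable sphere_measure"
    proof -
      have "u \<in> borel_measurable (phase_measure X)" using uL by (simp add: Linf_def)
      moreover have "x \<in> space (restrict_space lborel X)" using \<open>x \<in> X\<close> by (simp add: space_restrict_space)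
      ultimately show ?thesis unfolding phase_measure_def by (metis measurable_Pair1' measurable_compose)
    qed
    note [measurable] = u_m section_meas[OF bounded_borel_meas[OF v(1)], of x]
    show "K u (x, \<theta>) = K v (x, \<theta>)"
      unfolding K_def fst_conv snd_conv
      by (intro integral_cong_AE borel_measurable_times kk_section u_m section_meas[OF bounded_borel_meas[OF v(1)]])
        (use ae in \<open>auto elim!: eventually_mono\<close>)
  qed
  have rep: "AE \<theta> in sphere_measure. AE x in lborel. x \<in> X \<longrightarrow>
      u (x, \<theta>) = E (x, \<theta>) * f (x, \<theta>) + J (\<lambda>z. K v z + S z) (x, \<theta>)"
    using SS phase_AE(2)[OF str[unfolded streaming_eq_def]] inflow_AE[OF infl[unfolded inflow_trace_def]] AE_space
  proof eventually_elim
    case (elim \<theta>)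
    have \<theta>: "\<theta> \<in> S2" using elim(4) by simp
    let ?g = "\<lambda>x. transport_op \<sigma> k u (x, \<theta>) + S' (x, \<theta>)"
    have "AE x in lborel. x \<in> X \<longrightarrow> ?g x = (K v (x, \<theta>) + S (x, \<theta>)) - s x * u (x, \<theta>)"
      using elim(1) uv1 by eventually_elim (auto simp: transport_op_eq[OF _ \<theta>])
    note g = chord_AE[OF this, of \<theta>]
    from elim(2) have "AE x in lborel. x \<in> X \<longrightarrow> (\<forall>T\<ge>0. (\<forall>r\<in>{0..T}. x + r *\<^sub>R \<theta> \<in> X) \<longrightarrow>
        set_integrable lborel {0..T} (\<lambda>r. ?g (x + r *\<^sub>R \<theta>)) \<and>
        u (x + T *\<^sub>R \<theta>, \<theta>) - u (x, \<theta>) = (LINT r:{0..T}|lborel. ?g (x + r *\<^sub>R \<theta>)))" by simp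
    note st = chord_AE[OF this, of \<theta>]
    show ?case
      using g st elim(3)
    proof eventually_elim
      case (elim x)
      show ?case
      proof
        assume x: "x \<in> X"
        have fy: "f (x - \<tau> x \<theta> *\<^sub>R \<theta>, \<theta>) = f (x, \<theta>)" using line_invD[OF f(2), of x "- \<tau> x \<theta>" \<theta>] by simp
        have lim: "((\<lambda>t. u (x - \<tau> x \<theta> *\<^sub>R \<theta> + t *\<^sub>R \<theta>, \<theta>)) \<longlongrightarrow> f (x, \<theta>)) (at_right 0)"
          using elim(3) x fy by simp
        show "u (x, \<theta>) = E (x, \<theta>) * f (x, \<theta>) + J (\<lambda>z. K v z + S z) (x, \<theta>)"
          by (rule chord_representation[OF \<theta> x h elim(1) elim(2) lim])
      qed
    qed
  qed
  define d where "d = (\<lambda>z. v z - sol S f z)"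
  have d: "bounded_borel d" unfolding d_def by (intro bounded_borel_diff v sol_bounded_borel S f)
  have uv2: "AE \<theta> in sphere_measure. AE x in lborel. x \<in> X \<longrightarrow> v (x, \<theta>) = u (x, \<theta>)"
    by (rule phase_AE(2)[OF v(2)])
  have "AE \<theta> in sphere_measure. AE x in lborel. x \<in> X \<longrightarrow> d (x, \<theta>) = L d (x, \<theta>)"
    using rep uv2
  proof eventually_elim
    case (elim \<theta>)
    then show ?case
    proof eventually_elim
      case (elim x)
      have "L d (x, \<theta>) = L v (x, \<theta>) - L (sol S f) (x, \<theta>)"
        unfolding d_def by (intro L_diff v sol_bounded_borel S f)
      moreover have "J (\<lambda>z. K v z + S z) (x, \<theta>) = L v (x, \<theta>) + J S (x, \<theta>)"
        unfolding L_def by (intro J_add K_bounded_borel v S)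
      ultimately show ?case using elim sol_eq_L[OF S f(1), of "(x, \<theta>)"] by (auto simp: d_def)
    qed
  qed
  from contraction_AE[OF d this] uv2 show ?thesis
  proof eventually_elim
    case (elim \<theta>)
    then show ?case by eventually_elim (auto simp: d_def)
  qed
qed

text \<open>Along almost every line the trace is the limit of \<open>u\<close> at the exit, and \<open>u\<close> agrees with the
  Neumann series at almost every point of the line.\<close>

theorem exit_value:
  assumes sol: "transport_solution X \<sigma> k S' f u" and S: "bounded_borel S" and f: "bounded_borel f" "line_inv f"
    and SS: "AE \<theta> in sphere_measure. AE x in lborel. x \<in> X \<longrightarrow> S' (x, \<theta>) = S (x, \<theta>)"
    and tr: "outflow_trace X u g"
  shows "AE \<theta> in sphere_measure. AE x in lborel. x \<in> X \<longrightarrow>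
    g (x + \<tau> x (- \<theta>) *\<^sub>R \<theta>, \<theta>) = sol S f (x + \<tau> x (- \<theta>) *\<^sub>R \<theta>, \<theta>)"
  using solution_unique[OF sol S f SS] outflow_AE[OF tr[unfolded outflow_trace_def]] AE_space
proof eventually_elim
  case (elim \<theta>)
  have \<theta>: "\<theta> \<in> S2" "- \<theta> \<in> S2" using elim(3) by simp_all
  from chord_AE[OF elim(1), of \<theta>] elim(2) show ?case
  proof eventually_elim
    case (elim x)
    show ?case
    proof
      assume x: "x \<in> X"
      define T where "T = \<tau> x (- \<theta>)"
      define y where "y = x + T *\<^sub>R \<theta>"
      have T: "0 < T" unfolding T_def by (rule tau_pos[OF \<theta>(2) x])
      have inside: "y - t *\<^sub>R \<theta> \<in> X" if "0 < t" "t < T" for t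
      proof -
        have "x - (T - t) *\<^sub>R (- \<theta>) \<in> X" using that by (intro inside_chord) (auto simp: T_def)
        then show ?thesis by (simp add: y_def algebra_simps)
      qed
      have l1: "((\<lambda>t. u (y - t *\<^sub>R \<theta>, \<theta>)) \<longlongrightarrow> g (y, \<theta>)) (at_right 0)"
        using elim(2) x by (simp add: y_def T_def)
      have l2: "((\<lambda>t. sol S f (y - t *\<^sub>R \<theta>, \<theta>)) \<longlongrightarrow> sol S f (y, \<theta>)) (at_right 0)"
        by (rule sol_exit_limit[OF S f \<theta>(1) T inside])
      have "x - (- T + 1 * t) *\<^sub>R \<theta> = y - t *\<^sub>R \<theta>" for t by (simp add: y_def algebra_simps)
      then have "AE t in lborel. y - t *\<^sub>R \<theta> \<in> X \<longrightarrow> u (y - t *\<^sub>R \<theta>, \<theta>) = sol S f (y - t *\<^sub>R \<theta>, \<theta>)"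
        using AE_lborel_affine[OF elim(1), of 1 "- T"] by simp
      then have "AE t in lborel. 0 < t \<and> t < T \<longrightarrow> u (y - t *\<^sub>R \<theta>, \<theta>) - sol S f (y - t *\<^sub>R \<theta>, \<theta>) = 0"
        by eventually_elim (use inside in auto)
      then have "g (y, \<theta>) - sol S f (y, \<theta>) = 0"
        by (rule limit_zero_of_AE_zero[OF tendsto_diff[OF l1 l2] T])
      then show "g (x + \<tau> x (- \<theta>) *\<^sub>R \<theta>, \<theta>) = sol S f (x + \<tau> x (- \<theta>) *\<^sub>R \<theta>, \<theta>)"
        by (simp add: y_def T_def)
    qed
  qed
qed

end

section \<open>Narrow beams scatter little\<close>

lemma integral_lorentz_le:
  fixes c r :: real
  assumes "0 < r" "0 \<le> T"
  shows "(LINT t:{0..T}|lborel. r\<^sup>2 / (r\<^sup>2 + (t - c)\<^sup>2)) \<le> pi * r"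
    and "set_integrable lborel {0..T} (\<lambda>t. r\<^sup>2 / (r\<^sup>2 + (t - c)\<^sup>2))"
proof -
  have pos: "0 < r\<^sup>2 + (t - c)\<^sup>2" for t using assms by (simp add: add_pos_nonneg)
  show int: "set_integrable lborel {0..T} (\<lambda>t. r\<^sup>2 / (r\<^sup>2 + (t - c)\<^sup>2))"
    by (rule set_integrable_bounded[where M=1]) (use pos in \<open>auto simp: abs_div_pos field_simps\<close>)
  have der: "((\<lambda>t. r * arctan ((t - c) / r)) has_real_derivative r\<^sup>2 / (r\<^sup>2 + (t - c)\<^sup>2)) (at t)" for t
  proof -
    have "((\<lambda>t. r * arctan ((t - c) / r)) has_real_derivative r * (inverse (1 + ((t - c) / r)\<^sup>2) * (1 / r))) (at t)"
      using assms by (auto intro!: derivative_eq_intros)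
    moreover have "r * (inverse (1 + ((t - c) / r)\<^sup>2) * (1 / r)) = r\<^sup>2 / (r\<^sup>2 + (t - c)\<^sup>2)"
    proof -
      have "1 + ((t - c) / r)\<^sup>2 = (r\<^sup>2 + (t - c)\<^sup>2) / r\<^sup>2"
        using assms by (simp add: power_divide add_divide_distrib)
      then show ?thesis using assms by simp
    qed
    ultimately show ?thesis by simp
  qed
  have "((\<lambda>t. r\<^sup>2 / (r\<^sup>2 + (t - c)\<^sup>2)) has_integral r * arctan ((T - c) / r) - r * arctan ((0 - c) / r)) {0..T}"
    by (rule fundamental_theorem_of_calculus[OF assms(2)])
      (use der in \<open>auto simp: has_real_derivative_iff_has_vector_derivative[symmetric] intro: has_field_derivative_at_within\<close>)
  then have "(LINT t:{0..T}|lborel. r\<^sup>2 / (r\<^sup>2 + (t - c)\<^sup>2)) = r * (arctan ((T - c) / r) - arctan ((0 - c) / r))"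
    by (simp add: set_borel_integral_eq_integral(2)[OF int] integral_unique algebra_simps)
  also have "\<dots> \<le> r * pi"
    using assms arctan_bounded[of "(T - c) / r"] arctan_bounded[of "(0 - c) / r"]
    by (intro mult_left_mono) linarith+
  finally show "(LINT t:{0..T}|lborel. r\<^sup>2 / (r\<^sup>2 + (t - c)\<^sup>2)) \<le> pi * r" by (simp add: mult.commute)
qed

lemma dist_line_ge:
  fixes x p \<theta> :: vec3
  assumes "norm \<theta> = 1"
  shows "(t - (x - p) \<bullet> \<theta>)\<^sup>2 \<le> (dist (x - t *\<^sub>R \<theta>) p)\<^sup>2"
proof -
  have "\<bar>(x - t *\<^sub>R \<theta> - p) \<bullet> \<theta>\<bar> \<le> norm (x - t *\<^sub>R \<theta> - p) * norm \<theta>" by (rule Cauchy_Schwarz_ineq2)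
  moreover have "(x - t *\<^sub>R \<theta> - p) \<bullet> \<theta> = (x - p) \<bullet> \<theta> - t"
    using assms by (simp add: inner_diff_left norm_eq_1)
  ultimately have "\<bar>t - (x - p) \<bullet> \<theta>\<bar> \<le> \<bar>dist (x - t *\<^sub>R \<theta>) p\<bar>"
    using assms by (simp add: dist_norm)
  then show ?thesis by (rule abs_le_square_iff[THEN iffD1])
qed

context coefficients
begin

definition beam_const :: real where "beam_const = 5760 * pi * Kmax / (1 - q)"

lemma beam_const_nonneg: "0 \<le> beam_const"
  using Kmax_nonneg q_less by (simp add: beam_const_def)

text \<open>Of a beam of lines meeting a ball of radius \<open>r\<close>, a point at distance \<open>d\<close> sees a solid angle
  \<open>O(r\<^sup>2 / (r\<^sup>2 + d\<^sup>2))\<close>; integrated along any line this is \<open>O(r)\<close>.\<close>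

lemma L_beam:
  assumes g: "bounded_borel g" and A: "0 \<le> A" and r: "0 < r"
    and beam: "\<And>x \<theta>. \<theta> \<in> S2 \<Longrightarrow> \<bar>g (x, \<theta>)\<bar> \<le> (if hits_ball p r x \<theta> then A else 0)"
  shows "\<bar>L g z\<bar> \<le> 5760 * pi * Kmax * A * r"
proof (cases "snd z \<in> S2")
  case False
  then have "\<tau> (fst z) (snd z) = 0" by (simp add: back_time_def)
  then have "\<bar>L g z\<bar> \<le> \<bar>att s (fst z) (snd z) 0 * K g (fst z - 0 *\<^sub>R snd z, snd z)\<bar> * (0 - 0)"
    unfolding L_def J_def by (intro order_trans[OF set_integral_bound]) auto
  then show ?thesis using A r Kmax_nonneg by simp
next
  case True
  obtain x \<theta> where z: "z = (x, \<theta>)" by force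
  have \<theta>: "norm \<theta> = 1" using True z by simp
  define D where "D = 5760 * Kmax * A"
  have D: "0 \<le> D" using A Kmax_nonneg by (simp add: D_def)
  have Kg: "\<bar>K g (y, \<theta>)\<bar> \<le> D * (r\<^sup>2 / (r\<^sup>2 + (dist y p)\<^sup>2))" for y
  proof -
    let ?H = "{\<theta>' \<in> S2. hits_ball p r y \<theta>'}"
    have "\<bar>K g (y, \<theta>)\<bar> \<le> (LINT \<theta>'|sphere_measure. norm (kk y \<theta> \<theta>' * g (y, \<theta>')))"
      unfolding K_def fst_conv snd_conv real_norm_def[symmetric] by (rule integral_norm_bound)
    also have "\<dots> \<le> (LINT \<theta>'|sphere_measure. (Kmax * A) * indicator ?H \<theta>')"
    proof (rule integral_mono)
      show "integrable sphere_measure (\<lambda>\<theta>'. norm (kk y \<theta> \<theta>' * g (y, \<theta>')))"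
        by (intro integrable_norm kk_u_int g)
      show "integrable sphere_measure (\<lambda>\<theta>'. (Kmax * A) * indicator ?H \<theta>')"
        using sets_hits_ball by (intro integrable_mult_right integrable_real_indicator) (auto simp: sphere.emeasure_eq_measure)
      fix \<theta>' assume "\<theta>' \<in> space sphere_measure"
      then have "\<bar>kk y \<theta> \<theta>'\<bar> * \<bar>g (y, \<theta>')\<bar> \<le> Kmax * (if hits_ball p r y \<theta>' then A else 0)"
        using kk_nonneg kk_le Kmax_nonneg beam by (intro mult_mono) auto
      then show "norm (kk y \<theta> \<theta>' * g (y, \<theta>')) \<le> (Kmax * A) * indicator ?H \<theta>'"
        using \<open>\<theta>' \<in> space sphere_measure\<close> by (auto simp: abs_mult indicator_def)
    qed
    also have "\<dots> = Kmax * A * measure sphere_measure ?H"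
    proof -
      have "?H \<inter> S2 = ?H" by auto
      then show ?thesis by simp
    qed
    also have "\<dots> \<le> Kmax * A * (5760 * (r\<^sup>2 / (r\<^sup>2 + (dist y p)\<^sup>2)))"
      using A Kmax_nonneg r by (intro mult_left_mono measure_hits_ball_le) auto
    finally show ?thesis by (simp add: D_def mult_ac)
  qed
  define c where "c = (x - p) \<bullet> \<theta>"
  have "\<bar>L g z\<bar> \<le> (LINT t:{0..\<tau> x \<theta>}|lborel. \<bar>att s x \<theta> t * K g (x - t *\<^sub>R \<theta>, \<theta>)\<bar>)"
    using set_integral_norm_bound[OF att_h_int[OF K_bounded_borel[OF g], of 0 "\<tau> x \<theta>" x \<theta>]] by (simp add: L_def J_def z)
  also have "\<dots> \<le> (LINT t:{0..\<tau> x \<theta>}|lborel. D * (r\<^sup>2 / (r\<^sup>2 + (t - c)\<^sup>2)))"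
  proof (rule set_integral_mono)
    show "set_integrable lborel {0..\<tau> x \<theta>} (\<lambda>t. \<bar>att s x \<theta> t * K g (x - t *\<^sub>R \<theta>, \<theta>)\<bar>)"
      by (intro set_integrable_abs att_h_int K_bounded_borel g)
    show "set_integrable lborel {0..\<tau> x \<theta>} (\<lambda>t. D * (r\<^sup>2 / (r\<^sup>2 + (t - c)\<^sup>2)))"
      using integral_lorentz_le(2)[OF r tau_nonneg] by (rule set_integrable_mult_right)
    fix t
    have "\<bar>att s x \<theta> t\<bar> * \<bar>K g (x - t *\<^sub>R \<theta>, \<theta>)\<bar> \<le> 1 * (D * (r\<^sup>2 / (r\<^sup>2 + (dist (x - t *\<^sub>R \<theta>) p)\<^sup>2)))"
      using att_pos[of x \<theta> t] att_le_1[of x \<theta> t] by (intro mult_mono Kg) auto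
    also have "\<dots> \<le> D * (r\<^sup>2 / (r\<^sup>2 + (t - c)\<^sup>2))"
      using dist_line_ge[OF \<theta>, of t x p] D r
      by (auto simp: c_def intro!: mult_left_mono divide_left_mono mult_pos_pos add_pos_nonneg)
    finally show "\<bar>att s x \<theta> t * K g (x - t *\<^sub>R \<theta>, \<theta>)\<bar> \<le> D * (r\<^sup>2 / (r\<^sup>2 + (t - c)\<^sup>2))"
      by (simp add: abs_mult)
  qed
  also have "\<dots> \<le> D * (pi * r)"
    unfolding set_integral_mult_right by (intro mult_left_mono integral_lorentz_le(1) r tau_nonneg D)
  finally show ?thesis by (simp add: D_def mult_ac)
qed

text \<open>The scattered part \<open>res g - g\<close> is the Neumann series of \<open>L g\<close>, which is uniformly \<open>O(A r)\<close>.\<close>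

lemma res_beam:
  assumes g: "bounded_borel g" and A: "0 \<le> A" and r: "0 < r"
    and beam: "\<And>x \<theta>. \<theta> \<in> S2 \<Longrightarrow> \<bar>g (x, \<theta>)\<bar> \<le> (if hits_ball p r x \<theta> then A else 0)"
  shows "\<bar>res g z - g z\<bar> \<le> beam_const * A * r"
proof -
  obtain G where G: "\<And>z. \<bar>g z\<bar> \<le> G" using g bounded_borelE by blast
  note rg = res_bounded_borel[OF g G]
  note Lb = L_bounded_borel[OF g]
  have "(\<lambda>z. res g z - g z) = res (L g)"
  proof (rule res_unique)
    fix z
    have "L (\<lambda>z. res g z - g z) z = L (res g) z - L g z" by (rule L_diff[OF rg g])
    then show "res g z - g z = L g z + L (\<lambda>z. res g z - g z) z" using res_eq[OF g G, of z] by simp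
  qed (intro bounded_borel_diff rg g Lb)+
  then have "res g z - g z = res (L g) z" by metis
  also have "\<bar>\<dots>\<bar> \<le> 5760 * pi * Kmax * A * r / (1 - q)"
    by (rule res_bound[OF Lb L_beam[OF g A r beam]])
  finally show ?thesis by (simp add: beam_const_def)
qed

text \<open>A line meets the ball in a segment of length at most \<open>2 r\<close>, so \<open>J S\<close> is a beam of height \<open>2 r M\<close>.\<close>

lemma sol_concentrated_source:
  assumes S: "bounded_borel S" and M: "0 \<le> M" and r: "0 < r"
    and conc: "\<And>x \<theta>. \<bar>S (x, \<theta>)\<bar> \<le> (if dist x p < r then M else 0)"
  shows "\<bar>sol S (\<lambda>_. 0) z - J S z\<bar> \<le> beam_const * (2 * r * M) * r"
proof -
  have "\<bar>J S (x, \<theta>)\<bar> \<le> (if hits_ball p r x \<theta> then 2 * r * M else 0)" if \<theta>: "\<theta> \<in> S2" for x \<theta>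
  proof (cases "hits_ball p r x \<theta>")
    case False
    have "S (x - t *\<^sub>R \<theta>, \<theta>) = 0" for t
    proof -
      have "\<not> dist (x + (- t) *\<^sub>R \<theta>) p < r" using False unfolding hits_ball_def by blast
      then show ?thesis using conc[of "x - t *\<^sub>R \<theta>" \<theta>] by simp
    qed
    then show ?thesis using False by (simp add: J_def)
  next
    case True
    define c where "c = (x - p) \<bullet> \<theta>"
    have "\<bar>J S (x, \<theta>)\<bar> \<le> (LINT t|lborel. norm (indicator {0..\<tau> x \<theta>} t *\<^sub>R (att s x \<theta> t * S (x - t *\<^sub>R \<theta>, \<theta>))))"
      unfolding J_def fst_conv snd_conv set_lebesgue_integral_def real_norm_def[symmetric] by (rule integral_norm_bound)
    also have "\<dots> \<le> (LINT t|lborel. M * indicator {c - r..c + r} t)"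
    proof (rule integral_mono)
      show "integrable lborel (\<lambda>t. norm (indicator {0..\<tau> x \<theta>} t *\<^sub>R (att s x \<theta> t * S (x - t *\<^sub>R \<theta>, \<theta>))))"
        using att_h_int[OF S, of 0 "\<tau> x \<theta>" x \<theta>] unfolding set_integrable_def by (rule integrable_norm)
      show "integrable lborel (\<lambda>t. M * indicator {c - r..c + r} t)"
        by (intro integrable_mult_right integrable_real_indicator) (auto simp: emeasure_lborel_Icc_eq)
      fix t
      have "\<bar>S (x - t *\<^sub>R \<theta>, \<theta>)\<bar> \<le> M * indicator {c - r..c + r} t"
      proof (cases "dist (x - t *\<^sub>R \<theta>) p < r")
        case True
        have "(t - c)\<^sup>2 \<le> (dist (x - t *\<^sub>R \<theta>) p)\<^sup>2" unfolding c_def using \<theta> by (intro dist_line_ge) simp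
        then have "\<bar>t - c\<bar> \<le> \<bar>dist (x - t *\<^sub>R \<theta>) p\<bar>" by (rule abs_le_square_iff[THEN iffD2])
        then have "t \<in> {c - r..c + r}" using True by auto
        then show ?thesis using conc[of "x - t *\<^sub>R \<theta>" \<theta>] True by simp
      next
        case False
        then show ?thesis using conc[of "x - t *\<^sub>R \<theta>" \<theta>] M by (simp add: indicator_def)
      qed
      then have "\<bar>att s x \<theta> t\<bar> * \<bar>S (x - t *\<^sub>R \<theta>, \<theta>)\<bar> \<le> 1 * (M * indicator {c - r..c + r} t)"
        using att_pos[of x \<theta> t] att_le_1[of x \<theta> t] by (intro mult_mono) auto
      then show "norm (indicator {0..\<tau> x \<theta>} t *\<^sub>R (att s x \<theta> t * S (x - t *\<^sub>R \<theta>, \<theta>))) \<le> M * indicator {c - r..c + r} t"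
        using M by (cases "t \<in> {0..\<tau> x \<theta>}") (simp_all add: abs_mult)
    qed
    also have "\<dots> = 2 * r * M" using r by simp
    finally show ?thesis using True by simp
  qed
  note beam = this
  show ?thesis
    using res_beam[OF J_bounded_borel[OF S] _ r beam] M r by (simp add: sol_def)
qed

lemma sol_beam_inflow:
  assumes f: "bounded_borel f" and r: "0 < r"
    and beam: "\<And>x \<theta>. \<bar>f (x, \<theta>)\<bar> \<le> (if hits_ball p r x \<theta> then 1 else 0)"
  shows "\<bar>sol (\<lambda>_. 0) f z - E z * f z\<bar> \<le> beam_const * r"
proof -
  have J0: "J (\<lambda>_. 0) z = 0" for z by (simp add: J_def)
  have "\<bar>E (x, \<theta>) * f (x, \<theta>)\<bar> \<le> (if hits_ball p r x \<theta> then 1 else 0)" for x \<theta>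
  proof -
    have "\<bar>E (x, \<theta>)\<bar> * \<bar>f (x, \<theta>)\<bar> \<le> 1 * (if hits_ball p r x \<theta> then 1 else 0)"
      using E_bounds[of "(x, \<theta>)"] beam by (intro mult_mono) auto
    then show ?thesis by (simp add: abs_mult)
  qed
  note b = this
  have "\<bar>res (\<lambda>z. E z * f z) z - E z * f z\<bar> \<le> beam_const * 1 * r"
    by (rule res_beam[OF bounded_borel_mult[OF E_bounded_borel f] _ r b]) auto
  then show ?thesis by (simp add: sol_def J0)
qed

lemma J_cong:
  assumes g: "bounded_borel g" and h: "bounded_borel h" and "\<And>x \<theta>. x \<in> X \<Longrightarrow> g (x, \<theta>) = h (x, \<theta>)"
  shows "J g = J h"
proof
  fix z :: "vec3 \<times> vec3"
  let ?T = "\<tau> (fst z) (snd z)"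
  show "J g z = J h z"
    unfolding J_def set_lebesgue_integral_def
  proof (rule integral_cong_AE)
    show "AE t in lborel. indicator {0..?T} t *\<^sub>R (att s (fst z) (snd z) t * g (fst z - t *\<^sub>R snd z, snd z)) =
        indicator {0..?T} t *\<^sub>R (att s (fst z) (snd z) t * h (fst z - t *\<^sub>R snd z, snd z))"
      using AE_lborel_singleton[of "0::real"] AE_lborel_singleton[of ?T]
      by eventually_elim (auto simp: indicator_def assms(3) inside_chord)
  qed (rule borel_measurable_integrable[OF att_h_int[OF g, unfolded set_integrable_def]]
      borel_measurable_integrable[OF att_h_int[OF h, unfolded set_integrable_def]])+
qed

lemma sol_bound_source_on:
  assumes S: "bounded_borel S" and M: "\<And>x \<theta>. x \<in> X \<Longrightarrow> \<bar>S (x, \<theta>)\<bar> \<le> M" "0 \<le> M"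
  shows "\<bar>sol S (\<lambda>_. 0) z\<bar> \<le> M * (2 * R) / (1 - q)"
proof -
  define S' where "S' = (\<lambda>z. (indicator (X \<times> UNIV) z :: real) * S z)"
  have "bounded_borel (indicator (X \<times> UNIV) :: vec3 \<times> vec3 \<Rightarrow> real)"
  proof (rule bounded_borelI[where M=1])
    have "X \<times> (UNIV :: vec3 set) \<in> sets borel" using X_open by (intro borel_open open_Times) auto
    then show "(indicator (X \<times> UNIV) :: vec3 \<times> vec3 \<Rightarrow> real) \<in> borel_measurable borel" by measurable
  qed (simp add: indicator_def)
  then have S': "bounded_borel S'" unfolding S'_def by (intro bounded_borel_mult S)
  have "J S = J S'" by (rule J_cong[OF S S']) (simp add: S'_def indicator_def)
  then have "sol S (\<lambda>_. 0) = sol S' (\<lambda>_. 0)" by (simp add: sol_def)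
  moreover have "\<bar>S' z\<bar> \<le> M" for z using M by (cases z) (auto simp: S'_def indicator_def)
  ultimately show ?thesis using sol_bound_source[OF S', of M z] by simp
qed

end

section \<open>Trigonometric polynomials\<close>

text \<open>A countable set of frequencies, so that the exceptional null sets of all these measurements can
  be united.\<close>

definition rational_vec :: "vec3 \<Rightarrow> bool" where
  "rational_vec Q \<longleftrightarrow> (\<forall>i. Q $ i \<in> \<rat>)"

lemma rational_vec_add: "rational_vec P \<Longrightarrow> rational_vec Q \<Longrightarrow> rational_vec (P + Q)"
  and rational_vec_diff: "rational_vec P \<Longrightarrow> rational_vec Q \<Longrightarrow> rational_vec (P - Q)"
  by (simp_all add: rational_vec_def)

lemma countable_rational_vec: "countable {Q. rational_vec Q}"
proof -
  have "{Q. rational_vec Q} \<subseteq> (\<lambda>(a, b, c). vector [a, b, c]) ` (\<rat> \<times> \<rat> \<times> \<rat>)"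
  proof
    fix Q assume "Q \<in> {Q. rational_vec Q}"
    then have "(Q $ 1, Q $ 2, Q $ 3) \<in> \<rat> \<times> \<rat> \<times> \<rat>" by (simp add: rational_vec_def)
    moreover have "Q = (\<lambda>(a, b, c). vector [a, b, c]) (Q $ 1, Q $ 2, Q $ 3)"
      by (simp add: vec_eq_iff forall_3)
    ultimately show "Q \<in> (\<lambda>(a, b, c). vector [a, b, c]) ` (\<rat> \<times> \<rat> \<times> \<rat>)" by (rule rev_image_eqI)
  qed
  moreover have "countable ((\<lambda>(a, b, c). vector [a, b, c] :: vec3) ` (\<rat> \<times> \<rat> \<times> \<rat>))"
    by (intro countable_image countable_SIGMA countable_rat)
  ultimately show ?thesis by (rule countable_subset)
qed

inductive trig_poly :: "(vec3 \<Rightarrow> real) \<Rightarrow> bool" where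
  cos: "rational_vec Q \<Longrightarrow> trig_poly (\<lambda>x. c * cos (Q \<bullet> x))"
| sin: "rational_vec Q \<Longrightarrow> trig_poly (\<lambda>x. c * sin (Q \<bullet> x))"
| add: "trig_poly f \<Longrightarrow> trig_poly g \<Longrightarrow> trig_poly (\<lambda>x. f x + g x)"

inductive cos_poly :: "(vec3 \<Rightarrow> real) \<Rightarrow> bool" where
  cos: "rational_vec Q \<Longrightarrow> cos_poly (\<lambda>x. c * cos (Q \<bullet> x))"
| add: "cos_poly f \<Longrightarrow> cos_poly g \<Longrightarrow> cos_poly (\<lambda>x. f x + g x)"

lemma rational_vec_zero: "rational_vec 0" by (simp add: rational_vec_def)

lemma trig_poly_continuous: "trig_poly f \<Longrightarrow> continuous_on S f"
  by (induction rule: trig_poly.induct) (auto intro!: continuous_intros)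

lemma trig_poly_mult_cos:
  assumes P: "rational_vec P" and "trig_poly g"
  shows "trig_poly (\<lambda>x. (a * cos (P \<bullet> x)) * g x)" "trig_poly (\<lambda>x. (a * sin (P \<bullet> x)) * g x)"
  using assms(2)
proof (induction rule: trig_poly.induct)
  case (cos Q c)
  note R = rational_vec_diff[OF P cos] rational_vec_add[OF P cos] rational_vec_diff[OF cos P]
  { case 1
    have "(\<lambda>x. (a * cos (P \<bullet> x)) * (c * cos (Q \<bullet> x))) =
        (\<lambda>x. (a * c / 2) * cos ((P - Q) \<bullet> x) + (a * c / 2) * cos ((P + Q) \<bullet> x))"
      by (auto simp: inner_diff_left inner_add_left cos_diff cos_add algebra_simps)
    then show ?case using R by (simp only:) (intro trig_poly.intros; assumption)
  next
    case 2
    have "(\<lambda>x. (a * sin (P \<bullet> x)) * (c * cos (Q \<bullet> x))) =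
        (\<lambda>x. (a * c / 2) * sin ((P - Q) \<bullet> x) + (a * c / 2) * sin ((P + Q) \<bullet> x))"
      by (auto simp: inner_diff_left inner_add_left sin_diff sin_add algebra_simps)
    then show ?case using R by (simp only:) (intro trig_poly.intros; assumption) }
next
  case (sin Q c)
  note R = rational_vec_diff[OF P sin] rational_vec_add[OF P sin] rational_vec_diff[OF sin P]
  { case 1
    have "(\<lambda>x. (a * cos (P \<bullet> x)) * (c * sin (Q \<bullet> x))) =
        (\<lambda>x. (a * c / 2) * sin ((Q - P) \<bullet> x) + (a * c / 2) * sin ((P + Q) \<bullet> x))"
      by (auto simp: inner_diff_left inner_add_left sin_diff sin_add algebra_simps)
    then show ?case using R by (simp only:) (intro trig_poly.intros; assumption)
  next
    case 2
    have "(\<lambda>x. (a * sin (P \<bullet> x)) * (c * sin (Q \<bullet> x))) =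
        (\<lambda>x. (a * c / 2) * cos ((P - Q) \<bullet> x) + (- a * c / 2) * cos ((P + Q) \<bullet> x))"
      by (auto simp: inner_diff_left inner_add_left cos_diff cos_add algebra_simps)
    then show ?case using R by (simp only:) (intro trig_poly.intros; assumption) }
next
  case (add f g)
  { case 1
    have "(\<lambda>x. (a * cos (P \<bullet> x)) * (f x + g x)) = (\<lambda>x. (a * cos (P \<bullet> x)) * f x + (a * cos (P \<bullet> x)) * g x)"
      by (auto simp: algebra_simps)
    then show ?case using trig_poly.add[OF add.IH(1,3)] by simp
  next
    case 2
    have "(\<lambda>x. (a * sin (P \<bullet> x)) * (f x + g x)) = (\<lambda>x. (a * sin (P \<bullet> x)) * f x + (a * sin (P \<bullet> x)) * g x)"
      by (auto simp: algebra_simps)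
    then show ?case using trig_poly.add[OF add.IH(2,4)] by simp }
qed

lemma trig_poly_mult: "trig_poly f \<Longrightarrow> trig_poly g \<Longrightarrow> trig_poly (\<lambda>x. f x * g x)"
proof (induction f rule: trig_poly.induct)
  case (add f h)
  have "(\<lambda>x. (f x + h x) * g x) = (\<lambda>x. f x * g x + h x * g x)" by (auto simp: algebra_simps)
  then show ?case using trig_poly.add[OF add.IH] add.prems by simp
qed (auto intro: trig_poly_mult_cos)

lemma trig_poly_even_part: "trig_poly f \<Longrightarrow> cos_poly (\<lambda>x. f x + f (- x))"
proof (induction rule: trig_poly.induct)
  case (cos Q c)
  have "(\<lambda>x. c * cos (Q \<bullet> x) + c * cos (Q \<bullet> - x)) = (\<lambda>x. (2 * c) * cos (Q \<bullet> x))" by (auto simp: algebra_simps)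
  then show ?case using cos_poly.cos[OF cos, of "2 * c"] by simp
next
  case (sin Q c)
  have "(\<lambda>x. c * sin (Q \<bullet> x) + c * sin (Q \<bullet> - x)) = (\<lambda>x. 0 * cos (0 \<bullet> x))" by auto
  then show ?case using cos_poly.cos[OF rational_vec_zero, of 0] by simp
next
  case (add f g)
  have "(\<lambda>x. f x + g x + (f (- x) + g (- x))) = (\<lambda>x. (f x + f (- x)) + (g x + g (- x)))" by auto
  then show ?case using cos_poly.add[OF add.IH] by simp
qed

text \<open>Stone--Weierstrass. Rational frequencies separate points because arbitrarily small
  frequencies are available.\<close>

lemma trig_poly_dense:
  assumes "continuous_on (cball 0 R) f" "0 < (e::real)"
  obtains g where "trig_poly g" "\<And>x. x \<in> cball 0 R \<Longrightarrow> \<bar>f x - g x\<bar> < e"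
proof -
  have "\<exists>g. trig_poly g \<and> (\<forall>x\<in>cball 0 R. \<bar>f x - g x\<bar> < e)"
  proof (rule Stone_Weierstrass_HOL[where P=trig_poly])
    show "trig_poly (\<lambda>x. c)" for c using trig_poly.cos[OF rational_vec_zero, of c] by simp
    fix x y :: vec3 assume "x \<in> cball 0 R \<and> y \<in> cball 0 R \<and> x \<noteq> y"
    then obtain i where i: "x $ i \<noteq> y $ i" by (auto simp: vec_eq_iff)
    define d where "d = x $ i - y $ i"
    have d: "d \<noteq> 0" using i by (simp add: d_def)
    obtain n :: nat where n: "\<bar>d\<bar> < real n" using reals_Archimedean2 by blast
    define Q :: vec3 where "Q = axis i (1 / real n)"
    have n0: "0 < real n" using n by linarith
    have Q: "rational_vec Q" by (auto simp: rational_vec_def Q_def axis_def)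
    have Qx: "Q \<bullet> z = z $ i / real n" for z by (simp add: Q_def inner_axis')
    have "\<not> (cos (Q \<bullet> x) = cos (Q \<bullet> y) \<and> sin (Q \<bullet> x) = sin (Q \<bullet> y))"
    proof
      assume eq: "cos (Q \<bullet> x) = cos (Q \<bullet> y) \<and> sin (Q \<bullet> x) = sin (Q \<bullet> y)"
      have "cos (Q \<bullet> x - Q \<bullet> y) = 1"
        using eq sin_cos_squared_add[of "Q \<bullet> y"] by (simp add: cos_diff power2_eq_square)
      moreover have "Q \<bullet> x - Q \<bullet> y = d / real n" by (simp add: Qx d_def diff_divide_distrib)
      ultimately have c1: "cos \<bar>d / real n\<bar> = cos 0" unfolding cos_abs_real by simp
      have "\<bar>d / real n\<bar> < 1" using n n0 by simp
      then have "\<bar>d / real n\<bar> \<le> pi" using pi_gt3 by linarith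
      then have "\<bar>d / real n\<bar> = 0" using cos_inj_pi[of "\<bar>d / real n\<bar>" 0] c1 by simp
      then show False using d n0 by simp
    qed
    then consider "1 * cos (Q \<bullet> x) \<noteq> 1 * cos (Q \<bullet> y)" | "1 * sin (Q \<bullet> x) \<noteq> 1 * sin (Q \<bullet> y)" by auto
    then show "\<exists>f. trig_poly f \<and> f x \<noteq> f y"
    proof cases
      case 1 then show ?thesis by (intro exI[of _ "\<lambda>x. 1 * cos (Q \<bullet> x)"] conjI trig_poly.cos Q)
    next
      case 2 then show ?thesis by (intro exI[of _ "\<lambda>x. 1 * sin (Q \<bullet> x)"] conjI trig_poly.sin Q)
    qed
  qed (use assms trig_poly_continuous trig_poly_mult in \<open>auto intro: trig_poly.add\<close>)
  then show ?thesis using that by blast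
qed

section \<open>From boundary data to weighted interior values\<close>

locale two_coefficients =
  A: extended_coefficients X R s1 kk1 q1 Smax1 Kmax1 \<sigma>1 k1 + B: extended_coefficients X R s2 kk2 q2 Smax2 Kmax2 \<sigma>2 k2
  for X R s1 kk1 q1 Smax1 Kmax1 \<sigma>1 k1 s2 kk2 q2 Smax2 Kmax2 \<sigma>2 k2

context two_coefficients
begin

lemma cos_source_bounded:
  assumes "bounded_borel u"
  shows "bounded_borel (\<lambda>z. a * cos (Q \<bullet> fst z) * u z)"
proof -
  have "bounded_borel (\<lambda>z::vec3 \<times> vec3. a * cos (Q \<bullet> fst z))"
  proof (rule bounded_borelI[where M="\<bar>a\<bar>"])
    show "(\<lambda>z::vec3 \<times> vec3. a * cos (Q \<bullet> fst z)) \<in> borel_measurable borel"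
      by (intro borel_measurable_continuous_onI continuous_intros)
    show "\<bar>a * cos (Q \<bullet> fst z)\<bar> \<le> \<bar>a\<bar>" for z :: "vec3 \<times> vec3"
      using mult_left_mono[OF abs_cos_le_one[of "Q \<bullet> fst z"], of "\<bar>a\<bar>"] by (simp add: abs_mult)
  qed
  then show ?thesis by (rule bounded_borel_mult) (fact assms)
qed

text \<open>The Neumann series of the first system represents its boundary value, hence also that of the
  second system, where exit values are those of the second Neumann series.\<close>

lemma exit_data_equal:
  assumes f: "bounded_borel f" "line_inv f" and eq: "A01 X a \<sigma>1 k1 Q f = A01 X a \<sigma>2 k2 Q f"
  shows "AE \<theta> in sphere_measure. AE x in lborel. x \<in> X \<longrightarrow>
    A.sol (\<lambda>z. a * cos (Q \<bullet> fst z) * A.sol (\<lambda>_. 0) f z) (\<lambda>_. 0) (x + back_time X x (- \<theta>) *\<^sub>R \<theta>, \<theta>) =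
    B.sol (\<lambda>z. a * cos (Q \<bullet> fst z) * B.sol (\<lambda>_. 0) f z) (\<lambda>_. 0) (x + back_time X x (- \<theta>) *\<^sub>R \<theta>, \<theta>)"
proof -
  note zero = bounded_borel_const[of 0]
  define SA where "SA = (\<lambda>z. a * cos (Q \<bullet> fst z) * A.sol (\<lambda>_. 0) f z)"
  define SB where "SB = (\<lambda>z. a * cos (Q \<bullet> fst z) * B.sol (\<lambda>_. 0) f z)"
  have SA: "bounded_borel SA" unfolding SA_def by (intro cos_source_bounded A.sol_bounded_borel zero f)
  have SB: "bounded_borel SB" unfolding SB_def by (intro cos_source_bounded B.sol_bounded_borel zero f)
  have SA': "SA = (\<lambda>(x, \<theta>). a * cos (Q \<bullet> x) * A.sol (\<lambda>_. 0) f (x, \<theta>))" by (auto simp: SA_def)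
  have "A.sol SA (\<lambda>_. 0) \<in> A01 X a \<sigma>1 k1 Q f"
    unfolding A01_def
  proof (intro CollectI conjI exI)
    show "A.sol SA (\<lambda>_. 0) \<in> Linf (outflow_measure X)"
      by (intro bounded_borel_Linf A.sol_bounded_borel SA zero)
    show "transport_solution X \<sigma>1 k1 (\<lambda>_. 0) f (A.sol (\<lambda>_. 0) f)"
      by (rule A.sol_transport_solution[OF zero f])
    show "transport_solution X \<sigma>1 k1 (\<lambda>(x, \<theta>). a * cos (Q \<bullet> x) * A.sol (\<lambda>_. 0) f (x, \<theta>)) (\<lambda>_. 0) (A.sol SA (\<lambda>_. 0))"
      using A.sol_transport_solution[OF SA zero line_inv_zero] unfolding SA' .
    show "outflow_trace X (A.sol SA (\<lambda>_. 0)) (A.sol SA (\<lambda>_. 0))"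
      by (rule A.sol_outflow_trace[OF SA zero line_inv_zero])
  qed
  then have "A.sol SA (\<lambda>_. 0) \<in> A01 X a \<sigma>2 k2 Q f" using eq by simp
  then obtain u00 u01 where u: "transport_solution X \<sigma>2 k2 (\<lambda>_. 0) f u00"
    "transport_solution X \<sigma>2 k2 (\<lambda>(x, \<theta>). a * cos (Q \<bullet> x) * u00 (x, \<theta>)) (\<lambda>_. 0) u01"
    "outflow_trace X u01 (A.sol SA (\<lambda>_. 0))" by (auto simp: A01_def)
  have "AE \<theta> in sphere_measure. AE x in lborel. x \<in> X \<longrightarrow> u00 (x, \<theta>) = B.sol (\<lambda>_. 0) f (x, \<theta>)"
    by (rule B.solution_unique[OF u(1) zero f]) simp
  then have "AE \<theta> in sphere_measure. AE x in lborel. x \<in> X \<longrightarrow>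
      (case (x, \<theta>) of (x, \<theta>) \<Rightarrow> a * cos (Q \<bullet> x) * u00 (x, \<theta>)) = SB (x, \<theta>)"
  proof eventually_elim
    case (elim \<theta>)
    then show ?case by eventually_elim (simp add: SB_def)
  qed
  from B.exit_value[OF u(2) SB zero line_inv_zero this u(3)]
  show ?thesis by (simp add: SA_def SB_def)
qed

definition exit_gap :: "(vec3 \<times> vec3 \<Rightarrow> real) \<Rightarrow> vec3 \<times> vec3 \<Rightarrow> (vec3 \<Rightarrow> real) \<Rightarrow> real" where
  "exit_gap f z \<eta> = A.sol (\<lambda>z. \<eta> (fst z) * A.sol (\<lambda>_. 0) f z) (\<lambda>_. 0) z -
    B.sol (\<lambda>z. \<eta> (fst z) * B.sol (\<lambda>_. 0) f z) (\<lambda>_. 0) z"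

definition modulation :: "(vec3 \<Rightarrow> real) \<Rightarrow> bool" where
  "modulation \<eta> \<longleftrightarrow> continuous_on UNIV \<eta> \<and> bounded (range \<eta>)"

lemma modulation_bounded_borel:
  assumes "modulation \<eta>" "bounded_borel u"
  shows "bounded_borel (\<lambda>z. \<eta> (fst z) * u z)"
proof (rule bounded_borel_mult[OF _ assms(2)])
  obtain M where M: "\<And>x. \<bar>\<eta> x\<bar> \<le> M" using assms(1) by (auto simp: modulation_def bounded_iff)
  show "bounded_borel (\<lambda>z. \<eta> (fst z))"
  proof (rule bounded_borelI[OF _ M])
    have "continuous_on UNIV (\<lambda>z::vec3 \<times> vec3. \<eta> (fst z))"
      using assms(1) by (auto intro!: continuous_on_compose2[of UNIV \<eta>] continuous_intros simp: modulation_def)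
    then show "(\<lambda>z::vec3 \<times> vec3. \<eta> (fst z)) \<in> borel_measurable borel" by (rule borel_measurable_continuous_onI)
  qed
qed

lemma modulation_add: "modulation f \<Longrightarrow> modulation g \<Longrightarrow> modulation (\<lambda>x. f x + g x)"
  by (auto simp: modulation_def intro!: continuous_intros bounded_plus_comp)

lemma modulation_cmult: "modulation f \<Longrightarrow> modulation (\<lambda>x. c * f x)"
  using bounded_scaling[of "range f" c]
  by (auto simp: modulation_def image_image intro!: continuous_intros)

lemma modulation_cos: "modulation (\<lambda>x. c * cos (Q \<bullet> x))"
proof (rule modulation_cmult)
  show "modulation (\<lambda>x. cos (Q \<bullet> x))"
    by (auto simp: modulation_def bounded_iff intro!: continuous_intros exI[of _ 1])
qed

lemma modulation_cos_poly: "cos_poly f \<Longrightarrow> modulation f"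
  by (induction rule: cos_poly.induct) (auto intro: modulation_cos modulation_add)

context
  fixes f assumes f: "bounded_borel f" "line_inv f"
begin

lemma uA: "bounded_borel (A.sol (\<lambda>_. 0) f)" and uB: "bounded_borel (B.sol (\<lambda>_. 0) f)"
  by (intro A.sol_bounded_borel B.sol_bounded_borel bounded_borel_const f)+

lemma exit_gap_add:
  assumes "modulation \<eta>" "modulation \<psi>"
  shows "exit_gap f z (\<lambda>x. \<eta> x + \<psi> x) = exit_gap f z \<eta> + exit_gap f z \<psi>"
  unfolding exit_gap_def distrib_right
  by (subst A.sol_add_source B.sol_add_source; (intro modulation_bounded_borel assms uA uB)?)+ simp

lemma exit_gap_cmult:
  assumes "modulation \<eta>"
  shows "exit_gap f z (\<lambda>x. c * \<eta> x) = c * exit_gap f z \<eta>"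
  unfolding exit_gap_def mult.assoc
  by (subst A.sol_cmult_source B.sol_cmult_source; (intro modulation_bounded_borel assms uA uB)?)+
    (simp add: right_diff_distrib)

lemma exit_gap_bound:
  obtains C where "0 \<le> C"
    "\<And>z \<eta> e. modulation \<eta> \<Longrightarrow> (\<And>x. x \<in> X \<Longrightarrow> \<bar>\<eta> x\<bar> \<le> e) \<Longrightarrow> 0 \<le> e \<Longrightarrow> \<bar>exit_gap f z \<eta>\<bar> \<le> C * e"
proof -
  obtain MA where MA: "0 \<le> MA" "\<And>z. \<bar>A.sol (\<lambda>_. 0) f z\<bar> \<le> MA" using bounded_borelE[OF uA] by blast
  obtain MB where MB: "0 \<le> MB" "\<And>z. \<bar>B.sol (\<lambda>_. 0) f z\<bar> \<le> MB" using bounded_borelE[OF uB] by blast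
  have R: "0 < R" by (rule A.R_pos)
  show ?thesis
  proof (rule that[of "MA * (2 * R) / (1 - q1) + MB * (2 * R) / (1 - q2)"])
    fix z \<eta> and e :: real
    assume \<eta>: "modulation \<eta>" "\<And>x. x \<in> X \<Longrightarrow> \<bar>\<eta> x\<bar> \<le> e" and e: "0 \<le> e"
    have "\<bar>A.sol (\<lambda>z. \<eta> (fst z) * A.sol (\<lambda>_. 0) f z) (\<lambda>_. 0) z\<bar> \<le> (e * MA) * (2 * R) / (1 - q1)"
      by (rule A.sol_bound_source_on[OF modulation_bounded_borel[OF \<eta>(1) uA]])
        (use \<eta>(2) MA e in \<open>auto simp: abs_mult intro!: mult_mono\<close>)
    moreover have "\<bar>B.sol (\<lambda>z. \<eta> (fst z) * B.sol (\<lambda>_. 0) f z) (\<lambda>_. 0) z\<bar> \<le> (e * MB) * (2 * R) / (1 - q2)"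
      by (rule B.sol_bound_source_on[OF modulation_bounded_borel[OF \<eta>(1) uB]])
        (use \<eta>(2) MB e in \<open>auto simp: abs_mult intro!: mult_mono\<close>)
    ultimately have "\<bar>exit_gap f z \<eta>\<bar> \<le> (e * MA) * (2 * R) / (1 - q1) + (e * MB) * (2 * R) / (1 - q2)"
      unfolding exit_gap_def by linarith
    then show "\<bar>exit_gap f z \<eta>\<bar> \<le> (MA * (2 * R) / (1 - q1) + MB * (2 * R) / (1 - q2)) * e"
      by (simp add: algebra_simps)
  qed (use MA MB R A.q_less B.q_less in auto)
qed

text \<open>Trigonometric polynomials approximate \<open>\<eta>\<close> uniformly, and since \<open>\<eta>\<close> is even, so do their even
  parts, which are combinations of cosines.\<close>

lemma exit_gap_even:
  assumes zero: "\<And>Q. rational_vec Q \<Longrightarrow> exit_gap f z (\<lambda>x. 1 * cos (Q \<bullet> x)) = 0"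
    and \<eta>: "modulation \<eta>" "\<And>x. \<eta> (- x) = \<eta> x"
  shows "exit_gap f z \<eta> = 0"
proof -
  obtain C where C: "0 \<le> C"
    "\<And>z \<eta> e. modulation \<eta> \<Longrightarrow> (\<And>x. x \<in> X \<Longrightarrow> \<bar>\<eta> x\<bar> \<le> e) \<Longrightarrow> 0 \<le> e \<Longrightarrow> \<bar>exit_gap f z \<eta>\<bar> \<le> C * e"
    using exit_gap_bound by blast
  have poly: "exit_gap f z p = 0" if "cos_poly p" for p
    using that
  proof (induction rule: cos_poly.induct)
    case (cos Q c)
    have "exit_gap f z (\<lambda>x. c * (1 * cos (Q \<bullet> x))) = c * exit_gap f z (\<lambda>x. 1 * cos (Q \<bullet> x))"
      by (rule exit_gap_cmult[OF modulation_cos])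
    then show ?case using zero[OF cos] by simp
  next
    case (add p r)
    then show ?case by (simp add: exit_gap_add modulation_cos_poly)
  qed
  have small: "\<bar>2 * exit_gap f z \<eta>\<bar> \<le> C * (2 * e)" if e: "0 < e" for e
  proof -
    obtain g where g: "trig_poly g" "\<And>x. x \<in> cball 0 R \<Longrightarrow> \<bar>\<eta> x - g x\<bar> < e"
    proof (rule trig_poly_dense[OF _ e])
      show "continuous_on (cball 0 R) \<eta>" using \<eta>(1) by (auto simp: modulation_def intro: continuous_on_subset)
    qed blast
    define p where "p x = g x + g (- x)" for x
    have p: "cos_poly p" unfolding p_def using g(1) by (rule trig_poly_even_part)
    note mp = modulation_cos_poly[OF p]
    define d where "d x = 2 * \<eta> x + (-1) * p x" for x
    have d: "modulation d" unfolding d_def by (intro modulation_add modulation_cmult \<eta> mp)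
    have "\<bar>exit_gap f z d\<bar> \<le> C * (2 * e)"
    proof (rule C(2)[OF d])
      fix x assume "x \<in> X"
      then have "x \<in> cball 0 R" "- x \<in> cball 0 R" using A.in_ball by auto
      then have "\<bar>\<eta> x - g x\<bar> < e" "\<bar>\<eta> x - g (- x)\<bar> < e" using g(2)[of x] g(2)[of "- x"] \<eta>(2) by auto
      then have "\<eta> x - g x < e" "g x - \<eta> x < e" "\<eta> x - g (- x) < e" "g (- x) - \<eta> x < e"
        unfolding abs_less_iff by simp_all
      then show "\<bar>d x\<bar> \<le> 2 * e" unfolding d_def p_def abs_le_iff by simp
    qed (use e in simp)
    moreover have "exit_gap f z d = 2 * exit_gap f z \<eta> + (-1) * exit_gap f z p"
      unfolding d_def by (subst exit_gap_add; (intro modulation_cmult \<eta> mp)?) (simp only: exit_gap_cmult[OF \<eta>(1)] exit_gap_cmult[OF mp])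
    ultimately show ?thesis by (simp add: poly[OF p])
  qed
  have "\<bar>2 * exit_gap f z \<eta>\<bar> \<le> 0"
  proof (rule field_le_epsilon)
    fix e :: real assume e: "0 < e"
    have "\<bar>2 * exit_gap f z \<eta>\<bar> \<le> C * (2 * (e / (2 * (C + 1))))" by (rule small) (use e C in simp)
    also have "\<dots> = (C / (C + 1)) * e" using C(1) by (simp add: field_simps)
    also have "\<dots> \<le> 1 * e" using e C by (intro mult_right_mono) auto
    finally show "\<bar>2 * exit_gap f z \<eta>\<bar> \<le> 0 + e" by simp
  qed
  then show ?thesis by simp
qed

end

end

definition bump :: "real \<Rightarrow> vec3 \<Rightarrow> vec3 \<Rightarrow> real" where
  "bump r p x = max 0 (1 - dist x p / r)"

lemma bump_bounds: "0 \<le> bump r p x" "0 < r \<Longrightarrow> bump r p x \<le> 1"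
  by (auto simp: bump_def)

lemma bump_outside: "0 < r \<Longrightarrow> r \<le> dist x p \<Longrightarrow> bump r p x = 0"
  by (auto simp: bump_def field_simps)

lemma bump_inside: "0 < r \<Longrightarrow> dist x p \<le> r / 2 \<Longrightarrow> 1 / 2 \<le> bump r p x"
  by (auto simp: bump_def field_simps)

lemma bump_continuous: "continuous_on S (bump r p)"
  unfolding bump_def divide_inverse by (intro continuous_intros)

lemma bump_reflect: "bump r (- p) x = bump r p (- x)"
proof -
  have "x - - p = - (- x - p)" by simp
  then have "dist x (- p) = dist (- x) p" unfolding dist_norm by (metis norm_minus_cancel)
  then show ?thesis by (simp add: bump_def)
qed

lemma AE_not_parallel: "AE \<theta> in sphere_measure. AE x in lborel. \<forall>c. x \<noteq> c *\<^sub>R (\<theta> :: vec3)"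
proof (rule AE_I2)
  fix \<theta> :: vec3
  have "dim {\<theta>} \<le> 1" by (rule order_trans[OF dim_le_card']) auto
  then have "dim (span {\<theta>}) < DIM(vec3)" by simp
  then have "negligible (span {\<theta>})" by (rule negligible_lowdim)
  then have "AE x in completion lborel. x \<notin> span {\<theta>}"
    by (intro AE_not_in) (simp add: negligible_iff_null_sets)
  then have "AE x in lborel. x \<notin> span {\<theta>}" by (simp add: AE_completion_iff)
  then show "AE x in lborel. \<forall>c. x \<noteq> c *\<^sub>R \<theta>"
    by (rule AE_space_mono) (auto intro: span_mul span_base)
qed

context two_coefficients
begin

lemma modulation_bump: "0 < r \<Longrightarrow> modulation (bump r p)"
  using bump_bounds by (auto simp: modulation_def bounded_iff intro!: bump_continuous exI[of _ 1])

context
  fixes f assumes f: "bounded_borel f" "line_inv f"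
begin

text \<open>Modulate near \<open>p\<close> and \<open>- p\<close> with radius \<open>r\<close>. Along the line through \<open>p\<close> the unscattered signal
  is of order \<open>r\<close> and all scattered contributions are \<open>O(r\<^sup>2)\<close>. The line of sight misses the ball
  around \<open>- p\<close>, which contributes scattered light only.\<close>

lemma exit_signal:
  assumes C: "extended_coefficients X R s kk q Smax Kmax \<sigma> k"
    and u_def: "u = coefficients.sol X s kk (\<lambda>_. 0) f"
    and M: "0 \<le> M" "\<And>z. \<bar>u z\<bar> \<le> M" and r: "0 < r"
    and far: "\<And>t. t \<in> {0..back_time X y \<theta>} \<Longrightarrow> r \<le> dist (y - t *\<^sub>R \<theta>) (- p)"
  shows "\<bar>coefficients.sol X s kk (\<lambda>z. (bump r p (fst z) + bump r (- p) (fst z)) * u z) (\<lambda>_. 0) (y, \<theta>) -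
    (LINT t:{0..back_time X y \<theta>}|lborel. att s y \<theta> t * (bump r p (y - t *\<^sub>R \<theta>) * u (y - t *\<^sub>R \<theta>, \<theta>)))\<bar>
    \<le> 4 * coefficients.beam_const q Kmax * M * r\<^sup>2"
proof -
  interpret C: extended_coefficients X R s kk q Smax Kmax \<sigma> k by fact
  have u: "bounded_borel u" unfolding u_def by (intro C.sol_bounded_borel bounded_borel_const f)
  define Sp where "Sp c = (\<lambda>z. bump r c (fst z) * u z)" for c
  have Sp: "bounded_borel (Sp c)" for c
    unfolding Sp_def by (rule modulation_bounded_borel[OF modulation_bump[OF r] u])
  have conc: "\<bar>Sp c (x, \<theta>)\<bar> \<le> (if dist x c < r then M else 0)" for c x \<theta>
  proof (cases "dist x c < r")
    case True
    have "\<bar>bump r c x\<bar> * \<bar>u (x, \<theta>)\<bar> \<le> 1 * M"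
      using bump_bounds(1)[of r c x] bump_bounds(2)[OF r, of c x] M by (intro mult_mono) auto
    then show ?thesis using True by (simp add: Sp_def abs_mult)
  qed (simp add: Sp_def bump_outside[OF r])
  have "(\<lambda>z. (bump r p (fst z) + bump r (- p) (fst z)) * u z) = (\<lambda>z. Sp p z + Sp (- p) z)"
    by (auto simp: Sp_def distrib_right)
  then have split: "C.sol (\<lambda>z. (bump r p (fst z) + bump r (- p) (fst z)) * u z) (\<lambda>_. 0) (y, \<theta>) =
      C.sol (Sp p) (\<lambda>_. 0) (y, \<theta>) + C.sol (Sp (- p)) (\<lambda>_. 0) (y, \<theta>)"
    using C.sol_add_source[OF Sp Sp] by simp
  have "C.J (Sp (- p)) (y, \<theta>) = (LINT t:{0..back_time X y \<theta>}|lborel. 0)"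
    unfolding C.J_def fst_conv snd_conv
    by (rule set_lebesgue_integral_cong) (auto simp: Sp_def bump_outside[OF r far])
  then have J0: "C.J (Sp (- p)) (y, \<theta>) = 0" by simp
  have J1: "C.J (Sp p) (y, \<theta>) = (LINT t:{0..back_time X y \<theta>}|lborel. att s y \<theta> t * (bump r p (y - t *\<^sub>R \<theta>) * u (y - t *\<^sub>R \<theta>, \<theta>)))"
    by (simp add: C.J_def Sp_def)
  have "\<bar>C.sol (Sp p) (\<lambda>_. 0) (y, \<theta>) - C.J (Sp p) (y, \<theta>)\<bar> \<le> C.beam_const * (2 * r * M) * r"
    "\<bar>C.sol (Sp (- p)) (\<lambda>_. 0) (y, \<theta>) - C.J (Sp (- p)) (y, \<theta>)\<bar> \<le> C.beam_const * (2 * r * M) * r"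
    by (rule C.sol_concentrated_source[OF Sp M(1) r conc])+
  then have "\<bar>C.sol (Sp p) (\<lambda>_. 0) (y, \<theta>) + C.sol (Sp (- p)) (\<lambda>_. 0) (y, \<theta>) - C.J (Sp p) (y, \<theta>)\<bar>
      \<le> C.beam_const * (2 * r * M) * r + C.beam_const * (2 * r * M) * r"
    unfolding J0 by linarith
  then show ?thesis unfolding split J1 by (simp add: power2_eq_square algebra_simps)
qed

lemma weight_continuous:
  assumes C: "extended_coefficients X R s kk q Smax Kmax \<sigma> k"
    and u_def: "u = coefficients.sol X s kk (\<lambda>_. 0) f"
    and t0: "0 < t0" "t0 < back_time X y \<theta>" and \<theta>: "\<theta> \<in> S2"
  shows "isCont (\<lambda>t. att s y \<theta> t * u (y - t *\<^sub>R \<theta>, \<theta>)) t0"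
proof -
  interpret C: extended_coefficients X R s kk q Smax Kmax \<sigma> k by fact
  define T where "T = (t0 + back_time X y \<theta>) / 2"
  have T: "t0 < T" "T < back_time X y \<theta>" using t0 by (auto simp: T_def)
  define x where "x = y - T *\<^sub>R \<theta>"
  have x: "x \<in> X" unfolding x_def using t0 T by (intro A.inside_chord) auto
  have seg: "x + r *\<^sub>R \<theta> \<in> X" if "0 \<le> r" "r < T" for r
  proof -
    have "y - (T - r) *\<^sub>R \<theta> \<in> X" using that T by (intro A.inside_chord) auto
    then show ?thesis by (simp add: x_def algebra_simps)
  qed
  have "continuous_on {0..T} (\<lambda>r. u (x + r *\<^sub>R \<theta>, \<theta>))"
    unfolding u_def using t0 T
    by (intro C.sol_continuous_on_segment[OF bounded_borel_const f \<theta> x seg]) auto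
  then have "continuous_on {0..T} (\<lambda>t. u (x + (T - t) *\<^sub>R \<theta>, \<theta>))"
    by (rule continuous_on_compose2[where f="\<lambda>t. T - t"]) (auto intro!: continuous_intros)
  moreover have "x + (T - t) *\<^sub>R \<theta> = y - t *\<^sub>R \<theta>" for t by (simp add: x_def algebra_simps)
  ultimately have "continuous_on {0..T} (\<lambda>t. u (y - t *\<^sub>R \<theta>, \<theta>))" by simp
  moreover have "continuous_on {0..T} (\<lambda>t. att s y \<theta> t)"
    unfolding att_def by (intro continuous_intros indefinite_continuous C.s_line_int)
  ultimately have "continuous_on {0..T} (\<lambda>t. att s y \<theta> t * u (y - t *\<^sub>R \<theta>, \<theta>))"
    by (rule continuous_on_mult[rotated])
  then have "continuous_on {0<..<T} (\<lambda>t. att s y \<theta> t * u (y - t *\<^sub>R \<theta>, \<theta>))"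
    by (rule continuous_on_subset) auto
  then show ?thesis using t0 T by (simp add: continuous_on_eq_continuous_at)
qed

text \<open>If the weights differed at \<open>t0\<close>, their difference would keep its sign nearby. With a bump of radius
  \<open>r\<close> the unscattered signals would then differ by at least a multiple of \<open>r\<close>, but equal exit values
  and \<open>exit_signal\<close> leave room for \<open>O(r\<^sup>2)\<close> only.\<close>

lemma weights_equal_on_line:
  assumes \<theta>: "\<theta> \<in> S2" and off: "\<And>c. y \<noteq> c *\<^sub>R \<theta>"
    and zero: "\<And>Q. rational_vec Q \<Longrightarrow> exit_gap f (y, \<theta>) (\<lambda>x. 1 * cos (Q \<bullet> x)) = 0"
    and t0: "0 < t0" "t0 < back_time X y \<theta>"
  shows "att s1 y \<theta> t0 * A.sol (\<lambda>_. 0) f (y - t0 *\<^sub>R \<theta>, \<theta>) = att s2 y \<theta> t0 * B.sol (\<lambda>_. 0) f (y - t0 *\<^sub>R \<theta>, \<theta>)"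
proof (rule ccontr)
  assume ne: "\<not> ?thesis"
  define T where "T = back_time X y \<theta>"
  define u1 where "u1 = A.sol (\<lambda>_. 0) f"
  define u2 where "u2 = B.sol (\<lambda>_. 0) f"
  define w1 where "w1 t = att s1 y \<theta> t * u1 (y - t *\<^sub>R \<theta>, \<theta>)" for t
  define w2 where "w2 t = att s2 y \<theta> t * u2 (y - t *\<^sub>R \<theta>, \<theta>)" for t
  define p where "p = y - t0 *\<^sub>R \<theta>"
  define \<epsilon> where "\<epsilon> = \<bar>w1 t0 - w2 t0\<bar> / 2"
  define sg where "sg = sgn (w1 t0 - w2 t0)"
  have D0: "w1 t0 - w2 t0 \<noteq> 0" using ne by (simp add: w1_def w2_def u1_def u2_def)
  have \<epsilon>: "0 < \<epsilon>" using D0 by (simp add: \<epsilon>_def)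
  have A': "extended_coefficients X R s1 kk1 q1 Smax1 Kmax1 \<sigma>1 k1" by (rule A.extended_coefficients_axioms)
  have B': "extended_coefficients X R s2 kk2 q2 Smax2 Kmax2 \<sigma>2 k2" by (rule B.extended_coefficients_axioms)
  have "isCont (\<lambda>t. w1 t - w2 t) t0"
    unfolding w1_def w2_def
    by (rule continuous_diff[OF weight_continuous[OF A' u1_def t0 \<theta>] weight_continuous[OF B' u2_def t0 \<theta>]])
  then obtain d1 where d1: "0 < d1" "\<And>t. dist t t0 < d1 \<Longrightarrow> dist (w1 t - w2 t) (w1 t0 - w2 t0) < \<epsilon>"
    using \<epsilon> unfolding continuous_at_eps_delta by auto
  have sign: "\<epsilon> \<le> sg * (w1 t - w2 t)" if "dist t t0 < d1" for t
  proof -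
    have near: "\<bar>(w1 t - w2 t) - (w1 t0 - w2 t0)\<bar> < \<epsilon>" using d1(2)[OF that] by (simp add: dist_real_def)
    show ?thesis
    proof (cases "0 < w1 t0 - w2 t0")
      case True
      then have "sg = 1" "w1 t0 - w2 t0 = 2 * \<epsilon>" by (simp_all add: sg_def \<epsilon>_def)
      then show ?thesis using near by (simp add: abs_less_iff)
    next
      case False
      then have "sg = - 1" "w1 t0 - w2 t0 = - 2 * \<epsilon>" using D0 by (simp_all add: sg_def \<epsilon>_def)
      then show ?thesis using near by (simp add: abs_less_iff)
    qed
  qed
  have "compact ((\<lambda>t. y - t *\<^sub>R \<theta>) ` {0..T})"
    by (intro compact_continuous_image continuous_intros) auto
  then have cl: "closed ((\<lambda>t. y - t *\<^sub>R \<theta>) ` {0..T})" by (rule compact_imp_closed)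
  \<comment> \<open>A line through both \<open>p\<close> and \<open>- p\<close> would contain the origin.\<close>
  have "- p \<notin> (\<lambda>t. y - t *\<^sub>R \<theta>) ` {0..T}"
  proof
    assume "- p \<in> (\<lambda>t. y - t *\<^sub>R \<theta>) ` {0..T}"
    then obtain t where t: "- p = y - t *\<^sub>R \<theta>" by auto
    have "2 *\<^sub>R y = (t + t0) *\<^sub>R \<theta>" using t unfolding p_def scaleR_2 by (simp add: algebra_simps)
    then have "(1/2) *\<^sub>R (2 *\<^sub>R y) = (1/2) *\<^sub>R ((t + t0) *\<^sub>R \<theta>)" by simp
    then have "y = ((1/2) * (t + t0)) *\<^sub>R \<theta>" unfolding scaleR_scaleR by simp
    then show False using off by blast
  qed
  then obtain d2 where d2: "0 < d2" "\<And>x. x \<in> (\<lambda>t. y - t *\<^sub>R \<theta>) ` {0..T} \<Longrightarrow> d2 \<le> dist (- p) x"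
    using separate_point_closed[OF cl] by blast
  obtain M1 where M1: "0 \<le> M1" "\<And>z. \<bar>u1 z\<bar> \<le> M1" using bounded_borelE[OF uA[OF f]] unfolding u1_def by blast
  obtain M2 where M2: "0 \<le> M2" "\<And>z. \<bar>u2 z\<bar> \<le> M2" using bounded_borelE[OF uB[OF f]] unfolding u2_def by blast
  define C where "C = 4 * A.beam_const * M1 + 4 * B.beam_const * M2"
  have C: "0 \<le> C" using M1 M2 A.beam_const_nonneg B.beam_const_nonneg by (simp add: C_def)
  define r where "r = min (min (d1 / 2) d2) (min (min t0 (T - t0)) (\<epsilon> / (4 * (C + 1))))"
  have "0 < \<epsilon> / (4 * (C + 1))" using \<epsilon> C by simp
  then have r: "0 < r" "r < d1" "r \<le> d2" "r \<le> t0" "r \<le> T - t0" "r \<le> \<epsilon> / (4 * (C + 1))"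
    using d1(1) d2(1) t0 unfolding r_def T_def by linarith+
  have far: "r \<le> dist (y - t *\<^sub>R \<theta>) (- p)" if "t \<in> {0..back_time X y \<theta>}" for t
  proof -
    have "d2 \<le> dist (- p) (y - t *\<^sub>R \<theta>)" by (rule d2(2)[OF imageI]) (use that in \<open>simp add: T_def\<close>)
    then show ?thesis using r(3) by (simp add: dist_commute)
  qed
  have even: "exit_gap f (y, \<theta>) (\<lambda>x. bump r p x + bump r (- p) x) = 0"
  proof (rule exit_gap_even[OF f zero])
    show "modulation (\<lambda>x. bump r p x + bump r (- p) x)"
      by (intro modulation_add modulation_bump r(1))
    show "bump r p (- x) + bump r (- p) (- x) = bump r p x + bump r (- p) x" for x
      by (simp add: bump_reflect)
  qed
  define b where "b t = bump r p (y - t *\<^sub>R \<theta>)" for t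
  define I1 where "I1 = (LINT t:{0..T}|lborel. att s1 y \<theta> t * (bump r p (y - t *\<^sub>R \<theta>) * u1 (y - t *\<^sub>R \<theta>, \<theta>)))"
  define I2 where "I2 = (LINT t:{0..T}|lborel. att s2 y \<theta> t * (bump r p (y - t *\<^sub>R \<theta>) * u2 (y - t *\<^sub>R \<theta>, \<theta>)))"
  note e1 = exit_signal[OF A' u1_def M1 r(1) far, folded T_def, folded I1_def]
  note e2 = exit_signal[OF B' u2_def M2 r(1) far, folded T_def, folded I2_def]
  have "A.sol (\<lambda>z. (bump r p (fst z) + bump r (- p) (fst z)) * u1 z) (\<lambda>_. 0) (y, \<theta>) =
      B.sol (\<lambda>z. (bump r p (fst z) + bump r (- p) (fst z)) * u2 z) (\<lambda>_. 0) (y, \<theta>)"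
    using even by (simp add: exit_gap_def u1_def u2_def)
  then have "\<bar>I1 - I2\<bar> \<le> 4 * A.beam_const * M1 * r\<^sup>2 + 4 * B.beam_const * M2 * r\<^sup>2"
    using e1 e2 by linarith
  then have upper: "\<bar>I1 - I2\<bar> \<le> C * r\<^sup>2" by (simp add: C_def distrib_right)
  note mod = modulation_bump[OF r(1)]
  have i1: "set_integrable lborel {0..T} (\<lambda>t. att s1 y \<theta> t * (bump r p (y - t *\<^sub>R \<theta>) * u1 (y - t *\<^sub>R \<theta>, \<theta>)))"
    using A.att_h_int[OF modulation_bounded_borel[OF mod uA[OF f]], of 0 T y \<theta>] by (simp add: u1_def)
  have i2: "set_integrable lborel {0..T} (\<lambda>t. att s2 y \<theta> t * (bump r p (y - t *\<^sub>R \<theta>) * u2 (y - t *\<^sub>R \<theta>, \<theta>)))"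
    using B.att_h_int[OF modulation_bounded_borel[OF mod uB[OF f]], of 0 T y \<theta>] by (simp add: u2_def)
  have dist_p: "dist (y - t *\<^sub>R \<theta>) p = \<bar>t - t0\<bar>" for t
  proof -
    have "y - t *\<^sub>R \<theta> - p = (t0 - t) *\<^sub>R \<theta>" by (simp add: p_def algebra_simps)
    then show ?thesis using \<theta> by (simp add: dist_norm abs_minus_commute)
  qed
  have "(\<epsilon> / 2) * r = (LINT t:{0..T}|lborel. (\<epsilon> / 2) * indicator {t0 - r / 2..t0 + r / 2} t)"
  proof -
    have "(LINT t:{0..T}|lborel. (\<epsilon> / 2) * indicator {t0 - r / 2..t0 + r / 2} t) =
        (LINT t|lborel. (\<epsilon> / 2) * indicator {t0 - r / 2..t0 + r / 2} t)"
      unfolding set_lebesgue_integral_def using r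
      by (intro Bochner_Integration.integral_cong) (auto simp: indicator_def)
    also have "\<dots> = (\<epsilon> / 2) * r" using r(1) by simp
    finally show ?thesis by (rule sym)
  qed
  also have "\<dots> \<le> (LINT t:{0..T}|lborel. sg * (att s1 y \<theta> t * (bump r p (y - t *\<^sub>R \<theta>) * u1 (y - t *\<^sub>R \<theta>, \<theta>)) -
      att s2 y \<theta> t * (bump r p (y - t *\<^sub>R \<theta>) * u2 (y - t *\<^sub>R \<theta>, \<theta>))))"
  proof (rule set_integral_mono)
    show "set_integrable lborel {0..T} (\<lambda>t. (\<epsilon> / 2) * indicator {t0 - r / 2..t0 + r / 2} t)"
      by (rule set_integrable_bounded[where M="\<epsilon> / 2"]) (use \<epsilon> in \<open>auto simp: indicator_def\<close>)
    show "set_integrable lborel {0..T} (\<lambda>t. sg * (att s1 y \<theta> t * (bump r p (y - t *\<^sub>R \<theta>) * u1 (y - t *\<^sub>R \<theta>, \<theta>)) -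
      att s2 y \<theta> t * (bump r p (y - t *\<^sub>R \<theta>) * u2 (y - t *\<^sub>R \<theta>, \<theta>))))"
      by (intro set_integrable_mult_right set_integral_diff(1) i1 i2)
    fix t
    have "sg * (att s1 y \<theta> t * (bump r p (y - t *\<^sub>R \<theta>) * u1 (y - t *\<^sub>R \<theta>, \<theta>)) -
      att s2 y \<theta> t * (bump r p (y - t *\<^sub>R \<theta>) * u2 (y - t *\<^sub>R \<theta>, \<theta>))) = b t * (sg * (w1 t - w2 t))"
      by (simp add: b_def w1_def w2_def algebra_simps)
    moreover have "(\<epsilon> / 2) * indicator {t0 - r / 2..t0 + r / 2} t \<le> b t * (sg * (w1 t - w2 t))"
    proof (cases "\<bar>t - t0\<bar> < r")
      case False
      then have "b t = 0" unfolding b_def by (intro bump_outside r(1)) (simp add: dist_p)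
      moreover have "t \<notin> {t0 - r / 2..t0 + r / 2}" using False r(1) by auto
      ultimately show ?thesis by simp
    next
      case True
      then have ge: "\<epsilon> \<le> sg * (w1 t - w2 t)" using r by (intro sign) (simp add: dist_real_def)
      have b0: "0 \<le> b t" unfolding b_def by (rule bump_bounds)
      show ?thesis
      proof (cases "t \<in> {t0 - r / 2..t0 + r / 2}")
        case True
        then have "dist (y - t *\<^sub>R \<theta>) p \<le> r / 2" unfolding dist_p abs_le_iff by auto
        then have "1 / 2 \<le> b t" unfolding b_def by (rule bump_inside[OF r(1)])
        then have "(1 / 2) * \<epsilon> \<le> b t * (sg * (w1 t - w2 t))" using ge \<epsilon> b0 by (intro mult_mono) auto
        then show ?thesis using True by simp
      next
        case False
        have "0 \<le> sg * (w1 t - w2 t)" using ge \<epsilon> by linarith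
        from mult_nonneg_nonneg[OF b0 this] have "0 \<le> b t * (sg * (w1 t - w2 t))" .
        then show ?thesis using False by simp
      qed
    qed
    ultimately show "(\<epsilon> / 2) * indicator {t0 - r / 2..t0 + r / 2} t \<le>
      sg * (att s1 y \<theta> t * (bump r p (y - t *\<^sub>R \<theta>) * u1 (y - t *\<^sub>R \<theta>, \<theta>)) -
      att s2 y \<theta> t * (bump r p (y - t *\<^sub>R \<theta>) * u2 (y - t *\<^sub>R \<theta>, \<theta>)))" by (simp only:)
  qed
  also have "\<dots> = sg * (I1 - I2)"
    unfolding set_integral_mult_right I1_def I2_def by (subst set_integral_diff(2)[OF i1 i2]) simp
  also have "\<dots> \<le> \<bar>sg * (I1 - I2)\<bar>" by simp
  also have "\<dots> \<le> 1 * \<bar>I1 - I2\<bar>" unfolding abs_mult by (intro mult_right_mono) (auto simp: sg_def sgn_if)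
  also have "\<dots> \<le> C * r * r" using upper by (simp add: power2_eq_square mult.assoc)
  finally have "\<epsilon> / 2 \<le> C * r" using r(1) by (simp only: mult_le_cancel_right_pos)
  also have "\<dots> \<le> C * (\<epsilon> / (4 * (C + 1)))" using r(6) C by (intro mult_left_mono)
  also have "\<dots> = (\<epsilon> / 4) * (C / (C + 1))" by simp
  also have "\<dots> \<le> (\<epsilon> / 4) * 1" using \<epsilon> C by (intro mult_left_mono) auto
  finally show False using \<epsilon> by simp
qed

text \<open>Almost every line misses the origin, and for almost every line the exit data agree for all
  rational frequencies at once.\<close>

theorem weights_equal:
  assumes a: "a \<noteq> 0" and eq: "\<And>Q. A01 X a \<sigma>1 k1 Q f = A01 X a \<sigma>2 k2 Q f"
  shows "AE \<theta> in sphere_measure. AE x in lborel. x \<in> X \<longrightarrow>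
    (\<forall>t y. y = x + back_time X x (- \<theta>) *\<^sub>R \<theta> \<longrightarrow> 0 < t \<longrightarrow> t < back_time X y \<theta> \<longrightarrow>
      att s1 y \<theta> t * A.sol (\<lambda>_. 0) f (y - t *\<^sub>R \<theta>, \<theta>) = att s2 y \<theta> t * B.sol (\<lambda>_. 0) f (y - t *\<^sub>R \<theta>, \<theta>))"
proof -
  let ?y = "\<lambda>x \<theta>. x + back_time X x (- \<theta>) *\<^sub>R \<theta>"
  have one: "AE \<theta> in sphere_measure. AE x in lborel. x \<in> X \<longrightarrow> exit_gap f (?y x \<theta>, \<theta>) (\<lambda>x. 1 * cos (Q \<bullet> x)) = 0" for Q
    using exit_data_equal[OF f eq[of Q]]
  proof eventually_elim
    case (elim \<theta>)
    then show ?case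
    proof eventually_elim
      case (elim x)
      show ?case
      proof
        assume "x \<in> X"
        note e = mp[OF elim this]
        have assoc: "(\<lambda>z. a * cos (Q \<bullet> fst z) * v z) = (\<lambda>z. a * (1 * cos (Q \<bullet> fst z) * v z))" for v :: "vec3 \<times> vec3 \<Rightarrow> real"
          by auto
        have "a * exit_gap f (?y x \<theta>, \<theta>) (\<lambda>x. 1 * cos (Q \<bullet> x)) = 0"
          using e unfolding assoc exit_gap_def right_diff_distrib
            A.sol_cmult_source[OF modulation_bounded_borel[OF modulation_cos uA[OF f]]]
            B.sol_cmult_source[OF modulation_bounded_borel[OF modulation_cos uB[OF f]]]
          by linarith
        then show "exit_gap f (?y x \<theta>, \<theta>) (\<lambda>x. 1 * cos (Q \<bullet> x)) = 0" using a by simp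
      qed
    qed
  qed
  have "AE \<theta> in sphere_measure. \<forall>Q\<in>{Q. rational_vec Q}. AE x in lborel. x \<in> X \<longrightarrow> exit_gap f (?y x \<theta>, \<theta>) (\<lambda>x. 1 * cos (Q \<bullet> x)) = 0"
    by (rule AE_ball_countable[OF countable_rational_vec, THEN iffD2]) (rule ballI[OF one])
  then show ?thesis
    using AE_not_parallel AE_space
  proof eventually_elim
    case (elim \<theta>)
    have \<theta>: "\<theta> \<in> S2" using elim(3) by simp
    have "AE x in lborel. \<forall>Q\<in>{Q. rational_vec Q}. x \<in> X \<longrightarrow> exit_gap f (?y x \<theta>, \<theta>) (\<lambda>x. 1 * cos (Q \<bullet> x)) = 0"
      by (rule AE_ball_countable[OF countable_rational_vec, THEN iffD2]) (fact elim(1))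
    then show ?case
      using elim(2)
    proof eventually_elim
      case (elim x)
      show ?case
      proof (intro impI allI)
        fix t y assume x: "x \<in> X" and y: "y = ?y x \<theta>" and t: "0 < t" "t < back_time X y \<theta>"
        have off: "y \<noteq> c *\<^sub>R \<theta>" for c
        proof
          assume "y = c *\<^sub>R \<theta>"
          then have "x = (c - back_time X x (- \<theta>)) *\<^sub>R \<theta>" unfolding y by (simp add: algebra_simps)
          then show False using elim(2) by blast
        qed
        have zero: "exit_gap f (y, \<theta>) (\<lambda>x. 1 * cos (Q \<bullet> x)) = 0" if "rational_vec Q" for Q
          unfolding y using bspec[OF elim(1), of Q] that x by simp
        show "att s1 y \<theta> t * A.sol (\<lambda>_. 0) f (y - t *\<^sub>R \<theta>, \<theta>) = att s2 y \<theta> t * B.sol (\<lambda>_. 0) f (y - t *\<^sub>R \<theta>, \<theta>)"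
          by (rule weights_equal_on_line[OF \<theta> off zero t])
      qed
    qed
  qed
qed

end

end

section \<open>Injectivity of the X-ray transform\<close>

lemma AE_sphere_ex:
  assumes "AE \<theta> in sphere_measure. P \<theta>" "open U" "\<theta>0 \<in> U" "\<theta>0 \<in> S2"
  shows "\<exists>\<theta>\<in>S2. \<theta> \<in> U \<and> P \<theta>"
proof (rule ccontr)
  assume no: "\<not> ?thesis"
  obtain N where N: "N \<in> null_sets sphere_measure" "{\<theta>\<in>space sphere_measure. \<not> P \<theta>} \<subseteq> N"
    using assms(1) by (auto simp: eventually_ae_filter)
  have "{\<theta> \<in> S2. \<theta> \<in> U} \<subseteq> N" using no N(2) by auto
  then have "measure sphere_measure {\<theta> \<in> S2. \<theta> \<in> U} \<le> measure sphere_measure N"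
    using N(1) by (intro sphere.finite_measure_mono) auto
  then show False
    using sphere_measure_open_pos[OF assms(2-4)] N(1) by (simp add: null_sets_def measure_def)
qed

lemma lborel_integral_translate:
  fixes f :: "vec3 \<Rightarrow> real"
  assumes [measurable]: "f \<in> borel_measurable borel"
  shows "(LINT x|lborel. f (c + x)) = (LINT x|lborel. f x)"
proof -
  have "(LINT x|lborel. f x) = (LINT x|distr lborel borel ((+) c). f x)" by (simp add: lborel_distr_plus)
  also have "\<dots> = (LINT x|lborel. f (c + x))" by (rule integral_distr) auto
  finally show ?thesis by simp
qed

lemma lborel_integrable_translate:
  fixes f :: "vec3 \<Rightarrow> real"
  assumes "integrable lborel f"
  shows "integrable lborel (\<lambda>x. f (c + x))"
proof -
  have "integrable (distr lborel borel ((+) c)) f" using assms by (simp add: lborel_distr_plus)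
  then show ?thesis by (rule integrable_distr[rotated]) auto
qed

context transport_domain
begin

lemma domain_integrable:
  assumes [measurable]: "h \<in> borel_measurable borel" and M: "\<And>x. \<bar>h x\<bar> \<le> (M::real)"
  shows "integrable lborel (\<lambda>x. indicator X x * h x)"
proof (rule Bochner_Integration.integrable_bound)
  have "emeasure lborel X \<le> emeasure lborel (cball 0 R :: vec3 set)"
    by (rule emeasure_mono[OF order_trans[OF in_ball ball_subset_cball]]) simp
  also have "\<dots> < \<infinity>" by (intro emeasure_bounded_finite) auto
  finally show "integrable lborel (\<lambda>x. indicator X x * M)"
    by (intro integrable_mult_left integrable_real_indicator) auto
  show "AE x in lborel. norm (indicator X x * h x) \<le> norm (indicator X x * M)"
    using M by (intro AE_I2) (auto simp: indicator_def intro: order_trans[OF _ abs_ge_self])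
  have "(\<lambda>x. indicator X x * h x) \<in> borel_measurable borel" by measurable
  then show "(\<lambda>x. indicator X x * h x) \<in> borel_measurable lborel" by simp
qed

definition chord_params :: "vec3 \<Rightarrow> vec3 \<Rightarrow> real set" where
  "chord_params \<theta> x = {- \<tau> x (- \<theta>)<..<\<tau> x \<theta>}"

lemma chord_move_pos:
  assumes \<theta>: "\<theta> \<in> S2" and x: "x \<in> X" and t: "0 < t" "t < \<tau> x \<theta>"
  shows "x - t *\<^sub>R \<theta> \<in> X" "\<tau> (x - t *\<^sub>R \<theta>) \<theta> = \<tau> x \<theta> - t" "\<tau> (x - t *\<^sub>R \<theta>) (- \<theta>) = \<tau> x (- \<theta>) + t"
proof -
  show "x - t *\<^sub>R \<theta> \<in> X" "\<tau> (x - t *\<^sub>R \<theta>) \<theta> = \<tau> x \<theta> - t" using tau_back[OF \<theta> t] by simp_all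
  have "\<tau> (x + t *\<^sub>R (- \<theta>)) (- \<theta>) = t + \<tau> x (- \<theta>)"
  proof (rule tau_shift)
    fix r assume r: "0 \<le> r" "r < t"
    show "x + r *\<^sub>R - \<theta> \<in> X"
    proof (cases "r = 0")
      case False
      then have "x - r *\<^sub>R \<theta> \<in> X" using r t by (intro inside_chord) auto
      then show ?thesis by simp
    qed (use x in simp)
  qed (use \<theta> x t in auto)
  then show "\<tau> (x - t *\<^sub>R \<theta>) (- \<theta>) = \<tau> x (- \<theta>) + t" by simp
qed

lemma chord_move:
  assumes \<theta>: "\<theta> \<in> S2" and x: "x \<in> X" and t: "t \<in> chord_params \<theta> x"
  shows "x - t *\<^sub>R \<theta> \<in> X" "\<tau> (x - t *\<^sub>R \<theta>) \<theta> = \<tau> x \<theta> - t" "\<tau> (x - t *\<^sub>R \<theta>) (- \<theta>) = \<tau> x (- \<theta>) + t"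
proof -
  have \<theta>': "- \<theta> \<in> S2" using \<theta> by simp
  consider "t = 0" | "0 < t" | "t < 0" by linarith
  then have "x - t *\<^sub>R \<theta> \<in> X \<and> \<tau> (x - t *\<^sub>R \<theta>) \<theta> = \<tau> x \<theta> - t \<and> \<tau> (x - t *\<^sub>R \<theta>) (- \<theta>) = \<tau> x (- \<theta>) + t"
  proof cases
    case 1 then show ?thesis using x by simp
  next
    case 2 then show ?thesis using chord_move_pos[OF \<theta> x] t by (simp add: chord_params_def)
  next
    case 3 then show ?thesis using chord_move_pos[OF \<theta>' x, of "- t"] t by (simp add: chord_params_def)
  qed
  then show "x - t *\<^sub>R \<theta> \<in> X" "\<tau> (x - t *\<^sub>R \<theta>) \<theta> = \<tau> x \<theta> - t" "\<tau> (x - t *\<^sub>R \<theta>) (- \<theta>) = \<tau> x (- \<theta>) + t" by auto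
qed

lemma tau_measurable' [measurable]:
  assumes [measurable]: "f \<in> borel_measurable N"
  shows "(\<lambda>z. \<tau> (f z) \<theta>) \<in> borel_measurable N"
proof -
  have "(\<lambda>z. (f z, \<theta>)) \<in> N \<rightarrow>\<^sub>M borel" by (intro borel_measurable_Pair) measurable
  from measurable_compose[OF this measurable_back_time] show ?thesis by simp
qed

text \<open>Each point spreads the mass \<open>g \<delta>\<close> uniformly over its chord. By translation invariance the total
  mass equals the integral of the mass received, and a point receives a multiple of the chord
  integral of \<open>\<delta>\<close>, because \<open>g\<close> and the length of the chord are constant along the chord.\<close>

lemma chord_integral_zero:
  assumes \<theta>: "\<theta> \<in> S2"
    and d_meas [measurable]: "\<delta> \<in> borel_measurable borel" and g_meas [measurable]: "g \<in> borel_measurable borel"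
    and D: "\<And>x. \<bar>\<delta> x\<bar> \<le> (D::real)" and G: "\<And>x. \<bar>g x\<bar> \<le> (G::real)" and inv: "\<And>x t. g (x + t *\<^sub>R \<theta>) = g x"
    and zero: "AE x in lborel. x \<in> X \<longrightarrow> (LINT t|lborel. indicator (chord_params \<theta> x) t * \<delta> (x - t *\<^sub>R \<theta>)) = 0"
  shows "(LINT x|lborel. indicator X x * (g x * \<delta> x)) = 0"
proof -
  define \<theta>' where "\<theta>' = - \<theta>"
  have \<theta>': "\<theta>' \<in> S2" using \<theta> by (simp add: \<theta>'_def)
  define l where "l x = \<tau> x \<theta> + \<tau> x \<theta>'" for x
  have lpos: "0 < l x" if "x \<in> X" for x
    using tau_pos[OF \<theta> that] tau_pos[OF \<theta>' that] by (simp add: l_def)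
  have l_meas [measurable]: "l \<in> borel_measurable borel" unfolding l_def by measurable
  define c where "c x t = (if x \<in> X \<and> - \<tau> x \<theta>' < t \<and> t < \<tau> x \<theta> then 1 else 0 :: real)" for x t
  have c_ind: "c x t = indicator X x * indicator (chord_params \<theta> x) t" for x t
    by (auto simp: c_def chord_params_def indicator_def \<theta>'_def)
  define F where "F x t = c x t * (g x * \<delta> x / l x)" for x t
  have F_meas [measurable]: "(\<lambda>(x, t). F x t) \<in> borel_measurable (borel \<Otimes>\<^sub>M borel)"
    unfolding F_def c_def by measurable
  have ind_int: "integrable lborel (indicator (chord_params \<theta> x) :: real \<Rightarrow> real)" for x
    unfolding chord_params_def using tau_nonneg[of x \<theta>] tau_nonneg[of x "- \<theta>"]
    by (intro integrable_real_indicator) (auto simp: emeasure_lborel_Ioo)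
  have ind_val: "measure lborel (chord_params \<theta> x) = l x" for x
    unfolding chord_params_def l_def \<theta>'_def using tau_nonneg[of x \<theta>] tau_nonneg[of x "- \<theta>"] by simp
  have F_alt: "F x t = (indicator X x * (g x * \<delta> x / l x)) * indicator (chord_params \<theta> x) t" for x t
    by (simp add: F_def c_ind)
  have F_int_t: "integrable lborel (F x)" for x
    unfolding F_alt by (intro integrable_mult_right ind_int)
  have F_val: "(LINT t|lborel. F x t) = indicator X x * (g x * \<delta> x)" for x
    unfolding F_alt using lpos[of x] by (cases "x \<in> X") (simp_all add: ind_val)
  have F_norm: "(LINT t|lborel. norm (F x t)) = indicator X x * \<bar>g x * \<delta> x\<bar>" for x
  proof -
    have "norm (F x t) = (indicator X x * \<bar>g x * \<delta> x / l x\<bar>) * indicator (chord_params \<theta> x) t" for t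
      by (simp add: F_alt abs_mult)
    then show ?thesis using lpos[of x] by (cases "x \<in> X") (simp_all add: ind_val)
  qed
  have bound: "\<bar>g x * \<delta> x\<bar> \<le> G * D" for x
    unfolding abs_mult using G[of x] D[of x] by (intro mult_mono) (auto intro: order_trans[OF abs_ge_zero])
  have F_meas': "(\<lambda>z. F (fst z) (snd z)) \<in> borel_measurable (lborel \<Otimes>\<^sub>M lborel)"
    using F_meas by (simp add: split_beta cong: measurable_cong_sets)
  have F_int: "integrable (lborel \<Otimes>\<^sub>M lborel) (\<lambda>z. F (fst z) (snd z))"
  proof (rule lborel_pair.Fubini_integrable[OF F_meas'])
    show "integrable lborel (\<lambda>x. LINT t|lborel. norm (F (fst (x, t)) (snd (x, t))))"
      unfolding fst_conv snd_conv F_norm by (rule domain_integrable[of _ "G * D"]) (use bound in auto)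
  qed (simp add: F_int_t)
  have F_int': "integrable (lborel \<Otimes>\<^sub>M lborel) (\<lambda>(x, t). F x t)"
    using F_int unfolding case_prod_unfold .
  define F' where "F' t x = F (t *\<^sub>R \<theta> + x) t" for t x
  have F'_meas: "(\<lambda>z. F' (fst z) (snd z)) \<in> borel_measurable (lborel \<Otimes>\<^sub>M lborel)"
    unfolding F'_def F_def c_def by (simp cong: measurable_cong_sets)
  have AE_F: "AE t in lborel. integrable lborel (\<lambda>x. F x t)"
    by (rule lborel_pair.AE_integrable_snd[OF F_int'])
  have F'_int: "integrable (lborel \<Otimes>\<^sub>M lborel) (\<lambda>z. F' (fst z) (snd z))"
  proof (rule lborel_pair.Fubini_integrable[OF F'_meas])
    have [measurable]: "(\<lambda>x. F x t) \<in> borel_measurable borel" for t unfolding F_def c_def by measurable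
    have "(LINT x|lborel. norm (F' t x)) = (LINT x|lborel. norm (F x t))" for t
      unfolding F'_def by (rule lborel_integral_translate[of "\<lambda>x. norm (F x t)"]) measurable
    moreover have "integrable lborel (\<lambda>t. LINT x|lborel. norm (F x t))"
    proof (rule lborel_pair.integrable_snd)
      show "integrable (lborel \<Otimes>\<^sub>M lborel) (\<lambda>(x, t). norm (F x t))"
        using integrable_norm[OF F_int] unfolding case_prod_unfold .
    qed
    ultimately show "integrable lborel (\<lambda>t. LINT x|lborel. norm (F' (fst (t, x)) (snd (t, x))))" by simp
    show "AE t in lborel. integrable lborel (\<lambda>x. F' (fst (t, x)) (snd (t, x)))"
      using AE_F by eventually_elim (simp add: F'_def lborel_integrable_translate[of "\<lambda>x. F x _"])
  qed
  have "(LINT x|lborel. indicator X x * (g x * \<delta> x)) = (LINT x|lborel. LINT t|lborel. F x t)"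
    by (simp add: F_val)
  also have "\<dots> = (LINT t|lborel. LINT x|lborel. F x t)"
    by (rule lborel_pair.Fubini_integral[OF F_int', symmetric])
  also have "\<dots> = (LINT t|lborel. LINT x|lborel. F' t x)"
  proof -
    have [measurable]: "(\<lambda>x. F x t) \<in> borel_measurable borel" for t unfolding F_def c_def by measurable
    show ?thesis unfolding F'_def by (subst lborel_integral_translate[of "\<lambda>x. F x _"]) simp_all
  qed
  also have "\<dots> = (LINT x|lborel. LINT t|lborel. F' t x)"
    by (rule lborel_pair.Fubini_integral[symmetric]) (use F'_int in \<open>unfold case_prod_unfold\<close>)
  also have "\<dots> = (LINT x::vec3|lborel. 0)"
  proof (rule integral_cong_AE)
    have "case_prod (\<lambda>x t. F' t x) \<in> borel_measurable (lborel \<Otimes>\<^sub>M lborel)"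
      unfolding F'_def F_def c_def by (simp add: split_beta cong: measurable_cong_sets)
    then show "(\<lambda>x. LINT t|lborel. F' t x) \<in> borel_measurable lborel"
      by (rule lborel.borel_measurable_lebesgue_integral)
    have F'_alt: "F' t x = (g x / l x * indicator X x) * (indicator (chord_params \<theta> x) (- t) * \<delta> (x - (- t) *\<^sub>R \<theta>))" for t x
    proof (cases "x \<in> X \<and> - t \<in> chord_params \<theta> x")
      case True
      define z where "z = x - (- t) *\<^sub>R \<theta>"
      have z: "z \<in> X" "\<tau> z \<theta> = \<tau> x \<theta> + t" "\<tau> z \<theta>' = \<tau> x \<theta>' - t"
        using chord_move[OF \<theta>, of x "- t"] True by (simp_all add: z_def \<theta>'_def)
      have zx: "t *\<^sub>R \<theta> + x = z" by (simp add: z_def)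
      have "c z t = 1" using z True tau_pos[OF \<theta>, of x] tau_pos[OF \<theta>', of x]
        by (simp add: c_def chord_params_def \<theta>'_def)
      moreover have "l z = l x" by (simp add: l_def z)
      moreover have "g z = g x" using inv[of x t] by (simp add: z_def)
      ultimately show ?thesis using True by (simp add: F'_def F_def zx z_def)
    next
      case False
      have "c (t *\<^sub>R \<theta> + x) t = 0"
      proof (rule ccontr)
        assume "c (t *\<^sub>R \<theta> + x) t \<noteq> 0"
        then have in1: "t *\<^sub>R \<theta> + x \<in> X" "t \<in> chord_params \<theta> (t *\<^sub>R \<theta> + x)"
          by (auto simp: c_def chord_params_def \<theta>'_def split: if_splits)
        then show False using chord_move[OF \<theta> in1] False tau_pos[OF \<theta> in1(1)] tau_pos[OF _ in1(1), of "- \<theta>"] \<theta>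
          by (auto simp: chord_params_def)
      qed
      then show ?thesis using False by (auto simp: F'_def F_def)
    qed
    have refl: "(LINT t|lborel. H (- t)) = (LINT t|lborel. H t)" for H :: "real \<Rightarrow> real"
      using lborel_integral_real_affine[of "-1" H 0] by simp
    show "AE x in lborel. (LINT t|lborel. F' t x) = 0"
      using zero
    proof eventually_elim
      case (elim x)
      have "(LINT t|lborel. F' t x) = (g x / l x * indicator X x) * (LINT t|lborel. indicator (chord_params \<theta> x) (- t) * \<delta> (x - (- t) *\<^sub>R \<theta>))"
        unfolding F'_alt by simp
      also have "(LINT t|lborel. indicator (chord_params \<theta> x) (- t) * \<delta> (x - (- t) *\<^sub>R \<theta>)) =
          (LINT t|lborel. indicator (chord_params \<theta> x) t * \<delta> (x - t *\<^sub>R \<theta>))"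
        by (rule refl[of "\<lambda>t. indicator (chord_params \<theta> x) t * \<delta> (x - t *\<^sub>R \<theta>)"])
      finally show ?case using elim by (cases "x \<in> X") auto
    qed
  qed simp
  finally show ?thesis by simp
qed

text \<open>For almost every direction \<open>\<theta>\<close> the Fourier transform of \<open>\<delta>\<close> on \<open>X\<close> vanishes at the frequencies orthogonal
  to \<open>\<theta>\<close>, since the corresponding waves are constant in direction \<open>\<theta>\<close>. By continuity it vanishes
  everywhere, so \<open>\<delta>\<close> is orthogonal to trigonometric polynomials and hence to bumps.\<close>

theorem xray_injective:
  assumes d_meas [measurable]: "\<delta> \<in> borel_measurable borel" and D: "\<And>x. \<bar>\<delta> x\<bar> \<le> (D::real)"
    and cont: "continuous_on X \<delta>"
    and zero: "AE \<theta> in sphere_measure. AE x in lborel. x \<in> X \<longrightarrow>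
      (LINT t|lborel. indicator (chord_params \<theta> x) t * \<delta> (x - t *\<^sub>R \<theta>)) = 0"
    and x0: "x0 \<in> X"
  shows "\<delta> x0 = 0"
proof -
  define H where "H h = (LINT x|lborel. indicator X x * (h x * \<delta> x))" for h
  have D0: "0 \<le> D" using D[of 0] by linarith
  have H_int: "integrable lborel (\<lambda>x. indicator X x * (h x * \<delta> x))"
    if "h \<in> borel_measurable borel" "\<And>x. \<bar>h x\<bar> \<le> M" for h M
  proof (rule domain_integrable[where M="M * D"])
    note [measurable] = that(1)
    show "(\<lambda>x. h x * \<delta> x) \<in> borel_measurable borel" by measurable
    show "\<bar>h x * \<delta> x\<bar> \<le> M * D" for x
      unfolding abs_mult using that(2)[of x] D[of x] by (intro mult_mono) (auto intro: order_trans[OF abs_ge_zero])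
  qed
  have [measurable]: "(\<lambda>x. cos (Q \<bullet> x)) \<in> borel_measurable borel" "(\<lambda>x. sin (Q \<bullet> x)) \<in> borel_measurable borel" for Q :: vec3
    by (intro borel_measurable_continuous_onI continuous_intros)+
  have cI: "integrable lborel (\<lambda>x. indicator X x * (cos (Q \<bullet> x) * \<delta> x))"
    and sI: "integrable lborel (\<lambda>x. indicator X x * (sin (Q \<bullet> x) * \<delta> x))" for Q
    by (rule H_int[where M=1]; simp)+
  have ortho: "AE \<theta> in sphere_measure. \<forall>Q. Q \<bullet> \<theta> = 0 \<longrightarrow> H (\<lambda>x. cos (Q \<bullet> x)) = 0 \<and> H (\<lambda>x. sin (Q \<bullet> x)) = 0"
    using zero
  proof (rule AE_space_mono, intro allI impI conjI)
    fix \<theta> Q assume \<theta>: "\<theta> \<in> space sphere_measure" and Q: "Q \<bullet> \<theta> = 0" and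
      z: "AE x in lborel. x \<in> X \<longrightarrow> (LINT t|lborel. indicator (chord_params \<theta> x) t * \<delta> (x - t *\<^sub>R \<theta>)) = 0"
    have \<theta>: "\<theta> \<in> S2" using \<theta> by simp
    show "H (\<lambda>x. cos (Q \<bullet> x)) = 0" unfolding H_def
      by (rule chord_integral_zero[OF \<theta> d_meas _ D _ _ z, where G=1]) (auto simp: inner_add_right Q)
    show "H (\<lambda>x. sin (Q \<bullet> x)) = 0" unfolding H_def
      by (rule chord_integral_zero[OF \<theta> d_meas _ D _ _ z, where G=1]) (auto simp: inner_add_right Q)
  qed
  have all: "H (\<lambda>x. cos (Q \<bullet> x)) = 0 \<and> H (\<lambda>x. sin (Q \<bullet> x)) = 0" for Q
  proof -
    obtain e :: vec3 where e: "e \<noteq> 0" "orthogonal Q e"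
      using orthogonal_to_vector_exists[of Q] by auto
    define \<theta>0 where "\<theta>0 = sgn e"
    have \<theta>0: "\<theta>0 \<in> S2" using e by (simp add: \<theta>0_def norm_sgn)
    have Q0: "Q \<bullet> \<theta>0 = 0" using e by (simp add: \<theta>0_def sgn_div_norm orthogonal_def)
    have "\<exists>\<theta>\<in>S2. \<theta> \<in> ball \<theta>0 (1 / real (Suc n)) \<and> (\<forall>Q. Q \<bullet> \<theta> = 0 \<longrightarrow> H (\<lambda>x. cos (Q \<bullet> x)) = 0 \<and> H (\<lambda>x. sin (Q \<bullet> x)) = 0)" for n
      by (rule AE_sphere_ex[OF ortho _ _ \<theta>0]) auto
    then have "\<exists>\<theta>. \<theta> \<in> S2 \<and> \<theta> \<in> ball \<theta>0 (1 / real (Suc n)) \<and> (\<forall>Q. Q \<bullet> \<theta> = 0 \<longrightarrow> H (\<lambda>x. cos (Q \<bullet> x)) = 0 \<and> H (\<lambda>x. sin (Q \<bullet> x)) = 0)" for n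
      by blast
    then obtain \<theta> where \<theta>: "\<And>n. \<theta> n \<in> S2" "\<And>n. \<theta> n \<in> ball \<theta>0 (1 / real (Suc n))"
      "\<And>n Q. Q \<bullet> \<theta> n = 0 \<Longrightarrow> H (\<lambda>x. cos (Q \<bullet> x)) = 0 \<and> H (\<lambda>x. sin (Q \<bullet> x)) = 0"
      by metis
    have "(\<lambda>n. dist (\<theta> n) \<theta>0) \<longlonglongrightarrow> 0"
    proof (rule Lim_null_comparison[OF _ LIMSEQ_Suc[OF lim_1_over_n]])
      show "eventually (\<lambda>n. norm (dist (\<theta> n) \<theta>0) \<le> 1 / real (Suc n)) sequentially"
        using \<theta>(2) by (intro always_eventually allI) (simp add: dist_commute less_imp_le)
    qed
    then have lim\<theta>: "\<theta> \<longlonglongrightarrow> \<theta>0" by (rule tendsto_dist_iff[THEN iffD2])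
    define P where "P n = Q - (Q \<bullet> \<theta> n) *\<^sub>R \<theta> n" for n
    \<comment> \<open>\<open>P n\<close> is the component of \<open>Q\<close> orthogonal to the good direction \<open>\<theta> n\<close>.\<close>
    have P0: "P n \<bullet> \<theta> n = 0" for n using \<theta>(1)[of n] by (simp add: P_def inner_diff_left norm_eq_1)
    have "P \<longlonglongrightarrow> Q - (Q \<bullet> \<theta>0) *\<^sub>R \<theta>0" unfolding P_def by (intro tendsto_intros lim\<theta>)
    then have limP: "P \<longlonglongrightarrow> Q" by (simp add: Q0)
    have dom: "integrable lborel (\<lambda>x. indicator X x * D)" using domain_integrable[of "\<lambda>_. D" D] D0 by simp
    have "(\<lambda>n. H (\<lambda>x. cos (P n \<bullet> x))) \<longlonglongrightarrow> H (\<lambda>x. cos (Q \<bullet> x))"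
      unfolding H_def
    proof (rule integral_dominated_convergence[OF _ _ dom])
      show "AE x in lborel. (\<lambda>n. indicator X x * (cos (P n \<bullet> x) * \<delta> x)) \<longlonglongrightarrow> indicator X x * (cos (Q \<bullet> x) * \<delta> x)"
        by (intro AE_I2 tendsto_intros limP)
      show "AE x in lborel. norm (indicator X x * (cos (P n \<bullet> x) * \<delta> x)) \<le> indicator X x * D" for n
      proof (intro AE_I2)
        fix x
        have "\<bar>cos (P n \<bullet> x)\<bar> * \<bar>\<delta> x\<bar> \<le> 1 * D" using D by (intro mult_mono) auto
        then show "norm (indicator X x * (cos (P n \<bullet> x) * \<delta> x)) \<le> indicator X x * D"
          by (simp add: abs_mult indicator_def)
      qed
    qed (rule borel_measurable_integrable[OF cI])+
    moreover have "H (\<lambda>x. cos (P n \<bullet> x)) = 0" for n using \<theta>(3)[OF P0[of n]] by simp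
    ultimately have 1: "H (\<lambda>x. cos (Q \<bullet> x)) = 0" by (simp add: LIMSEQ_const_iff)
    have "(\<lambda>n. H (\<lambda>x. sin (P n \<bullet> x))) \<longlonglongrightarrow> H (\<lambda>x. sin (Q \<bullet> x))"
      unfolding H_def
    proof (rule integral_dominated_convergence[OF _ _ dom])
      show "AE x in lborel. (\<lambda>n. indicator X x * (sin (P n \<bullet> x) * \<delta> x)) \<longlonglongrightarrow> indicator X x * (sin (Q \<bullet> x) * \<delta> x)"
        by (intro AE_I2 tendsto_intros limP)
      show "AE x in lborel. norm (indicator X x * (sin (P n \<bullet> x) * \<delta> x)) \<le> indicator X x * D" for n
      proof (intro AE_I2)
        fix x
        have "\<bar>sin (P n \<bullet> x)\<bar> * \<bar>\<delta> x\<bar> \<le> 1 * D" using D by (intro mult_mono) auto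
        then show "norm (indicator X x * (sin (P n \<bullet> x) * \<delta> x)) \<le> indicator X x * D"
          by (simp add: abs_mult indicator_def)
      qed
    qed (rule borel_measurable_integrable[OF sI])+
    moreover have "H (\<lambda>x. sin (P n \<bullet> x)) = 0" for n using \<theta>(3)[OF P0[of n]] by simp
    ultimately have "H (\<lambda>x. sin (Q \<bullet> x)) = 0" by (simp add: LIMSEQ_const_iff)
    with 1 show ?thesis by simp
  qed
  have trig: "H g = 0 \<and> g \<in> borel_measurable borel \<and> (\<exists>M. \<forall>x. \<bar>g x\<bar> \<le> M)" if "trig_poly g" for g
    using that
  proof (induction rule: trig_poly.induct)
    case (cos Q c)
    have "\<bar>c * cos (Q \<bullet> x)\<bar> \<le> \<bar>c\<bar>" for x
      using mult_left_mono[OF abs_cos_le_one[of "Q \<bullet> x"], of "\<bar>c\<bar>"] by (simp add: abs_mult)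
    moreover have "H (\<lambda>x. c * cos (Q \<bullet> x)) = c * H (\<lambda>x. cos (Q \<bullet> x))"
      unfolding H_def by (simp add: mult.left_commute[of _ c] mult.assoc)
    ultimately show ?case using all[of Q] by auto
  next
    case (sin Q c)
    have "\<bar>c * sin (Q \<bullet> x)\<bar> \<le> \<bar>c\<bar>" for x
      using mult_left_mono[OF abs_sin_le_one[of "Q \<bullet> x"], of "\<bar>c\<bar>"] by (simp add: abs_mult)
    moreover have "H (\<lambda>x. c * sin (Q \<bullet> x)) = c * H (\<lambda>x. sin (Q \<bullet> x))"
      unfolding H_def by (simp add: mult.left_commute[of _ c] mult.assoc)
    ultimately show ?case using all[of Q] by auto
  next
    case (add f g)
    then obtain M N where MN: "\<And>x. \<bar>f x\<bar> \<le> M" "\<And>x. \<bar>g x\<bar> \<le> N" by auto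
    have "\<bar>f x + g x\<bar> \<le> M + N" for x using MN[of x] abs_triangle_ineq[of "f x" "g x"] by linarith
    moreover have "H (\<lambda>x. f x + g x) = H f + H g"
      unfolding H_def distrib_right distrib_left
      by (intro Bochner_Integration.integral_add H_int[OF _ MN(1)] H_int[OF _ MN(2)]) (use add in auto)
    ultimately show ?case using add by auto
  qed
  show ?thesis
  proof (rule ccontr)
    assume ne: "\<delta> x0 \<noteq> 0"
    define \<eta> where "\<eta> = \<bar>\<delta> x0\<bar> / 2"
    define sg where "sg = sgn (\<delta> x0)"
    have \<eta>: "0 < \<eta>" using ne by (simp add: \<eta>_def)
    have "isCont \<delta> x0" using cont x0 X_open by (simp add: continuous_on_eq_continuous_at)
    then obtain r1 where r1: "0 < r1" "\<And>x. dist x x0 < r1 \<Longrightarrow> dist (\<delta> x) (\<delta> x0) < \<eta>"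
      using \<eta> unfolding continuous_at_eps_delta by auto
    obtain r2 where r2: "0 < r2" "ball x0 r2 \<subseteq> X" using X_open x0 open_contains_ball by blast
    define r where "r = min r1 r2"
    have r: "0 < r" "ball x0 r \<subseteq> X" "r \<le> r1" using r1 r2 by (auto simp: r_def)
    have sign: "\<eta> \<le> sg * \<delta> x" if "dist x x0 < r" for x
    proof -
      have near: "\<bar>\<delta> x - \<delta> x0\<bar> < \<eta>" using r1(2)[of x] that r by (simp add: dist_real_def)
      show ?thesis
      proof (cases "0 < \<delta> x0")
        case True
        then have "sg = 1" "\<delta> x0 = 2 * \<eta>" by (simp_all add: sg_def \<eta>_def)
        then show ?thesis using near by (simp add: abs_less_iff)
      next
        case False
        then have "sg = - 1" "\<delta> x0 = - 2 * \<eta>" using ne by (simp_all add: sg_def \<eta>_def)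
        then show ?thesis using near by (simp add: abs_less_iff)
      qed
    qed
    have b_meas [measurable]: "bump r x0 \<in> borel_measurable borel"
      by (intro borel_measurable_continuous_onI bump_continuous)
    have b_abs: "\<bar>bump r x0 x\<bar> \<le> 1" for x using bump_bounds(1)[of r x0 x] bump_bounds(2)[OF r(1), of x0 x] by simp
    define m where "m = measure lborel (ball x0 (r / 2))"
    have ball_fin: "emeasure lborel (ball x0 (r / 2)) < \<infinity>" by (intro emeasure_bounded_finite) auto
    have "\<not> negligible (ball x0 (r / 2))" using r by (intro open_not_negligible) auto
    then have "emeasure lborel (ball x0 (r / 2)) \<noteq> 0"
      by (auto simp: negligible_iff_null_sets null_sets_completion_iff null_sets_def)
    then have m: "0 < m" unfolding m_def using ball_fin by (simp add: measure_def enn2real_positive_iff zero_less_iff_neq_zero less_top)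
    have "(\<eta> / 2) * m = (LINT x|lborel. (\<eta> / 2) * indicator (ball x0 (r / 2)) x)" by (simp add: m_def)
    also have "\<dots> \<le> (LINT x|lborel. sg * (indicator X x * (bump r x0 x * \<delta> x)))"
    proof (rule integral_mono)
      show "integrable lborel (\<lambda>x. (\<eta> / 2) * indicator (ball x0 (r / 2)) x)"
        using ball_fin by (intro integrable_mult_right integrable_real_indicator) auto
      show "integrable lborel (\<lambda>x. sg * (indicator X x * (bump r x0 x * \<delta> x)))"
        by (intro integrable_mult_right H_int[OF b_meas b_abs])
      fix x
      show "(\<eta> / 2) * indicator (ball x0 (r / 2)) x \<le> sg * (indicator X x * (bump r x0 x * \<delta> x))"
      proof (cases "dist x x0 < r")
        case False
        then show ?thesis using bump_outside[OF r(1), of x x0] r(1) by (simp add: indicator_def dist_commute)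
      next
        case True
        then have "x \<in> X" using r(2) by (auto simp: dist_commute)
        moreover have "(\<eta> / 2) * indicator (ball x0 (r / 2)) x \<le> bump r x0 x * (sg * \<delta> x)"
        proof (cases "x \<in> ball x0 (r / 2)")
          case in_half: True
          then have "1 / 2 \<le> bump r x0 x" by (intro bump_inside r(1)) (simp add: dist_commute less_imp_le)
          then have "(1 / 2) * \<eta> \<le> bump r x0 x * (sg * \<delta> x)"
            using sign[OF True] \<eta> bump_bounds(1) by (intro mult_mono) auto
          then show ?thesis using in_half by simp
        next
          case False
          have "0 \<le> sg * \<delta> x" using sign[OF True] \<eta> by linarith
          from mult_nonneg_nonneg[OF bump_bounds(1) this] have "0 \<le> bump r x0 x * (sg * \<delta> x)" .
          then show ?thesis using False by simp
        qed
        ultimately show ?thesis by (simp add: algebra_simps)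
      qed
    qed
    also have "\<dots> = sg * H (bump r x0)" by (simp add: H_def)
    finally have low: "(\<eta> / 2) * m \<le> sg * H (bump r x0)" .
    have upper: "\<bar>H (bump r x0)\<bar> \<le> e * (LINT x|lborel. indicator X x * D)" if e: "0 < e" for e
    proof -
      obtain g where g: "trig_poly g" "\<And>x. x \<in> cball 0 R \<Longrightarrow> \<bar>bump r x0 x - g x\<bar> < e"
        by (rule trig_poly_dense[OF bump_continuous e]) blast
      obtain M where M: "\<And>x. \<bar>g x\<bar> \<le> M" and gm: "g \<in> borel_measurable borel" "H g = 0" using trig[OF g(1)] by blast
      have "H (bump r x0) - H g = (LINT x|lborel. indicator X x * (bump r x0 x * \<delta> x) - indicator X x * (g x * \<delta> x))"
        unfolding H_def by (intro Bochner_Integration.integral_diff[symmetric] H_int[OF b_meas b_abs] H_int[OF gm(1) M])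
      also have "norm \<dots> \<le> (LINT x|lborel. norm (indicator X x * (bump r x0 x * \<delta> x) - indicator X x * (g x * \<delta> x)))"
        by (rule integral_norm_bound)
      also have "\<dots> \<le> (LINT x|lborel. e * (indicator X x * D))"
      proof (rule integral_mono)
        show "integrable lborel (\<lambda>x. norm (indicator X x * (bump r x0 x * \<delta> x) - indicator X x * (g x * \<delta> x)))"
          by (intro integrable_norm Bochner_Integration.integrable_diff H_int[OF b_meas b_abs] H_int[OF gm(1) M])
        show "integrable lborel (\<lambda>x. e * (indicator X x * D))"
          using domain_integrable[of "\<lambda>_. D" D] D0 by (intro integrable_mult_right) simp
        fix x
        show "norm (indicator X x * (bump r x0 x * \<delta> x) - indicator X x * (g x * \<delta> x)) \<le> e * (indicator X x * D)"
        proof (cases "x \<in> X")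
          case True
          then have "\<bar>bump r x0 x - g x\<bar> \<le> e" using in_ball g(2)[of x] by force
          then have "\<bar>bump r x0 x - g x\<bar> * \<bar>\<delta> x\<bar> \<le> e * D" using D e by (intro mult_mono) auto
          then show ?thesis using True by (simp add: left_diff_distrib[symmetric] abs_mult)
        qed simp
      qed
      finally show ?thesis using gm(2) by simp
    qed
    define I where "I = (LINT x|lborel. indicator X x * D)"
    have I: "0 \<le> I" unfolding I_def using D0 by (intro integral_nonneg_AE AE_I2) simp
    define e where "e = (\<eta> * m) / (4 * (I + 1))"
    have e: "0 < e" using \<eta> m I by (simp add: e_def)
    have "sg * H (bump r x0) \<le> \<bar>H (bump r x0)\<bar>"
      by (auto simp: sg_def sgn_if abs_if)
    also have "\<dots> \<le> e * I" using upper[OF e] by (simp add: I_def)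
    also have "\<dots> \<le> e * (I + 1)" using e by (intro mult_left_mono) auto
    also have "\<dots> = (\<eta> * m) / 4" using I by (simp add: e_def field_simps)
    finally have "(\<eta> / 2) * m \<le> (\<eta> * m) / 4" using low by linarith
    then show False using \<eta> m by simp
  qed
qed

end

section \<open>Recovery of the attenuation\<close>

lemma AE_lborel_ex:
  fixes U :: "vec3 set"
  assumes "AE x in lborel. P x" "open U" "U \<noteq> {}"
  shows "\<exists>x\<in>U. P x"
proof (rule ccontr)
  assume no: "\<not> ?thesis"
  obtain N where N: "N \<in> null_sets lborel" "{x\<in>space lborel. \<not> P x} \<subseteq> N"
    using assms(1) by (auto simp: eventually_ae_filter)
  have "U \<subseteq> N" using no N(2) by auto
  then have "U \<in> null_sets lborel"
    using N(1) assms(2) null_sets_subset[of N lborel U] by auto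
  then have "negligible U" by (simp add: negligible_iff_null_sets null_sets_completionI)
  then show False using open_not_negligible[OF assms(2,3)] by simp
qed

context coefficients
begin

lemma att_end:
  assumes "0 < N"
  shows "((\<lambda>r. att s y \<theta> (N - r)) \<longlongrightarrow> att s y \<theta> N) (at_right 0)"
proof -
  have c: "continuous_on {0..N} (\<lambda>t. att s y \<theta> t)"
    unfolding att_def by (intro continuous_intros indefinite_continuous s_line_int)
  have "continuous_on {0..N} (\<lambda>r. att s y \<theta> (N - r))"
    by (rule continuous_on_compose2[OF c]) (auto intro!: continuous_intros)
  then have "((\<lambda>r. att s y \<theta> (N - r)) \<longlongrightarrow> att s y \<theta> (N - 0)) (at 0 within {0..N})"
    using assms unfolding continuous_on by (auto dest!: bspec[where x=0])
  then show ?thesis using assms by (simp add: at_within_Icc_at_right)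
qed

end

lemma line_inv_const: "line_inv (\<lambda>_. c)" by (simp add: line_inv_def)

context two_coefficients
begin

text \<open>With unit inflow the weighted value at the entrance of a chord is the transmission along the
  whole chord, so the transmissions agree. Their logarithms are X-ray transforms.\<close>

theorem attenuation_determined:
  assumes a: "a \<noteq> 0" and eq: "\<And>Q. A01 X a \<sigma>1 k1 Q (\<lambda>_. 1) = A01 X a \<sigma>2 k2 Q (\<lambda>_. 1)"
    and x0: "x0 \<in> X"
  shows "\<sigma>1 x0 = \<sigma>2 x0"
proof -
  note one = bounded_borel_const[of 1] line_inv_const[of 1]
  define \<delta> where "\<delta> x = indicator X x * (s1 x - s2 x)" for x
  have \<delta>_meas: "\<delta> \<in> borel_measurable borel"
    unfolding \<delta>_def using A.s_meas B.s_meas A.X_borel by measurable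
  have \<delta>_bound: "\<bar>\<delta> x\<bar> \<le> Smax1 + Smax2" for x
    using A.s_abs[of x] B.s_abs[of x] A.Smax_nonneg B.Smax_nonneg by (auto simp: \<delta>_def indicator_def)
  have \<delta>_cont: "continuous_on X \<delta>"
  proof (rule continuous_on_eq)
    show "continuous_on X (\<lambda>x. s1 x - s2 x)" by (intro continuous_intros A.s_cont B.s_cont)
  qed (simp add: \<delta>_def)
  have infl: "AE z in inflow_measure X. True" by simp
  have zero: "AE \<theta> in sphere_measure. AE x in lborel. x \<in> X \<longrightarrow>
      (LINT t|lborel. indicator (A.chord_params \<theta> x) t * \<delta> (x - t *\<^sub>R \<theta>)) = 0"
    using weights_equal[OF one a eq] A.inflow_AE[OF infl] AE_space
  proof eventually_elim
    case (elim \<theta>)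
    have \<theta>: "\<theta> \<in> S2" "- \<theta> \<in> S2" using elim(3) by simp_all
    from elim(1,2) show ?case
    proof eventually_elim
      case (elim x)
      show ?case
      proof
        assume x: "x \<in> X"
        define T where "T = back_time X x (- \<theta>)"
        define y where "y = x + T *\<^sub>R \<theta>"
        define N where "N = back_time X y \<theta>"
        have T: "0 < T" unfolding T_def by (rule A.tau_pos[OF \<theta>(2) x])
        have N: "N = T + back_time X x \<theta>"
          unfolding N_def y_def
        proof (rule A.tau_shift[OF \<theta>(1) _ x])
          fix r assume r: "0 \<le> r" "r < T"
          show "x + r *\<^sub>R \<theta> \<in> X"
          proof (cases "r = 0")
            case False
            then have "x - r *\<^sub>R (- \<theta>) \<in> X" using r by (intro A.inside_chord) (auto simp: T_def)
            then show ?thesis by simp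
          qed (use x in simp)
        qed (use T in simp)
        have N0: "0 < N" using T A.tau_pos[OF \<theta>(1) x] N by simp
        define e where "e = x - back_time X x \<theta> *\<^sub>R \<theta>"
        have eG: "(e, \<theta>) \<in> Gamma_minus X" using elim(2) x by (simp add: e_def)
        have er: "e + r *\<^sub>R \<theta> = y - (N - r) *\<^sub>R \<theta>" for r by (simp add: e_def y_def N algebra_simps)
        let ?G = "\<lambda>r. att s1 y \<theta> (N - r) * A.sol (\<lambda>_. 0) (\<lambda>_. 1) (e + r *\<^sub>R \<theta>, \<theta>) -
            att s2 y \<theta> (N - r) * B.sol (\<lambda>_. 0) (\<lambda>_. 1) (e + r *\<^sub>R \<theta>, \<theta>)"
        have "(?G \<longlongrightarrow> att s1 y \<theta> N * 1 - att s2 y \<theta> N * 1) (at_right 0)"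
          by (intro tendsto_intros A.att_end[OF N0] B.att_end[OF N0]
              A.sol_entry_limit[OF bounded_borel_const one eG] B.sol_entry_limit[OF bounded_borel_const one eG])
        moreover have "AE r in lborel. 0 < r \<and> r < N \<longrightarrow> ?G r = 0"
        proof (intro AE_I2 impI)
          fix r assume "0 < r \<and> r < N"
          then show "?G r = 0"
            using elim(1) x unfolding er by (simp add: y_def T_def N_def)
        qed
        ultimately have "att s1 y \<theta> N * 1 - att s2 y \<theta> N * 1 = 0" by (rule limit_zero_of_AE_zero[OF _ N0])
        then have int_eq: "(LINT r:{0..N}|lborel. s1 (y - r *\<^sub>R \<theta>)) = (LINT r:{0..N}|lborel. s2 (y - r *\<^sub>R \<theta>))"
          by (simp add: att_def)
        have "(LINT t|lborel. indicator (A.chord_params \<theta> x) t * \<delta> (x - t *\<^sub>R \<theta>)) =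
            (LINT r|lborel. indicator (A.chord_params \<theta> x) (- T + 1 * r) * \<delta> (x - (- T + 1 * r) *\<^sub>R \<theta>))"
          using lborel_integral_real_affine[of 1 "\<lambda>t. indicator (A.chord_params \<theta> x) t * \<delta> (x - t *\<^sub>R \<theta>)" "- T"] by simp
        also have "\<dots> = (LINT r|lborel. indicator {0..N} r *\<^sub>R (s1 (y - r *\<^sub>R \<theta>) - s2 (y - r *\<^sub>R \<theta>)))"
        proof (rule integral_cong_AE)
          note [measurable] = A.s_meas B.s_meas \<delta>_meas
          show "(\<lambda>r. indicator (A.chord_params \<theta> x) (- T + 1 * r) * \<delta> (x - (- T + 1 * r) *\<^sub>R \<theta>)) \<in> borel_measurable lborel"
            unfolding A.chord_params_def by measurable
          show "(\<lambda>r. indicator {0..N} r *\<^sub>R (s1 (y - r *\<^sub>R \<theta>) - s2 (y - r *\<^sub>R \<theta>))) \<in> borel_measurable lborel"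
            by measurable
          show "AE r in lborel. indicator (A.chord_params \<theta> x) (- T + 1 * r) * \<delta> (x - (- T + 1 * r) *\<^sub>R \<theta>) =
              indicator {0..N} r *\<^sub>R (s1 (y - r *\<^sub>R \<theta>) - s2 (y - r *\<^sub>R \<theta>))"
            using AE_lborel_singleton[of "0::real"] AE_lborel_singleton[of N]
          proof eventually_elim
            case (elim r)
            have pt: "x - (- T + 1 * r) *\<^sub>R \<theta> = y - r *\<^sub>R \<theta>" by (simp add: y_def algebra_simps)
            have iff: "- T + 1 * r \<in> A.chord_params \<theta> x \<longleftrightarrow> 0 < r \<and> r < N"
              by (auto simp: A.chord_params_def T_def N)
            show ?case
            proof (cases "0 < r \<and> r < N")
              case True
              then have "y - r *\<^sub>R \<theta> \<in> X" by (intro A.inside_chord) (auto simp: N_def)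
              then show ?thesis using True iff pt by (simp add: \<delta>_def)
            next
              case False
              then have "r \<notin> {0..N}" using elim by auto
              then show ?thesis using False iff by simp
            qed
          qed
        qed
        also have "\<dots> = (LINT r:{0..N}|lborel. s1 (y - r *\<^sub>R \<theta>)) - (LINT r:{0..N}|lborel. s2 (y - r *\<^sub>R \<theta>))"
          using set_integral_diff(2)[OF A.s_line_int B.s_line_int, of 0 N y \<theta> y \<theta>] by (simp add: set_lebesgue_integral_def)
        finally show "(LINT t|lborel. indicator (A.chord_params \<theta> x) t * \<delta> (x - t *\<^sub>R \<theta>)) = 0"
          using int_eq by simp
      qed
    qed
  qed
  have "\<delta> x0 = 0" by (rule A.xray_injective[OF \<delta>_meas \<delta>_bound \<delta>_cont zero x0])
  then show ?thesis using x0 A.s_eq[OF x0] B.s_eq[OF x0] by (simp add: \<delta>_def)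
qed

end

section \<open>Recovery of the scattering kernel\<close>

definition beam :: "vec3 \<Rightarrow> real \<Rightarrow> vec3 \<Rightarrow> real \<Rightarrow> vec3 \<times> vec3 \<Rightarrow> real" where
  "beam p r c \<epsilon> z = (if hits_ball p r (fst z) (snd z) \<and> dist (snd z) c < \<epsilon> then 1 else 0)"

lemma beam_bounded_borel: "bounded_borel (beam p r c \<epsilon>)"
proof (rule bounded_borelI[where M=1])
  have "open ({(z, \<theta>). hits_ball p r z \<theta>} \<inter> {z. dist (snd z) c < \<epsilon>})"
    by (intro open_Int open_hits_ball open_Collect_less continuous_intros)
  then have "(indicator ({(z, \<theta>). hits_ball p r z \<theta>} \<inter> {z. dist (snd z) c < \<epsilon>}) :: vec3 \<times> vec3 \<Rightarrow> real) \<in> borel_measurable borel"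
    by (intro borel_measurable_indicator) simp
  moreover have "beam p r c \<epsilon> = indicator ({(z, \<theta>). hits_ball p r z \<theta>} \<inter> {z. dist (snd z) c < \<epsilon>})"
    by (auto simp: beam_def fun_eq_iff indicator_def)
  ultimately show "beam p r c \<epsilon> \<in> borel_measurable borel" by simp
qed (simp add: beam_def)

lemma beam_line_inv: "line_inv (beam p r c \<epsilon>)"
  by (simp add: line_inv_def beam_def)

context two_coefficients
begin

context
  assumes s_agree: "\<And>x. x \<in> X \<Longrightarrow> s1 x = s2 x"
begin

lemma att_agree:
  assumes "0 \<le> t" "t \<le> back_time X y \<theta>"
  shows "att s1 y \<theta> t = att s2 y \<theta> t"
proof -
  have "(LINT r:{0..t}|lborel. s1 (y - r *\<^sub>R \<theta>)) = (LINT r:{0..t}|lborel. s2 (y - r *\<^sub>R \<theta>))"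
    unfolding set_lebesgue_integral_def
  proof (rule integral_cong_AE)
    note [measurable] = A.s_meas B.s_meas
    show "(\<lambda>r. indicator {0..t} r *\<^sub>R s1 (y - r *\<^sub>R \<theta>)) \<in> borel_measurable lborel"
      "(\<lambda>r. indicator {0..t} r *\<^sub>R s2 (y - r *\<^sub>R \<theta>)) \<in> borel_measurable lborel" by measurable
    show "AE r in lborel. indicator {0..t} r *\<^sub>R s1 (y - r *\<^sub>R \<theta>) = indicator {0..t} r *\<^sub>R s2 (y - r *\<^sub>R \<theta>)"
      using AE_lborel_singleton[of "0::real"] AE_lborel_singleton[of t]
    proof eventually_elim
      case (elim r)
      show ?case
      proof (cases "r \<in> {0..t}")
        case True
        then have "y - r *\<^sub>R \<theta> \<in> X" using elim assms by (intro A.inside_chord) auto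
        then show ?thesis by (simp add: s_agree)
      qed simp
    qed
  qed
  then show ?thesis by (simp add: att_def)
qed

lemma E_agree: "A.E z = B.E z"
  unfolding A.E_def B.E_def by (intro att_agree A.tau_nonneg order_refl)

text \<open>Suppose \<open>k1 - k2\<close> is positive near \<open>(x0, \<theta>0, c0)\<close>. Illuminate a ball of radius \<open>r\<close> near \<open>x0\<close> with a
  beam of directions near \<open>c0\<close>. In the ball the radiation is the unscattered beam up to \<open>O(r)\<close>, so
  scattering into directions near \<open>\<theta>0\<close> is strictly stronger in the first system. But the two
  solutions agree, which forces equal amounts of light scattered along short segments.\<close>

lemma kernel_not_greater:
  assumes a: "a \<noteq> 0" and D: "\<And>U. open U \<Longrightarrow> U \<noteq> {} \<Longrightarrow> \<exists>d\<in>D. d \<in> (U :: vec3 set)"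
    and eq: "\<And>Q p c n m. p \<in> D \<Longrightarrow> c \<in> D \<Longrightarrow>
      A01 X a \<sigma>1 k1 Q (beam p (1 / real (Suc n)) c (1 / real (Suc m))) =
      A01 X a \<sigma>2 k2 Q (beam p (1 / real (Suc n)) c (1 / real (Suc m)))"
    and cont: "continuous_on (X \<times> S2 \<times> S2) (\<lambda>z. k1 (fst z) (fst (snd z)) (snd (snd z)))"
      "continuous_on (X \<times> S2 \<times> S2) (\<lambda>z. k2 (fst z) (fst (snd z)) (snd (snd z)))"
    and x0: "x0 \<in> X" "\<theta>0 \<in> S2" "c0 \<in> S2"
  shows "k1 x0 \<theta>0 c0 \<le> k2 x0 \<theta>0 c0"
proof (rule ccontr)
  assume "\<not> ?thesis"
  then have gt: "k2 x0 \<theta>0 c0 < k1 x0 \<theta>0 c0" by simp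
  define \<eta> where "\<eta> = (k1 x0 \<theta>0 c0 - k2 x0 \<theta>0 c0) / 2"
  have \<eta>: "0 < \<eta>" using gt by (simp add: \<eta>_def)
  let ?\<kappa> = "\<lambda>z. k1 (fst z) (fst (snd z)) (snd (snd z)) - k2 (fst z) (fst (snd z)) (snd (snd z))"
  have "continuous_on (X \<times> S2 \<times> S2) ?\<kappa>" by (intro continuous_intros cont)
  then obtain d where d: "0 < d" "\<And>z. z \<in> X \<times> S2 \<times> S2 \<Longrightarrow> dist z (x0, \<theta>0, c0) < d \<Longrightarrow>
      dist (?\<kappa> z) (?\<kappa> (x0, \<theta>0, c0)) < \<eta>"
    using x0 \<eta> unfolding continuous_on_iff by (metis mem_Sigma_iff)
  obtain d' where d': "0 < d'" "ball x0 d' \<subseteq> X" using A.X_open x0 open_contains_ball by blast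
  define \<rho> where "\<rho> = min (d / 3) d'"
  have \<rho>: "0 < \<rho>" "\<rho> \<le> d / 3" "ball x0 \<rho> \<subseteq> X" using d(1) d' by (auto simp: \<rho>_def)
  have \<kappa>: "\<eta> \<le> k1 x \<theta> \<theta>' - k2 x \<theta> \<theta>'"
    if "dist x x0 < \<rho>" "\<theta> \<in> S2" "dist \<theta> \<theta>0 < \<rho>" "\<theta>' \<in> S2" "dist \<theta>' c0 < \<rho>" for x \<theta> \<theta>'
  proof -
    have "x \<in> X" using that \<rho>(3) by (auto simp: dist_commute)
    then have in1: "(x, \<theta>, \<theta>') \<in> X \<times> S2 \<times> S2" using that by simp
    have "dist (x, \<theta>, \<theta>') (x0, \<theta>0, c0) \<le> dist x x0 + dist (\<theta>, \<theta>') (\<theta>0, c0)"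
      unfolding dist_Pair_Pair[of x] by (rule sqrt_sum_squares_le_sum) auto
    also have "dist (\<theta>, \<theta>') (\<theta>0, c0) \<le> dist \<theta> \<theta>0 + dist \<theta>' c0"
      unfolding dist_Pair_Pair by (rule sqrt_sum_squares_le_sum) auto
    finally have "dist (x, \<theta>, \<theta>') (x0, \<theta>0, c0) < d" using that \<rho>(2) by linarith
    moreover have "2 * \<eta> = k1 x0 \<theta>0 c0 - k2 x0 \<theta>0 c0" by (simp add: \<eta>_def)
    ultimately have "\<bar>(k1 x \<theta> \<theta>' - k2 x \<theta> \<theta>') - 2 * \<eta>\<bar> < \<eta>"
      using d(2)[OF in1] by (simp add: dist_real_def)
    then show ?thesis by (simp add: abs_less_iff)
  qed
  obtain m :: nat where m: "1 / real (Suc m) < \<rho> / 2"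
    using reals_Archimedean[of "\<rho> / 2"] \<rho>(1) by (auto simp: inverse_eq_divide)
  define \<epsilon> where "\<epsilon> = 1 / real (Suc m)"
  have \<epsilon>: "0 < \<epsilon>" "\<epsilon> < \<rho> / 2" using m by (simp_all add: \<epsilon>_def)
  obtain c where c: "c \<in> D" "dist c c0 < \<epsilon>"
    using D[of "ball c0 \<epsilon>"] \<epsilon> by (auto simp: dist_commute)
  obtain p where p: "p \<in> D" "dist p x0 < \<rho> / 2"
    using D[of "ball x0 (\<rho> / 2)"] \<rho>(1) by (auto simp: dist_commute)
  define cap where "cap = {\<theta>' \<in> S2. \<theta>' \<in> ball c \<epsilon>}"
  have cap_sets: "cap \<in> sets sphere_measure" unfolding cap_def by (rule sphere_measure_sets_borel) auto
  define \<mu> where "\<mu> = measure sphere_measure cap"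
  have \<mu>: "0 < \<mu>" unfolding \<mu>_def cap_def
    by (rule sphere_measure_open_pos[of _ c0]) (use c x0 in auto)
  have cap_near: "dist \<theta>' c0 < \<rho>" if "\<theta>' \<in> cap" for \<theta>'
    using that dist_triangle[of \<theta>' c0 c] c \<epsilon> by (auto simp: cap_def dist_commute)
  \<comment> \<open>A chord has length at most \<open>2 R\<close>, so \<open>e0\<close> bounds the attenuation of the beam from below.\<close>
  define e0 where "e0 = exp (- (Smax1 * (2 * R)))"
  have e0: "0 < e0" by (simp add: e0_def)
  define C where "C = 24 * Kmax1 * A.beam_const + 24 * Kmax2 * B.beam_const"
  have C: "0 \<le> C" using A.Kmax_nonneg B.Kmax_nonneg A.beam_const_nonneg B.beam_const_nonneg by (simp add: C_def)
  \<comment> \<open>The two gains differ by at least \<open>b\<close>, up to an error \<open>C r\<close>; \<open>b\<close> does not depend on \<open>r\<close>.\<close>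
  define b where "b = \<eta> * e0 * \<mu>"
  have b: "0 < b" using \<eta> e0 \<mu> by (simp add: b_def)
  obtain n :: nat where n: "1 / real (Suc n) < min (\<rho> / 2) (b / (2 * (C + 1)))"
    using reals_Archimedean[of "min (\<rho> / 2) (b / (2 * (C + 1)))"] \<rho>(1) b C by (auto simp: inverse_eq_divide)
  define r where "r = 1 / real (Suc n)"
  have r: "0 < r" "r < \<rho> / 2" "r < b / (2 * (C + 1))" using n by (simp_all add: r_def)
  have "C * r \<le> (C + 1) * r" using r(1) by (intro mult_right_mono) auto
  also have "\<dots> \<le> (C + 1) * (b / (2 * (C + 1)))" using r(3) C by (intro mult_left_mono) auto
  also have "\<dots> = b / 2" using C by (simp add: field_simps)
  finally have Cr: "C * r \<le> b / 2" .
  have ball_X: "ball p r \<subseteq> ball x0 \<rho>"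
  proof
    fix x assume "x \<in> ball p r"
    then show "x \<in> ball x0 \<rho>" using dist_triangle[of x0 x p] p r by (auto simp: dist_commute)
  qed
  define f where "f = beam p r c \<epsilon>"
  have f: "bounded_borel f" "line_inv f" unfolding f_def by (rule beam_bounded_borel beam_line_inv)+
  note z0 = bounded_borel_const[of 0]
  define u1 where "u1 = A.sol (\<lambda>_. 0) f"
  define u2 where "u2 = B.sol (\<lambda>_. 0) f"
  have u: "bounded_borel u1" "bounded_borel u2"
    unfolding u1_def u2_def by (intro A.sol_bounded_borel B.sol_bounded_borel z0 f)+
  have beam_le: "\<bar>f (x, \<theta>)\<bar> \<le> (if hits_ball p r x \<theta> then 1 else 0)" for x \<theta> by (simp add: f_def beam_def)
  have near1: "\<bar>u1 z - A.E z * f z\<bar> \<le> A.beam_const * r" and near2: "\<bar>u2 z - B.E z * f z\<bar> \<le> B.beam_const * r" for z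
    unfolding u1_def u2_def by (rule A.sol_beam_inflow[OF f(1) r(1) beam_le] B.sol_beam_inflow[OF f(1) r(1) beam_le])+
  have EfA: "bounded_borel (\<lambda>z. A.E z * f z)" and EfB: "bounded_borel (\<lambda>z. B.E z * f z)"
    by (intro bounded_borel_mult A.E_bounded_borel B.E_bounded_borel f)+
  have gain: "b / 2 \<le> A.K u1 (x, \<theta>) - B.K u2 (x, \<theta>)" if x: "x \<in> ball p r" and \<theta>: "\<theta> \<in> S2" "dist \<theta> \<theta>0 < \<rho>" for x \<theta>
  proof -
    have x\<rho>: "dist x x0 < \<rho>" "x \<in> X" using x ball_X \<rho>(3) by (auto simp: dist_commute)
    have "\<bar>A.K (\<lambda>z. u1 z - A.E z * f z) (x, \<theta>)\<bar> \<le> A.beam_const * r * (24 * Kmax1)"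
      by (rule A.K_bound_global[OF bounded_borel_diff[OF u(1) EfA] near1])
    then have 1: "\<bar>A.K u1 (x, \<theta>) - A.K (\<lambda>z. A.E z * f z) (x, \<theta>)\<bar> \<le> A.beam_const * r * (24 * Kmax1)"
      by (simp add: A.K_diff[OF u(1) EfA])
    have "\<bar>B.K (\<lambda>z. u2 z - B.E z * f z) (x, \<theta>)\<bar> \<le> B.beam_const * r * (24 * Kmax2)"
      by (rule B.K_bound_global[OF bounded_borel_diff[OF u(2) EfB] near2])
    then have 2: "\<bar>B.K u2 (x, \<theta>) - B.K (\<lambda>z. B.E z * f z) (x, \<theta>)\<bar> \<le> B.beam_const * r * (24 * Kmax2)"
      by (simp add: B.K_diff[OF u(2) EfB])
    have hit: "hits_ball p r x \<theta>'" for \<theta>'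
      unfolding hits_ball_def using x by (intro exI[of _ 0]) (simp add: dist_commute)
    have fx: "f (x, \<theta>') = indicator cap \<theta>'" if "\<theta>' \<in> S2" for \<theta>'
      using that by (auto simp: f_def beam_def hit cap_def indicator_def dist_commute)
    have "b = (LINT \<theta>'|sphere_measure. (\<eta> * e0) * indicator cap \<theta>')"
    proof -
      have "cap \<inter> space sphere_measure = cap" by (auto simp: cap_def)
      then show ?thesis by (simp add: b_def \<mu>_def)
    qed
    also have "\<dots> \<le> (LINT \<theta>'|sphere_measure. kk1 x \<theta> \<theta>' * (A.E (x, \<theta>') * f (x, \<theta>')) - kk2 x \<theta> \<theta>' * (B.E (x, \<theta>') * f (x, \<theta>')))"
    proof (rule integral_mono)
      show "integrable sphere_measure (\<lambda>\<theta>'. (\<eta> * e0) * indicator cap \<theta>')"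
        using cap_sets by (intro integrable_mult_right integrable_real_indicator) (auto simp: sphere.emeasure_eq_measure)
      show "integrable sphere_measure (\<lambda>\<theta>'. kk1 x \<theta> \<theta>' * (A.E (x, \<theta>') * f (x, \<theta>')) - kk2 x \<theta> \<theta>' * (B.E (x, \<theta>') * f (x, \<theta>')))"
        by (intro Bochner_Integration.integrable_diff A.kk_u_int[OF EfA] B.kk_u_int[OF EfB])
      fix \<theta>' assume "\<theta>' \<in> space sphere_measure"
      then have \<theta>': "\<theta>' \<in> S2" by simp
      show "(\<eta> * e0) * indicator cap \<theta>' \<le> kk1 x \<theta> \<theta>' * (A.E (x, \<theta>') * f (x, \<theta>')) - kk2 x \<theta> \<theta>' * (B.E (x, \<theta>') * f (x, \<theta>'))"
      proof (cases "\<theta>' \<in> cap")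
        case True
        have "\<eta> \<le> k1 x \<theta> \<theta>' - k2 x \<theta> \<theta>'" by (rule \<kappa>[OF x\<rho>(1) \<theta> \<theta>' cap_near[OF True]])
        moreover have "e0 \<le> A.E (x, \<theta>')" unfolding e0_def by (rule A.E_bounds)
        ultimately have "\<eta> * e0 \<le> (k1 x \<theta> \<theta>' - k2 x \<theta> \<theta>') * A.E (x, \<theta>')"
          using \<eta> e0 by (intro mult_mono) auto
        then show ?thesis
          using True by (simp add: fx[OF \<theta>'] E_agree[symmetric] A.kk_eq[OF x\<rho>(2) \<theta>(1) \<theta>'] B.kk_eq[OF x\<rho>(2) \<theta>(1) \<theta>'] left_diff_distrib)
      qed (simp add: fx[OF \<theta>'])
    qed
    also have "\<dots> = A.K (\<lambda>z. A.E z * f z) (x, \<theta>) - B.K (\<lambda>z. B.E z * f z) (x, \<theta>)"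
      unfolding A.K_def B.K_def fst_conv snd_conv
      by (intro Bochner_Integration.integral_diff A.kk_u_int[OF EfA] B.kk_u_int[OF EfB])
    finally have 3: "b \<le> A.K (\<lambda>z. A.E z * f z) (x, \<theta>) - B.K (\<lambda>z. B.E z * f z) (x, \<theta>)" .
    have "A.beam_const * r * (24 * Kmax1) + B.beam_const * r * (24 * Kmax2) = C * r" by (simp add: C_def algebra_simps)
    then show ?thesis using 1 2 3 Cr unfolding abs_le_iff by linarith
  qed
  have eqf: "A01 X a \<sigma>1 k1 Q f = A01 X a \<sigma>2 k2 Q f" for Q
    unfolding f_def r_def \<epsilon>_def by (rule eq[OF p(1) c(1)])
  obtain \<theta> where \<theta>: "\<theta> \<in> S2" "\<theta> \<in> ball \<theta>0 \<rho>" and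
    ae: "AE x in lborel. x \<in> X \<longrightarrow>
      (\<forall>t y. y = x + back_time X x (- \<theta>) *\<^sub>R \<theta> \<longrightarrow> 0 < t \<longrightarrow> t < back_time X y \<theta> \<longrightarrow>
        att s1 y \<theta> t * u1 (y - t *\<^sub>R \<theta>, \<theta>) = att s2 y \<theta> t * u2 (y - t *\<^sub>R \<theta>, \<theta>))"
    using AE_sphere_ex[OF weights_equal[OF f a eqf] open_ball _ x0(2), of \<theta>0 \<rho>] \<rho>(1) unfolding u1_def u2_def by auto
  have \<theta>': "- \<theta> \<in> S2" "dist \<theta> \<theta>0 < \<rho>" using \<theta> by (simp_all add: dist_commute)
  obtain x where x: "x \<in> ball p r" and w: "x \<in> X \<longrightarrow>
      (\<forall>t y. y = x + back_time X x (- \<theta>) *\<^sub>R \<theta> \<longrightarrow> 0 < t \<longrightarrow> t < back_time X y \<theta> \<longrightarrow>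
        att s1 y \<theta> t * u1 (y - t *\<^sub>R \<theta>, \<theta>) = att s2 y \<theta> t * u2 (y - t *\<^sub>R \<theta>, \<theta>))"
    using AE_lborel_ex[OF ae open_ball, of p r] r(1) by auto
  have xX: "x \<in> X" using x ball_X \<rho>(3) by blast
  define T where "T = back_time X x (- \<theta>)"
  define y where "y = x + T *\<^sub>R \<theta>"
  have T: "0 < T" unfolding T_def by (rule A.tau_pos[OF \<theta>'(1) xX])
  have \<tau>y: "back_time X y \<theta> = T + back_time X x \<theta>"
    unfolding y_def
  proof (rule A.tau_shift[OF \<theta>(1) _ xX])
    fix r assume r: "0 \<le> r" "r < T"
    show "x + r *\<^sub>R \<theta> \<in> X"
    proof (cases "r = 0")
      case False
      then have "x - r *\<^sub>R (- \<theta>) \<in> X" using r by (intro A.inside_chord) (auto simp: T_def)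
      then show ?thesis by simp
    qed (use xX in simp)
  qed (use T in simp)
  have same: "u1 (x - v *\<^sub>R \<theta>, \<theta>) = u2 (x - v *\<^sub>R \<theta>, \<theta>)" if v: "0 \<le> v" "v < back_time X x \<theta>" for v
  proof -
    have "att s1 y \<theta> (T + v) * u1 (y - (T + v) *\<^sub>R \<theta>, \<theta>) = att s2 y \<theta> (T + v) * u2 (y - (T + v) *\<^sub>R \<theta>, \<theta>)"
      using w xX v T \<tau>y by (simp add: y_def T_def)
    moreover have "att s1 y \<theta> (T + v) = att s2 y \<theta> (T + v)" using v T \<tau>y by (intro att_agree) auto
    moreover have "y - (T + v) *\<^sub>R \<theta> = x - v *\<^sub>R \<theta>" by (simp add: y_def algebra_simps)
    ultimately show ?thesis using A.att_pos[of y \<theta> "T + v"] B.att_pos[of y \<theta> "T + v"] by simp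
  qed
  define t where "t = (r - dist x p) / 2"
  have t: "0 < t" "dist x p + t < r" using x by (auto simp: t_def dist_commute field_simps)
  have in_ball: "x - v *\<^sub>R \<theta> \<in> ball p r" if "0 \<le> v" "v \<le> t" for v
  proof -
    have "dist (x - v *\<^sub>R \<theta>) x = v" using \<theta>(1) that by (simp add: dist_norm)
    then have "dist (x - v *\<^sub>R \<theta>) p < r" using dist_triangle[of "x - v *\<^sub>R \<theta>" p x] that t by linarith
    then show ?thesis by (simp only: mem_ball dist_commute)
  qed
  have inX: "x - v *\<^sub>R \<theta> \<in> X" if "0 \<le> v" "v \<le> t" for v using in_ball[OF that] ball_X \<rho>(3) by blast
  have t\<tau>: "t < back_time X x \<theta>" by (rule A.tau_greater[OF \<theta>(1) t(1)]) (use inX in auto)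
  define x' where "x' = x - t *\<^sub>R \<theta>"
  have x'X: "x' \<in> X" unfolding x'_def using t by (intro inX) auto
  have x'x: "x' + t *\<^sub>R \<theta> = x" by (simp add: x'_def)
  have seg: "x' + v *\<^sub>R \<theta> \<in> X" if "0 \<le> v" "v < t" for v
    using inX[of "t - v"] that by (simp add: x'_def algebra_simps)
  have h1: "bounded_borel (\<lambda>z. A.K u1 z + 0)" and h2: "bounded_borel (\<lambda>z. B.K u2 z + 0)"
    by (intro bounded_borel_add A.K_bounded_borel B.K_bounded_borel u z0)+
  have fl1: "u1 (x, \<theta>) = att s1 x \<theta> t * u1 (x', \<theta>) + (LINT v:{0..t}|lborel. att s1 x \<theta> v * (A.K u1 (x - v *\<^sub>R \<theta>, \<theta>) + 0))"
    using A.ballistic_flow[OF h1 f(2) \<theta>(1) less_imp_le[OF t(1)] x'X seg A.sol_eq[OF z0 f(1), folded u1_def]]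
    unfolding x'x .
  have fl2: "u2 (x, \<theta>) = att s2 x \<theta> t * u2 (x', \<theta>) + (LINT v:{0..t}|lborel. att s2 x \<theta> v * (B.K u2 (x - v *\<^sub>R \<theta>, \<theta>) + 0))"
    using B.ballistic_flow[OF h2 f(2) \<theta>(1) less_imp_le[OF t(1)] x'X seg B.sol_eq[OF z0 f(1), folded u2_def]]
    unfolding x'x .
  have "u1 (x, \<theta>) = u2 (x, \<theta>)" using same[of 0] A.tau_pos[OF \<theta>(1) xX] by simp
  moreover have "u1 (x', \<theta>) = u2 (x', \<theta>)" unfolding x'_def using t t\<tau> by (intro same) auto
  moreover have "att s1 x \<theta> t = att s2 x \<theta> t" using t t\<tau> by (intro att_agree) auto
  ultimately have ints: "(LINT v:{0..t}|lborel. att s1 x \<theta> v * (A.K u1 (x - v *\<^sub>R \<theta>, \<theta>) + 0)) =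
      (LINT v:{0..t}|lborel. att s2 x \<theta> v * (B.K u2 (x - v *\<^sub>R \<theta>, \<theta>) + 0))"
    using fl1 fl2 by simp
  have i1: "set_integrable lborel {0..t} (\<lambda>v. att s1 x \<theta> v * (A.K u1 (x - v *\<^sub>R \<theta>, \<theta>) + 0))"
    using A.att_h_int[OF h1] .
  have i2: "set_integrable lborel {0..t} (\<lambda>v. att s2 x \<theta> v * (B.K u2 (x - v *\<^sub>R \<theta>, \<theta>) + 0))"
    using B.att_h_int[OF h2] .
  have "0 < exp (- (Smax1 * t)) * (b / 2) * t" using b t by simp
  also have "\<dots> = (LINT v:{0..t}|lborel. exp (- (Smax1 * t)) * (b / 2))" using t by (simp add: set_integral_const)
  also have "\<dots> \<le> (LINT v:{0..t}|lborel. att s1 x \<theta> v * (A.K u1 (x - v *\<^sub>R \<theta>, \<theta>) + 0) - att s2 x \<theta> v * (B.K u2 (x - v *\<^sub>R \<theta>, \<theta>) + 0))"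
  proof (rule set_integral_mono)
    show "set_integrable lborel {0..t} (\<lambda>v. exp (- (Smax1 * t)) * (b / 2))"
      by (rule set_integrable_bounded[where M="exp (- (Smax1 * t)) * (b / 2)"]) (use b in auto)
    show "set_integrable lborel {0..t} (\<lambda>v. att s1 x \<theta> v * (A.K u1 (x - v *\<^sub>R \<theta>, \<theta>) + 0) - att s2 x \<theta> v * (B.K u2 (x - v *\<^sub>R \<theta>, \<theta>) + 0))"
      by (rule set_integral_diff(1)[OF i1 i2])
    fix v assume v: "v \<in> {0..t}"
    have "exp (- (Smax1 * t)) \<le> exp (- (Smax1 * v))" using v A.Smax_nonneg by (simp add: mult_left_mono)
    also have "\<dots> \<le> att s1 x \<theta> v" using v by (intro A.att_ge) auto
    finally have att: "exp (- (Smax1 * t)) \<le> att s1 x \<theta> v" .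
    have "b / 2 \<le> A.K u1 (x - v *\<^sub>R \<theta>, \<theta>) - B.K u2 (x - v *\<^sub>R \<theta>, \<theta>)"
      using v by (intro gain in_ball \<theta> \<theta>') auto
    then have "exp (- (Smax1 * t)) * (b / 2) \<le> att s1 x \<theta> v * (A.K u1 (x - v *\<^sub>R \<theta>, \<theta>) - B.K u2 (x - v *\<^sub>R \<theta>, \<theta>))"
      using att b A.att_pos[of x \<theta> v] by (intro mult_mono) auto
    moreover have "att s1 x \<theta> v = att s2 x \<theta> v" using v t\<tau> by (intro att_agree) auto
    ultimately show "exp (- (Smax1 * t)) * (b / 2) \<le>
        att s1 x \<theta> v * (A.K u1 (x - v *\<^sub>R \<theta>, \<theta>) + 0) - att s2 x \<theta> v * (B.K u2 (x - v *\<^sub>R \<theta>, \<theta>) + 0)"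
      by (simp add: right_diff_distrib)
  qed
  also have "\<dots> = 0" using set_integral_diff(2)[OF i1 i2] ints by simp
  finally show False by simp
qed

end

end

section \<open>Admissible coefficients\<close>

text \<open>The essential supremum in \<open>total_scattering\<close> bounds the scattering integral only for almost
  every direction. Since that integral depends continuously on the direction, the bound holds for
  every direction.\<close>

lemma scattering_integral_le:
  assumes adm: "admissible X \<sigma> k" and x: "x \<in> X" and \<theta>: "\<theta> \<in> S2"
    and K: "\<And>\<theta> \<theta>'. \<theta> \<in> S2 \<Longrightarrow> \<theta>' \<in> S2 \<Longrightarrow> \<bar>k x \<theta> \<theta>'\<bar> \<le> K" and K0: "0 \<le> K"
  shows "(LINT \<theta>'|sphere_measure. k x \<theta> \<theta>') \<le> total_scattering k x"
    and "total_scattering k x \<le> 24 * K"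
proof -
  define I where "I \<theta> = (LINT \<theta>'|sphere_measure. k x \<theta> \<theta>')" for \<theta>
  have kc: "continuous_on (X \<times> S2 \<times> S2) (\<lambda>(x, \<theta>, \<theta>'). k x \<theta> \<theta>')"
    using adm by (simp add: admissible_def)
  have kc1: "continuous_on S2 (\<lambda>\<theta>'. k x \<theta> \<theta>')" if "\<theta> \<in> S2" for \<theta>
  proof -
    have "continuous_on S2 (\<lambda>\<theta>'. (x, \<theta>, \<theta>'))" by (intro continuous_intros)
    from continuous_on_compose2[OF kc this] show ?thesis using that x by (simp add: image_subset_iff)
  qed
  have kc2: "continuous_on S2 (\<lambda>\<theta>. k x \<theta> \<theta>')" if "\<theta>' \<in> S2" for \<theta>'
  proof -
    have "continuous_on S2 (\<lambda>\<theta>. (x, \<theta>, \<theta>'))" by (intro continuous_intros)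
    from continuous_on_compose2[OF kc this] show ?thesis using that x by (simp add: image_subset_iff)
  qed
  have km: "(\<lambda>\<theta>'. k x \<theta> \<theta>') \<in> borel_measurable sphere_measure" if "\<theta> \<in> S2" for \<theta>
    using borel_measurable_continuous_on_restrict[OF kc1[OF that]]
    by (simp cong: measurable_cong_sets add: sphere_measure_sets)
  have Ki: "integrable sphere_measure (\<lambda>_. K)" by simp
  have Ic: "continuous_on S2 I"
    unfolding continuous_on_sequentially
  proof (intro allI ballI impI)
    fix u \<theta>0 assume \<theta>0: "\<theta>0 \<in> S2" and "(\<forall>n. u n \<in> S2) \<and> u \<longlonglongrightarrow> \<theta>0"
    then have u: "\<And>n. u n \<in> S2" "u \<longlonglongrightarrow> \<theta>0" by auto
    have "(\<lambda>n. LINT \<theta>'|sphere_measure. k x (u n) \<theta>') \<longlonglongrightarrow> (LINT \<theta>'|sphere_measure. k x \<theta>0 \<theta>')"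
    proof (rule integral_dominated_convergence[OF _ _ Ki])
      show "AE \<theta>' in sphere_measure. (\<lambda>n. k x (u n) \<theta>') \<longlonglongrightarrow> k x \<theta>0 \<theta>'"
        using kc2 u \<theta>0 unfolding continuous_on_sequentially by (intro AE_I2) (auto simp: comp_def)
      show "AE \<theta>' in sphere_measure. norm (k x (u n) \<theta>') \<le> K" for n
        using K u by (intro AE_I2) auto
    qed (use km u \<theta>0 in auto)
    then show "(I \<circ> u) \<longlonglongrightarrow> I \<theta>0" by (simp add: I_def comp_def)
  qed
  have Im: "I \<in> borel_measurable sphere_measure"
    using borel_measurable_continuous_on_restrict[OF Ic]
    by (simp cong: measurable_cong_sets add: sphere_measure_sets)
  have Ib: "\<bar>I \<theta>\<bar> \<le> 24 * K" if "\<theta> \<in> S2" for \<theta>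
  proof -
    have "\<bar>I \<theta>\<bar> \<le> (LINT \<theta>'|sphere_measure. K)"
      unfolding I_def
    proof (rule order_trans[OF integral_abs_bound integral_mono'])
      show "\<bar>k x \<theta> \<theta>'\<bar> \<le> K" if "\<theta>' \<in> space sphere_measure" for \<theta>' using K that \<open>\<theta> \<in> S2\<close> by simp
    qed (use K0 in auto)
    also have "\<dots> \<le> 24 * K" using measure_sphere_le[of S2] K0 by (simp add: mult_right_mono)
    finally show ?thesis .
  qed
  define e where "e = esssup sphere_measure (\<lambda>\<theta>. ereal \<bar>I \<theta>\<bar>)"
  have ts: "total_scattering k x = real_of_ereal e" by (simp add: total_scattering_def e_def I_def)
  have le_e: "AE \<theta> in sphere_measure. ereal \<bar>I \<theta>\<bar> \<le> e" unfolding e_def by (rule esssup_AE)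
  have e_le: "e \<le> ereal (24 * K)"
    unfolding e_def using Im Ib by (intro esssup_I AE_I2) auto
  show "total_scattering k x \<le> 24 * K" unfolding ts using e_le K0 by (cases e) auto
  have ae: "AE \<theta> in sphere_measure. I \<theta> \<le> real_of_ereal e"
    using le_e
  proof eventually_elim
    case (elim \<theta>)
    then show ?case using e_le by (cases e) auto
  qed
  show "(LINT \<theta>'|sphere_measure. k x \<theta> \<theta>') \<le> total_scattering k x"
  proof (rule ccontr)
    assume "\<not> ?thesis"
    then have gt: "0 < I \<theta> - real_of_ereal e" by (simp add: ts I_def)
    then obtain d where d: "0 < d" "\<And>\<theta>'. \<theta>' \<in> S2 \<Longrightarrow> dist \<theta>' \<theta> < d \<Longrightarrow> dist (I \<theta>') (I \<theta>) < I \<theta> - real_of_ereal e"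
      using Ic[unfolded continuous_on_iff, rule_format, OF \<theta> gt] by blast
    obtain \<theta>' where "\<theta>' \<in> S2" "\<theta>' \<in> ball \<theta> d" "I \<theta>' \<le> real_of_ereal e"
      using AE_sphere_ex[OF ae open_ball _ \<theta>, of \<theta> d] d(1) by auto
    then show False using d(2)[of \<theta>'] by (simp add: dist_real_def dist_commute)
  qed
qed

text \<open>Extending the coefficients by zero makes them Borel on the whole space. The lower bound on
  absorption turns scattering into a strict contraction.\<close>

lemma (in transport_domain) admissible_extended:
  assumes adm: "admissible X \<sigma> k"
  obtains q Smax Kmax where "extended_coefficients X R (\<lambda>x. if x \<in> X then \<sigma> x else 0)
      (\<lambda>x \<theta> \<theta>'. if x \<in> X \<and> \<theta> \<in> S2 \<and> \<theta>' \<in> S2 then k x \<theta> \<theta>' else 0) q Smax Kmax \<sigma> k"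
proof -
  let ?s = "\<lambda>x. if x \<in> X then \<sigma> x else 0"
  let ?kk = "\<lambda>x \<theta> \<theta>'. if x \<in> X \<and> \<theta> \<in> S2 \<and> \<theta>' \<in> S2 then k x \<theta> \<theta>' else 0"
  have sc: "continuous_on X \<sigma>" and kc: "continuous_on (X \<times> S2 \<times> S2) (\<lambda>(x, \<theta>, \<theta>'). k x \<theta> \<theta>')"
    and sn: "\<And>x. x \<in> X \<Longrightarrow> 0 \<le> \<sigma> x" and kn: "\<And>x \<theta> \<theta>'. x \<in> X \<Longrightarrow> \<theta> \<in> S2 \<Longrightarrow> \<theta>' \<in> S2 \<Longrightarrow> 0 \<le> k x \<theta> \<theta>'"
    using adm unfolding admissible_def by blast+
  have "bounded (\<sigma> ` X)" and kb: "bounded ((\<lambda>(x, \<theta>, \<theta>'). k x \<theta> \<theta>') ` (X \<times> S2 \<times> S2))"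
    using adm unfolding admissible_def by blast+
  then obtain S0 where S0: "\<And>x. x \<in> X \<Longrightarrow> \<bar>\<sigma> x\<bar> \<le> S0" by (auto simp: bounded_iff)
  obtain K0 where K0: "\<And>x \<theta> \<theta>'. x \<in> X \<Longrightarrow> \<theta> \<in> S2 \<Longrightarrow> \<theta>' \<in> S2 \<Longrightarrow> \<bar>k x \<theta> \<theta>'\<bar> \<le> K0"
    using kb unfolding bounded_iff by fastforce
  obtain c where c: "0 < c" "c < (INF x\<in>X. \<sigma> x - total_scattering k x)"
    using adm unfolding admissible_def by blast
  define K where "K = max K0 0"
  have K: "0 \<le> K" "\<And>x \<theta> \<theta>'. x \<in> X \<Longrightarrow> \<theta> \<in> S2 \<Longrightarrow> \<theta>' \<in> S2 \<Longrightarrow> \<bar>k x \<theta> \<theta>'\<bar> \<le> K"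
    using K0 by (auto simp: K_def le_max_iff_disj)
  define Smax where "Smax = max S0 c"
  have Smax: "0 < Smax" "c \<le> Smax" "\<And>x. x \<in> X \<Longrightarrow> \<sigma> x \<le> Smax" using c(1) S0 by (auto simp: Smax_def le_max_iff_disj abs_le_iff)
  \<comment> \<open>\<open>\<sigma> - c \<le> (1 - c / Smax) \<sigma>\<close> since \<open>\<sigma> \<le> Smax\<close>.\<close>
  define q where "q = 1 - c / Smax"
  have axis: "axis 1 1 \<in> S2" by simp
  have bdd: "bdd_below ((\<lambda>x. \<sigma> x - total_scattering k x) ` X)"
  proof (rule bdd_belowI2)
    fix x assume x: "x \<in> X"
    show "- (24 * K) \<le> \<sigma> x - total_scattering k x"
      using scattering_integral_le(2)[OF adm x axis K(2)[OF x] K(1)] sn[OF x] by linarith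
  qed
  have "extended_coefficients X R ?s ?kk q Smax K \<sigma> k"
  proof (unfold_locales)
    have "(\<lambda>x. indicator X x *\<^sub>R \<sigma> x) \<in> borel_measurable borel"
      by (rule borel_measurable_continuous_on_indicator[OF X_borel sc])
    moreover have "(\<lambda>x. indicator X x *\<^sub>R \<sigma> x) = ?s" by (auto simp: fun_eq_iff)
    ultimately show "?s \<in> borel_measurable borel" by simp
    have sph: "S2 \<in> sets borel" by (simp add: borel_closed)
    have "X \<times> S2 \<times> S2 \<in> sets borel"
      by (intro borel_Times X_borel sph)
    then have "(\<lambda>z. indicator (X \<times> S2 \<times> S2) z *\<^sub>R (case z of (x, \<theta>, \<theta>') \<Rightarrow> k x \<theta> \<theta>')) \<in> borel_measurable borel"
      by (rule borel_measurable_continuous_on_indicator) (rule kc)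
    moreover have "(\<lambda>z. indicator (X \<times> S2 \<times> S2) z *\<^sub>R (case z of (x, \<theta>, \<theta>') \<Rightarrow> k x \<theta> \<theta>')) =
        (\<lambda>z. ?kk (fst z) (fst (snd z)) (snd (snd z)))" by (auto simp: fun_eq_iff indicator_def)
    ultimately show "(\<lambda>z. ?kk (fst z) (fst (snd z)) (snd (snd z))) \<in> borel_measurable borel" by simp
    show "continuous_on X ?s" by (rule continuous_on_eq[OF sc]) simp
    show "0 \<le> q" "q < 1" using c(1) Smax by (simp_all add: q_def field_simps)
    show "(LINT \<theta>'|sphere_measure. ?kk x \<theta> \<theta>') \<le> q * ?s x" if x: "x \<in> X" and \<theta>: "\<theta> \<in> S2" for x \<theta>
    proof -
      have "(LINT \<theta>'|sphere_measure. ?kk x \<theta> \<theta>') = (LINT \<theta>'|sphere_measure. k x \<theta> \<theta>')"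
        using x \<theta> by (intro Bochner_Integration.integral_cong) auto
      also have "\<dots> \<le> total_scattering k x"
        by (rule scattering_integral_le(1)[OF adm x \<theta> K(2)[OF x] K(1)])
      also have "\<dots> \<le> \<sigma> x - c"
        using cINF_lower[OF bdd x] c(2) by linarith
      also have "\<dots> \<le> \<sigma> x - c / Smax * \<sigma> x"
      proof -
        have "c / Smax * \<sigma> x \<le> c / Smax * Smax" using Smax(3)[OF x] c(1) Smax(1) by (intro mult_left_mono) auto
        then show ?thesis using Smax(1) by simp
      qed
      also have "\<dots> = q * ?s x" using x by (simp add: q_def left_diff_distrib)
      finally show ?thesis .
    qed
  qed (use sn kn Smax K in \<open>auto simp: abs_le_iff\<close>)
  then show ?thesis by (rule that)
qed

section \<open>Injectivity of the boundary value map\<close>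

text \<open>A single real parameter suffices because countably many beams do: negative parameters give
  unit inflow, and \<open>t \<ge> 0\<close> gives beam number \<open>\<lfloor>t\<rfloor>\<close> in an enumeration.\<close>

definition probe :: "vec3 set \<Rightarrow> real \<Rightarrow> vec3 \<times> vec3 \<Rightarrow> real" where
  "probe D t =
     (if t < 0 then (\<lambda>_. 1)
      else case from_nat_into (D \<times> D \<times> UNIV \<times> UNIV) (nat \<lfloor>t\<rfloor>) of (p, c, n, m) \<Rightarrow>
        beam p (1 / real (Suc n)) c (1 / real (Suc m)))"

lemma probe_bounded_borel: "bounded_borel (probe D t)"
  by (simp add: probe_def bounded_borel_const beam_bounded_borel split: prod.split)

lemma one_in_probes: "(\<lambda>_. 1) \<in> range (probe D)"
  by (rule range_eqI[of _ _ "-1"]) (simp add: probe_def)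

lemma beam_in_probes:
  assumes "countable D" "p \<in> D" "c \<in> D"
  shows "beam p (1 / real (Suc n)) c (1 / real (Suc m)) \<in> range (probe D)"
proof -
  let ?B = "D \<times> D \<times> (UNIV :: nat set) \<times> (UNIV :: nat set)"
  have "from_nat_into ?B (to_nat_on ?B (p, c, n, m)) = (p, c, n, m)"
    using assms by (intro from_nat_into_to_nat_on countable_SIGMA) auto
  then have "probe D (real (to_nat_on ?B (p, c, n, m))) = beam p (1 / real (Suc n)) c (1 / real (Suc m))"
    by (simp add: probe_def)
  then show ?thesis by (metis rangeI)
qed

lemma (in transport_domain) admissible_pair:
  assumes "admissible X \<sigma>1 k1" "admissible X \<sigma>2 k2"
  obtains s1 kk1 q1 Smax1 Kmax1 s2 kk2 q2 Smax2 Kmax2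
  where "two_coefficients X R s1 kk1 q1 Smax1 Kmax1 \<sigma>1 k1 s2 kk2 q2 Smax2 Kmax2 \<sigma>2 k2"
  by (rule admissible_extended[OF assms(1)], rule admissible_extended[OF assms(2)])
    (rule that, rule two_coefficients.intro)

lemma (in transport_domain) unit_inflow_determines_attenuation:
  assumes "a \<noteq> 0" "admissible X \<sigma>1 k1" "admissible X \<sigma>2 k2"
    and "\<And>Q. A01 X a \<sigma>1 k1 Q (\<lambda>_. 1) = A01 X a \<sigma>2 k2 Q (\<lambda>_. 1)" "x \<in> X"
  shows "\<sigma>1 x = \<sigma>2 x"
proof -
  from admissible_pair[OF assms(2,3)] obtain s1 kk1 q1 Smax1 Kmax1 s2 kk2 q2 Smax2 Kmax2
    where "two_coefficients X R s1 kk1 q1 Smax1 Kmax1 \<sigma>1 k1 s2 kk2 q2 Smax2 Kmax2 \<sigma>2 k2" .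
  then show ?thesis by (rule two_coefficients.attenuation_determined) (use assms in auto)
qed

lemma (in transport_domain) beams_determine_kernel_le:
  assumes a: "a \<noteq> 0" and adm: "admissible X \<sigma>1 k1" "admissible X \<sigma>2 k2"
    and \<sigma>: "\<And>x. x \<in> X \<Longrightarrow> \<sigma>1 x = \<sigma>2 x"
    and D: "\<And>U. open U \<Longrightarrow> U \<noteq> {} \<Longrightarrow> \<exists>d\<in>D. d \<in> (U :: vec3 set)"
    and eq: "\<And>Q p c n m. p \<in> D \<Longrightarrow> c \<in> D \<Longrightarrow>
      A01 X a \<sigma>1 k1 Q (beam p (1 / real (Suc n)) c (1 / real (Suc m))) =
      A01 X a \<sigma>2 k2 Q (beam p (1 / real (Suc n)) c (1 / real (Suc m)))"
    and x: "x \<in> X" "\<theta> \<in> S2" "\<theta>' \<in> S2"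
  shows "k1 x \<theta> \<theta>' \<le> k2 x \<theta> \<theta>'"
proof -
  from admissible_pair[OF adm] obtain s1 kk1 q1 Smax1 Kmax1 s2 kk2 q2 Smax2 Kmax2
    where "two_coefficients X R s1 kk1 q1 Smax1 Kmax1 \<sigma>1 k1 s2 kk2 q2 Smax2 Kmax2 \<sigma>2 k2" .
  then interpret two_coefficients X R s1 kk1 q1 Smax1 Kmax1 \<sigma>1 k1 s2 kk2 q2 Smax2 Kmax2 \<sigma>2 k2 .
  have "continuous_on (X \<times> S2 \<times> S2) (\<lambda>(x, \<theta>, \<theta>'). k1 x \<theta> \<theta>')" "continuous_on (X \<times> S2 \<times> S2) (\<lambda>(x, \<theta>, \<theta>'). k2 x \<theta> \<theta>')"
    using adm unfolding admissible_def by blast+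
  then have cont: "continuous_on (X \<times> S2 \<times> S2) (\<lambda>z. k1 (fst z) (fst (snd z)) (snd (snd z)))"
    "continuous_on (X \<times> S2 \<times> S2) (\<lambda>z. k2 (fst z) (fst (snd z)) (snd (snd z)))"
    by (simp_all add: case_prod_unfold)
  have "s1 y = s2 y" if "y \<in> X" for y by (simp only: A.s_eq[OF that] B.s_eq[OF that] \<sigma>[OF that])
  from kernel_not_greater[OF this a D eq cont x] show ?thesis .
qed

theorem theorem1p1:
  fixes X :: "(real ^ 3) set" and a :: real
  assumes "bounded_smooth_domain X" and "a \<noteq> 0"
  shows
    "(\<forall>\<sigma>1 k1 \<sigma>2 k2. admissible X \<sigma>1 k1 \<and> admissible X \<sigma>2 k2 \<and>
        (\<forall>Q. \<forall>f\<in>Linf (inflow_measure X). A01 X a \<sigma>1 k1 Q f = A01 X a \<sigma>2 k2 Q f) \<longrightarrow>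
        (\<forall>x\<in>X. \<sigma>1 x = \<sigma>2 x) \<and> (\<forall>x\<in>X. \<forall>\<theta>\<in>S2. \<forall>\<theta>'\<in>S2. k1 x \<theta> \<theta>' = k2 x \<theta> \<theta>'))
     \<and>
     (\<exists>f\<in>Linf (inflow_measure X). \<forall>\<sigma>1 k1 \<sigma>2 k2. admissible X \<sigma>1 k1 \<and> admissible X \<sigma>2 k2 \<and>
        (\<forall>Q. A01 X a \<sigma>1 k1 Q f = A01 X a \<sigma>2 k2 Q f) \<longrightarrow>
        (\<forall>x\<in>X. \<sigma>1 x = \<sigma>2 x))
     \<and>
     (\<exists>\<phi> :: real \<Rightarrow> (real ^ 3) \<times> (real ^ 3) \<Rightarrow> real. range \<phi> \<subseteq> Linf (inflow_measure X) \<and>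
        (\<forall>\<sigma>1 k1 \<sigma>2 k2. admissible X \<sigma>1 k1 \<and> admissible X \<sigma>2 k2 \<and>
          (\<forall>Q. \<forall>f\<in>range \<phi>. A01 X a \<sigma>1 k1 Q f = A01 X a \<sigma>2 k2 Q f) \<longrightarrow>
          (\<forall>x\<in>X. \<sigma>1 x = \<sigma>2 x) \<and> (\<forall>x\<in>X. \<forall>\<theta>\<in>S2. \<forall>\<theta>'\<in>S2. k1 x \<theta> \<theta>' = k2 x \<theta> \<theta>')))"
proof -
  have "bounded X" using assms(1) by (simp add: bounded_smooth_domain_def)
  then obtain R where "X \<subseteq> ball 0 R" using bounded_subset_ballD[of X 0] by blast
  with assms(1) interpret transport_domain X R by unfold_locales
  obtain D :: "vec3 set" where D: "countable D" "\<And>U. open U \<Longrightarrow> U \<noteq> {} \<Longrightarrow> \<exists>d\<in>D. d \<in> U"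
    using countable_dense_setE by blast
  have probes: "range (probe D) \<subseteq> Linf (inflow_measure X)"
    using bounded_borel_Linf(2)[OF probe_bounded_borel] by blast
  have main: "(\<forall>x\<in>X. \<sigma>1 x = \<sigma>2 x) \<and> (\<forall>x\<in>X. \<forall>\<theta>\<in>S2. \<forall>\<theta>'\<in>S2. k1 x \<theta> \<theta>' = k2 x \<theta> \<theta>')"
    if adm: "admissible X \<sigma>1 k1" "admissible X \<sigma>2 k2"
      and eq: "\<And>Q f. f \<in> range (probe D) \<Longrightarrow> A01 X a \<sigma>1 k1 Q f = A01 X a \<sigma>2 k2 Q f" for \<sigma>1 k1 \<sigma>2 k2
  proof -
    have \<sigma>: "\<sigma>1 x = \<sigma>2 x" if "x \<in> X" for x
      by (rule unit_inflow_determines_attenuation[OF assms(2) adm eq[OF one_in_probes] that])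
    have beams: "A01 X a \<sigma>1 k1 Q (beam p (1 / real (Suc n)) c (1 / real (Suc m))) =
        A01 X a \<sigma>2 k2 Q (beam p (1 / real (Suc n)) c (1 / real (Suc m)))" if "p \<in> D" "c \<in> D" for Q p c n m
      by (rule eq[OF beam_in_probes[OF D(1) that]])
    have "k1 x \<theta> \<theta>' = k2 x \<theta> \<theta>'" if x: "x \<in> X" "\<theta> \<in> S2" "\<theta>' \<in> S2" for x \<theta> \<theta>'
    proof (rule antisym)
      show "k1 x \<theta> \<theta>' \<le> k2 x \<theta> \<theta>'"
        by (rule beams_determine_kernel_le[OF assms(2) adm \<sigma> D(2) beams x])
      show "k2 x \<theta> \<theta>' \<le> k1 x \<theta> \<theta>'"
        by (rule beams_determine_kernel_le[OF assms(2) adm(2,1) \<sigma>[symmetric] D(2) beams[symmetric] x])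
    qed
    with \<sigma> show ?thesis by blast
  qed
  show ?thesis
  proof (intro conjI)
    show "\<forall>\<sigma>1 k1 \<sigma>2 k2. admissible X \<sigma>1 k1 \<and> admissible X \<sigma>2 k2 \<and>
        (\<forall>Q. \<forall>f\<in>Linf (inflow_measure X). A01 X a \<sigma>1 k1 Q f = A01 X a \<sigma>2 k2 Q f) \<longrightarrow>
        (\<forall>x\<in>X. \<sigma>1 x = \<sigma>2 x) \<and> (\<forall>x\<in>X. \<forall>\<theta>\<in>S2. \<forall>\<theta>'\<in>S2. k1 x \<theta> \<theta>' = k2 x \<theta> \<theta>')"
      by (intro allI impI main) (use probes in blast)+
    show "\<exists>f\<in>Linf (inflow_measure X). \<forall>\<sigma>1 k1 \<sigma>2 k2. admissible X \<sigma>1 k1 \<and> admissible X \<sigma>2 k2 \<and>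
        (\<forall>Q. A01 X a \<sigma>1 k1 Q f = A01 X a \<sigma>2 k2 Q f) \<longrightarrow> (\<forall>x\<in>X. \<sigma>1 x = \<sigma>2 x)"
    proof (intro bexI allI impI ballI)
      show "(\<lambda>_. 1) \<in> Linf (inflow_measure X)" using probes one_in_probes by blast
      fix \<sigma>1 k1 \<sigma>2 k2 x
      assume "admissible X \<sigma>1 k1 \<and> admissible X \<sigma>2 k2 \<and>
        (\<forall>Q. A01 X a \<sigma>1 k1 Q (\<lambda>_. 1) = A01 X a \<sigma>2 k2 Q (\<lambda>_. 1))" "x \<in> X"
      then show "\<sigma>1 x = \<sigma>2 x" using unit_inflow_determines_attenuation[OF assms(2)] by blast
    qed
    show "\<exists>\<phi> :: real \<Rightarrow> vec3 \<times> vec3 \<Rightarrow> real. range \<phi> \<subseteq> Linf (inflow_measure X) \<and>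
        (\<forall>\<sigma>1 k1 \<sigma>2 k2. admissible X \<sigma>1 k1 \<and> admissible X \<sigma>2 k2 \<and>
          (\<forall>Q. \<forall>f\<in>range \<phi>. A01 X a \<sigma>1 k1 Q f = A01 X a \<sigma>2 k2 Q f) \<longrightarrow>
          (\<forall>x\<in>X. \<sigma>1 x = \<sigma>2 x) \<and> (\<forall>x\<in>X. \<forall>\<theta>\<in>S2. \<forall>\<theta>'\<in>S2. k1 x \<theta> \<theta>' = k2 x \<theta> \<theta>'))"
    proof (intro exI[of _ "probe D"] conjI[OF probes] allI impI main)
    qed blast+
  qed
qed

end
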